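(* For each rational number $r \geq 1$, the set $\mathcal{S}^{\mathrm{MDG}}_{r}$ is $\mathrm{P}^{\mathrm{NP}}_{\|}$-complete under polynomial-time many-one reductions.
   Context: All graphs are undirected, nonempty, finite, without multiple edges or self-loops. A vertex cover of a graph $G$ is a set $C \subseteq V(G)$ with $\{v,w\}\cap C \neq \emptyset$ for every edge $\{v,w\}\in E(G)$; $\mathrm{mvc}(G)$ denotes the minimum size of a vertex cover of $G$. The maximum-degree greedy heuristic (MDG) on input $G$ starts with $C=\emptyset$ and, as long as an edge remains, nondeterministically chooses a vertex $v$ of maximum degree in the current graph, adds $v$ to $C$, and deletes $v$ and all edges incident to $v$; it outputs $C$. Let $\mathrm{min\text{-}mdg}(G)$ be the minimum size of an output of MDG on input $G$ over all possible sequences of nondeterministic choices. For a rational $r\geq 1$, $\mathcal{S}^{\mathrm{MDG}}_{r} = \{G \mid G \text{ is a graph and } \mathrm{min\text{-}mdg}(G) \leq r\cdot\mathrm{mvc}(G)\}$ (graphs encoded as binary strings in a standard way). $\mathrm{P}^{\mathrm{NP}}_{\|}$ is the class of problems decidable in polynomial time with parallel (truth-table) access to an NP oracle. Hardness/completeness is with respect to polynomial-time many-one reducibility: $A \leq^p_m B$ iff there is a polynomial-time computable $f$ with $x\in A \iff f(x)\in B$ for all $x$. *)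

theory Defs
  imports Complex_Main "HOL-Computational_Algebra.Polynomial"
begin

type_synonym 'a graph = "'a set \<times> 'a set set"

definition is_graph :: "'a graph \<Rightarrow> bool" where
  "is_graph G \<longleftrightarrow> finite (fst G) \<and> fst G \<noteq> {} \<and>
     snd G \<subseteq> {{u, v} | u v. u \<in> fst G \<and> v \<in> fst G \<and> u \<noteq> v}"

definition vertex_cover :: "'a graph \<Rightarrow> 'a set \<Rightarrow> bool" where
  "vertex_cover G C \<longleftrightarrow> C \<subseteq> fst G \<and> (\<forall>e\<in>snd G. e \<inter> C \<noteq> {})"

definition mvc :: "'a graph \<Rightarrow> nat" where
  "mvc G = (LEAST k. \<exists>C. vertex_cover G C \<and> card C = k)"

definition degree_in :: "'a graph \<Rightarrow> 'a \<Rightarrow> nat" where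
  "degree_in G v = card {e \<in> snd G. v \<in> e}"

definition delete_vertex :: "'a graph \<Rightarrow> 'a \<Rightarrow> 'a graph" where
  "delete_vertex G v = (fst G - {v}, {e \<in> snd G. v \<notin> e})"

inductive mdg_step :: "'a graph \<times> 'a set \<Rightarrow> 'a graph \<times> 'a set \<Rightarrow> bool" where
  "\<lbrakk>snd G \<noteq> {}; v \<in> fst G; \<forall>u\<in>fst G. degree_in G u \<le> degree_in G v\<rbrakk>
    \<Longrightarrow> mdg_step (G, C) (delete_vertex G v, insert v C)"

definition mdg_outputs :: "'a graph \<Rightarrow> 'a set set" where
  "mdg_outputs G = {C. \<exists>H. mdg_step\<^sup>*\<^sup>* (G, {}) (H, C) \<and> snd H = {}}"

definition min_mdg :: "'a graph \<Rightarrow> nat" where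
  "min_mdg G = (LEAST k. \<exists>C\<in>mdg_outputs G. card C = k)"

type_synonym word = "bool list"
type_synonym lang = "word set"

text \<open>Every bit is doubled and the word is closed by the block 01, so that the result is
  self-delimiting.\<close>

definition enc_word :: "word \<Rightarrow> word" where
  "enc_word w = concat (map (\<lambda>b. [b, b]) w) @ [False, True]"

definition enc_pair :: "word \<Rightarrow> word \<Rightarrow> word" where
  "enc_pair x y = enc_word x @ y"

definition enc_words :: "word list \<Rightarrow> word" where
  "enc_words ws = concat (map enc_word ws)"

text \<open>The row-wise adjacency matrix of a graph with vertex set \<open>{..<n}\<close>.\<close>

definition enc_graph :: "nat graph \<Rightarrow> word" where
  "enc_graph G = (let n = card (fst G) in
     concat (map (\<lambda>i. map (\<lambda>j. {i, j} \<in> snd G) [0..<n]) [0..<n]))"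

definition S_MDG :: "rat \<Rightarrow> lang" where
  "S_MDG r = {enc_graph G | G n. is_graph G \<and> fst G = {..<n} \<and>
     of_nat (min_mdg G) \<le> r * of_nat (mvc G)}"

text \<open>The states are \<open>0, \<dots>, tm_states M\<close>, where \<open>0\<close> is initial and \<open>tm_states M\<close> is
  the halting state. The symbols are \<open>0, \<dots>, tm_symbols M - 1\<close>, where \<open>0\<close> is the blank and
  \<open>1\<close>, \<open>2\<close> represent the bits 0 and 1. In each step and for each tape the machine writes a symbol
  and moves the head by an offset in \<open>{-1, 0, 1}\<close>. Tapes are infinite in both directions. The
  first tape holds the input, the last one the output.\<close>

record tm =
  tm_tapes :: nat
  tm_states :: nat
  tm_symbols :: nat
  tm_trans :: "nat \<Rightarrow> nat list \<Rightarrow> nat \<times> (nat \<times> int) list"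

definition valid_tm :: "tm \<Rightarrow> bool" where
  "valid_tm M \<longleftrightarrow> tm_tapes M \<ge> 1 \<and> tm_symbols M \<ge> 3 \<and>
     (\<forall>q < tm_states M. \<forall>ss. length ss = tm_tapes M \<and> set ss \<subseteq> {..<tm_symbols M} \<longrightarrow>
        (case tm_trans M q ss of (q', acts) \<Rightarrow>
           q' \<le> tm_states M \<and> length acts = tm_tapes M \<and>
           set acts \<subseteq> {..<tm_symbols M} \<times> {-1, 0, 1}))"

type_synonym config = "nat \<times> ((int \<Rightarrow> nat) \<times> int) list"

definition tm_step :: "tm \<Rightarrow> config \<Rightarrow> config" where
  "tm_step M = (\<lambda>(q, ts).
     if q < tm_states M then
       (case tm_trans M q (map (\<lambda>(t, h). t h) ts) of (q', acts) \<Rightarrow>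
          (q', map2 (\<lambda>(t, h) (s, m). (t(h := s), h + m)) ts acts))
     else (q, ts))"

definition word_tape :: "word \<Rightarrow> int \<Rightarrow> nat" where
  "word_tape w i =
     (if 0 \<le> i \<and> i < int (length w) then (if w ! nat i then 2 else 1) else 0)"

definition tm_init :: "tm \<Rightarrow> word \<Rightarrow> config" where
  "tm_init M x = (0, (word_tape x, 0) # replicate (tm_tapes M - 1) (word_tape [], 0))"

definition tm_halts_with :: "tm \<Rightarrow> word \<Rightarrow> nat \<Rightarrow> word \<Rightarrow> bool" where
  "tm_halts_with M x t y \<longleftrightarrow>
     (case (tm_step M ^^ t) (tm_init M x) of (q, ts) \<Rightarrow>
        q = tm_states M \<and> fst (last ts) = word_tape y)"

definition polytime :: "(word \<Rightarrow> word) \<Rightarrow> bool" where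
  "polytime f \<longleftrightarrow> (\<exists>M (p :: nat poly). valid_tm M \<and>
     (\<forall>x. \<exists>t \<le> poly p (length x). tm_halts_with M x t (f x)))"

definition class_P :: "lang set" where
  "class_P = {L. polytime (\<lambda>x. [x \<in> L])}"

definition class_NP :: "lang set" where
  "class_NP = {L. \<exists>R \<in> class_P. \<exists>p :: nat poly. \<forall>x.
     x \<in> L \<longleftrightarrow> (\<exists>w. length w \<le> poly p (length x) \<and> enc_pair x w \<in> R)}"

text \<open>Parallel access: all queries \<open>g x\<close> are computed from the input before any answer is known;
  the input together with the vector of answers is then evaluated in polynomial time.\<close>

definition class_P_NP_par :: "lang set" where
  "class_P_NP_par = {L. \<exists>A \<in> class_NP. \<exists>g. \<exists>V \<in> class_P.
     polytime (\<lambda>x. enc_words (g x)) \<and>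
     (\<forall>x. x \<in> L \<longleftrightarrow> enc_pair x (map (\<lambda>y. y \<in> A) (g x)) \<in> V)}"

definition many_one_reducible :: "lang \<Rightarrow> lang \<Rightarrow> bool" (infix "\<le>\<^sub>m\<^sup>p" 50) where
  "A \<le>\<^sub>m\<^sup>p B \<longleftrightarrow> (\<exists>f. polytime f \<and> (\<forall>x. x \<in> A \<longleftrightarrow> f x \<in> B))"

definition many_one_complete :: "lang set \<Rightarrow> lang \<Rightarrow> bool" where
  "many_one_complete \<C> L \<longleftrightarrow> L \<in> \<C> \<and> (\<forall>A \<in> \<C>. A \<le>\<^sub>m\<^sup>p L)"

end

theory Submission
  imports Defs
begin

text \<open>
  Membership: ask for all \<open>k\<close> whether some greedy run has at most \<open>k\<close> steps, and whether some vertex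
  cover \<open>C\<close> satisfies \<open>p |C| < q k\<close>, where \<open>r = p / q\<close>. The graph belongs to the set iff for some
  \<open>k\<close> the first answer is yes and the second is no.

  Hardness: guess witnesses for the queries of a machine for \<open>L\<close>, let \<open>s\<close> be the number of verified
  ones and \<open>acc\<close> the verdict when exactly these queries are answered yes. The maximum of
  \<open>2 s + acc\<close> is attained at the true answers, so \<open>x \<in> L\<close> iff every optimal guess has \<open>acc = 1\<close>.
  The computation on a guess becomes a constraint satisfaction problem, and this a graph \<open>G\<close> on which
  the greedy heuristic is optimal and whose minimum vertex covers correspond to optimal guesses.
  Attaching to the vertex \<open>\<beta>\<close> of the claim \<open>acc = 1\<close> a vertex \<open>z\<close> with \<open>D\<close> pendant paths of length two
  forces the heuristic to take \<open>z\<close>, so that it pays \<open>D + 1 + mvc G\<close>. The minimum is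
  \<open>D + mvc G + e\<close>, where \<open>e = 0\<close> if \<open>\<beta>\<close> lies in some minimum cover of \<open>G\<close>, i.e. \<open>x \<notin> L\<close>, and \<open>e = 1\<close>
  otherwise. The unknown \<open>mvc G\<close> is cancelled in \<open>p mvc - q mdg\<close> by copies of \<open>G\<close> with such a gadget
  at every vertex, whose minimum does not depend on \<open>mvc G\<close>; copies of a fixed graph of
  ratio above \<open>r\<close> adjust the remaining constant to a threshold at \<open>e = 1\<close>.

  Polynomial time is handled by a language of stack programs: compiled to Turing machines, they yield a
  class of functions on encoded types with good closure properties; a simulation of Turing
  machines in this class gives the converse.
\<close>


section \<open>Stack programs and their compilation to Turing machines\<close>

text \<open>Greedy is optimal on \<open>G\<close> because every value of a variable has
  \<open>K = card CV * n\<close> copies. Copies of different values are joined, so while such values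
  compete their degrees exceed those of all constraint vertices, and a run can remove all values but
  one per variable first. Which value survives is open to the nondeterminism, so the run can follow
  an optimal assignment. Afterwards, while edges remain, a satisfied constraint vertex never has
  maximum degree.

  The weight 2 in \<open>2 s + acc\<close> makes a missing yes answer cost more than the verdict can
  gain; false yes answers cannot be verified at all.

  With \<open>r = (q + d) / q\<close>, look at \<open>(q + d) * mvc - q * mdg\<close>, which is
  additive over disjoint unions since both numbers are. A copy of \<open>G\<close> with the gadget
  at the claim contributes \<open>d * mvc G\<close>, up to terms known in advance and the wanted
  \<open>e\<close>; a copy with gadgets everywhere contributes \<open>- q * mvc G\<close>. So
  \<open>q\<close> of the former and \<open>d\<close> of the latter cancel the unknown. A bad graph
  contributes some \<open>- c\<close>, and taking everything else \<open>c\<close> times makes the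
  correction divisible by \<open>c\<close>.\<close>

datatype prog =
    Push nat bool
  | Pop nat
  | Seq prog prog (infixr ";;" 60)
  | Cond nat prog prog
  | While nat prog

type_synonym state = "nat \<Rightarrow> word"

text \<open>The third argument is the exact number of machine steps. A push takes two: on a stack
  that grows to the left the head has to move before it writes, whereas a machine step writes before
  it moves. An empty register counts as false in \<open>Cond\<close>.\<close>

inductive exec :: "prog \<Rightarrow> state \<Rightarrow> nat \<Rightarrow> state \<Rightarrow> bool" where
  exec_Push: "exec (Push r b) s 2 (s(r := b # s r))"
| exec_Pop: "exec (Pop r) s 1 (s(r := tl (s r)))"
| exec_Seq: "exec p s n s1 \<Longrightarrow> exec q s1 m s2 \<Longrightarrow> exec (p ;; q) s (n + m) s2"
| exec_CondT: "s r \<noteq> [] \<and> hd (s r) \<Longrightarrow> exec p s n s' \<Longrightarrow> exec (Cond r p q) s (Suc n) s'"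
| exec_CondF: "\<not> (s r \<noteq> [] \<and> hd (s r)) \<Longrightarrow> exec q s n s' \<Longrightarrow> exec (Cond r p q) s (Suc n) s'"
| exec_WhileE: "s r = [] \<Longrightarrow> exec (While r p) s 1 s"
| exec_WhileN: "s r \<noteq> [] \<Longrightarrow> exec p s n s1 \<Longrightarrow> exec (While r p) s1 m s2 \<Longrightarrow>
    exec (While r p) s (Suc (n + m)) s2"

text \<open>Tape \<open>K\<close> is the output tape. It is written from left to right and never read, so that
  the output starts at cell 0; the other tapes hold stacks that grow to the left.\<close>

fun wf_prog :: "nat \<Rightarrow> prog \<Rightarrow> bool" where
  "wf_prog K (Push r b) \<longleftrightarrow> r \<le> K"
| "wf_prog K (Pop r) \<longleftrightarrow> r < K"
| "wf_prog K (p ;; q) \<longleftrightarrow> wf_prog K p \<and> wf_prog K q"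
| "wf_prog K (Cond r p q) \<longleftrightarrow> r < K \<and> wf_prog K p \<and> wf_prog K q"
| "wf_prog K (While r p) \<longleftrightarrow> r < K \<and> wf_prog K p"

fun psize :: "prog \<Rightarrow> nat" where
  "psize (Push r b) = 2"
| "psize (Pop r) = 1"
| "psize (p ;; q) = psize p + psize q"
| "psize (Cond r p q) = Suc (psize p + psize q)"
| "psize (While r p) = Suc (psize p)"

definition bit_sym :: "bool \<Rightarrow> nat" where "bit_sym b = (if b then 2 else 1)"

definition acts_at :: "nat \<Rightarrow> nat \<Rightarrow> nat \<times> int \<Rightarrow> nat list \<Rightarrow> (nat \<times> int) list" where
  "acts_at K r a ss = map (\<lambda>i. if i = r then a else (ss ! i, 0)) [0..<Suc K]"

abbreviation stay :: "nat \<Rightarrow> nat list \<Rightarrow> (nat \<times> int) list" where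
  "stay K ss \<equiv> acts_at K 0 (ss ! 0, 0) ss"

text \<open>The code of \<open>p\<close> is entered in state 0 and left in state
  \<open>psize p\<close>. Composite programs shift the states of their parts and redirect the exits
  of these; tapes that are not concerned get their scanned symbol rewritten.\<close>

fun ptrans :: "nat \<Rightarrow> prog \<Rightarrow> nat \<Rightarrow> nat list \<Rightarrow> nat \<times> (nat \<times> int) list" where
  "ptrans K (Push r b) q ss =
     (if q = 0 then (1, acts_at K r (if r = K then (bit_sym b, 0) else (ss ! r, -1)) ss)
      else (2, acts_at K r (if r = K then (ss ! r, 1) else (bit_sym b, 0)) ss))"
| "ptrans K (Pop r) q ss = (1, acts_at K r (0, 1) ss)"
| "ptrans K (p1 ;; p2) q ss =
     (if q < psize p1 then ptrans K p1 q ss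
      else map_prod ((+) (psize p1)) id (ptrans K p2 (q - psize p1) ss))"
| "ptrans K (Cond r p1 p2) q ss =
     (if q = 0 then (if ss ! r = 2 then 1 else Suc (psize p1), stay K ss)
      else if q \<le> psize p1 then
        map_prod (\<lambda>q'. if q' = psize p1 then Suc (psize p1 + psize p2) else Suc q') id
          (ptrans K p1 (q - 1) ss)
      else map_prod ((+) (Suc (psize p1))) id (ptrans K p2 (q - Suc (psize p1)) ss))"
| "ptrans K (While r p) q ss =
     (if q = 0 then (if ss ! r \<noteq> 0 then 1 else Suc (psize p), stay K ss)
      else map_prod (\<lambda>q'. if q' = psize p then 0 else Suc q') id (ptrans K p (q - 1) ss))"

definition scan :: "((int \<Rightarrow> nat) \<times> int) list \<Rightarrow> nat list" where
  "scan ts = map (\<lambda>(t, h). t h) ts"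

definition act :: "((int \<Rightarrow> nat) \<times> int) list \<Rightarrow> (nat \<times> int) list \<Rightarrow> ((int \<Rightarrow> nat) \<times> int) list" where
  "act ts as = map2 (\<lambda>(t, h) (s, m). (t(h := s), h + m)) ts as"

text \<open>Runs of a bare transition function in which each step starts from a state below
  \<open>S\<close>. This speaks of code fragments before they belong to a machine, so that they can
  be relocated by a renaming of states.\<close>

inductive reach :: "(nat \<Rightarrow> nat list \<Rightarrow> nat \<times> (nat \<times> int) list) \<Rightarrow> nat \<Rightarrow> nat \<Rightarrow> config \<Rightarrow> config \<Rightarrow> bool"
  for d S where
  reach_0: "reach d S 0 c c"
| reach_Suc: "q < S \<Longrightarrow> reach d S n (fst (d q (scan ts)), act ts (snd (d q (scan ts)))) c \<Longrightarrow>
    reach d S (Suc n) (q, ts) c"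

lemma reach_trans:
  "reach d S n c1 c2 \<Longrightarrow> reach d S m c2 c3 \<Longrightarrow> reach d S (n + m) c1 c3"
  by (induction rule: reach.induct) (auto intro: reach.intros)

lemma reach_embed:
  assumes "reach d S n c c'"
    and "\<And>q ss. q < S \<Longrightarrow> e q < S' \<and> d' (e q) ss = map_prod e id (d q ss)"
  shows "reach d' S' n (e (fst c), snd c) (e (fst c'), snd c')"
  using assms(1)
proof (induction rule: reach.induct)
  case (reach_Suc q n ts c)
  show ?case
    using reach_Suc assms(2)[OF reach_Suc(1), of "scan ts"] by (auto intro!: reach.reach_Suc)
qed (auto intro: reach.intros)

lemma reach_step:
  "q < S \<Longrightarrow> d q (scan ts) = (q', as) \<Longrightarrow> act ts as = ts' \<Longrightarrow> reach d S 1 (q, ts) (q', ts')"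
  using reach_Suc[of q S d 0 ts] reach_0 by fastforce

lemma reach_tm_step:
  "reach d S n c c' \<Longrightarrow> tm_states M = S \<Longrightarrow> tm_trans M = d \<Longrightarrow> (tm_step M ^^ n) c = c'"
proof (induction rule: reach.induct)
  case (reach_Suc q n ts c)
  have "tm_step M (q, ts) = (fst (d q (scan ts)), act ts (snd (d q (scan ts))))"
    using reach_Suc by (simp add: tm_step_def scan_def act_def split: prod.split)
  then show ?case using reach_Suc by (simp add: funpow_swap1)
qed simp

text \<open>Offsets are relative to the head, which stands on the top of the stack. As
  \<open>word_tape\<close> is blank at negative positions, the cells to the left are required to be
  blank. The output register lists what was written in reverse, since a push prepends.\<close>

definition rep :: "nat \<Rightarrow> state \<Rightarrow> ((int \<Rightarrow> nat) \<times> int) list \<Rightarrow> bool" where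
  "rep K s ts \<longleftrightarrow> length ts = Suc K \<and>
     (\<forall>i<K. \<forall>j. fst (ts ! i) (snd (ts ! i) + j) = word_tape (s i) j) \<and>
     fst (ts ! K) = word_tape (rev (s K)) \<and> snd (ts ! K) = int (length (s K))"

lemma word_tape_0: "word_tape w 0 = (if w = [] then 0 else bit_sym (hd w))"
  by (cases w) (auto simp: word_tape_def bit_sym_def)

lemma scan_rep: "rep K s ts \<Longrightarrow> i < K \<Longrightarrow> scan ts ! i = word_tape (s i) 0"
  unfolding rep_def by (auto simp: scan_def case_prod_unfold) (metis add.right_neutral)

lemma scan_nth: "i < length ts \<Longrightarrow> scan ts ! i = fst (ts ! i) (snd (ts ! i))"
  by (simp add: scan_def case_prod_unfold)

lemma length_act: "length ts = Suc K \<Longrightarrow> length (act ts (acts_at K r a ss)) = Suc K"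
  by (simp add: acts_at_def act_def)

lemma act_nth: "length ts = Suc K \<Longrightarrow> i \<le> K \<Longrightarrow> act ts (acts_at K r a (scan ts)) ! i =
   (if i = r then ((fst (ts ! i))(snd (ts ! i) := fst a), snd (ts ! i) + snd a) else ts ! i)"
  by (simp add: acts_at_def act_def case_prod_unfold scan_nth del: upt_Suc)

lemma act_stay: "length ts = Suc K \<Longrightarrow> act ts (stay K (scan ts)) = ts"
  by (rule nth_equalityI) (simp_all add: length_act act_nth scan_nth less_Suc_eq_le)

lemma word_tape_Cons: "word_tape (b # w) j = (if j = 0 then bit_sym b else word_tape w (j - 1))"
  by (cases "j > 0") (auto simp: word_tape_def bit_sym_def nth_Cons' nat_diff_distrib)

lemma word_tape_tl: "word_tape (tl w) j = (if j + 1 = 0 then 0 else word_tape w (j + 1))"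
proof (cases w)
  case (Cons a v)
  then show ?thesis by (auto simp: word_tape_Cons) (auto simp: word_tape_def)
qed (auto simp: word_tape_def)

lemma word_tape_snoc: "word_tape (w @ [b]) = (word_tape w)(int (length w) := bit_sym b)"
  by (rule ext) (auto simp: word_tape_def bit_sym_def nth_append nat_less_iff)

lemma reach_exec:
  "exec p s n s' \<Longrightarrow> wf_prog K p \<Longrightarrow> rep K s ts \<Longrightarrow>
   \<exists>ts'. reach (ptrans K p) (psize p) n (0, ts) (psize p, ts') \<and> rep K s' ts'"
proof (induction arbitrary: ts rule: exec.induct)
  case (exec_Push r b s)
  let ?a1 = "if r = K then (bit_sym b, 0) else (scan ts ! r, -1)"
  define t1 where "t1 = act ts (acts_at K r ?a1 (scan ts))"
  let ?a2 = "if r = K then (scan t1 ! r, 1) else (bit_sym b, 0)"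
  define t2 where "t2 = act t1 (acts_at K r ?a2 (scan t1))"
  have l0: "length ts = Suc K" "r \<le> K" using exec_Push by (auto simp: rep_def)
  then have l1: "length t1 = Suc K" unfolding t1_def by (rule_tac length_act)
  then have l2: "length t2 = Suc K" unfolding t2_def by (rule length_act)
  have n1: "t1 ! i = (if i = r then ((fst (ts ! i))(snd (ts ! i) := fst ?a1), snd (ts ! i) + snd ?a1) else ts ! i)"
    if "i \<le> K" for i unfolding t1_def by (subst act_nth) (use l0 that in auto)
  have n2: "t2 ! i = (if i = r then ((fst (t1 ! i))(snd (t1 ! i) := fst ?a2), snd (t1 ! i) + snd ?a2) else t1 ! i)"
    if "i \<le> K" for i unfolding t2_def by (subst act_nth) (use l1 that in auto)
  have sc: "scan ts ! r = fst (ts ! r) (snd (ts ! r))" "scan t1 ! r = fst (t1 ! r) (snd (t1 ! r))"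
    using l0 l1 by (simp_all add: scan_nth)
  have "reach (ptrans K (Push r b)) 2 1 (0, ts) (1, t1)"
    by (rule reach_step) (auto simp: t1_def)
  moreover have "reach (ptrans K (Push r b)) 2 1 (1, t1) (2, t2)"
    by (rule reach_step) (auto simp: t2_def)
  ultimately have "reach (ptrans K (Push r b)) 2 2 (0, ts) (2, t2)"
    using reach_trans by (metis one_add_one)
  moreover have "rep K (s(r := b # s r)) t2"
  proof (cases "r = K")
    case True
    have "fst (t2 ! K) = word_tape (rev (s K) @ [b]) \<and> snd (t2 ! K) = int (length (s K)) + 1"
      using n1[of K] n2[of K] sc exec_Push(2) True by (simp add: rep_def word_tape_snoc)
    moreover have "t2 ! i = ts ! i" if "i < K" for i using n1[of i] n2[of i] that True by simp
    ultimately show ?thesis using exec_Push(2) l2 True by (simp add: rep_def)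
  next
    case False
    have "fst (t2 ! i) (snd (t2 ! i) + j) = word_tape ((s(r := b # s r)) i) j" if "i < K" for i j
    proof (cases "i = r")
      case True
      have *: "fst (ts ! r) (snd (ts ! r) + (j - 1)) = word_tape (s r) (j - 1)"
        using exec_Push(2) that True unfolding rep_def by blast
      have "fst (t2 ! i) (snd (t2 ! i) + j) = (if j = 0 then bit_sym b else fst (ts ! r) (snd (ts ! r) + (j - 1)))"
        using that True False n1[of r] n2[of r] sc by (simp add: algebra_simps)
      then show ?thesis using True by (simp only: * word_tape_Cons fun_upd_same)
    next
      case False
      then show ?thesis using exec_Push(2) that n1[of i] n2[of i] by (simp add: rep_def)
    qed
    then show ?thesis using exec_Push(2) l2 False n1[of K] n2[of K] by (simp add: rep_def)
  qed
  ultimately show ?case unfolding psize.simps by blast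
next
  case (exec_Pop r s)
  define t1 where "t1 = act ts (acts_at K r (0, 1) (scan ts))"
  have l0: "length ts = Suc K" "r < K" using exec_Pop by (auto simp: rep_def)
  then have l1: "length t1 = Suc K" unfolding t1_def by (rule_tac length_act)
  have n1: "t1 ! i = (if i = r then ((fst (ts ! i))(snd (ts ! i) := 0), snd (ts ! i) + 1) else ts ! i)"
    if "i \<le> K" for i unfolding t1_def by (subst act_nth) (use l0 that in auto)
  have "reach (ptrans K (Pop r)) 1 1 (0, ts) (1, t1)"
    by (rule reach_step) (auto simp: t1_def)
  moreover have "rep K (s(r := tl (s r))) t1"
  proof -
    have "fst (t1 ! i) (snd (t1 ! i) + j) = word_tape ((s(r := tl (s r))) i) j" if "i < K" for i j
    proof (cases "i = r")
      case True
      have *: "fst (ts ! r) (snd (ts ! r) + (j + 1)) = word_tape (s r) (j + 1)"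
        using exec_Pop(2) that True unfolding rep_def by blast
      have "fst (t1 ! i) (snd (t1 ! i) + j) = (if j + 1 = 0 then 0 else fst (ts ! r) (snd (ts ! r) + (j + 1)))"
        using that True n1[of r] by (simp add: algebra_simps)
      then show ?thesis using True by (simp only: * word_tape_tl fun_upd_same)
    next
      case False
      then show ?thesis using exec_Pop(2) that n1[of i] by (simp add: rep_def)
    qed
    then show ?thesis using exec_Pop(2) l0 l1 n1[of K] by (simp add: rep_def)
  qed
  ultimately show ?case unfolding psize.simps by blast
next
  case (exec_Seq p s n s1 q m s2)
  obtain t1 where t1: "reach (ptrans K p) (psize p) n (0, ts) (psize p, t1)" "rep K s1 t1"
    using exec_Seq by auto
  obtain t2 where t2: "reach (ptrans K q) (psize q) m (0, t1) (psize q, t2)" "rep K s2 t2"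
    using exec_Seq t1 by auto
  have "reach (ptrans K (p ;; q)) (psize (p ;; q)) n (0, ts) (psize p, t1)"
    using reach_embed[OF t1(1), of id] by (auto simp: map_prod_def case_prod_unfold)
  moreover have "reach (ptrans K (p ;; q)) (psize (p ;; q)) m (psize p, t1) (psize p + psize q, t2)"
    using reach_embed[OF t2(1), of "(+) (psize p)" "psize (p ;; q)" "ptrans K (p ;; q)"] by auto
  ultimately show ?case using reach_trans t2(2) by (metis psize.simps(3))
next
  case (exec_CondT s r p n s' q)
  obtain t1 where t1: "reach (ptrans K p) (psize p) n (0, ts) (psize p, t1)" "rep K s' t1"
    using exec_CondT by auto
  let ?e = "\<lambda>q'. if q' = psize p then Suc (psize p + psize q) else Suc q'"
  have "scan ts ! r = 2" using scan_rep[OF exec_CondT(5), of r] exec_CondT by (simp add: word_tape_0 bit_sym_def)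
  then have "reach (ptrans K (Cond r p q)) (psize (Cond r p q)) 1 (0, ts) (1, ts)"
    by (intro reach_step[OF _ _ act_stay]) (use exec_CondT(5) in \<open>auto simp: rep_def\<close>)
  \<comment> \<open>The renaming \<open>?e\<close> treats the exit state of \<open>p\<close>
    specially; positive size ensures that the entry state 0 is not mistaken for it.\<close>
  moreover have "psize p > 0" by (induction p) auto
  then have "reach (ptrans K (Cond r p q)) (psize (Cond r p q)) n (1, ts) (psize (Cond r p q), t1)"
    using reach_embed[OF t1(1), of ?e "psize (Cond r p q)" "ptrans K (Cond r p q)"] by auto
  ultimately show ?case using reach_trans t1(2) by (metis plus_1_eq_Suc)
next
  case (exec_CondF s r q n s' p)
  obtain t1 where t1: "reach (ptrans K q) (psize q) n (0, ts) (psize q, t1)" "rep K s' t1"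
    using exec_CondF by auto
  have "scan ts ! r \<noteq> 2" using scan_rep[OF exec_CondF(5), of r] exec_CondF by (auto simp: word_tape_0 bit_sym_def)
  then have "reach (ptrans K (Cond r p q)) (psize (Cond r p q)) 1 (0, ts) (Suc (psize p), ts)"
    by (intro reach_step[OF _ _ act_stay]) (use exec_CondF(5) in \<open>auto simp: rep_def\<close>)
  moreover have "reach (ptrans K (Cond r p q)) (psize (Cond r p q)) n (Suc (psize p), ts) (psize (Cond r p q), t1)"
    using reach_embed[OF t1(1), of "(+) (Suc (psize p))" "psize (Cond r p q)" "ptrans K (Cond r p q)"] by auto
  ultimately show ?case using reach_trans t1(2) by (metis plus_1_eq_Suc)
next
  case (exec_WhileE s r p)
  have "scan ts ! r = 0" using scan_rep[OF exec_WhileE(3), of r] exec_WhileE by (simp add: word_tape_0)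
  then have "reach (ptrans K (While r p)) (psize (While r p)) 1 (0, ts) (psize (While r p), ts)"
    by (intro reach_step[OF _ _ act_stay]) (use exec_WhileE(3) in \<open>auto simp: rep_def\<close>)
  then show ?case using exec_WhileE by blast
next
  case (exec_WhileN s r p n s1 m s2)
  obtain t1 where t1: "reach (ptrans K p) (psize p) n (0, ts) (psize p, t1)" "rep K s1 t1"
    using exec_WhileN by auto
  obtain t2 where t2: "reach (ptrans K (While r p)) (psize (While r p)) m (0, t1) (psize (While r p), t2)" "rep K s2 t2"
    using exec_WhileN t1 by blast
  let ?e = "\<lambda>q'. if q' = psize p then 0 else Suc q'"
  have "scan ts ! r \<noteq> 0" using scan_rep[OF exec_WhileN(7), of r] exec_WhileN by (simp add: word_tape_0 bit_sym_def)
  then have "reach (ptrans K (While r p)) (psize (While r p)) 1 (0, ts) (1, ts)"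
    by (intro reach_step[OF _ _ act_stay]) (use exec_WhileN(7) in \<open>auto simp: rep_def\<close>)
  moreover have "psize p > 0" by (induction p) auto
  then have "reach (ptrans K (While r p)) (psize (While r p)) n (1, ts) (0, t1)"
    using reach_embed[OF t1(1), of ?e "psize (While r p)" "ptrans K (While r p)"] by auto
  ultimately have "reach (ptrans K (While r p)) (psize (While r p)) (1 + n + m) (0, ts) (psize (While r p), t2)"
    using reach_trans t2(1) by blast
  then show ?case using t2(2) unfolding plus_1_eq_Suc add_Suc by blast
qed

lemma acts_at_valid:
  assumes "length ss = Suc K" "set ss \<subseteq> {..<3}" "fst a < 3" "snd a \<in> {-1, 0, 1}"
  shows "length (acts_at K r a ss) = Suc K \<and> set (acts_at K r a ss) \<subseteq> {..<3} \<times> {-1, 0, 1}"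
proof -
  have "ss ! i < 3" if "i < Suc K" for i using that assms(1,2) nth_mem[of i ss] by (simp add: subset_iff)
  then show ?thesis using assms(3,4) by (cases a) (auto simp: acts_at_def simp del: upt_Suc)
qed

lemma ptrans_valid:
  assumes "wf_prog K p" "q < psize p" "length ss = Suc K" "set ss \<subseteq> {..<3}" "ptrans K p q ss = (q', as)"
  shows "q' \<le> psize p \<and> length as = Suc K \<and> set as \<subseteq> {..<3} \<times> {-1, 0, 1}"
  using assms
proof (induction p arbitrary: q q' as)
  case (Push r b)
  then have "ss ! r < 3" "bit_sym b < 3" using nth_mem[of r ss] by (auto simp: subset_iff bit_sym_def)
  with Push show ?case
    using acts_at_valid[of ss K "(ss ! r, -1)" r] acts_at_valid[of ss K "(ss ! r, 1)" r]
      acts_at_valid[of ss K "(bit_sym b, 0)" r] by (auto split: if_splits)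
next
  case (Pop r)
  then show ?case using acts_at_valid[of ss K "(0, 1)" r] by auto
next
  case (Seq p1 p2)
  show ?case
  proof (cases "q < psize p1")
    case True then show ?thesis using Seq.IH(1)[of q q' as] Seq.prems by auto
  next
    case False
    then show ?thesis
      using Seq.IH(2)[of "q - psize p1" "q' - psize p1" as] Seq.prems
      by (cases "ptrans K p2 (q - psize p1) ss") auto
  qed
next
  case (Cond r p1 p2)
  have st: "set (stay K ss) \<subseteq> {..<3} \<times> {-1, 0, 1}"
    using Cond.prems acts_at_valid[of ss K "(ss ! 0, 0)" 0] nth_mem[of 0 ss] by (simp add: subset_iff)
  consider "q = 0" | "q \<noteq> 0" "q \<le> psize p1" | "q > psize p1" by linarith
  then show ?case
  proof cases
    case 1 then show ?thesis using Cond.prems st by (auto simp: acts_at_def split: if_splits simp del: upt_Suc)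
  next
    case 2
    obtain q1 a1 where e: "ptrans K p1 (q - 1) ss = (q1, a1)" by fastforce
    then show ?thesis using Cond.IH(1)[of "q - 1" q1 a1] Cond.prems 2 by (cases q) (auto split: if_splits)
  next
    case 3
    obtain q1 a1 where e: "ptrans K p2 (q - Suc (psize p1)) ss = (q1, a1)" by fastforce
    then show ?thesis using Cond.IH(2)[of "q - Suc (psize p1)" q1 a1] Cond.prems 3 by (auto split: if_splits)
  qed
next
  case (While r p)
  have st: "set (stay K ss) \<subseteq> {..<3} \<times> {-1, 0, 1}"
    using While.prems acts_at_valid[of ss K "(ss ! 0, 0)" 0] nth_mem[of 0 ss] by (simp add: subset_iff)
  show ?case
  proof (cases "q = 0")
    case True then show ?thesis using While.prems st by (auto simp: acts_at_def split: if_splits simp del: upt_Suc)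
  next
    case False
    obtain q1 a1 where e: "ptrans K p (q - 1) ss = (q1, a1)" by fastforce
    then show ?thesis using While.IH[of "q - 1" q1 a1] While.prems False by (cases q) (auto split: if_splits)
  qed
qed

lemma compile_prog:
  assumes "wf_prog K p" "K \<ge> 1"
  obtains M where "valid_tm M"
    "\<And>x n s'. exec p (\<lambda>i. if i = 0 then x else []) n s' \<Longrightarrow> tm_halts_with M x n (rev (s' K))"
proof
  let ?M = "\<lparr>tm_tapes = Suc K, tm_states = psize p, tm_symbols = 3, tm_trans = ptrans K p\<rparr>"
  show "valid_tm ?M"
    unfolding valid_tm_def
  proof (intro conjI allI impI)
    fix q ss
    assume "q < tm_states ?M" "length ss = tm_tapes ?M \<and> set ss \<subseteq> {..<tm_symbols ?M}"
    then show "case tm_trans ?M q ss of (q', acts) \<Rightarrow> q' \<le> tm_states ?M \<and>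
        length acts = tm_tapes ?M \<and> set acts \<subseteq> {..<tm_symbols ?M} \<times> {-1, 0, 1}"
      using ptrans_valid[OF assms(1), of q ss "fst (ptrans K p q ss)" "snd (ptrans K p q ss)"]
      by (simp add: case_prod_unfold)
  qed (use assms in auto)
  fix x n s' assume e: "exec p (\<lambda>i. if i = 0 then x else []) n s'"
  have "rep K (\<lambda>i. if i = 0 then x else []) (snd (tm_init ?M x))"
    using assms(2) by (auto simp: rep_def tm_init_def nth_Cons')
  then obtain ts' where ts': "reach (ptrans K p) (psize p) n (0, snd (tm_init ?M x)) (psize p, ts')" "rep K s' ts'"
    using reach_exec[OF e assms(1)] by blast
  then have "(tm_step ?M ^^ n) (tm_init ?M x) = (psize p, ts')"
    using reach_tm_step[of "ptrans K p" "psize p" n "tm_init ?M x" _ ?M] by (simp add: tm_init_def)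
  then show "tm_halts_with ?M x n (rev (s' K))"
    using ts'(2) by (cases ts' rule: rev_cases) (auto simp: tm_halts_with_def rep_def)
qed

section \<open>Polynomial bounds\<close>

definition pb :: "(nat \<Rightarrow> nat) \<Rightarrow> bool" where
  "pb T \<longleftrightarrow> (\<exists>p :: nat poly. \<forall>n. T n \<le> poly p n)"

lemma poly_nat_mono: "m \<le> n \<Longrightarrow> poly (p :: nat poly) m \<le> poly p n"
  by (induction p) (auto intro!: add_mono mult_mono)

named_theorems pb_intros

lemma pb_const[pb_intros]: "pb (\<lambda>n. c)"
  unfolding pb_def by (rule exI[of _ "[:c:]"]) simp

lemma pb_id[pb_intros]: "pb (\<lambda>n. n)"
  unfolding pb_def by (rule exI[of _ "[:0, 1:]"]) simp

lemma pb_poly[pb_intros]: "pb T \<Longrightarrow> pb (\<lambda>n. poly p (T n))"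
  unfolding pb_def
proof clarify
  fix q :: "nat poly" assume "\<forall>n. T n \<le> poly q n"
  then have "\<forall>n. poly p (T n) \<le> poly (pcompose p q) n"
    by (auto simp: poly_pcompose intro: poly_nat_mono)
  then show "\<exists>q. \<forall>n. poly p (T n) \<le> poly q n" by blast
qed

lemma pb_add[pb_intros]: "pb S \<Longrightarrow> pb T \<Longrightarrow> pb (\<lambda>n. S n + T n)"
  unfolding pb_def
proof clarify
  fix p q :: "nat poly" assume "\<forall>n. S n \<le> poly p n" "\<forall>n. T n \<le> poly q n"
  then have "\<forall>n. S n + T n \<le> poly (p + q) n" by (auto intro: add_mono)
  then show "\<exists>q. \<forall>n. S n + T n \<le> poly q n" by blast
qed

lemma pb_mult[pb_intros]: "pb S \<Longrightarrow> pb T \<Longrightarrow> pb (\<lambda>n. S n * T n)"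
  unfolding pb_def
proof clarify
  fix p q :: "nat poly" assume "\<forall>n. S n \<le> poly p n" "\<forall>n. T n \<le> poly q n"
  then have "\<forall>n. S n * T n \<le> poly (p * q) n" by (auto intro: mult_mono)
  then show "\<exists>q. \<forall>n. S n * T n \<le> poly q n" by blast
qed

lemma pb_Suc[pb_intros]: "pb S \<Longrightarrow> pb (\<lambda>n. Suc (S n))"
  using pb_add[of S "\<lambda>_. 1"] pb_const by simp

section \<open>Programs for elementary operations\<close>

definition runs :: "prog \<Rightarrow> state \<Rightarrow> nat \<Rightarrow> state \<Rightarrow> bool" where
  "runs p s N s' \<longleftrightarrow> (\<exists>n\<le>N. exec p s n s')"

lemma runs_mono: "runs p s N s' \<Longrightarrow> N \<le> N' \<Longrightarrow> runs p s N' s'"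
  unfolding runs_def by (meson order_trans)

lemma runs_eq: "runs p s N s' \<Longrightarrow> N \<le> N' \<Longrightarrow> s' = s'' \<Longrightarrow> runs p s N' s''"
  using runs_mono by blast

lemma runs_Push: "runs (Push r b) s 2 (s(r := b # s r))"
  unfolding runs_def using exec_Push by blast

lemma runs_Pop: "runs (Pop r) s 1 (s(r := tl (s r)))"
  unfolding runs_def using exec_Pop by blast

lemma runs_Seq: "runs p s a s1 \<Longrightarrow> runs q s1 b s2 \<Longrightarrow> runs (p ;; q) s (a + b) s2"
  unfolding runs_def by (meson add_mono exec_Seq)

lemma runs_CondT: "s r \<noteq> [] \<and> hd (s r) \<Longrightarrow> runs p s a s1 \<Longrightarrow> runs (Cond r p q) s (Suc a) s1"
  unfolding runs_def by (meson exec_CondT Suc_le_mono)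

lemma runs_CondF: "\<not> (s r \<noteq> [] \<and> hd (s r)) \<Longrightarrow> runs q s a s1 \<Longrightarrow> runs (Cond r p q) s (Suc a) s1"
  unfolding runs_def by (meson exec_CondF Suc_le_mono)

lemma runs_WhileE: "s r = [] \<Longrightarrow> runs (While r p) s 1 s"
  unfolding runs_def using exec_WhileE by blast

lemma runs_WhileN: "s r \<noteq> [] \<Longrightarrow> runs p s a s1 \<Longrightarrow> runs (While r p) s1 b s2 \<Longrightarrow>
   runs (While r p) s (Suc (a + b)) s2"
  unfolding runs_def by (meson add_mono exec_WhileN Suc_le_mono)

section \<open>Moving, clearing and duplicating registers\<close>

definition MV :: "nat \<Rightarrow> nat \<Rightarrow> prog" where
  "MV a b = While a (Cond a (Push b True) (Push b False) ;; Pop a)"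

definition CLR :: "nat \<Rightarrow> prog" where
  "CLR a = While a (Pop a)"

text \<open>With \<open>a = b\<close> every bit is pushed twice in succession, which produces the
  doubled bits of \<open>enc_word\<close>.\<close>

definition DUP :: "nat \<Rightarrow> nat \<Rightarrow> nat \<Rightarrow> prog" where
  "DUP t a b = While t (Cond t (Push a True ;; Push b True) (Push a False ;; Push b False) ;; Pop t)"

definition dbl :: "word \<Rightarrow> word" where "dbl w = concat (map (\<lambda>b. [b, b]) w)"

lemma dbl_simps[simp]: "dbl [] = []" "dbl (b # w) = b # b # dbl w" "dbl (v @ w) = dbl v @ dbl w"
  "length (dbl w) = 2 * length w"
  by (simp_all add: dbl_def) (induction w; simp)

lemma enc_word_dbl: "enc_word w = dbl w @ [False, True]"
  by (simp add: enc_word_def dbl_def)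

lemma length_enc_word[simp]: "length (enc_word w) = 2 * length w + 2"
  by (simp add: enc_word_dbl)

lemma runs_MV:
  assumes "a \<noteq> b"
  shows "runs (MV a b) s (5 * length (s a) + 1) (s(a := [], b := rev (s a) @ s b))"
proof (induction "s a" arbitrary: s)
  case Nil
  show ?case unfolding MV_def by (rule runs_eq[OF runs_WhileE]) (use Nil assms in \<open>auto simp: fun_eq_iff\<close>)
next
  case (Cons c w)
  note sa = Cons(2)[symmetric]
  let ?s1 = "s(b := c # s b)" and ?s2 = "s(b := c # s b, a := w)"
  have "runs (Cond a (Push b True) (Push b False)) s 3 ?s1"
  proof (cases c)
    case True
    then show ?thesis by (intro runs_eq[OF runs_CondT[OF _ runs_Push]]) (auto simp: sa)
  next
    case False
    then show ?thesis by (intro runs_eq[OF runs_CondF[OF _ runs_Push]]) (auto simp: sa)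
  qed
  then have "runs (Cond a (Push b True) (Push b False) ;; Pop a) s 4 ?s2"
    by (intro runs_eq[OF runs_Seq[OF _ runs_Pop]]) (use assms in \<open>auto simp: fun_eq_iff sa\<close>)
  moreover have "runs (MV a b) ?s2 (5 * length w + 1) (s(a := [], b := rev (s a) @ s b))"
    by (rule runs_eq[OF Cons(1)[of ?s2]]) (use assms in \<open>auto simp: fun_eq_iff sa\<close>)
  ultimately have "runs (MV a b) s (Suc (4 + (5 * length w + 1))) (s(a := [], b := rev (s a) @ s b))"
    unfolding MV_def by (intro runs_WhileN) (auto simp: sa)
  then show ?case by (rule runs_mono) (simp add: sa)
qed

lemma runs_CLR: "runs (CLR a) s (2 * length (s a) + 1) (s(a := []))"
proof (induction "s a" arbitrary: s)
  case Nil
  show ?case unfolding CLR_def by (rule runs_eq[OF runs_WhileE]) (use Nil in auto)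
next
  case (Cons c w)
  note sa = Cons(2)[symmetric]
  have "runs (CLR a) (s(a := w)) (2 * length w + 1) (s(a := []))"
    by (rule runs_eq[OF Cons(1)[of "s(a := w)"]]) auto
  moreover have "runs (Pop a) s 1 (s(a := w))"
    by (rule runs_eq[OF runs_Pop]) (auto simp: sa)
  ultimately have "runs (CLR a) s (Suc (1 + (2 * length w + 1))) (s(a := []))"
    unfolding CLR_def by (intro runs_WhileN) (auto simp: sa)
  then show ?case by (rule runs_mono) (simp add: sa)
qed

lemma runs_DUP:
  assumes "t \<noteq> a" "t \<noteq> b"
  shows "runs (DUP t a b) s (7 * length (s t) + 1)
     (if a = b then s(t := [], a := dbl (rev (s t)) @ s a)
      else s(t := [], a := rev (s t) @ s a, b := rev (s t) @ s b))"
proof (induction "s t" arbitrary: s)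
  case Nil
  show ?case unfolding DUP_def by (rule runs_eq[OF runs_WhileE]) (use Nil assms in \<open>auto simp: fun_eq_iff\<close>)
next
  case (Cons c w)
  note sa = Cons(2)[symmetric]
  let ?fin = "\<lambda>s. if a = b then s(t := [], a := dbl (rev (s t)) @ s a)
      else s(t := [], a := rev (s t) @ s a, b := rev (s t) @ s b)"
  let ?s0 = "s(a := c # s a)" let ?s1 = "?s0(b := c # ?s0 b)" let ?s2 = "?s1(t := w)"
  have *: "runs (Push a c ;; Push b c) s 4 ?s1"
    by (rule runs_eq[OF runs_Seq[OF runs_Push runs_Push]]) auto
  have "runs (Cond t (Push a True ;; Push b True) (Push a False ;; Push b False)) s 5 ?s1"
  proof (cases c)
    case True
    then show ?thesis using * by (intro runs_eq[OF runs_CondT]) (auto simp: sa)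
  next
    case False
    then show ?thesis using * by (intro runs_eq[OF runs_CondF]) (auto simp: sa)
  qed
  then have "runs (Cond t (Push a True ;; Push b True) (Push a False ;; Push b False) ;; Pop t) s 6 ?s2"
    by (intro runs_eq[OF runs_Seq[OF _ runs_Pop]]) (use assms in \<open>auto simp: fun_eq_iff sa\<close>)
  moreover have "runs (DUP t a b) ?s2 (7 * length w + 1) (?fin s)"
    by (rule runs_eq[OF Cons(1)[of ?s2]]) (use assms in \<open>auto simp: fun_eq_iff sa\<close>)
  ultimately have "runs (DUP t a b) s (Suc (6 + (7 * length w + 1))) (?fin s)"
    unfolding DUP_def by (intro runs_WhileN) (auto simp: sa)
  then show ?case by (rule runs_mono) (simp add: sa)
qed

text \<open>Unlike \<open>wf_prog\<close>, this excludes even pushes to tape \<open>K\<close>: only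
  the final transfer of a result touches the output tape.\<close>

fun regs_below :: "nat \<Rightarrow> prog \<Rightarrow> bool" where
  "regs_below K (Push r b) \<longleftrightarrow> r < K"
| "regs_below K (Pop r) \<longleftrightarrow> r < K"
| "regs_below K (p ;; q) \<longleftrightarrow> regs_below K p \<and> regs_below K q"
| "regs_below K (Cond r p q) \<longleftrightarrow> r < K \<and> regs_below K p \<and> regs_below K q"
| "regs_below K (While r p) \<longleftrightarrow> r < K \<and> regs_below K p"

lemma regs_below_wf: "regs_below K p \<Longrightarrow> wf_prog K p"
  by (induction p) auto

lemma regs_below_mono: "regs_below K p \<Longrightarrow> K \<le> K' \<Longrightarrow> regs_below K' p"
  by (induction p) auto

lemma regs_below_macros[simp]:
  "regs_below K (MV a b) \<longleftrightarrow> a < K \<and> b < K" "regs_below K (CLR a) \<longleftrightarrow> a < K"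
  "regs_below K (DUP t a b) \<longleftrightarrow> t < K \<and> a < K \<and> b < K"
  by (auto simp: MV_def CLR_def DUP_def)

text \<open>A step lengthens a register by at most one bit, so a time bound is also a bound on the
  size of the result.\<close>

lemma exec_length: "exec p s n s' \<Longrightarrow> length (s' r) \<le> length (s r) + n"
  by (induction rule: exec.induct) auto

section \<open>Encodings and polynomial-time functions between encoded types\<close>

class enc =
  fixes enc :: "'a \<Rightarrow> word"
  assumes enc_inj: "enc x = enc y \<Longrightarrow> x = y"

abbreviation len :: "'a::enc \<Rightarrow> nat" where "len x \<equiv> length (enc x)"

lemma enc_word_prefix: "enc_word u @ y = enc_word v @ z \<longleftrightarrow> u = v \<and> y = z"
proof (induction u arbitrary: v)
  case Nil show ?case by (cases v) (auto simp: enc_word_dbl)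
next
  case (Cons b u) then show ?case by (cases v) (auto simp: enc_word_dbl)
qed

instantiation bool :: enc begin
definition enc_bool :: "bool \<Rightarrow> word" where "enc_bool b = [b]"
instance by standard (simp add: enc_bool_def)
end

text \<open>Unary numbers: the size of a number is its value, so a loop bounded by a computed number
  is polynomial. All numbers in the reduction are polynomially bounded, hence nothing is
  lost.\<close>

instantiation nat :: enc begin
definition enc_nat :: "nat \<Rightarrow> word" where "enc_nat n = replicate n True"
instance by standard (simp add: enc_nat_def replicate_eq_replicate)
end

instantiation prod :: (enc, enc) enc begin
definition enc_prod :: "'a \<times> 'b \<Rightarrow> word" where "enc_prod p = enc_pair (enc (fst p)) (enc (snd p))"
instance by standard (auto simp: enc_prod_def enc_pair_def enc_word_prefix prod_eq_iff enc_inj)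
end

instantiation list :: (enc) enc begin
definition enc_list :: "'a list \<Rightarrow> word" where "enc_list xs = enc_words (map enc xs)"
instance
proof
  fix xs ys :: "'a list"
  show "enc xs = enc ys \<Longrightarrow> xs = ys"
  proof (induction xs arbitrary: ys)
    case Nil then show ?case by (cases ys) (auto simp: enc_list_def enc_words_def enc_word_dbl)
  next
    case (Cons x xs) then show ?case
      by (cases ys) (auto simp: enc_list_def enc_words_def enc_word_prefix enc_inj, auto simp: enc_word_dbl)
  qed
qed
end

text \<open>Words that are encoded by themselves, in contrast to the generic encoding of lists.\<close>

datatype raw = Raw (unraw: word)

instantiation raw :: enc begin
definition enc_raw :: "raw \<Rightarrow> word" where "enc_raw = unraw"
instance by standard (simp add: enc_raw_def raw.expand)
end

lemma enc_simps[simp]: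
  "enc b = [b]" "enc n = replicate n True" "enc (x, y) = enc_word (enc x) @ enc y"
  "enc ([] :: 'a::enc list) = []" "enc (z # zs) = enc_word (enc z) @ enc zs"
  "enc (Raw w) = w"
  by (simp_all add: enc_bool_def enc_nat_def enc_prod_def enc_pair_def enc_list_def enc_words_def enc_raw_def)

text \<open>The work registers are empty before and after, and registers from \<open>K\<close> on
  keep arbitrary contents, so a program can run beside saved data. The domain \<open>D\<close>
  admits partial operations such as taking a list apart or parsing a word known to be a
  code.\<close>

definition pf_on :: "'a set \<Rightarrow> ('a::enc \<Rightarrow> 'b::enc) \<Rightarrow> bool" where
  "pf_on D f \<longleftrightarrow> (\<exists>P K T. regs_below K P \<and> K \<ge> 1 \<and> pb T \<and> (\<forall>x\<in>D. \<forall>s. s 0 = enc x \<longrightarrow>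
     (\<forall>i. 1 \<le> i \<and> i < K \<longrightarrow> s i = []) \<longrightarrow> runs P s (T (len x)) (s(0 := enc (f x)))))"

abbreviation pf :: "('a::enc \<Rightarrow> 'b::enc) \<Rightarrow> bool" where "pf \<equiv> pf_on UNIV"

lemma pf_onI:
  assumes "regs_below K P" "K \<ge> 1" "pb T"
    "\<And>x s. x \<in> D \<Longrightarrow> s 0 = enc x \<Longrightarrow> (\<And>i. 1 \<le> i \<Longrightarrow> i < K \<Longrightarrow> s i = []) \<Longrightarrow>
       runs P s (T (len x)) (s(0 := enc (f x)))"
  shows "pf_on D f"
  unfolding pf_on_def using assms by blast

lemma pf_onE:
  assumes "pf_on D f" 
  obtains P K p where "regs_below K P" "K \<ge> 1"
    "\<And>K' x s. K' \<ge> K \<Longrightarrow> x \<in> D \<Longrightarrow> s 0 = enc x \<Longrightarrow> (\<And>i. 1 \<le> i \<Longrightarrow> i < K' \<Longrightarrow> s i = []) \<Longrightarrow>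
       runs P s (poly p (len x)) (s(0 := enc (f x)))"
    "\<And>x. x \<in> D \<Longrightarrow> len (f x) \<le> poly p (len x)"
proof -
  obtain P K T where P: "regs_below K P" "K \<ge> 1" "pb T"
    and r: "\<forall>x\<in>D. \<forall>s. s 0 = enc x \<longrightarrow>
     (\<forall>i. 1 \<le> i \<and> i < K \<longrightarrow> s i = []) \<longrightarrow> runs P s (T (len x)) (s(0 := enc (f x)))"
    using assms unfolding pf_on_def by blast
  obtain p where p: "\<And>n. T n \<le> poly p n" using P(3) unfolding pb_def by blast
  \<comment> \<open>The additional \<open>n\<close> lets the same polynomial bound the output, which
    is at most as long as the input plus the running time.\<close>
  let ?p = "p + [:0, 1:]"
  have T: "T n \<le> poly ?p n" for n using p[of n] by simp
  have "len (f x) \<le> poly ?p (len x)" if x: "x \<in> D" for x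
  proof -
    let ?s = "\<lambda>i. if i = (0::nat) then enc x else []"
    have "runs P ?s (T (len x)) (?s(0 := enc (f x)))" using r x by simp
    then obtain n where "n \<le> T (len x)" "exec P ?s n (?s(0 := enc (f x)))" unfolding runs_def by blast
    then show ?thesis using exec_length[of P ?s n _ 0] p[of "len x"] by fastforce
  qed
  then show thesis using that[of K P ?p] P r T by (meson order_less_le_trans runs_mono)
qed

section \<open>Recoding, composition, pairing, projections and conditionals\<close>

lemma pf_on_subset: "pf_on D f \<Longrightarrow> E \<subseteq> D \<Longrightarrow> pf_on E f"
  unfolding pf_on_def by blast

lemma pf_on_cong: "pf_on D f \<Longrightarrow> (\<And>x. x \<in> D \<Longrightarrow> f x = g x) \<Longrightarrow> pf_on D g"
  unfolding pf_on_def by (metis (no_types, lifting))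

lemma pf_size:
  assumes "pf_on D f" obtains p :: "nat poly" where "\<And>x. x \<in> D \<Longrightarrow> len (f x) \<le> poly p (len x)"
  by (rule pf_onE[OF assms]) (rule that)

text \<open>A change of type that leaves the word alone costs nothing. \<open>Pop 1\<close> on an
  empty register stands for the empty program.\<close>

lemma pf_on_recode: "(\<And>x. x \<in> D \<Longrightarrow> enc (f x) = enc x) \<Longrightarrow> pf_on D f"
  by (rule pf_onI[of 2 "Pop 1" "\<lambda>_. 1"])
    (auto intro!: pb_intros runs_eq[OF runs_Pop] simp: fun_eq_iff)

lemma pf_on_comp:
  assumes "pf_on D g" "pf_on E f" "\<And>x. x \<in> D \<Longrightarrow> g x \<in> E"
  shows "pf_on D (\<lambda>x. f (g x))"
proof -
  obtain P K p where P: "regs_below K P" "K \<ge> 1"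
    "\<And>K' x s. K' \<ge> K \<Longrightarrow> x \<in> D \<Longrightarrow> s 0 = enc x \<Longrightarrow> (\<And>i. 1 \<le> i \<Longrightarrow> i < K' \<Longrightarrow> s i = []) \<Longrightarrow>
       runs P s (poly p (len x)) (s(0 := enc (g x)))"
    "\<And>x. x \<in> D \<Longrightarrow> len (g x) \<le> poly p (len x)"
    using assms(1) by (rule pf_onE) blast
  obtain Q L q where Q: "regs_below L Q" "L \<ge> 1"
    "\<And>K' x s. K' \<ge> L \<Longrightarrow> x \<in> E \<Longrightarrow> s 0 = enc x \<Longrightarrow> (\<And>i. 1 \<le> i \<Longrightarrow> i < K' \<Longrightarrow> s i = []) \<Longrightarrow>
       runs Q s (poly q (len x)) (s(0 := enc (f x)))"
    using assms(2) by (rule pf_onE) blast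
  let ?K = "max K L"
  show ?thesis
  proof (rule pf_onI[of ?K "P ;; Q" "\<lambda>n. poly p n + poly q (poly p n)"])
    show "regs_below ?K (P ;; Q)" using P(1) Q(1) by (auto intro: regs_below_mono)
    fix x s assume x: "x \<in> D" "s 0 = enc x" "\<And>i. 1 \<le> i \<Longrightarrow> i < ?K \<Longrightarrow> s i = []"
    have "runs P s (poly p (len x)) (s(0 := enc (g x)))" using P(3)[of ?K] x by simp
    moreover have "runs Q (s(0 := enc (g x))) (poly q (len (g x))) (s(0 := enc (f (g x))))"
      using Q(3)[of ?K "g x" "s(0 := enc (g x))"] x assms(3) by simp
    ultimately have "runs (P ;; Q) s (poly p (len x) + poly q (len (g x))) (s(0 := enc (f (g x))))"
      by (rule runs_Seq)
    then show "runs (P ;; Q) s (poly p (len x) + poly q (poly p (len x))) (s(0 := enc (f (g x))))"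
      by (rule runs_mono) (use P(4) x in \<open>simp add: poly_nat_mono\<close>)
  qed (use P in \<open>auto intro!: pb_intros\<close>)
qed

lemma pf_on_pair:
  assumes "pf_on D f" "pf_on D g"
  shows "pf_on D (\<lambda>x. (f x, g x))"
proof -
  obtain P K p where P: "regs_below K P" "K \<ge> 1"
    "\<And>K' x s. K' \<ge> K \<Longrightarrow> x \<in> D \<Longrightarrow> s 0 = enc x \<Longrightarrow> (\<And>i. 1 \<le> i \<Longrightarrow> i < K' \<Longrightarrow> s i = []) \<Longrightarrow>
       runs P s (poly p (len x)) (s(0 := enc (f x)))"
    "\<And>x. x \<in> D \<Longrightarrow> len (f x) \<le> poly p (len x)"
    using assms(1) by (rule pf_onE) blast
  obtain Q L q where Q: "regs_below L Q" "L \<ge> 1"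
    "\<And>K' x s. K' \<ge> L \<Longrightarrow> x \<in> D \<Longrightarrow> s 0 = enc x \<Longrightarrow> (\<And>i. 1 \<le> i \<Longrightarrow> i < K' \<Longrightarrow> s i = []) \<Longrightarrow>
       runs Q s (poly q (len x)) (s(0 := enc (g x)))"
    "\<And>x. x \<in> D \<Longrightarrow> len (g x) \<le> poly q (len x)"
    using assms(2) by (rule pf_onE) blast
  define K' where "K' = max K L"
  have K': "K' \<ge> K" "K' \<ge> L" "K' \<ge> 1" using P(2) by (auto simp: K'_def)
  \<comment> \<open>The second component is computed first, because the code of the first one has to
    be stacked on top of it. Registers \<open>K'\<close> to \<open>K' + 2\<close> are out of reach
    of \<open>P\<close> and \<open>Q\<close>; every \<open>MV\<close> reverses, so two of them
    restore the order. The two pushes lay down the closing block 01 before the doubled bits.\<close>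
  let ?R = "MV 0 (K' + 1) ;; DUP (K' + 1) 0 K' ;; Q ;; MV 0 (K' + 1) ;; MV K' (K' + 2) ;; MV (K' + 2) 0 ;; P ;;
     MV 0 K' ;; MV (K' + 1) 0 ;; Push 0 True ;; Push 0 False ;; DUP K' 0 0"
  let ?T = "\<lambda>n. (5 * n + 1) + ((7 * n + 1) + (poly q n + ((5 * poly q n + 1) + ((5 * n + 1) + ((5 * n + 1) +
    (poly p n + ((5 * poly p n + 1) + ((5 * poly q n + 1) + (2 + (2 + (7 * poly p n + 1))))))))))) "
  show ?thesis
  proof (rule pf_onI[of "K' + 3" ?R ?T])
    show "regs_below (K' + 3) ?R"
      using P(1) Q(1) K' by (auto intro: regs_below_mono)
    fix x s assume x: "x \<in> D" "s 0 = enc x" "\<And>i. 1 \<le> i \<Longrightarrow> i < K' + 3 \<Longrightarrow> s i = []"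
    define F where "F = enc (f x)" define G where "G = enc (g x)" define X where "X = enc x"
    have FG: "length F \<le> poly p (length X)" "length G \<le> poly q (length X)"
      using P(4)[OF x(1)] Q(4)[OF x(1)] by (auto simp: F_def G_def X_def)
    have s: "s 0 = X" "s K' = []" "s (K' + 1) = []" "s (K' + 2) = []" "K' \<noteq> 0" "0 \<noteq> K'"
      using x K' by (auto simp: X_def)
    have r1: "runs (MV 0 (K' + 1)) s (5 * length X + 1) (s(0 := [], K' + 1 := rev X))"
      by (rule runs_eq[OF runs_MV]) (use s in auto)
    have r2: "runs (DUP (K' + 1) 0 K') (s(0 := [], K' + 1 := rev X)) (7 * length X + 1) (s(K' := X))"
      by (rule runs_eq[OF runs_DUP]) (use s in \<open>auto simp: fun_eq_iff\<close>)
    have r3: "runs Q (s(K' := X)) (poly q (length X)) (s(K' := X, 0 := G))"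
      using Q(3)[of K' x "s(K' := X)"] x K' s by (auto simp: X_def G_def)
    have r4: "runs (MV 0 (K' + 1)) (s(K' := X, 0 := G)) (5 * poly q (length X) + 1) (s(K' := X, 0 := [], K' + 1 := rev G))"
      by (rule runs_eq[OF runs_MV]) (use s FG in \<open>auto simp: fun_eq_iff\<close>)
    have r5: "runs (MV K' (K' + 2)) (s(K' := X, 0 := [], K' + 1 := rev G)) (5 * length X + 1)
       (s(0 := [], K' + 1 := rev G, K' + 2 := rev X))"
      by (rule runs_eq[OF runs_MV]) (use s in \<open>auto simp: fun_eq_iff\<close>)
    have r6: "runs (MV (K' + 2) 0) (s(0 := [], K' + 1 := rev G, K' + 2 := rev X)) (5 * length X + 1)
       (s(K' + 1 := rev G))"
      by (rule runs_eq[OF runs_MV]) (use s in \<open>auto simp: fun_eq_iff\<close>)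
    have r7: "runs P (s(K' + 1 := rev G)) (poly p (length X)) (s(K' + 1 := rev G, 0 := F))"
      using P(3)[of K' x "s(K' + 1 := rev G)"] x K' s by (auto simp: X_def F_def)
    have r8: "runs (MV 0 K') (s(K' + 1 := rev G, 0 := F)) (5 * poly p (length X) + 1) (s(K' + 1 := rev G, 0 := [], K' := rev F))"
      by (rule runs_eq[OF runs_MV]) (use s FG in \<open>auto simp: fun_eq_iff\<close>)
    have r9: "runs (MV (K' + 1) 0) (s(K' + 1 := rev G, 0 := [], K' := rev F)) (5 * poly q (length X) + 1) (s(0 := G, K' := rev F))"
      by (rule runs_eq[OF runs_MV]) (use s FG in \<open>auto simp: fun_eq_iff\<close>)
    have r10: "runs (Push 0 True) (s(0 := G, K' := rev F)) 2 (s(0 := True # G, K' := rev F))"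
      by (rule runs_eq[OF runs_Push]) (use s in \<open>auto simp: fun_eq_iff\<close>)
    have r11: "runs (Push 0 False) (s(0 := True # G, K' := rev F)) 2 (s(0 := False # True # G, K' := rev F))"
      by (rule runs_eq[OF runs_Push]) (use s in \<open>auto simp: fun_eq_iff\<close>)
    have r12: "runs (DUP K' 0 0) (s(0 := False # True # G, K' := rev F)) (7 * poly p (length X) + 1) (s(0 := enc (f x, g x)))"
      by (rule runs_eq[OF runs_DUP]) (use s FG in \<open>auto simp: fun_eq_iff enc_word_dbl F_def G_def\<close>)
    show "runs ?R s (?T (len x)) (s(0 := enc (f x, g x)))"
      unfolding X_def[symmetric]
      by (intro runs_Seq[OF r1] runs_Seq[OF r2] runs_Seq[OF r3] runs_Seq[OF r4] runs_Seq[OF r5] runs_Seq[OF r6]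
        runs_Seq[OF r7] runs_Seq[OF r8] runs_Seq[OF r9] runs_Seq[OF r10] runs_Seq[OF r11] r12)
  qed (use P in \<open>auto intro!: pb_intros\<close>)
qed

text \<open>Register 2 is a flag that keeps the loop going until the closing block 01 is met. The
  bits split off end up reversed in register 1.\<close>

definition UNP :: prog where
  "UNP = Push 2 True ;; While 2 (Cond 0 (Pop 0 ;; Pop 0 ;; Push 1 True)
     (Pop 0 ;; Cond 0 (Pop 0 ;; Pop 2) (Pop 0 ;; Push 1 False)))"

lemma runs_UNP:
  assumes "s 0 = enc_word u @ v" "s 1 = []" "s 2 = []"
  shows "runs UNP s (8 * length u + 9) (s(0 := v, 1 := rev u))"
proof -
  let ?B = "Cond 0 (Pop 0 ;; Pop 0 ;; Push 1 True) (Pop 0 ;; Cond 0 (Pop 0 ;; Pop 2) (Pop 0 ;; Push 1 False))"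
  have "runs (While 2 ?B) s (8 * length u + 7) (s(0 := v, 1 := rev u @ s 1, 2 := []))"
    if "s 0 = enc_word u @ v" "s 2 = [True]" for s :: state and u
    using that
  proof (induction u arbitrary: s)
    case Nil
    have 1: "runs (Pop 0) s 1 (s(0 := True # v))"
      by (rule runs_eq[OF runs_Pop]) (use Nil in \<open>auto simp: enc_word_dbl\<close>)
    have 2: "runs (Pop 0) (s(0 := True # v)) 1 (s(0 := v))"
      by (rule runs_eq[OF runs_Pop]) auto
    have 3: "runs (Pop 2) (s(0 := v)) 1 (s(0 := v, 2 := []))"
      by (rule runs_eq[OF runs_Pop]) (use Nil in auto)
    have 4: "runs (Cond 0 (Pop 0 ;; Pop 2) (Pop 0 ;; Push 1 False)) (s(0 := True # v)) (Suc (1 + 1)) (s(0 := v, 2 := []))"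
      by (rule runs_CondT[OF _ runs_Seq[OF 2 3]]) simp
    have "runs ?B s (Suc (1 + Suc (1 + 1))) (s(0 := v, 2 := []))"
      by (rule runs_CondF[OF _ runs_Seq[OF 1 4]]) (use Nil in \<open>simp add: enc_word_dbl\<close>)
    then have "runs (While 2 ?B) s (Suc (Suc (1 + Suc (1 + 1)) + 1)) (s(0 := v, 2 := []))"
      by (rule runs_WhileN[rotated, OF _ runs_WhileE]) (use Nil in auto)
    then show ?case by (rule runs_eq) (auto simp: fun_eq_iff)
  next
    case (Cons b u)
    let ?s1 = "s(0 := b # enc_word u @ v)" and ?s2 = "s(0 := enc_word u @ v)"
    let ?s3 = "s(0 := enc_word u @ v, 1 := b # s 1)"
    have 1: "runs (Pop 0) s 1 ?s1"
      by (rule runs_eq[OF runs_Pop]) (use Cons in \<open>auto simp: enc_word_dbl\<close>)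
    have 2: "runs (Pop 0) ?s1 1 ?s2"
      by (rule runs_eq[OF runs_Pop]) auto
    have 3: "runs (Push 1 b) ?s2 2 ?s3"
      by (rule runs_eq[OF runs_Push]) auto
    have "runs ?B s 6 ?s3"
    proof (cases b)
      case True
      show ?thesis
        by (rule runs_mono[OF runs_CondT[OF _ runs_Seq[OF 1 runs_Seq[OF 2]]]])
          (use 3 True Cons in \<open>auto simp: enc_word_dbl\<close>)
    next
      case False
      have 4: "runs (Cond 0 (Pop 0 ;; Pop 2) (Pop 0 ;; Push 1 False)) ?s1 (Suc (1 + 2)) ?s3"
        by (rule runs_CondF[OF _ runs_Seq[OF 2]]) (use False 3 in auto)
      show ?thesis
        by (rule runs_mono[OF runs_CondF[OF _ runs_Seq[OF 1 4]]]) (use False Cons in \<open>auto simp: enc_word_dbl\<close>)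
    qed
    moreover have "runs (While 2 ?B) ?s3 (8 * length u + 7) (?s3(0 := v, 1 := rev u @ ?s3 1, 2 := []))"
      by (rule Cons.IH) (use Cons in auto)
    ultimately have "runs (While 2 ?B) s (Suc (6 + (8 * length u + 7))) (?s3(0 := v, 1 := rev u @ ?s3 1, 2 := []))"
      by (rule runs_WhileN[rotated]) (use Cons in auto)
    then show ?case by (rule runs_eq) (auto simp: fun_eq_iff)
  qed
  from this[of "s(2 := [True])" u] have "runs (While 2 ?B) (s(2 := [True])) (8 * length u + 7)
     ((s(2 := [True]))(0 := v, 1 := rev u @ (s(2 := [True])) 1, 2 := []))"
    using assms by simp
  then have w: "runs (While 2 ?B) (s(2 := [True])) (8 * length u + 7) (s(0 := v, 1 := rev u))"
    by (rule runs_eq) (use assms in \<open>auto simp: fun_eq_iff\<close>)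
  have "runs (Push 2 True) s 2 (s(2 := [True]))" by (rule runs_eq[OF runs_Push]) (use assms in auto)
  from runs_Seq[OF this w] show ?thesis unfolding UNP_def by (rule runs_mono) simp
qed

lemma regs_below_UNP[simp]: "regs_below K UNP \<longleftrightarrow> 3 \<le> K"
  by (auto simp: UNP_def)

lemma pf_on_fst0: "pf_on D fst"
proof (rule pf_onI[of 3 "UNP ;; CLR 0 ;; MV 1 0" "\<lambda>n. (8 * n + 9) + ((2 * n + 1) + (5 * n + 1))"])
  fix x :: "'a \<times> 'b" and s :: state
  assume s: "s 0 = enc x" "\<And>i. 1 \<le> i \<Longrightarrow> i < 3 \<Longrightarrow> s i = []"
  obtain a b where [simp]: "x = (a, b)" by fastforce
  have 1: "runs UNP s (8 * len x + 9) (s(0 := enc b, 1 := rev (enc a)))"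
    by (rule runs_mono[OF runs_UNP]) (use s in auto)
  have 2: "runs (CLR 0) (s(0 := enc b, 1 := rev (enc a))) (2 * len x + 1) (s(0 := [], 1 := rev (enc a)))"
    by (rule runs_eq[OF runs_CLR]) auto
  have 3: "runs (MV 1 0) (s(0 := [], 1 := rev (enc a))) (5 * len x + 1) (s(0 := enc (fst x)))"
    by (rule runs_eq[OF runs_MV]) (use s in \<open>auto simp: fun_eq_iff\<close>)
  show "runs (UNP ;; CLR 0 ;; MV 1 0) s ((8 * len x + 9) + ((2 * len x + 1) + (5 * len x + 1))) (s(0 := enc (fst x)))"
    by (intro runs_Seq[OF 1] runs_Seq[OF 2] 3)
qed (auto intro!: pb_intros)

lemma pf_on_snd0: "pf_on D snd"
proof (rule pf_onI[of 3 "UNP ;; CLR 1" "\<lambda>n. (8 * n + 9) + (2 * n + 1)"])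
  fix x :: "'a \<times> 'b" and s :: state
  assume s: "s 0 = enc x" "\<And>i. 1 \<le> i \<Longrightarrow> i < 3 \<Longrightarrow> s i = []"
  obtain a b where [simp]: "x = (a, b)" by fastforce
  have 1: "runs UNP s (8 * len x + 9) (s(0 := enc b, 1 := rev (enc a)))"
    by (rule runs_mono[OF runs_UNP]) (use s in auto)
  have 2: "runs (CLR 1) (s(0 := enc b, 1 := rev (enc a))) (2 * len x + 1) (s(0 := enc (snd x)))"
    by (rule runs_eq[OF runs_CLR]) (use s in \<open>auto simp: fun_eq_iff\<close>)
  show "runs (UNP ;; CLR 1) s ((8 * len x + 9) + (2 * len x + 1)) (s(0 := enc (snd x)))"
    by (intro runs_Seq[OF 1] 2)
qed (auto intro!: pb_intros)

text \<open>Each branch has to work only where it is taken; this is how operations with a restricted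
  domain become usable behind a test.\<close>

lemma pf_on_if:
  assumes "pf_on D b" "pf_on {x \<in> D. b x} f" "pf_on {x \<in> D. \<not> b x} g"
  shows "pf_on D (\<lambda>x. if b x then f x else g x)"
proof -
  obtain B H h where B: "regs_below H B" "H \<ge> 1"
    "\<And>K' x s. K' \<ge> H \<Longrightarrow> x \<in> D \<Longrightarrow> s 0 = enc x \<Longrightarrow> (\<And>i. 1 \<le> i \<Longrightarrow> i < K' \<Longrightarrow> s i = []) \<Longrightarrow>
       runs B s (poly h (len x)) (s(0 := enc (b x)))"
    using assms(1) by (rule pf_onE) blast
  obtain P K p where P: "regs_below K P" "K \<ge> 1"
    "\<And>K' x s. K' \<ge> K \<Longrightarrow> x \<in> {x \<in> D. b x} \<Longrightarrow> s 0 = enc x \<Longrightarrow> (\<And>i. 1 \<le> i \<Longrightarrow> i < K' \<Longrightarrow> s i = []) \<Longrightarrow>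
       runs P s (poly p (len x)) (s(0 := enc (f x)))"
    using assms(2) by (rule pf_onE) blast
  obtain Q L q where Q: "regs_below L Q" "L \<ge> 1"
    "\<And>K' x s. K' \<ge> L \<Longrightarrow> x \<in> {x \<in> D. \<not> b x} \<Longrightarrow> s 0 = enc x \<Longrightarrow> (\<And>i. 1 \<le> i \<Longrightarrow> i < K' \<Longrightarrow> s i = []) \<Longrightarrow>
       runs Q s (poly q (len x)) (s(0 := enc (g x)))"
    using assms(3) by (rule pf_onE) blast
  define K' where "K' = max H (max K L)"
  have K': "K' \<ge> K" "K' \<ge> L" "K' \<ge> H" "K' \<ge> 1" using P(2) by (auto simp: K'_def)
  let ?back = "\<lambda>P. Pop 0 ;; MV K' (K' + 1) ;; MV (K' + 1) 0 ;; P"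
  let ?R = "MV 0 (K' + 1) ;; DUP (K' + 1) 0 K' ;; B ;; Cond 0 (?back P) (?back Q)"
  let ?T = "\<lambda>n. (5 * n + 1) + ((7 * n + 1) + (poly h n + (Suc (1 + ((5 * n + 1) + ((5 * n + 1) + (poly p n + poly q n)))))))"
  show ?thesis
  proof (rule pf_onI[of "K' + 2" ?R ?T])
    show "regs_below (K' + 2) ?R"
      using P(1) Q(1) B(1) K' by (auto intro: regs_below_mono)
    fix x s assume x: "x \<in> D" "s 0 = enc x" "\<And>i. 1 \<le> i \<Longrightarrow> i < K' + 2 \<Longrightarrow> s i = []"
    define X where "X = enc x"
    have s: "s 0 = X" "s K' = []" "s (K' + 1) = []" "K' \<noteq> 0" "0 \<noteq> K'"
      using x K' by (auto simp: X_def)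
    have r1: "runs (MV 0 (K' + 1)) s (5 * length X + 1) (s(0 := [], K' + 1 := rev X))"
      by (rule runs_eq[OF runs_MV]) (use s in auto)
    have r2: "runs (DUP (K' + 1) 0 K') (s(0 := [], K' + 1 := rev X)) (7 * length X + 1) (s(K' := X))"
      by (rule runs_eq[OF runs_DUP]) (use s in \<open>auto simp: fun_eq_iff\<close>)
    have r3: "runs B (s(K' := X)) (poly h (length X)) (s(K' := X, 0 := [b x]))"
      using B(3)[of K' x "s(K' := X)"] x K' s by (auto simp: X_def)
    have r4: "runs (Pop 0) (s(K' := X, 0 := [b x])) 1 (s(K' := X, 0 := []))"
      by (rule runs_eq[OF runs_Pop]) (use s in \<open>auto simp: fun_eq_iff\<close>)
    have r5: "runs (MV K' (K' + 1)) (s(K' := X, 0 := [])) (5 * length X + 1) (s(0 := [], K' + 1 := rev X))"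
      by (rule runs_eq[OF runs_MV]) (use s in \<open>auto simp: fun_eq_iff\<close>)
    have r6: "runs (MV (K' + 1) 0) (s(0 := [], K' + 1 := rev X)) (5 * length X + 1) s"
      by (rule runs_eq[OF runs_MV]) (use s in \<open>auto simp: fun_eq_iff\<close>)
    let ?t = "1 + ((5 * length X + 1) + ((5 * length X + 1) + (poly p (length X) + poly q (length X))))"
    have "runs (Cond 0 (?back P) (?back Q)) (s(K' := X, 0 := [b x])) (Suc ?t)
       (s(0 := enc (if b x then f x else g x)))"
    proof (cases "b x")
      case True
      have "runs P s (poly p (length X) + poly q (length X)) (s(0 := enc (f x)))"
        by (rule runs_mono[OF P(3)[of K' x s]]) (use x K' s True in \<open>auto simp: X_def\<close>)
      then have "runs (?back P) (s(K' := X, 0 := [b x])) ?t (s(0 := enc (f x)))"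
        by (intro runs_Seq[OF r4] runs_Seq[OF r5] runs_Seq[OF r6])
      then show ?thesis using True s by (intro runs_CondT) auto
    next
      case False
      have "runs Q s (poly p (length X) + poly q (length X)) (s(0 := enc (g x)))"
        by (rule runs_mono[OF Q(3)[of K' x s]]) (use x K' s False in \<open>auto simp: X_def\<close>)
      then have "runs (?back Q) (s(K' := X, 0 := [b x])) ?t (s(0 := enc (g x)))"
        by (intro runs_Seq[OF r4] runs_Seq[OF r5] runs_Seq[OF r6])
      then show ?thesis using False s by (intro runs_CondF) auto
    qed
    then show "runs ?R s (?T (len x)) (s(0 := enc (if b x then f x else g x)))"
      unfolding X_def[symmetric] by (intro runs_Seq[OF r1] runs_Seq[OF r2] runs_Seq[OF r3])
  qed (use P in \<open>auto intro!: pb_intros\<close>)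
qed

fun PUSHW :: "word \<Rightarrow> prog" where
  "PUSHW [] = CLR 0"
| "PUSHW (b # w) = PUSHW w ;; Push 0 b"

lemma runs_PUSHW: "runs (PUSHW w) s (2 * length (s 0) + 1 + 2 * length w) (s(0 := w))"
proof (induction w)
  case Nil show ?case unfolding PUSHW.simps by (rule runs_eq[OF runs_CLR]) auto
next
  case (Cons b w)
  show ?case unfolding PUSHW.simps by (rule runs_eq[OF runs_Seq[OF Cons runs_Push]]) auto
qed

lemma pf_on_const: "pf_on D (\<lambda>x. c)"
proof -
  have "regs_below 1 (PUSHW w)" for w by (induction w) auto
  then show ?thesis
    by (intro pf_onI[of 1 "PUSHW (enc c)" "\<lambda>n. 2 * n + 1 + 2 * len c"])
      (auto intro!: pb_intros runs_eq[OF runs_PUSHW])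
qed

text \<open>Compares register 2 with the front of register 0 and leaves one mark in register 1 per
  mismatch. \<open>Pop 3\<close> acts on an empty register and serves as the idle branch.\<close>

definition EQP :: prog where
  "EQP = While 2 (Cond 2 (Cond 0 (Pop 3) (Push 1 True)) (Cond 0 (Push 1 True) (Pop 3)) ;; Pop 2 ;; Pop 0)"

fun mismatch :: "word \<Rightarrow> word \<Rightarrow> bool" where
  "mismatch [] z = False"
| "mismatch (b # w) z = (b \<noteq> (z \<noteq> [] \<and> hd z) \<or> mismatch w (tl z))"

text \<open>The code is prefix-free: an unequal pair of bits occurs only as the closing block, so
  different words show a difference before either code runs out.\<close>

lemma mismatch_enc_word: "\<not> mismatch (enc_word u) (enc_word v @ r) \<longleftrightarrow> u = v"
proof (induction u arbitrary: v)
  case Nil show ?case by (cases v) (auto simp: enc_word_dbl)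
next
  case (Cons b u) then show ?case by (cases v) (auto simp: enc_word_dbl)
qed

lemma runs_EQP:
  assumes "s 3 = []"
  shows "\<exists>k. length k \<le> length (s 1) + length (s 2) \<and> (k \<noteq> [] \<longleftrightarrow> mismatch (s 2) (s 0) \<or> s 1 \<noteq> []) \<and>
    (set (s 1) \<subseteq> {True} \<longrightarrow> set k \<subseteq> {True}) \<and>
    runs EQP s (7 * length (s 2) + 1) (s(0 := drop (length (s 2)) (s 0), 1 := k, 2 := []))"
  using assms
proof (induction "s 2" arbitrary: s)
  case Nil
  show ?case
    by (rule exI[of _ "s 1"]) (use Nil(1)[symmetric] in \<open>auto simp: EQP_def fun_eq_iff intro!: runs_eq[OF runs_WhileE]\<close>)
next
  case (Cons c w)
  note sa = Cons(2)[symmetric]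
  define m where "m \<longleftrightarrow> c \<noteq> (s 0 \<noteq> [] \<and> hd (s 0))"
  let ?s1 = "s(1 := if m then True # s 1 else s 1)" let ?s2 = "?s1(2 := w)" let ?s3 = "?s2(0 := tl (s 0))"
  have pu: "runs (Push 1 True) s 2 (s(1 := True # s 1))" by (rule runs_Push)
  have po: "runs (Pop 3) s 2 (s(1 := s 1))"
    by (rule runs_eq[OF runs_Pop]) (use Cons(3) in \<open>auto simp: fun_eq_iff\<close>)
  have "runs (Cond 2 (Cond 0 (Pop 3) (Push 1 True)) (Cond 0 (Push 1 True) (Pop 3))) s (Suc (Suc 2)) ?s1"
  proof (cases c)
    case True
    show ?thesis
    proof (rule runs_CondT)
      show "runs (Cond 0 (Pop 3) (Push 1 True)) s (Suc 2) ?s1"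
      proof (cases m)
        case m: True
        show ?thesis by (rule runs_CondF) (use pu True m m_def in auto)
      next
        case False
        show ?thesis by (rule runs_CondT) (use po True False m_def in auto)
      qed
    qed (use True sa in auto)
  next
    case False
    show ?thesis
    proof (rule runs_CondF)
      show "runs (Cond 0 (Push 1 True) (Pop 3)) s (Suc 2) ?s1"
      proof (cases m)
        case m: True
        show ?thesis by (rule runs_CondT) (use pu False m m_def in auto)
      next
        case m: False
        show ?thesis by (rule runs_CondF) (use po False m m_def in auto)
      qed
    qed (use False sa in auto)
  qed
  moreover have "runs (Pop 2) ?s1 1 ?s2" by (rule runs_eq[OF runs_Pop]) (auto simp: sa)
  moreover have "runs (Pop 0) ?s2 1 ?s3" by (rule runs_eq[OF runs_Pop]) auto
  ultimately have body: "runs (Cond 2 (Cond 0 (Pop 3) (Push 1 True)) (Cond 0 (Push 1 True) (Pop 3)) ;; Pop 2 ;; Pop 0) s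
     (Suc (Suc 2) + (1 + 1)) ?s3" by (intro runs_Seq)
  have "\<exists>k. length k \<le> length (?s3 1) + length (?s3 2) \<and> (k \<noteq> [] \<longleftrightarrow> mismatch (?s3 2) (?s3 0) \<or> ?s3 1 \<noteq> []) \<and>
    (set (?s3 1) \<subseteq> {True} \<longrightarrow> set k \<subseteq> {True}) \<and>
    runs EQP ?s3 (7 * length (?s3 2) + 1) (?s3(0 := drop (length (?s3 2)) (?s3 0), 1 := k, 2 := []))"
    by (rule Cons(1)) (use Cons in auto)
  then obtain k where k: "length k \<le> length (?s3 1) + length w" "k \<noteq> [] \<longleftrightarrow> mismatch w (tl (s 0)) \<or> ?s3 1 \<noteq> []"
    "set (?s3 1) \<subseteq> {True} \<longrightarrow> set k \<subseteq> {True}"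
    "runs EQP ?s3 (7 * length w + 1) (?s3(0 := drop (length w) (tl (s 0)), 1 := k, 2 := []))"
    by auto
  have "runs EQP s (Suc ((Suc (Suc 2) + (1 + 1)) + (7 * length w + 1))) (?s3(0 := drop (length w) (tl (s 0)), 1 := k, 2 := []))"
    unfolding EQP_def by (rule runs_WhileN[OF _ body k(4)[unfolded EQP_def]]) (simp add: sa)
  then have "runs EQP s (7 * length (s 2) + 1) (s(0 := drop (length (s 2)) (s 0), 1 := k, 2 := []))"
    by (rule runs_eq) (auto simp: sa fun_eq_iff drop_Suc)
  moreover have "k \<noteq> [] \<longleftrightarrow> mismatch (s 2) (s 0) \<or> s 1 \<noteq> []" using k(2) by (auto simp: sa m_def split: if_splits)
  ultimately show ?case using k(1,3) by (intro exI[of _ k]) (auto simp: sa split: if_splits)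
qed

text \<open>The last component is a dummy. It puts the second component into the delimited position
  of a pair, so that both codes can be compared as blocks.\<close>

lemma pf_eq0: "pf (\<lambda>x :: 'a::enc \<times> 'a \<times> 'b::enc. fst x = fst (snd x))"
proof -
  let ?R = "UNP ;; Push 2 True ;; Push 2 False ;; DUP 1 2 2 ;; EQP ;; CLR 0 ;; Cond 1 (CLR 1 ;; Push 0 False) (Push 0 True)"
  let ?T = "\<lambda>n. (8 * n + 9) + (2 + (2 + ((7 * n + 1) + ((7 * (2 * n + 2) + 1) + ((2 * n + 1) + Suc ((2 * (2 * n + 2) + 1) + 2))))))"
  show ?thesis
  proof (rule pf_onI[of 4 ?R ?T])
    fix x :: "'a \<times> 'a \<times> 'b" and s :: state
    assume s: "s 0 = enc x" "\<And>i. 1 \<le> i \<Longrightarrow> i < 4 \<Longrightarrow> s i = []"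
    obtain a b c where [simp]: "x = (a, b, c)" by (cases x) auto
    let ?U = "enc a" and ?V = "enc_word (enc b) @ enc c" let ?n = "len x"
    have s0: "s 1 = []" "s 2 = []" "s 3 = []" using s by auto
    have r1: "runs UNP s (8 * ?n + 9) (s(0 := ?V, 1 := rev ?U))"
      by (rule runs_mono[OF runs_UNP]) (use s in auto)
    have r2: "runs (Push 2 True) (s(0 := ?V, 1 := rev ?U)) 2 (s(0 := ?V, 1 := rev ?U, 2 := [True]))"
      by (rule runs_eq[OF runs_Push]) (use s in auto)
    have r3: "runs (Push 2 False) (s(0 := ?V, 1 := rev ?U, 2 := [True])) 2 (s(0 := ?V, 1 := rev ?U, 2 := [False, True]))"
      by (rule runs_eq[OF runs_Push]) (use s in auto)
    let ?s4 = "s(0 := ?V, 2 := enc_word ?U)"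
    have r4: "runs (DUP 1 2 2) (s(0 := ?V, 1 := rev ?U, 2 := [False, True])) (7 * ?n + 1) ?s4"
      by (rule runs_eq[OF runs_DUP]) (use s in \<open>auto simp: fun_eq_iff enc_word_dbl\<close>)
    obtain k where k: "length k \<le> length (enc_word ?U)" "k \<noteq> [] \<longleftrightarrow> mismatch (enc_word ?U) ?V"
      "set k \<subseteq> {True}"
      "runs EQP ?s4 (7 * length (enc_word ?U) + 1) (?s4(0 := drop (length (enc_word ?U)) ?V, 1 := k, 2 := []))"
      using runs_EQP[of ?s4] s0 by auto
    let ?W = "drop (length (enc_word ?U)) ?V"
    have r5: "runs EQP ?s4 (7 * (2 * ?n + 2) + 1) (s(0 := ?W, 1 := k))"
      by (rule runs_eq[OF k(4)]) (use s0 in \<open>auto simp: fun_eq_iff\<close>)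
    have r6: "runs (CLR 0) (s(0 := ?W, 1 := k)) (2 * ?n + 1) (s(0 := [], 1 := k))"
      by (rule runs_eq[OF runs_CLR]) auto
    have "runs (Cond 1 (CLR 1 ;; Push 0 False) (Push 0 True)) (s(0 := [], 1 := k)) (Suc ((2 * (2 * ?n + 2) + 1) + 2))
        (s(0 := enc (a = b)))"
    proof (cases "a = b")
      case True
      then have "k = []" using k(2) mismatch_enc_word by blast
      then show ?thesis using True s0 by (intro runs_CondF runs_eq[OF runs_Push]) (auto simp: fun_eq_iff)
    next
      case False
      then have "k \<noteq> []" using k(2) mismatch_enc_word enc_inj by blast
      moreover have "runs (CLR 1) (s(0 := [], 1 := k)) (2 * (2 * ?n + 2) + 1) (s(0 := []))"
        by (rule runs_eq[OF runs_CLR]) (use k(1) s0 in \<open>auto simp: fun_eq_iff\<close>)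
      moreover have "runs (Push 0 False) (s(0 := [])) 2 (s(0 := enc (a = b)))"
        by (rule runs_eq[OF runs_Push]) (use False in auto)
      ultimately show ?thesis using k(3) by (intro runs_CondT runs_Seq) (auto simp: neq_Nil_conv)
    qed
    then show "runs ?R s (?T ?n) (s(0 := enc (fst x = fst (snd x))))"
      by (intro runs_Seq[OF r1] runs_Seq[OF r2] runs_Seq[OF r3] runs_Seq[OF r4] runs_Seq[OF r5] runs_Seq[OF r6]) simp
  qed (auto intro!: pb_intros simp: EQP_def)
qed

section \<open>Iteration with polynomially bounded intermediate results\<close>

definition pbx :: "('a::enc \<Rightarrow> nat) \<Rightarrow> bool" where
  "pbx F \<longleftrightarrow> (\<exists>p :: nat poly. \<forall>x. F x \<le> poly p (len x))"

named_theorems pbx_intros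
named_theorems pf_intros

lemma pbx_le: "pbx F \<Longrightarrow> (\<And>x. G x \<le> F x) \<Longrightarrow> pbx G"
  unfolding pbx_def by (meson order_trans)

lemma pbx_pb: "pb T \<Longrightarrow> pbx (\<lambda>x. T (len x))"
  unfolding pb_def pbx_def by blast

lemma pbx_const[pbx_intros]: "pbx (\<lambda>x. c)" using pbx_pb[OF pb_const] .

lemma pbx_add[pbx_intros]: assumes "pbx F" "pbx G" shows "pbx (\<lambda>x. F x + G x)"
proof -
  from assms obtain p q where "\<forall>x. F x \<le> poly p (len x)" "\<forall>x. G x \<le> poly q (len x)" unfolding pbx_def by blast
  then have "\<forall>x. F x + G x \<le> poly (p + q) (len x)" by (auto intro: add_mono)
  then show ?thesis unfolding pbx_def by blast
qed

lemma pbx_mult[pbx_intros]: assumes "pbx F" "pbx G" shows "pbx (\<lambda>x. F x * G x)"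
proof -
  from assms obtain p q where "\<forall>x. F x \<le> poly p (len x)" "\<forall>x. G x \<le> poly q (len x)" unfolding pbx_def by blast
  then have "\<forall>x. F x * G x \<le> poly (p * q) (len x)" by (auto intro: mult_mono)
  then show ?thesis unfolding pbx_def by blast
qed

lemma pbx_Suc[pbx_intros]: "pbx F \<Longrightarrow> pbx (\<lambda>x. Suc (F x))"
  using pbx_add[OF _ pbx_const[of 1]] by fastforce

lemma pbx_poly[pbx_intros]: assumes "pbx F" shows "pbx (\<lambda>x. poly p (F x))"
proof -
  from assms obtain q where "\<forall>x. F x \<le> poly q (len x)" unfolding pbx_def by blast
  then have "\<forall>x. poly p (F x) \<le> poly (pcompose p q) (len x)" by (auto simp: poly_pcompose intro: poly_nat_mono)
  then show ?thesis unfolding pbx_def by blast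
qed

lemma pbx_pf[pbx_intros]: "pf f \<Longrightarrow> pbx (\<lambda>x. len (f x))"
  by (erule pf_size) (auto simp: pbx_def)

lemma pbx_nat: "pf f \<Longrightarrow> pbx f"
  using pbx_pf[of f] by simp

text \<open>Iterating a polynomial-time function may let values grow exponentially, hence the bound
  \<open>B\<close> on all intermediate results. The code of the first component of
  \<open>g x\<close> serves as loop counter, one bit per round.\<close>

lemma pf_iter0:
  fixes f :: "'a::enc \<Rightarrow> 'a" and g :: "'x::enc \<Rightarrow> 'c::enc \<times> 'a"
  assumes "pf f" "pf g" "pbx B"
    and "\<And>x i. i \<le> len (fst (g x)) \<Longrightarrow> len ((f ^^ i) (snd (g x))) \<le> B x"
  shows "pf (\<lambda>x. (f ^^ len (fst (g x))) (snd (g x)))"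
proof -
  obtain G L q where G: "regs_below L G" "L \<ge> 1"
    "\<And>K' x s. K' \<ge> L \<Longrightarrow> x \<in> UNIV \<Longrightarrow> s 0 = enc x \<Longrightarrow> (\<And>i. 1 \<le> i \<Longrightarrow> i < K' \<Longrightarrow> s i = []) \<Longrightarrow>
       runs G s (poly q (len x)) (s(0 := enc (g x)))"
    "\<And>x. x \<in> UNIV \<Longrightarrow> len (g x) \<le> poly q (len x)"
    using assms(2) by (rule pf_onE) blast
  obtain F K p where F: "regs_below K F" "K \<ge> 1"
    "\<And>K' x s. K' \<ge> K \<Longrightarrow> x \<in> UNIV \<Longrightarrow> s 0 = enc x \<Longrightarrow> (\<And>i. 1 \<le> i \<Longrightarrow> i < K' \<Longrightarrow> s i = []) \<Longrightarrow>
       runs F s (poly p (len x)) (s(0 := enc (f x)))"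
    using assms(1) by (rule pf_onE) blast
  obtain b :: "nat poly" where b: "\<And>x. B x \<le> poly b (len x)" using assms(3) unfolding pbx_def by blast
  define K' where "K' = max 3 (max K L)"
  have K': "K' \<ge> K" "K' \<ge> L" "K' \<ge> 3" by (auto simp: K'_def)
  let ?W = "While K' (Pop K' ;; F)"
  have loop: "runs ?W s (length (s K') * (2 + poly p m) + 1) (s(0 := enc ((f ^^ length (s K')) a), K' := []))"
    if "s 0 = enc a" "\<And>i. 1 \<le> i \<Longrightarrow> i < K' \<Longrightarrow> s i = []" "\<And>i. i \<le> length (s K') \<Longrightarrow> len ((f ^^ i) a) \<le> m" for s a m
    using that
  proof (induction "s K'" arbitrary: s a)
    case Nil
    then show ?case using K' by (intro runs_eq[OF runs_WhileE]) (auto simp: fun_eq_iff)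
  next
    case (Cons c w)
    note sa = Cons(2)[symmetric]
    let ?s1 = "s(K' := w)" let ?s2 = "?s1(0 := enc (f a))"
    have 1: "runs (Pop K') s 1 ?s1" by (rule runs_eq[OF runs_Pop]) (auto simp: sa)
    have "runs F ?s1 (poly p (len a)) ?s2" using F(3)[of K' a ?s1] K' Cons by auto
    then have 2: "runs F ?s1 (poly p m) ?s2"
      by (rule runs_mono) (use Cons(5)[of 0] in \<open>simp add: poly_nat_mono\<close>)
    have 3: "runs ?W ?s2 (length w * (2 + poly p m) + 1) (?s2(0 := enc ((f ^^ length w) (f a)), K' := []))"
    proof -
      have "len ((f ^^ i) (f a)) \<le> m" if "i \<le> length w" for i
        using Cons(5)[of "Suc i"] that by (simp add: funpow_swap1 sa)
      then show ?thesis using Cons(1)[of ?s2 "f a"] Cons K' by auto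
    qed
    have "runs ?W s (Suc ((1 + poly p m) + (length w * (2 + poly p m) + 1))) (?s2(0 := enc ((f ^^ length w) (f a)), K' := []))"
      by (rule runs_WhileN[OF _ runs_Seq[OF 1 2] 3]) (simp add: sa)
    then show ?case by (rule runs_eq) (use K' in \<open>auto simp: sa fun_eq_iff funpow_swap1\<close>)
  qed
  let ?R = "G ;; UNP ;; MV 1 K' ;; ?W"
  let ?T = "\<lambda>n. poly q n + ((8 * poly q n + 9) + ((5 * poly q n + 1) + (poly q n * (2 + poly p (poly b n)) + 1)))"
  show ?thesis
  proof (rule pf_onI[of "K' + 1" ?R ?T])
    show "regs_below (K' + 1) ?R" using G(1) F(1) K' by (auto intro: regs_below_mono)
    fix x :: 'x and s :: state
    assume s: "s 0 = enc x" "\<And>i. 1 \<le> i \<Longrightarrow> i < K' + 1 \<Longrightarrow> s i = []"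
    obtain c a where g: "g x = (c, a)" by fastforce
    let ?n = "len x"
    have le: "2 * len c + 2 + len a \<le> poly q ?n" using G(4)[of x] by (simp add: g)
    have s0: "s 1 = []" "s 2 = []" "s K' = []" using s K' by auto
    have r1: "runs G s (poly q ?n) (s(0 := enc (g x)))" using G(3)[of K' x s] s K' by simp
    have r2: "runs UNP (s(0 := enc (g x))) (8 * poly q ?n + 9) (s(0 := enc a, 1 := rev (enc c)))"
      by (rule runs_eq[OF runs_UNP[of _ "enc c" "enc a"]]) (use s0 le in \<open>auto simp: g fun_eq_iff\<close>)
    have r3: "runs (MV 1 K') (s(0 := enc a, 1 := rev (enc c))) (5 * poly q ?n + 1) (s(0 := enc a, K' := enc c))"
      by (rule runs_eq[OF runs_MV]) (use s0 le K' in \<open>auto simp: fun_eq_iff\<close>)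
    let ?s = "s(0 := enc a, K' := enc c)"
    have "runs ?W ?s (length (?s K') * (2 + poly p (poly b ?n)) + 1) (?s(0 := enc ((f ^^ length (?s K')) a), K' := []))"
      by (rule loop) (use s K' assms(4)[of _ x] b[of x] in \<open>auto simp: g intro: order_trans\<close>)
    then have r4: "runs ?W ?s (poly q ?n * (2 + poly p (poly b ?n)) + 1) (s(0 := enc ((f ^^ len c) a)))"
      by (rule runs_eq) (use le s0 K' in \<open>auto simp: fun_eq_iff intro!: add_mono mult_right_mono\<close>)
    show "runs ?R s (?T ?n) (s(0 := enc ((f ^^ len (fst (g x))) (snd (g x)))))"
      by (intro runs_Seq[OF r1] runs_Seq[OF r2] runs_Seq[OF r3]) (use r4 in \<open>simp add: g\<close>)
  qed (auto intro!: pb_intros)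
qed

section \<open>Elementary operations on numbers and raw words, and the passage to Turing
  machines\<close>

lemma pf_Suc0: "pf Suc"
  by (rule pf_onI[of 1 "Push 0 True" "\<lambda>_. 2"]) (auto intro!: pb_intros runs_eq[OF runs_Push])

lemma pf_pred0: "pf (\<lambda>n :: nat. n - 1)"
proof (rule pf_onI[of 1 "Pop 0" "\<lambda>_. 1"])
  fix x :: nat and s :: state assume "s 0 = enc x"
  then show "runs (Pop 0) s 1 (s(0 := enc (x - 1)))"
    by (cases x) (auto intro!: runs_eq[OF runs_Pop])
qed (auto intro!: pb_intros)

lemma pf_raw_hd0: "pf (\<lambda>w. unraw w \<noteq> [] \<and> hd (unraw w))"
proof (rule pf_onI[of 1 "Cond 0 (CLR 0 ;; Push 0 True) (CLR 0 ;; Push 0 False)" "\<lambda>n. Suc ((2 * n + 1) + 2)"])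
  fix x :: raw and s :: state assume s: "s 0 = enc x"
  have 1: "runs (CLR 0) s (2 * len x + 1) (s(0 := []))" by (rule runs_eq[OF runs_CLR]) (simp_all add: s)
  have 2: "runs (Push 0 b) (s(0 := [])) 2 (s(0 := [b]))" for b by (rule runs_eq[OF runs_Push]) simp_all
  show "runs (Cond 0 (CLR 0 ;; Push 0 True) (CLR 0 ;; Push 0 False)) s (Suc ((2 * len x + 1) + 2))
     (s(0 := enc (unraw x \<noteq> [] \<and> hd (unraw x))))"
  proof (cases "s 0 \<noteq> [] \<and> hd (s 0)")
    case True
    then show ?thesis
      using runs_CondT[OF True runs_Seq[OF 1 2[of True]], of "CLR 0 ;; Push 0 False"] s by (simp add: enc_raw_def)
  next
    case False
    then have *: "(unraw x \<noteq> [] \<and> hd (unraw x)) = False" using s by (simp add: enc_raw_def)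
    show ?thesis unfolding * enc_simps by (rule runs_CondF[OF False runs_Seq[OF 1 2]])
  qed
qed (auto intro!: pb_intros)

lemma pf_raw_tl0: "pf (\<lambda>w. Raw (tl (unraw w)))"
  by (rule pf_onI[of 1 "Pop 0" "\<lambda>_. 1"]) (auto intro!: pb_intros runs_eq[OF runs_Pop] simp: enc_raw_def)

lemma pf_raw_Cons0: "pf (\<lambda>p. Raw (fst p # unraw (snd p)))"
proof (rule pf_onI[of 1 "Cond 0 (Pop 0 ;; Pop 0 ;; Pop 0 ;; Pop 0 ;; Push 0 True) (Pop 0 ;; Pop 0 ;; Pop 0 ;; Pop 0 ;; Push 0 False)" "\<lambda>_. 7"])
  fix x :: "bool \<times> raw" and s :: state assume s: "s 0 = enc x"
  obtain b w where x: "x = (b, Raw w)" by (cases x) (metis raw.exhaust)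
  have *: "runs (Pop 0 ;; Pop 0 ;; Pop 0 ;; Pop 0 ;; Push 0 b) s 6 (s(0 := b # w))"
    by (rule runs_eq[OF runs_Seq[OF runs_Pop runs_Seq[OF runs_Pop runs_Seq[OF runs_Pop runs_Seq[OF runs_Pop runs_Push]]]]])
      (auto simp: s x enc_word_dbl)
  show "runs (Cond 0 (Pop 0 ;; Pop 0 ;; Pop 0 ;; Pop 0 ;; Push 0 True) (Pop 0 ;; Pop 0 ;; Pop 0 ;; Pop 0 ;; Push 0 False)) s 7
     (s(0 := enc (Raw (fst x # unraw (snd x)))))"
  proof (cases b)
    case True
    then show ?thesis by (intro runs_eq[OF runs_CondT]) (use * in \<open>auto simp: s x enc_word_dbl\<close>)
  next
    case False
    then show ?thesis by (intro runs_eq[OF runs_CondF]) (use * in \<open>auto simp: s x enc_word_dbl\<close>)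
  qed
qed (auto intro!: pb_intros)

lemma pf_polytime:
  assumes "pf f" shows "polytime (\<lambda>w. enc (f (Raw w)))"
proof -
  obtain P K p where P: "regs_below K P" "K \<ge> 1"
    "\<And>K' x s. K' \<ge> K \<Longrightarrow> x \<in> UNIV \<Longrightarrow> s 0 = enc x \<Longrightarrow> (\<And>i. 1 \<le> i \<Longrightarrow> i < K' \<Longrightarrow> s i = []) \<Longrightarrow>
       runs P s (poly p (len x)) (s(0 := enc (f x)))"
    "\<And>x. x \<in> UNIV \<Longrightarrow> len (f x) \<le> poly p (len x)"
    using assms by (rule pf_onE) blast
  \<comment> \<open>The result has length at most \<open>p\<close>, so moving it takes
    \<open>5 * p + 1\<close> steps. The move reverses it, and the output tape lists register
    \<open>K\<close> in reverse, so the output appears in the right order.\<close>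
  let ?Q = "P ;; MV 0 K" let ?p = "[:6:] * p + [:1:]"
  have "wf_prog K ?Q" using P(2) regs_below_wf[OF P(1)] by (auto simp: MV_def)
  then obtain M where M: "valid_tm M"
    "\<And>x n s'. exec ?Q (\<lambda>i. if i = 0 then x else []) n s' \<Longrightarrow> tm_halts_with M x n (rev (s' K))"
    using compile_prog P(2) by blast
  have "\<exists>t\<le>poly ?p (length w). tm_halts_with M w t (enc (f (Raw w)))" for w
  proof -
    let ?s = "\<lambda>i. if i = 0 then w else []" let ?y = "enc (f (Raw w))"
    have "runs P ?s (poly p (length w)) (?s(0 := ?y))" using P(3)[of K "Raw w" ?s] by simp
    moreover have "runs (MV 0 K) (?s(0 := ?y)) (5 * poly p (length w) + 1) (?s(0 := [], K := rev ?y))"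
      by (rule runs_eq[OF runs_MV]) (use P(2) P(4)[of "Raw w"] in \<open>auto simp: fun_eq_iff\<close>)
    ultimately have "runs ?Q ?s (poly p (length w) + (5 * poly p (length w) + 1)) (?s(0 := [], K := rev ?y))"
      by (rule runs_Seq)
    then show ?thesis unfolding runs_def using M(2)[of w] by fastforce
  qed
  then show ?thesis unfolding polytime_def using M(1) by blast
qed

section \<open>A library of polynomial-time functions\<close>

lemma pf_compose: "pf f \<Longrightarrow> pf g \<Longrightarrow> pf (\<lambda>x. f (g x))"
  by (rule pf_on_comp[of UNIV g UNIV f]) auto

lemma pf_const[pf_intros]: "pf (\<lambda>x. c)" by (rule pf_on_const)
lemma pf_id[pf_intros]: "pf (\<lambda>x. x)" by (rule pf_on_recode) simp
lemma pf_pair[pf_intros]: "pf f \<Longrightarrow> pf g \<Longrightarrow> pf (\<lambda>x. (f x, g x))" by (rule pf_on_pair)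
lemma pf_fst[pf_intros]: "pf f \<Longrightarrow> pf (\<lambda>x. fst (f x))" by (rule pf_compose[OF pf_on_fst0])
lemma pf_snd[pf_intros]: "pf f \<Longrightarrow> pf (\<lambda>x. snd (f x))" by (rule pf_compose[OF pf_on_snd0])
lemma pf_if[pf_intros]: "pf b \<Longrightarrow> pf f \<Longrightarrow> pf g \<Longrightarrow> pf (\<lambda>x. if b x then f x else g x)"
  by (rule pf_on_if) (auto intro: pf_on_subset)
lemma pf_eq[pf_intros]: "pf f \<Longrightarrow> pf g \<Longrightarrow> pf (\<lambda>x. f x = g x)"
  using pf_compose[OF pf_eq0, of "\<lambda>x. (f x, g x, x)"] by (simp add: pf_pair pf_id)
lemma pf_Suc[pf_intros]: "pf f \<Longrightarrow> pf (\<lambda>x. Suc (f x))" by (rule pf_compose[OF pf_Suc0])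
lemma pf_pred: "pf f \<Longrightarrow> pf (\<lambda>x. f x - 1 :: nat)" by (rule pf_compose[OF pf_pred0])

lemma pf_not[pf_intros]: "pf f \<Longrightarrow> pf (\<lambda>x. \<not> f x)"
  by (rule pf_on_cong[OF pf_if[OF _ pf_const[of False] pf_const[of True], of f]]) auto
lemma pf_conj[pf_intros]: "pf f \<Longrightarrow> pf g \<Longrightarrow> pf (\<lambda>x. f x \<and> g x)"
  by (rule pf_on_cong[OF pf_if[OF _ _ pf_const[of False], of f g]]) auto
lemma pf_disj[pf_intros]: "pf f \<Longrightarrow> pf g \<Longrightarrow> pf (\<lambda>x. f x \<or> g x)"
  by (rule pf_on_cong[OF pf_not[OF pf_conj[OF pf_not pf_not], of f g]]) auto
lemma pf_imp[pf_intros]: "pf f \<Longrightarrow> pf g \<Longrightarrow> pf (\<lambda>x. f x \<longrightarrow> g x)"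
  by (rule pf_on_cong[OF pf_disj[OF pf_not, of f g]]) auto

lemma pf_Cons[pf_intros]: assumes "pf f" "pf g" shows "pf (\<lambda>x. f x # g x)"
proof -
  have "pf (\<lambda>p :: 'b \<times> 'b list. fst p # snd p)" by (rule pf_on_recode) auto
  from pf_compose[OF this pf_pair[OF assms]] show ?thesis by simp
qed

text \<open>A nonempty list has the same code as the pair of its head and tail, so taking it apart
  is a recoding on the domain of nonempty lists.\<close>

lemma pf_case_list[pf_intros]:
  fixes l :: "'x::enc \<Rightarrow> 'a::enc list"
  assumes "pf l" "pf f" "pf (\<lambda>z. g (fst z) (fst (snd z)) (snd (snd z)))"
  shows "pf (\<lambda>x. case l x of [] \<Rightarrow> f x | a # t \<Rightarrow> g x a t)"
proof -
  have "pf_on {x :: 'a list. x \<noteq> []} (\<lambda>l. (hd l, tl l))"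
    by (rule pf_on_recode) (auto simp: neq_Nil_conv)
  from pf_on_comp[OF pf_on_subset[OF assms(1) subset_UNIV, of "{x. \<not> l x = []}"] this]
  have "pf_on {x \<in> UNIV. \<not> l x = []} (\<lambda>x. (hd (l x), tl (l x)))" by simp
  from pf_on_pair[OF pf_on_subset[OF pf_id subset_UNIV] this]
  have "pf_on {x \<in> UNIV. \<not> l x = []} (\<lambda>x. (x, hd (l x), tl (l x)))" by simp
  from pf_on_comp[OF this assms(3)]
  have "pf_on {x \<in> UNIV. \<not> l x = []} (\<lambda>x. g x (hd (l x)) (tl (l x)))" by simp
  with assms have "pf (\<lambda>x. if l x = [] then f x else g x (hd (l x)) (tl (l x)))"
    by (intro pf_on_if[OF pf_eq[OF _ pf_const]]) (auto intro: pf_on_subset)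
  then show ?thesis by (rule pf_on_cong) (simp split: list.split)
qed

lemma pf_tl[pf_intros]: "pf f \<Longrightarrow> pf (\<lambda>x. tl (f x))"
  unfolding tl_def by (intro pf_intros)

lemma pf_iter:
  fixes f :: "'a::enc \<Rightarrow> 'a"
  assumes "pf c" "pf h" "pf f" "pbx B" "\<And>x i. i \<le> len (c x) \<Longrightarrow> len ((f ^^ i) (h x)) \<le> B x"
  shows "pf (\<lambda>x. (f ^^ len (c x)) (h x))"
  using pf_iter0[where f = f and g = "\<lambda>x. (c x, h x)" and B = B] assms by (simp add: pf_pair)

lemma pf_funpow:
  fixes f :: "'a::enc \<Rightarrow> 'a"
  assumes "pf c" "pf h" "pf f" "pbx B" "\<And>x i. i \<le> c x \<Longrightarrow> len ((f ^^ i) (h x)) \<le> B x"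
  shows "pf (\<lambda>x. (f ^^ c x) (h x))"
  using pf_iter[of c h f B] assms by simp

lemma len_mem: "a \<in> set l \<Longrightarrow> 2 * len a + 2 \<le> len l"
  by (induction l) auto

lemma len_append: "len (l @ m) = len l + len m"
  by (induction l) auto

lemma len_le: "(\<And>a. a \<in> set l \<Longrightarrow> len a \<le> b) \<Longrightarrow> len l \<le> length l * (2 * b + 2)"
proof (induction l)
  case (Cons a l)
  have "len a \<le> b" "len l \<le> length l * (2 * b + 2)" using Cons by auto
  then show ?case by simp
qed simp

lemma length_le_len: "length l \<le> len l"
  by (induction l) auto

lemma len_take: "len (take k l) \<le> len l"
  by (metis append_take_drop_id le_add1 len_append)

lemma len_rev: "len (rev l) = len l"
  by (induction l) (auto simp: len_append)

lemma pbx_length: "pf f \<Longrightarrow> pbx (\<lambda>x. length (f x))"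
  by (rule pbx_le[OF pbx_pf]) (auto intro: length_le_len)

lemma pf_fold:
  assumes "pf l" "pf h" "pf (\<lambda>z. g (fst z) (fst (snd z)) (snd (snd z)))" "pbx B"
    "\<And>x k. k \<le> length (l x) \<Longrightarrow> len (fold (g x) (take k (l x)) (h x)) \<le> B x"
  shows "pf (\<lambda>x. fold (g x) (l x) (h x))"
proof -
  \<comment> \<open>The state consists of the parameter, the remaining list and the accumulator. It
    stays put once the list is used up, so \<open>len (l x)\<close> rounds, at least the length of
    the list, give the fold.\<close>
  define S where "S = (\<lambda>z. case fst (snd z) of [] \<Rightarrow> z | a # t \<Rightarrow> (fst z, t, g (fst z) a (snd (snd z))))"
  have S: "(S ^^ n) (x, l, acc) = (x, drop n l, fold (g x) (take n l) acc)" for n x l acc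
  proof (induction n arbitrary: l acc)
    case (Suc n)
    have "(S ^^ Suc n) (x, l, acc) = (S ^^ n) (S (x, l, acc))" by (simp add: funpow_swap1)
    also have "\<dots> = (x, drop (Suc n) l, fold (g x) (take (Suc n) l) acc)"
      by (cases l) (simp_all add: S_def[THEN fun_cong] Suc)
    finally show ?case .
  qed simp
  have "pf S" unfolding S_def
    by (intro pf_intros pf_compose[OF assms(3), of "\<lambda>z. (fst (fst z), fst (snd z), snd (snd (fst z)))", simplified])
  have "pf (\<lambda>x. (S ^^ len (l x)) (x, l x, h x))"
  proof (rule pf_iter[OF assms(1) _ \<open>pf S\<close>])
    show "pf (\<lambda>x. (x, l x, h x))" using assms by (intro pf_intros)
    show "pbx (\<lambda>x. 2 * len x + 2 + (2 * len (l x) + 2 + B x))"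
      by (intro pbx_intros assms pf_intros)
    fix x i assume "i \<le> len (l x)"
    have "fold (g x) (take i (l x)) (h x) = fold (g x) (take (min i (length (l x))) (l x)) (h x)"
      by (cases "i \<le> length (l x)") (simp_all add: min_def)
    then have "len (fold (g x) (take i (l x)) (h x)) \<le> B x" using assms(5)[of "min i (length (l x))" x] by simp
    moreover have "len (drop i (l x)) \<le> len (l x)"
      by (metis append_take_drop_id le_add2 len_append)
    ultimately show "len ((S ^^ i) (x, l x, h x)) \<le> 2 * len x + 2 + (2 * len (l x) + 2 + B x)"
      by (simp add: S)
  qed
  then have "pf (\<lambda>x. snd (snd ((S ^^ len (l x)) (x, l x, h x))))" by (intro pf_intros)
  then show ?thesis by (simp add: S length_le_len)
qed

lemma pf_rev[pf_intros]: assumes "pf l" shows "pf (\<lambda>x. rev (l x))"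
proof -
  have "pf (\<lambda>x. fold Cons (l x) [])"
    by (rule pf_fold[where B = "\<lambda>x. len (l x)"])
      (use assms in \<open>auto intro!: pf_intros pbx_intros simp: len_rev len_take simp flip: rev_conv_fold\<close>)
  then show ?thesis by (simp add: rev_conv_fold)
qed

lemma pf_append[pf_intros]: assumes "pf l" "pf m" shows "pf (\<lambda>x. l x @ m x)"
proof -
  have *: "fold Cons l m = rev l @ m" for l m :: "'c list" by (induction l arbitrary: m) auto
  have "pf (\<lambda>x. fold Cons (rev (l x)) (m x))"
    by (rule pf_fold[where B = "\<lambda>x. len (l x) + len (m x)"])
      (use assms in \<open>auto intro!: pf_intros pbx_intros simp: * len_rev len_append\<close>,
       metis len_rev len_take)
  then show ?thesis by (simp add: *)
qed

lemma pf_map[pf_intros]: assumes "pf l" "pf (\<lambda>z. g (fst z) (snd z))" shows "pf (\<lambda>x. map (g x) (l x))"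
proof -
  have *: "fold (\<lambda>a acc. g x a # acc) l m = map (g x) (rev l) @ m" for x l m by (induction l arbitrary: m) auto
  obtain p :: "nat poly" where p: "\<And>z. len (g (fst z) (snd z)) \<le> poly p (len z)"
    using assms(2) by (rule pf_size) auto
  let ?b = "\<lambda>x. poly p (2 * len x + 2 + len (l x))"
  have "pf (\<lambda>x. fold (\<lambda>a acc. g x a # acc) (rev (l x)) [])"
  proof (rule pf_fold[where B = "\<lambda>x. length (l x) * (2 * ?b x + 2)"])
    show "pf (\<lambda>z. g (fst z) (fst (snd z)) # snd (snd z))"
      by (intro pf_intros pf_compose[OF assms(2), of "\<lambda>z. (fst z, fst (snd z))", simplified])
    show "pbx (\<lambda>x. length (l x) * (2 * ?b x + 2))" by (intro pbx_intros pbx_length assms pf_intros)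
    fix x k
    let ?m = "map (g x) (rev (take k (rev (l x))))"
    have "len (g x a) \<le> ?b x" if "a \<in> set (l x)" for a
    proof -
      have "len (g x a) \<le> poly p (len (x, a))" using p[of "(x, a)"] by simp
      also have "\<dots> \<le> ?b x" by (rule poly_nat_mono) (use len_mem[OF that] in simp)
      finally show ?thesis .
    qed
    then have "len ?m \<le> length ?m * (2 * ?b x + 2)"
      by (intro len_le) (auto dest: in_set_takeD)
    also have "\<dots> \<le> length (l x) * (2 * ?b x + 2)" by (intro mult_right_mono) auto
    finally show "len (fold (\<lambda>a acc. g x a # acc) (take k (rev (l x))) []) \<le> length (l x) * (2 * ?b x + 2)"
      by (simp add: *)
  qed (use assms in \<open>auto intro!: pf_intros\<close>)
  then show ?thesis by (simp add: *)
qed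

lemma len_concat: "len (concat ls) \<le> len ls"
  by (induction ls) (auto simp: len_append)

lemma pf_concat[pf_intros]: assumes "pf l" shows "pf (\<lambda>x. concat (l x))"
proof -
  have *: "fold (@) l m = concat (rev l) @ m" for l and m :: "'c list" by (induction l arbitrary: m) auto
  have "pf (\<lambda>x. fold (@) (rev (l x)) [])"
  proof (rule pf_fold[where B = "\<lambda>x. len (l x)"])
    fix x k
    have "len (concat (rev (take k (rev (l x))))) \<le> len (rev (take k (rev (l x))))" by (rule len_concat)
    also have "\<dots> \<le> len (l x)" by (metis len_rev len_take)
    finally show "len (fold (@) (take k (rev (l x))) []) \<le> len (l x)" by (simp add: *)
  qed (use assms in \<open>auto intro!: pf_intros pbx_intros\<close>)
  then show ?thesis by (simp add: *)
qed

lemma pf_filter[pf_intros]: assumes "pf l" "pf (\<lambda>z. P (fst z) (snd z))" shows "pf (\<lambda>x. filter (P x) (l x))"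
proof -
  have *: "filter P l = concat (map (\<lambda>a. if P a then [a] else []) l)" for P and l :: "'b list" by (induction l) auto
  show ?thesis unfolding * by (intro pf_intros assms)
qed

lemma pf_length[pf_intros]: assumes "pf l" shows "pf (\<lambda>x. length (l x))"
proof -
  have *: "fold (\<lambda>_. Suc) l n = length l + n" for l :: "'c list" and n by (induction l arbitrary: n) auto
  have "pf (\<lambda>x. fold (\<lambda>_. Suc) (l x) 0)"
    by (rule pf_fold[where B = "\<lambda>x. length (l x)"])
      (use assms in \<open>auto intro!: pf_intros pbx_length simp: *\<close>)
  then show ?thesis by (simp add: *)
qed

lemma pf_Ball[pf_intros]: assumes "pf l" "pf (\<lambda>z. P (fst z) (snd z))" shows "pf (\<lambda>x. \<forall>a\<in>set (l x). P x a)"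
proof -
  have *: "(\<forall>a\<in>set l. P a) \<longleftrightarrow> filter (\<lambda>a. \<not> P a) l = []" for P and l :: "'b list" by (induction l) auto
  show ?thesis unfolding * by (intro pf_intros assms)
qed

lemma pf_Bex[pf_intros]: assumes "pf l" "pf (\<lambda>z. P (fst z) (snd z))" shows "pf (\<lambda>x. \<exists>a\<in>set (l x). P x a)"
proof -
  have *: "(\<exists>a\<in>set l. P a) \<longleftrightarrow> \<not> (\<forall>a\<in>set l. \<not> P a)" for P and l :: "'b list" by auto
  show ?thesis unfolding * by (intro pf_intros assms)
qed

lemma pf_mem[pf_intros]: assumes "pf f" "pf l" shows "pf (\<lambda>x. f x \<in> set (l x))"
proof -
  have *: "a \<in> set l \<longleftrightarrow> (\<exists>b\<in>set l. b = a)" for a :: 'c and l by auto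
  show ?thesis unfolding * by (intro pf_intros assms pf_compose[OF assms(1), of fst])
qed

lemma pf_add[pf_intros]: assumes "pf f" "pf g" shows "pf (\<lambda>x. f x + g x :: nat)"
proof -
  have *: "(Suc ^^ i) n = n + i" for i n by (induction i) auto
  have "pf (\<lambda>x. (Suc ^^ g x) (f x))"
    by (rule pf_funpow[where B = "\<lambda>x. f x + g x"]) (use assms in \<open>auto intro!: pf_intros pbx_intros pbx_nat[of f] pbx_nat[of g] simp: *\<close>)
  then show ?thesis unfolding * .
qed

lemma pf_diff[pf_intros]: assumes "pf f" "pf g" shows "pf (\<lambda>x. f x - g x :: nat)"
proof -
  have *: "((\<lambda>n. n - 1) ^^ i) n = n - i" for i n :: nat by (induction i) auto
  have "pf (\<lambda>x. ((\<lambda>n. n - 1) ^^ g x) (f x))"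
    by (rule pf_funpow[where B = "\<lambda>x. f x"]) (use assms in \<open>auto intro!: pf_intros pbx_nat pf_pred simp: * simp del: One_nat_def\<close>)
  then show ?thesis by (simp add: * del: One_nat_def)
qed

lemma pf_le[pf_intros]: "pf f \<Longrightarrow> pf g \<Longrightarrow> pf (\<lambda>x. f x \<le> (g x :: nat))"
  using pf_eq[OF pf_diff pf_const[of 0], of f g] by simp

lemma pf_less[pf_intros]: "pf f \<Longrightarrow> pf g \<Longrightarrow> pf (\<lambda>x. f x < (g x :: nat))"
  using pf_le[OF pf_Suc, of f g] by (simp add: Suc_le_eq)

lemma pf_upt[pf_intros]: assumes "pf f" "pf g" shows "pf (\<lambda>x. [f x..<g x])"
proof -
  have *: "((\<lambda>z. (Suc (fst z), snd z @ [fst z])) ^^ i) (0, []) = (i, [0..<i])" for i by (induction i) auto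
  have "pf (\<lambda>x. ((\<lambda>z. (Suc (fst z), snd z @ [fst z])) ^^ n x) (0, []))" if n: "pf n" for n :: "'a \<Rightarrow> nat"
  proof (rule pf_funpow[where B = "\<lambda>x. 2 * n x + 2 + n x * (2 * n x + 2)"])
    fix x i assume i: "i \<le> n x"
    have "len [0..<i] \<le> length [0..<i] * (2 * n x + 2)" by (rule len_le) (use i in auto)
    also have "\<dots> \<le> n x * (2 * n x + 2)" using i by (intro mult_right_mono) auto
    finally show "len (((\<lambda>z. (Suc (fst z), snd z @ [fst z])) ^^ i) (0, [])) \<le> 2 * n x + 2 + n x * (2 * n x + 2)"
      using i by (simp add: *)
  qed (use n in \<open>auto intro!: pf_intros pbx_intros pbx_nat[of n]\<close>)
  then have "pf (\<lambda>x. snd (((\<lambda>z. (Suc (fst z), snd z @ [fst z])) ^^ (g x - f x)) (0, [])))"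
    using pf_diff[OF assms(2,1)] by (intro pf_snd) blast
  then have "pf (\<lambda>x. [0..<g x - f x])" by (simp add: *)
  then have "pf (\<lambda>x. map (\<lambda>i. i + f x) [0..<g x - f x])"
    by (intro pf_intros pf_compose[OF assms(1), of fst])
  then show ?thesis
  proof (rule pf_on_cong)
    fix x show "map (\<lambda>i. i + f x) [0..<g x - f x] = [f x..<g x]"
      by (cases "f x \<le> g x") (simp_all add: map_add_upt)
  qed
qed

lemma pf_sum_list[pf_intros]: assumes "pf l" shows "pf (\<lambda>x. sum_list (l x) :: nat)"
proof -
  have *: "fold (+) l n = sum_list l + n" for l and n :: nat by (induction l arbitrary: n) auto
  have s: "sum_list l \<le> len l" for l :: "nat list" by (induction l) auto
  have "pf (\<lambda>x. fold (+) (l x) 0)"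
    by (rule pf_fold[where B = "\<lambda>x. len (l x)"])
      (use assms in \<open>auto intro!: pf_intros pbx_intros simp: * intro: order_trans[OF s len_take]\<close>)
  then show ?thesis by (simp add: *)
qed

lemma pf_mult[pf_intros]: assumes "pf f" "pf g" shows "pf (\<lambda>x. f x * g x :: nat)"
proof -
  have "pf (\<lambda>x. sum_list (map (\<lambda>_. g x) [0..<f x]))"
    by (intro pf_intros assms pf_compose[OF assms(2), of fst])
  then show ?thesis by (simp add: sum_list_triv)
qed

lemma pf_poly[pf_intros]: assumes "pf f" shows "pf (\<lambda>x. poly p (f x) :: nat)"
  by (induction p) (auto intro!: pf_intros assms)

lemma pf_drop[pf_intros]: assumes "pf f" "pf g" shows "pf (\<lambda>x. drop (f x) (g x))"
proof -
  have *: "(tl ^^ i) l = drop i l" for i and l :: "'b list" by (induction i) (auto simp: drop_Suc tl_drop)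
  have "pf (\<lambda>x. (tl ^^ f x) (g x))"
  proof (rule pf_funpow[where B = "\<lambda>x. len (g x)"])
    fix x i show "len ((tl ^^ i) (g x)) \<le> len (g x)"
      unfolding * by (metis append_take_drop_id le_add2 len_append)
  qed (use assms in \<open>auto intro!: pf_intros pbx_intros\<close>)
  then show ?thesis by (simp add: *)
qed

lemma pf_take[pf_intros]: assumes "pf f" "pf g" shows "pf (\<lambda>x. take (f x) (g x))"
proof -
  have *: "take i l = rev (drop (length l - i) (rev l))" for i and l :: "'b list"
    by (cases "i \<le> length l") (simp_all add: rev_drop)
  show ?thesis unfolding * by (intro pf_intros assms)
qed

text \<open>The value of \<open>l ! i\<close> beyond the end of the list is unspecified; a default
  makes the access a total function that a program can compute.\<close>

definition nthd :: "'a \<Rightarrow> 'a list \<Rightarrow> nat \<Rightarrow> 'a" where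
  "nthd d l i = (if i < length l then l ! i else d)"

lemma nthd_simp[simp]: "i < length l \<Longrightarrow> nthd d l i = l ! i" by (simp add: nthd_def)

lemma pf_nthd[pf_intros]: assumes "pf d" "pf l" "pf i" shows "pf (\<lambda>x. nthd (d x) (l x) (i x))"
proof -
  have "pf (\<lambda>x. case drop (i x) (l x) of [] \<Rightarrow> d x | a # t \<Rightarrow> a)"
    by (intro pf_intros assms)
  then show ?thesis by (rule pf_on_cong) (auto simp: nthd_def Cons_nth_drop_Suc[symmetric])
qed

lemma pf_list_update[pf_intros]: assumes "pf l" "pf i" "pf f" shows "pf (\<lambda>x. (l x)[i x := f x])"
proof -
  have "pf (\<lambda>x. take (i x) (l x) @ (case drop (i x) (l x) of [] \<Rightarrow> [] | a # t \<Rightarrow> f x # t))"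
    by (intro pf_intros assms pf_compose[OF assms(3), of fst])
  then show ?thesis
  proof (rule pf_on_cong)
    fix x
    show "take (i x) (l x) @ (case drop (i x) (l x) of [] \<Rightarrow> [] | a # t \<Rightarrow> f x # t) = (l x)[i x := f x]"
      by (cases "i x < length (l x)") (auto simp: Cons_nth_drop_Suc[symmetric] upd_conv_take_nth_drop list_update_beyond)
  qed
qed

lemma pf_replicate[pf_intros]: assumes "pf f" "pf g" shows "pf (\<lambda>x. replicate (f x) (g x))"
proof -
  have "pf (\<lambda>x. map (\<lambda>_. g x) [0..<f x])" by (intro pf_intros assms pf_compose[OF assms(2), of fst])
  then show ?thesis by (simp add: map_replicate_const)
qed

text \<open>A function on a finite set is a hard-wired table whatever \<open>h\<close> is. In this
  way the transition function of a fixed machine enters a program.\<close>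

lemma pf_finite:
  assumes "finite A" "pf f" shows "pf (\<lambda>x. if f x \<in> A then h (f x) else c)"
  using assms(1)
proof (induction A rule: finite_induct)
  case empty then show ?case by (simp add: pf_const)
next
  case (insert a A)
  have "pf (\<lambda>x. if f x = a then h a else if f x \<in> A then h (f x) else c)"
    by (intro pf_intros assms insert)
  then show ?case by (rule pf_on_cong) auto
qed

lemma pf_raw_list[pf_intros]: assumes "pf f" shows "pf (\<lambda>x. unraw (f x))"
proof -
  define S where "S = (\<lambda>z. if fst z = Raw [] then z
    else (Raw (tl (unraw (fst z))), (unraw (fst z) \<noteq> [] \<and> hd (unraw (fst z))) # snd z))"
  have S: "(S ^^ i) (Raw w, l) = (Raw (drop i w), rev (take i w) @ l)" for i w l
  proof (induction i arbitrary: w l)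
    case (Suc i)
    have "(S ^^ Suc i) (Raw w, l) = (S ^^ i) (S (Raw w, l))" by (simp add: funpow_swap1)
    also have "\<dots> = (Raw (drop (Suc i) w), rev (take (Suc i) w) @ l)"
      by (cases w) (auto simp: S_def[THEN fun_cong] Suc)
    finally show ?case .
  qed simp
  have "pf S" unfolding S_def
    by (intro pf_intros pf_compose[OF pf_raw_tl0, of fst] pf_compose[OF pf_raw_hd0, of fst])
  then have "pf (\<lambda>x. (S ^^ len (f x)) (f x, []))"
  proof (rule pf_iter[where B = "\<lambda>x. 2 * len (f x) + 2 + len (f x) * (2 * 1 + 2)", rotated 2])
    fix x i assume i: "i \<le> len (f x)"
    obtain w where w: "f x = Raw w" by (cases "f x")
    have "len (rev (take i w)) \<le> length (rev (take i w)) * (2 * 1 + 2)" by (rule len_le) auto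
    also have "\<dots> \<le> length w * (2 * 1 + 2)" by (intro mult_right_mono) auto
    finally show "len ((S ^^ i) (f x, [])) \<le> 2 * len (f x) + 2 + len (f x) * (2 * 1 + 2)" by (simp add: w S)
  qed (auto intro!: pf_intros pbx_intros assms)
  then have "pf (\<lambda>x. rev (snd ((S ^^ len (f x)) (f x, []))))" by (intro pf_intros)
  then show ?thesis
  proof (rule pf_on_cong)
    fix x show "rev (snd ((S ^^ len (f x)) (f x, []))) = unraw (f x)" by (cases "f x") (simp add: S)
  qed
qed

lemma pf_Raw[pf_intros]: assumes "pf f" shows "pf (\<lambda>x. Raw (f x))"
proof -
  have *: "fold (\<lambda>b acc. Raw (b # unraw acc)) l (Raw w) = Raw (rev l @ w)" for l w by (induction l arbitrary: w) auto
  have "pf (\<lambda>x. fold (\<lambda>b acc. Raw (b # unraw acc)) (rev (f x)) (Raw []))"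
  proof (rule pf_fold[where B = "\<lambda>x. length (f x)"])
    show "pf (\<lambda>z. Raw (fst (snd z) # unraw (snd (snd z))))"
      using pf_compose[OF pf_raw_Cons0, of snd] by (simp add: pf_intros)
  qed (use assms in \<open>auto intro!: pf_intros pbx_length simp: *\<close>)
  then show ?thesis by (simp add: *)
qed

lemma pf_enc_pair[pf_intros]: assumes "pf f" "pf g" shows "pf (\<lambda>x. enc_pair (f x) (g x))"
proof -
  have "pf (\<lambda>p. Raw (enc_pair (unraw (fst p)) (unraw (snd p))))"
    by (rule pf_on_recode) (auto simp: enc_raw_def enc_prod_def)
  from pf_compose[OF this, of "\<lambda>x. (Raw (f x), Raw (g x))"] have "pf (\<lambda>x. Raw (enc_pair (f x) (g x)))"
    using assms by (simp add: pf_intros)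
  from pf_raw_list[OF this] show ?thesis by simp
qed

section \<open>Simulation of Turing machines\<close>

text \<open>\<open>N\<close> is a fixed window and \<open>n\<close> the elapsed time. As long as
  \<open>n\<close> is at most \<open>N\<close>, the heads are inside the window and write nothing
  outside it.\<close>

definition cinv :: "tm \<Rightarrow> nat \<Rightarrow> nat \<Rightarrow> config \<Rightarrow> bool" where
  "cinv M N n c \<longleftrightarrow> fst c \<le> tm_states M \<and> length (snd c) = tm_tapes M \<and>
     (\<forall>i < tm_tapes M. \<bar>snd (snd c ! i)\<bar> \<le> int n \<and>
        (\<forall>j. fst (snd c ! i) j < tm_symbols M \<and> (\<bar>j\<bar> > int N \<longrightarrow> fst (snd c ! i) j = 0)))"

lemma cinv_init:
  assumes "valid_tm M" "length w \<le> N" shows "cinv M N 0 (tm_init M w)"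
  using assms by (auto simp: cinv_def tm_init_def valid_tm_def nth_Cons' word_tape_def)

lemma tm_step_simps:
  assumes "valid_tm M" "cinv M N n (q, ts)" "q < tm_states M" "tm_trans M q (scan ts) = (q', as)"
  shows "length (scan ts) = tm_tapes M" "set (scan ts) \<subseteq> {..<tm_symbols M}"
    "q' \<le> tm_states M" "length as = tm_tapes M" "set as \<subseteq> {..<tm_symbols M} \<times> {-1, 0, 1}"
    "tm_step M (q, ts) = (q', act ts as)"
proof -
  show 1: "length (scan ts) = tm_tapes M" using assms(2) by (simp add: cinv_def scan_def)
  show 2: "set (scan ts) \<subseteq> {..<tm_symbols M}"
    using assms(2) by (auto simp: cinv_def scan_def set_conv_nth case_prod_unfold)
  show "q' \<le> tm_states M" "length as = tm_tapes M" "set as \<subseteq> {..<tm_symbols M} \<times> {-1, 0, 1}"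
    using assms(1,3,4) 1 2 unfolding valid_tm_def by fastforce+
  show "tm_step M (q, ts) = (q', act ts as)"
    using assms(3,4) by (simp add: tm_step_def scan_def act_def)
qed

lemma act_nth2: "i < length ts \<Longrightarrow> length as = length ts \<Longrightarrow>
    act ts as ! i = ((fst (ts ! i))(snd (ts ! i) := fst (as ! i)), snd (ts ! i) + snd (as ! i))"
  by (simp add: act_def case_prod_unfold)

lemma cinv_step:
  assumes "valid_tm M" "cinv M N n c" "n \<le> N" shows "cinv M N (Suc n) (tm_step M c)"
proof -
  obtain q ts where c: "c = (q, ts)" by fastforce
  show ?thesis
  proof (cases "q < tm_states M")
    case False
    then show ?thesis using assms(2) unfolding c by (force simp: tm_step_def cinv_def)
  next
    case True
    obtain q' as where t: "tm_trans M q (scan ts) = (q', as)" by fastforce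
    note s = tm_step_simps[OF assms(1) assms(2)[unfolded c] True t]
    have l: "length ts = tm_tapes M" using assms(2) c by (simp add: cinv_def)
    have "\<bar>snd (act ts as ! i)\<bar> \<le> int (Suc n) \<and> (\<forall>j. fst (act ts as ! i) j < tm_symbols M \<and>
        (\<bar>j\<bar> > int N \<longrightarrow> fst (act ts as ! i) j = 0))" if i: "i < tm_tapes M" for i
    proof -
      have "as ! i \<in> set as" using i s(4) by simp
      then have "as ! i \<in> {..<tm_symbols M} \<times> {-1, 0, 1}" using s(5) by (rule rev_subsetD)
      then have "fst (as ! i) < tm_symbols M" "\<bar>snd (as ! i)\<bar> \<le> 1" by (auto simp: mem_Times_iff)
      moreover have "\<bar>snd (ts ! i)\<bar> \<le> int n \<and> (\<forall>j. fst (ts ! i) j < tm_symbols M \<and> (\<bar>j\<bar> > int N \<longrightarrow> fst (ts ! i) j = 0))"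
        using assms(2) i c by (simp add: cinv_def)
      ultimately show ?thesis using i l s(4) assms(3) by (simp add: act_nth2) linarith
    qed
    then show ?thesis using s l c by (simp add: cinv_def act_def)
  qed
qed

lemma cinv_steps:
  assumes "valid_tm M" "length w \<le> N" "n \<le> N" shows "cinv M N n ((tm_step M ^^ n) (tm_init M w))"
  using assms(3) by (induction n) (auto intro: cinv_init cinv_step assms)

lemma tm_halts_mono:
  assumes "tm_halts_with M x t y" "t \<le> t'" shows "tm_halts_with M x t' y"
proof -
  obtain q ts where c: "(tm_step M ^^ t) (tm_init M x) = (q, ts)" by fastforce
  then have q: "q = tm_states M" using assms(1) by (simp add: tm_halts_with_def)
  have "(tm_step M ^^ i) (q, ts) = (q, ts)" for i by (induction i) (auto simp: tm_step_def q)
  then have "(tm_step M ^^ (t' - t + t)) (tm_init M x) = (q, ts)"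
    by (simp add: funpow_add c)
  then show ?thesis using assms c by (simp add: tm_halts_with_def)
qed

definition win :: "nat \<Rightarrow> (int \<Rightarrow> nat) \<times> int \<Rightarrow> nat list \<times> nat" where
  "win N th = (map (\<lambda>j. fst th (int j - int N)) [0..<2 * N + 1], nat (snd th + int N))"

text \<open>Moves are raised by one to become natural numbers; \<open>wact\<close> subtracts the one
  again.\<close>

definition tab :: "tm \<Rightarrow> nat \<times> nat list \<Rightarrow> nat \<times> (nat \<times> nat) list" where
  "tab M = (\<lambda>(q, ss). map_prod id (map (\<lambda>(s, m). (s, nat (m + 1)))) (tm_trans M q ss))"

definition tabdom :: "tm \<Rightarrow> (nat \<times> nat list) set" where
  "tabdom M = {..<tm_states M} \<times> {ss. length ss = tm_tapes M \<and> set ss \<subseteq> {..<tm_symbols M}}"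

lemma finite_tabdom: "finite (tabdom M)"
  using finite_lists_length_eq[of "{..<tm_symbols M}" "tm_tapes M"]
  by (auto simp: tabdom_def conj_commute)

text \<open>Written as a conditional on a finite domain, like \<open>intab\<close>, to have the form
  of \<open>pf_finite\<close>. The default value is kept from use by the test \<open>intab\<close>,
  which fails exactly when there is no transition to apply.\<close>

definition tabc :: "tm \<Rightarrow> nat \<times> nat list \<Rightarrow> nat \<times> (nat \<times> nat) list" where
  "tabc M z = (if z \<in> tabdom M then tab M z else (0, []))"

definition intab :: "tm \<Rightarrow> nat \<times> nat list \<Rightarrow> bool" where
  "intab M z = (if z \<in> tabdom M then True else False)"

lemma pf_tabc[pf_intros]: "pf f \<Longrightarrow> pf (\<lambda>x. tabc M (f x))"
  unfolding tabc_def by (rule pf_finite[OF finite_tabdom])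

lemma pf_intab[pf_intros]: "pf f \<Longrightarrow> pf (\<lambda>x. intab M (f x))"
  unfolding intab_def by (rule pf_finite[OF finite_tabdom])

definition wscan :: "(nat list \<times> nat) list \<Rightarrow> nat list" where
  "wscan cs = map (\<lambda>z. nthd 0 (fst z) (snd z)) cs"

definition wact :: "nat \<Rightarrow> (nat list \<times> nat) list \<Rightarrow> (nat \<times> nat) list \<Rightarrow> (nat list \<times> nat) list" where
  "wact k cs as = map (\<lambda>i. ((fst (nthd ([], 0) cs i))[snd (nthd ([], 0) cs i) := fst (nthd (0, 0) as i)],
      snd (nthd ([], 0) cs i) + snd (nthd (0, 0) as i) - 1)) [0..<k]"

definition sstep :: "tm \<Rightarrow> nat \<times> (nat list \<times> nat) list \<Rightarrow> nat \<times> (nat list \<times> nat) list" where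
  "sstep M z = (if intab M (fst z, wscan (snd z)) then
     (fst (tabc M (fst z, wscan (snd z))), wact (tm_tapes M) (snd z) (snd (tabc M (fst z, wscan (snd z)))))
     else z)"

lemma pf_sstep: "pf (sstep M)"
  unfolding sstep_def wscan_def wact_def by (intro pf_intros)

lemma wscan_win:
  assumes "cinv M N n (q, ts)" "n \<le> N" shows "wscan (map (win N) ts) = scan ts"
proof -
  have "nthd 0 (fst (win N (t, h))) (snd (win N (t, h))) = t h" if "(t, h) \<in> set ts" for t h
  proof -
    have "\<bar>h\<bar> \<le> int n" using assms(1) that by (force simp: cinv_def in_set_conv_nth)
    then have "nat (h + int N) < 2 * N + 1" "0 \<le> h + int N" using assms(2) by auto
    then show ?thesis by (simp add: win_def del: upt_Suc)
  qed
  then show ?thesis by (auto simp: wscan_def scan_def)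
qed

lemma sstep_win:
  assumes "valid_tm M" "cinv M N n (q, ts)" "n < N"
  shows "sstep M (q, map (win N) ts) = (case tm_step M (q, ts) of (q', ts') \<Rightarrow> (q', map (win N) ts'))"
proof (cases "q < tm_states M")
  case False
  then show ?thesis by (auto simp: sstep_def intab_def tabdom_def tm_step_def)
next
  case True
  obtain q' as where t: "tm_trans M q (scan ts) = (q', as)" by fastforce
  note s = tm_step_simps[OF assms(1,2) True t]
  have l: "length ts = tm_tapes M" using assms(2) by (simp add: cinv_def)
  have d: "(q, wscan (map (win N) ts)) \<in> tabdom M"
    using s(1,2) True assms by (simp add: wscan_win tabdom_def)
  let ?as = "map (\<lambda>(s, m). (s, nat (m + 1))) as"
  have "wact (tm_tapes M) (map (win N) ts) ?as = map (win N) (act ts as)"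
  proof (rule nth_equalityI)
    show "length (wact (tm_tapes M) (map (win N) ts) ?as) = length (map (win N) (act ts as))"
      using l s(4) by (simp add: wact_def act_def)
    fix i assume "i < length (wact (tm_tapes M) (map (win N) ts) ?as)"
    then have i: "i < tm_tapes M" by (simp add: wact_def)
    obtain u h where uh: "ts ! i = (u, h)" by fastforce
    obtain a m where am: "as ! i = (a, m)" by fastforce
    have h: "\<bar>h\<bar> \<le> int n" using assms(2) i uh by (force simp: cinv_def)
    have "as ! i \<in> set as" using i s(4) by simp
    then have m: "m \<in> {-1, 0, 1}" using s(5) am by auto
    have e: "nat (h + int N) + nat (m + 1) - 1 = nat (h + m + int N)" using h m assms(3) by auto
    have u: "(map (\<lambda>j. u (int j - int N)) [0..<2 * N + 1])[nat (h + int N) := a] =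
       map (\<lambda>j. (u(h := a)) (int j - int N)) [0..<2 * N + 1]"
      by (rule nth_equalityI) (use h assms(3) in \<open>auto simp: nth_list_update simp del: upt_Suc\<close>)
    show "wact (tm_tapes M) (map (win N) ts) ?as ! i = map (win N) (act ts as) ! i"
      using i l s(4) e u by (simp add: wact_def act_nth2 uh am win_def length_act act_def del: upt_Suc)
  qed
  then show ?thesis using d assms s
    by (simp add: sstep_def intab_def tabc_def tab_def wscan_win t)
qed

definition winit :: "tm \<Rightarrow> nat \<Rightarrow> word \<Rightarrow> nat \<times> (nat list \<times> nat) list" where
  "winit M N w = (0, (map (\<lambda>j. if N \<le> j \<and> j - N < length w then (if nthd False w (j - N) then 2 else 1) else 0)
      [0..<2 * N + 1], N) # replicate (tm_tapes M - 1) (replicate (2 * N + 1) 0, N))"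

lemma winit_win: "winit M N w = (case tm_init M w of (q, ts) \<Rightarrow> (q, map (win N) ts))"
proof -
  have "(if N \<le> j \<and> j - N < length w then (if nthd False w (j - N) then 2 else 1) else 0) =
     word_tape w (int j - int N)" for j
    by (auto simp: word_tape_def nat_diff_distrib nthd_def)
  moreover have "map (\<lambda>j. word_tape [] (int j - int N)) [0..<2 * N + 1] = replicate (2 * N + 1) 0"
    by (rule nth_equalityI) (auto simp: word_tape_def nth_Cons' simp del: upt_Suc replicate.simps)
  ultimately show ?thesis unfolding winit_def tm_init_def by (simp add: win_def del: upt_Suc replicate.simps)
qed

lemma sstep_steps:
  assumes "valid_tm M" "length w \<le> N" "n \<le> N"
  shows "(sstep M ^^ n) (winit M N w) = (case (tm_step M ^^ n) (tm_init M w) of (q, ts) \<Rightarrow> (q, map (win N) ts))"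
  using assms(3)
proof (induction n)
  case 0 then show ?case by (simp add: winit_win)
next
  case (Suc n)
  obtain q ts where c: "(tm_step M ^^ n) (tm_init M w) = (q, ts)" by fastforce
  have "cinv M N n (q, ts)" using cinv_steps[OF assms(1,2), of n] Suc c by simp
  from sstep_win[OF assms(1) this] Suc c show ?case by simp
qed

text \<open>On a tape of the form \<open>word_tape y\<close> the nonblank cells are exactly the bits
  of \<open>y\<close>, so dropping the blanks recovers \<open>y\<close> without knowledge of its
  length or of the window.\<close>

definition wout :: "nat \<times> (nat list \<times> nat) list \<Rightarrow> word" where
  "wout z = map (\<lambda>s. s = 2) (filter (\<lambda>s. s \<noteq> 0) (fst (nthd ([], 0) (snd z) (length (snd z) - 1))))"

lemma wout_win:
  assumes "cinv M N n (q, ts)" "tm_tapes M \<ge> 1" "fst (last ts) = word_tape y"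
  shows "wout (q, map (win N) ts) = y"
proof -
  have l: "length ts = tm_tapes M" "ts \<noteq> []" using assms by (auto simp: cinv_def)
  then have last: "last ts = ts ! (length ts - 1)" by (simp add: last_conv_nth)
  have "word_tape y j = 0" if "\<bar>j\<bar> > int N" for j
  proof -
    have "tm_tapes M - 1 < tm_tapes M" using assms(2) by simp
    then show ?thesis using assms(1,3) l(1) last that unfolding cinv_def by (metis snd_conv)
  qed
  \<comment> \<open>A longer word would have a bit in the cell just outside the window.\<close>
  from this[of "int N + 1"] have y: "length y \<le> N + 1" by (auto simp: word_tape_def split: if_splits)
  have "2 * N + 1 = N + length y + (N + 1 - length y)" using y by simp
  then have u: "[0..<2 * N + 1] = [0..<N] @ [N..<N + length y] @ [N + length y..<2 * N + 1]"
    using y by (metis add_0 append.assoc le_add1 upt_add_eq_append)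
  have "filter (\<lambda>s. s \<noteq> 0) (map (\<lambda>j. word_tape y (int j - int N)) [0..<2 * N + 1]) =
    filter (\<lambda>s. s \<noteq> 0) (map (\<lambda>j. word_tape y (int j - int N)) [N..<N + length y])"
    unfolding u by (auto simp: filter_empty_conv word_tape_def)
  also have "map (\<lambda>j. word_tape y (int j - int N)) [N..<N + length y] = map (\<lambda>b. if b then 2 else 1) y"
    by (rule nth_equalityI) (auto simp: word_tape_def)
  also have "filter (\<lambda>s. s \<noteq> 0) (map (\<lambda>b. if b then 2 else 1::nat) y) = map (\<lambda>b. if b then 2 else 1) y"
    by (auto simp: filter_id_conv)
  finally have e: "filter (\<lambda>s. s \<noteq> 0) (map (\<lambda>j. word_tape y (int j - int N)) [0..<2 * N + 1]) =
    map (\<lambda>b. if b then 2 else 1) y" .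
  have "map (\<lambda>s. s = (2::nat)) (map (\<lambda>b. if b then 2 else 1) y) = y" by (induction y) auto
  then have "map (\<lambda>s. s = 2) (filter (\<lambda>s. s \<noteq> 0) (map (\<lambda>j. word_tape y (int j - int N)) [0..<2 * N + 1])) = y"
    unfolding e .
  then show ?thesis using l assms(2,3) last by (simp add: wout_def win_def del: upt_Suc)
qed

lemma len_win_le:
  assumes "cinv M N n (q, ts)" "n \<le> N"
  shows "len (q, map (win N) ts) \<le> 2 * tm_states M + 2 +
    tm_tapes M * (2 * (2 * ((2 * N + 1) * (2 * tm_symbols M + 2)) + 2 + 2 * N) + 2)"
proof -
  have "len (map (win N) ts) \<le> length (map (win N) ts) * (2 * (2 * ((2 * N + 1) * (2 * tm_symbols M + 2)) + 2 + 2 * N) + 2)"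
  proof (rule len_le)
    fix a assume "a \<in> set (map (win N) ts)"
    then obtain i where i: "i < tm_tapes M" "a = win N (ts ! i)"
      using assms(1) by (force simp: cinv_def in_set_conv_nth)
    let ?l = "map (\<lambda>j. fst (ts ! i) (int j - int N)) [0..<2 * N + 1]"
    have "len ?l \<le> length ?l * (2 * tm_symbols M + 2)"
      by (rule len_le) (use assms(1) i in \<open>force simp: cinv_def less_imp_le\<close>)
    moreover have "nat (snd (ts ! i) + int N) \<le> 2 * N" using assms i by (force simp: cinv_def)
    ultimately show "len a \<le> 2 * ((2 * N + 1) * (2 * tm_symbols M + 2)) + 2 + 2 * N"
      unfolding i(2) win_def by (simp del: upt_Suc)
  qed
  then show ?thesis using assms(1) by (simp add: cinv_def)
qed

theorem polytime_pf:
  assumes "polytime f" "pf g" shows "pf (\<lambda>x. f (g x))"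
proof -
  obtain M p where M: "valid_tm M" and t: "\<And>x. \<exists>t \<le> poly p (length x). tm_halts_with M x t (f x)"
    using assms(1) unfolding polytime_def by blast
  \<comment> \<open>One number serves as time and as window: it exceeds the running time, a halted
    machine stays in its final configuration, and the input fits.\<close>
  define N where "N = (\<lambda>w :: word. poly p (length w) + length w)"
  have pfN: "pf N" unfolding N_def by (intro pf_intros)
  have inv: "cinv M (N w) n ((tm_step M ^^ n) (tm_init M w))" if "n \<le> N w" for n w
    by (rule cinv_steps) (use M that in \<open>auto simp: N_def\<close>)
  have "pf (\<lambda>w. (sstep M ^^ N w) (winit M (N w) w))"
  proof (rule pf_funpow[OF pfN _ pf_sstep])
    show "pf (\<lambda>w. winit M (N w) w)" unfolding winit_def
      by (intro pf_intros pfN pf_compose[OF pfN, of fst])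
    show "pbx (\<lambda>w. 2 * tm_states M + 2 +
       tm_tapes M * (2 * (2 * ((2 * N w + 1) * (2 * tm_symbols M + 2)) + 2 + 2 * N w) + 2))"
      by (intro pbx_intros pbx_nat[OF pfN])
    fix w i assume i: "i \<le> N w"
    obtain q ts where c: "(tm_step M ^^ i) (tm_init M w) = (q, ts)" by fastforce
    have "(sstep M ^^ i) (winit M (N w) w) = (q, map (win (N w)) ts)"
      using sstep_steps[OF M, of w "N w" i] i c by (simp add: N_def)
    then show "len ((sstep M ^^ i) (winit M (N w) w)) \<le> 2 * tm_states M + 2 +
       tm_tapes M * (2 * (2 * ((2 * N w + 1) * (2 * tm_symbols M + 2)) + 2 + 2 * N w) + 2)"
      using len_win_le[of M "N w" i q ts] inv[OF i] c i by simp
  qed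
  then have "pf (\<lambda>w. wout ((sstep M ^^ N w) (winit M (N w) w)))"
    unfolding wout_def by (intro pf_intros)
  then have "pf f"
  proof (rule pf_on_cong)
    fix w
    obtain q ts where c: "(tm_step M ^^ N w) (tm_init M w) = (q, ts)" by fastforce
    have "(sstep M ^^ N w) (winit M (N w) w) = (q, map (win (N w)) ts)"
      using sstep_steps[OF M, of w "N w" "N w"] c by (simp add: N_def)
    moreover have "tm_halts_with M w (N w) (f w)"
      using t[of w] tm_halts_mono[of M w _ "f w" "N w"] by (auto simp: N_def)
    then have "fst (last ts) = word_tape (f w)" by (simp add: tm_halts_with_def c)
    ultimately show "wout ((sstep M ^^ N w) (winit M (N w) w)) = f w"
      using wout_win[of M "N w" "N w" q ts "f w"] inv[of "N w" w] c M by (simp add: valid_tm_def)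
  qed
  then show ?thesis using assms(2) by (rule pf_compose)
qed

lemma class_P_pf: assumes "L \<in> class_P" "pf g" shows "pf (\<lambda>x. g x \<in> L)"
proof -
  have "pf (\<lambda>x. [g x \<in> L])" using assms polytime_pf[of "\<lambda>x. [x \<in> L]" g] by (simp add: class_P_def)
  from pf_eq[OF this pf_const[of "[True]"]] show ?thesis by (rule pf_on_cong) simp
qed

lemma pf_class_P: "pf (\<lambda>x. unraw x \<in> L) \<Longrightarrow> L \<in> class_P"
  using pf_polytime[of "\<lambda>x. unraw x \<in> L"] by (simp add: class_P_def)

section \<open>Greedy runs and vertex covers\<close>

text \<open>Graphs that may be empty: deletions and the empty disjoint union leave the class
  \<open>is_graph\<close>.\<close>

definition gr :: "'a graph \<Rightarrow> bool" where
  "gr G \<longleftrightarrow> finite (fst G) \<and> snd G \<subseteq> {{u, v} | u v. u \<in> fst G \<and> v \<in> fst G \<and> u \<noteq> v}"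

lemma is_graph_gr: "is_graph G \<longleftrightarrow> gr G \<and> fst G \<noteq> {}"
  by (auto simp: is_graph_def gr_def)

lemma gr_edgeE: assumes "gr G" "e \<in> snd G"
  obtains u v where "e = {u, v}" "u \<in> fst G" "v \<in> fst G" "u \<noteq> v"
  using assms unfolding gr_def by blast

lemma gr_finite_edges: "gr G \<Longrightarrow> finite (snd G)"
proof -
  assume "gr G"
  then have "snd G \<subseteq> Pow (fst G)" "finite (fst G)" unfolding gr_def by auto
  then show ?thesis by (meson finite_Pow_iff finite_subset)
qed

section \<open>Neighbourhoods, deletions and greedy runs as lists of choices\<close>

definition nb :: "'a graph \<Rightarrow> 'a \<Rightarrow> 'a set" where "nb G v = {u. {v, u} \<in> snd G}"

lemma nb_V: "gr G \<Longrightarrow> nb G v \<subseteq> fst G"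
  by (auto simp: nb_def elim!: gr_edgeE) (metis doubleton_eq_iff)

lemma finite_nb: "gr G \<Longrightarrow> finite (nb G v)"
  using nb_V finite_subset gr_def by metis

lemma degree_nb: assumes "gr G" shows "degree_in G v = card (nb G v)"
proof -
  have "{e \<in> snd G. v \<in> e} \<subseteq> (\<lambda>u. {v, u}) ` nb G v"
  proof
    fix e assume e: "e \<in> {e \<in> snd G. v \<in> e}"
    then obtain a b where "e = {a, b}" using gr_edgeE[OF assms] by (metis mem_Collect_eq)
    with e have "e = {v, a} \<or> e = {v, b}" by auto
    then show "e \<in> (\<lambda>u. {v, u}) ` nb G v" using e by (auto simp: nb_def)
  qed
  moreover have "(\<lambda>u. {v, u}) ` nb G v \<subseteq> {e \<in> snd G. v \<in> e}" by (auto simp: nb_def)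
  ultimately have "{e \<in> snd G. v \<in> e} = (\<lambda>u. {v, u}) ` nb G v" by (rule equalityI)
  moreover have "inj_on (\<lambda>u. {v, u}) (nb G v)"
    by (rule inj_onI) (metis doubleton_eq_iff)
  ultimately show ?thesis unfolding degree_in_def by (simp add: card_image)
qed

definition gdel :: "'a graph \<Rightarrow> 'a set \<Rightarrow> 'a graph" where
  "gdel G U = (fst G - U, {e \<in> snd G. e \<inter> U = {}})"

lemma gdel_empty[simp]: "gdel G {} = G" by (simp add: gdel_def)

lemma delete_gdel: "delete_vertex (gdel G U) v = gdel G (insert v U)"
  by (auto simp: delete_vertex_def gdel_def)

lemma gr_gdel: "gr G \<Longrightarrow> gr (gdel G U)"
  unfolding gr_def gdel_def by (auto dest!: subsetD)

lemma degree_gdel: assumes "gr G" "v \<notin> U" shows "degree_in (gdel G U) v = card (nb G v - U)"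
proof -
  have "nb (gdel G U) v = nb G v - U" using assms(2) by (auto simp: nb_def gdel_def)
  then show ?thesis using degree_nb[OF gr_gdel[OF assms(1)]] by simp
qed

fun mdgl :: "'a graph \<Rightarrow> 'a list \<Rightarrow> bool" where
  "mdgl G [] \<longleftrightarrow> snd G = {}"
| "mdgl G (v # vs) \<longleftrightarrow> snd G \<noteq> {} \<and> v \<in> fst G \<and> (\<forall>u\<in>fst G. degree_in G u \<le> degree_in G v) \<and>
     mdgl (delete_vertex G v) vs"

lemma mdgl_gdel_Cons:
  assumes "gr G"
  shows "mdgl (gdel G U) (v # vs) \<longleftrightarrow> snd (gdel G U) \<noteq> {} \<and> v \<in> fst G - U \<and>
    (\<forall>u\<in>fst G - U. card (nb G u - U) \<le> card (nb G v - U)) \<and> mdgl (gdel G (insert v U)) vs"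
proof -
  have f: "fst (gdel G U) = fst G - U" by (simp add: gdel_def)
  have d: "degree_in (gdel G U) u = card (nb G u - U)" if "u \<in> fst G - U" for u
    using that by (intro degree_gdel[OF assms]) auto
  show ?thesis unfolding mdgl.simps delete_gdel f using d by auto
qed

lemma mdgl_distinct: "mdgl G vs \<Longrightarrow> distinct vs \<and> set vs \<subseteq> fst G"
proof (induction vs arbitrary: G)
  case (Cons v vs)
  have "distinct vs \<and> set vs \<subseteq> fst (delete_vertex G v)" by (rule Cons.IH) (use Cons.prems in simp)
  then show ?case using Cons.prems by (auto simp: delete_vertex_def)
qed simp

lemma mdgl_cover: "mdgl G vs \<Longrightarrow> vertex_cover G (set vs)"
proof (induction vs arbitrary: G)
  case (Cons v vs)
  have "vertex_cover (delete_vertex G v) (set vs)" by (rule Cons.IH) (use Cons.prems in simp)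
  then show ?case using Cons.prems by (auto simp: delete_vertex_def vertex_cover_def)
qed (simp add: vertex_cover_def)

lemma mdg_steps_mdgl:
  "mdg_step\<^sup>*\<^sup>* (G, C) (H, C') \<Longrightarrow> snd H = {} \<Longrightarrow> \<exists>vs. mdgl G vs \<and> C' = C \<union> set vs"
proof (induction rule: converse_rtranclp_induct2)
  case refl
  then show ?case by (intro exI[of _ "[]"]) simp
next
  case (step G C G1 C1)
  then obtain vs where vs: "mdgl G1 vs" "C' = C1 \<union> set vs" by blast
  from step(1) obtain v where "snd G \<noteq> {}" "v \<in> fst G" "\<forall>u\<in>fst G. degree_in G u \<le> degree_in G v"
    "G1 = delete_vertex G v" "C1 = insert v C" by cases auto
  then show ?case using vs by (intro exI[of _ "v # vs"]) auto
qed

lemma mdgl_mdg_steps: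
  "mdgl G vs \<Longrightarrow> \<exists>H. mdg_step\<^sup>*\<^sup>* (G, C) (H, C \<union> set vs) \<and> snd H = {}"
proof (induction vs arbitrary: G C)
  case (Cons v vs)
  have "mdgl (delete_vertex G v) vs" using Cons.prems by simp
  from Cons.IH[OF this, of "insert v C"] obtain H where
    "mdg_step\<^sup>*\<^sup>* (delete_vertex G v, insert v C) (H, insert v C \<union> set vs)" "snd H = {}"
    by blast
  moreover have "mdg_step (G, C) (delete_vertex G v, insert v C)"
    using Cons.prems by (intro mdg_step.intros) auto
  ultimately show ?case by (intro exI[of _ H]) (auto intro: converse_rtranclp_into_rtranclp)
qed auto

lemma mdg_outputs_mdgl: "mdg_outputs G = {set vs | vs. mdgl G vs}"
  unfolding mdg_outputs_def using mdg_steps_mdgl[of G "{}"] mdgl_mdg_steps[of G _ "{}"] by fastforce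

lemma min_mdg_alt: "min_mdg G = (LEAST k. \<exists>vs. mdgl G vs \<and> length vs = k)"
proof -
  have "(\<exists>C\<in>mdg_outputs G. card C = k) \<longleftrightarrow> (\<exists>vs. mdgl G vs \<and> length vs = k)" for k
  proof -
    have "card (set vs) = length vs" if "mdgl G vs" for vs using mdgl_distinct[OF that] distinct_card by blast
    then show ?thesis unfolding mdg_outputs_mdgl by auto
  qed
  then show ?thesis unfolding min_mdg_def by simp
qed

lemma min_mdg_le: "mdgl G vs \<Longrightarrow> min_mdg G \<le> length vs"
  unfolding min_mdg_alt by (rule Least_le) blast

section \<open>Runs that exist and runs that are forced\<close>

lemma edge_gdel: assumes "gr G" "snd (gdel G U) \<noteq> {}" obtains u v where
  "u \<in> fst G - U" "v \<in> fst G - U" "v \<in> nb G u"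
proof -
  obtain e where e: "e \<in> snd G" "e \<inter> U = {}" using assms(2) by (auto simp: gdel_def)
  obtain u v where "e = {u, v}" "u \<in> fst G" "v \<in> fst G" using gr_edgeE[OF assms(1) e(1)] by metis
  then show ?thesis using e that[of u v] by (auto simp: nb_def)
qed

text \<open>Steers the nondeterminism: if, under an invariant, some vertex of maximum degree can
  always be found in what is left of the cover \<open>C\<close>, then a run stays inside
  \<open>C\<close> and is no longer than \<open>C\<close>.\<close>

lemma mdg_can:
  assumes "gr G" "vertex_cover G C" "Inv U" "U \<subseteq> C"
    and "\<And>U. Inv U \<Longrightarrow> U \<subseteq> C \<Longrightarrow> snd (gdel G U) \<noteq> {} \<Longrightarrow>
       \<exists>v\<in>C - U. (\<forall>u\<in>fst G - U. card (nb G u - U) \<le> card (nb G v - U)) \<and> Inv (insert v U)"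
  shows "\<exists>vs. mdgl (gdel G U) vs \<and> set vs \<subseteq> C - U"
  using assms(3,4)
proof (induction "card (C - U)" arbitrary: U rule: less_induct)
  case less
  have CV: "C \<subseteq> fst G" "finite C" using assms(1,2) by (auto simp: vertex_cover_def gr_def intro: finite_subset)
  show ?case
  proof (cases "snd (gdel G U) = {}")
    case True then show ?thesis by (intro exI[of _ "[]"]) simp
  next
    case False
    then obtain v where v: "v \<in> C - U" "\<forall>u\<in>fst G - U. card (nb G u - U) \<le> card (nb G v - U)" "Inv (insert v U)"
      using assms(5) less by blast
    have "card (C - insert v U) < card (C - U)" using v CV by (intro psubset_card_mono) auto
    then obtain vs where "mdgl (gdel G (insert v U)) vs" "set vs \<subseteq> C - insert v U"
      using less(1) less.prems v by blast
    then show ?thesis using v CV False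
      by (intro exI[of _ "v # vs"]) (auto simp: mdgl_gdel_Cons[OF assms(1)] simp del: mdgl.simps)
  qed
qed

lemma mdg_exists: assumes "gr G" shows "\<exists>vs. mdgl G vs"
proof -
  have "\<exists>vs. mdgl (gdel G {}) vs \<and> set vs \<subseteq> fst G - {}"
  proof (rule mdg_can[OF assms, where Inv = "\<lambda>_. True"])
    show "vertex_cover G (fst G)" using assms by (auto simp: vertex_cover_def elim!: gr_edgeE)
    fix U assume "snd (gdel G U) \<noteq> {}"
    then obtain u where u: "u \<in> fst G - U" using edge_gdel[OF assms] by blast
    let ?f = "\<lambda>v. card (nb G v - U)" let ?M = "Max (?f ` (fst G - U))"
    have fin: "finite (?f ` (fst G - U))" using assms by (simp add: gr_def)
    then have "?M \<in> ?f ` (fst G - U)" using u by (intro Max_in) auto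
    then obtain v where "v \<in> fst G - U" "?f v = ?M" by auto
    moreover have "\<forall>u\<in>fst G - U. ?f u \<le> ?M" using fin by auto
    ultimately show "\<exists>v\<in>fst G - U. (\<forall>u\<in>fst G - U. card (nb G u - U) \<le> card (nb G v - U)) \<and> True"
      by (intro bexI[of _ v]) auto
  qed auto
  then show ?thesis by auto
qed

lemma min_mdg_obtain: assumes "gr G" obtains vs where "mdgl G vs" "length vs = min_mdg G"
proof -
  have "\<exists>vs. mdgl G vs \<and> length vs = min_mdg G"
    unfolding min_mdg_alt by (rule LeastI_ex) (use mdg_exists[OF assms] in blast)
  then show ?thesis using that by blast
qed

lemma mvc_le: "vertex_cover G C \<Longrightarrow> mvc G \<le> card C"
  unfolding mvc_def by (rule Least_le) blast

lemma mvc_obtain: assumes "gr G" obtains C where "vertex_cover G C" "card C = mvc G"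
proof -
  have "vertex_cover G (fst G)" using assms by (auto simp: vertex_cover_def elim!: gr_edgeE)
  then have "\<exists>k C. vertex_cover G C \<and> card C = k" by blast
  from LeastI_ex[OF this] have "\<exists>C. vertex_cover G C \<and> card C = mvc G" unfolding mvc_def .
  then show ?thesis using that by blast
qed

lemma mvc_le_min_mdg: assumes "gr G" shows "mvc G \<le> min_mdg G"
proof -
  obtain vs where "mdgl G vs" "length vs = min_mdg G" using min_mdg_obtain[OF assms] .
  then show ?thesis using mvc_le[OF mdgl_cover] mdgl_distinct distinct_card by metis
qed

text \<open>As long as \<open>Z\<close> is not exhausted, an outsider is strictly beaten by some
  remaining vertex of \<open>Z\<close>, so every choice lies in \<open>Z\<close>. Applied to the
  outsider \<open>w\<close>, the same comparison yields a vertex of positive degree, so the run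
  cannot end early.\<close>

lemma mdg_forced:
  assumes "gr G" "Z \<subseteq> fst G" "w \<in> fst G - Z"
    and "\<And>U v. U \<subset> Z \<Longrightarrow> v \<in> fst G - Z \<Longrightarrow> \<exists>z\<in>Z - U. card (nb G v - U) < card (nb G z - U)"
  shows "mdgl (gdel G U) vs \<Longrightarrow> U \<subseteq> Z \<Longrightarrow> Z \<subseteq> U \<union> set vs"
proof (induction vs arbitrary: U)
  case Nil
  show ?case
  proof (rule ccontr)
    assume "\<not> ?thesis"
    then have "U \<subset> Z" using Nil by auto
    from assms(4)[OF this assms(3)] obtain z where z: "z \<in> Z - U" "card (nb G w - U) < card (nb G z - U)" by blast
    then obtain u where "u \<in> nb G z - U" by (metis card.empty ex_in_conv not_less0)
    then have "{z, u} \<in> snd (gdel G U)" using z(1) by (auto simp: nb_def gdel_def)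
    then show False using Nil by simp
  qed
next
  case (Cons v vs)
  show ?case
  proof (cases "U = Z")
    case False
    then have U: "U \<subset> Z" using Cons by blast
    have m: "v \<in> fst G - U" "\<forall>u\<in>fst G - U. card (nb G u - U) \<le> card (nb G v - U)" "mdgl (gdel G (insert v U)) vs"
      using Cons.prems(1) mdgl_gdel_Cons[OF assms(1)] by blast+
    have "v \<in> Z"
    proof (rule ccontr)
      assume "v \<notin> Z"
      then obtain z where "z \<in> Z - U" "card (nb G v - U) < card (nb G z - U)" using assms(4)[OF U] m(1) by blast
      then show False using m(2) assms(2) by (meson Diff_iff leD subsetD)
    qed
    then show ?thesis using Cons.IH[OF m(3)] U by auto
  qed auto
qed

subsection \<open>Isomorphisms and disjoint unions\<close>

definition gmap :: "('a \<Rightarrow> 'b) \<Rightarrow> 'a graph \<Rightarrow> 'b graph" where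
  "gmap f G = (f ` fst G, image f ` snd G)"

lemma gr_gmap: assumes "gr G" "inj_on f (fst G)" shows "gr (gmap f G)"
  unfolding gr_def
proof
  show "finite (fst (gmap f G))" using assms by (auto simp: gr_def gmap_def)
  show "snd (gmap f G) \<subseteq> {{u, v} |u v. u \<in> fst (gmap f G) \<and> v \<in> fst (gmap f G) \<and> u \<noteq> v}"
  proof
    fix e assume "e \<in> snd (gmap f G)"
    then obtain e' where e: "e' \<in> snd G" "e = f ` e'" by (auto simp: gmap_def)
    obtain u v where "e' = {u, v}" "u \<in> fst G" "v \<in> fst G" "u \<noteq> v" using gr_edgeE[OF assms(1) e(1)] .
    then have "e = {f u, f v}" "f u \<in> fst (gmap f G)" "f v \<in> fst (gmap f G)" "f u \<noteq> f v"
      using e assms(2) by (auto simp: gmap_def inj_on_eq_iff)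
    then show "e \<in> {{u, v} |u v. u \<in> fst (gmap f G) \<and> v \<in> fst (gmap f G) \<and> u \<noteq> v}" by blast
  qed
qed

lemma gr_edge_sub: "gr G \<Longrightarrow> e \<in> snd G \<Longrightarrow> e \<subseteq> fst G"
  by (auto elim!: gr_edgeE)

lemma degree_gmap: assumes "gr G" "inj_on f (fst G)" "v \<in> fst G"
  shows "degree_in (gmap f G) (f v) = degree_in G v"
proof -
  have m: "f v \<in> f ` e \<longleftrightarrow> v \<in> e" if "e \<in> snd G" for e
    by (rule inj_on_image_mem_iff[OF assms(2,3) gr_edge_sub[OF assms(1) that]])
  have "{e \<in> snd (gmap f G). f v \<in> e} = image f ` {e \<in> snd G. v \<in> e}"
    unfolding gmap_def snd_conv using m by blast
  moreover have "inj_on (image f) {e \<in> snd G. v \<in> e}"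
    by (rule inj_onI) (use inj_on_image_eq_iff[OF assms(2) gr_edge_sub[OF assms(1)] gr_edge_sub[OF assms(1)]] in blast)
  ultimately show ?thesis by (simp add: degree_in_def card_image)
qed

lemma delete_gmap: assumes "gr G" "inj_on f (fst G)" "v \<in> fst G"
  shows "delete_vertex (gmap f G) (f v) = gmap f (delete_vertex G v)"
proof -
  have m: "f v \<in> f ` e \<longleftrightarrow> v \<in> e" if "e \<in> snd G" for e
    by (rule inj_on_image_mem_iff[OF assms(2,3) gr_edge_sub[OF assms(1) that]])
  have "{e \<in> image f ` snd G. f v \<notin> e} = image f ` {e \<in> snd G. v \<notin> e}"
    using m by blast
  moreover have "f ` fst G - {f v} = f ` (fst G - {v})" using assms(2,3) by (auto simp: inj_on_eq_iff)
  ultimately show ?thesis by (simp add: delete_vertex_def gmap_def)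
qed

lemma gr_delete: "gr G \<Longrightarrow> gr (delete_vertex G v)"
  using gr_gdel[of G "{v}"] delete_gdel[of G "{}" v] by simp

lemma mdgl_gmap: "mdgl G vs \<Longrightarrow> gr G \<Longrightarrow> inj_on f (fst G) \<Longrightarrow> mdgl (gmap f G) (map f vs)"
proof (induction vs arbitrary: G)
  case Nil then show ?case by (simp add: gmap_def)
next
  case (Cons v vs)
  have "inj_on f (fst (delete_vertex G v))" using Cons.prems(3) by (auto simp: delete_vertex_def inj_on_def)
  with Cons.prems have "mdgl (gmap f (delete_vertex G v)) (map f vs)" by (intro Cons.IH gr_delete) auto
  moreover have "fst (gmap f G) = f ` fst G" "snd (gmap f G) = {} \<longleftrightarrow> snd G = {}" by (auto simp: gmap_def)
  ultimately show ?case using Cons.prems by (simp add: delete_gmap degree_gmap)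
qed

lemma gmap_inv: assumes "gr G" "inj_on f (fst G)" shows "gmap (the_inv_into (fst G) f) (gmap f G) = G"
proof -
  have "the_inv_into (fst G) f ` f ` e = e" if "e \<subseteq> fst G" for e
    unfolding image_image
    by (subst image_cong[OF refl, of _ _ "\<lambda>x. x"]) (use that assms(2) in \<open>auto intro!: the_inv_into_f_f\<close>)
  note i = this
  have "image (the_inv_into (fst G) f) ` image f ` snd G = (\<lambda>e. e) ` snd G"
    unfolding image_image[of "image (the_inv_into (fst G) f)"]
    by (intro image_cong refl i gr_edge_sub[OF assms(1)])
  then have "image (the_inv_into (fst G) f) ` image f ` snd G = snd G" by simp
  moreover have "the_inv_into (fst G) f ` f ` fst G = fst G" by (rule i) simp
  ultimately show ?thesis by (simp add: gmap_def)
qed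

lemma min_mdg_gmap: assumes "gr G" "inj_on f (fst G)" shows "min_mdg (gmap f G) = min_mdg G"
proof -
  have le: "min_mdg (gmap f G) \<le> min_mdg G" if "gr G" "inj_on f (fst G)" for G :: "'x graph" and f :: "'x \<Rightarrow> 'y"
    using min_mdg_obtain[OF that(1)] min_mdg_le[OF mdgl_gmap[OF _ that]] by (metis length_map)
  have "inj_on (the_inv_into (fst G) f) (fst (gmap f G))"
    using inj_on_the_inv_into[OF assms(2)] by (simp add: gmap_def)
  from le[OF gr_gmap[OF assms] this] have "min_mdg G \<le> min_mdg (gmap f G)" by (simp add: gmap_inv[OF assms])
  then show ?thesis using le[OF assms] by simp
qed

lemma mvc_gmap: assumes "gr G" "inj_on f (fst G)" shows "mvc (gmap f G) = mvc G"
proof -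
  have le: "mvc (gmap f G) \<le> mvc G" if g: "gr G" "inj_on f (fst G)" for G :: "'x graph" and f :: "'x \<Rightarrow> 'y"
  proof -
    obtain C where C: "vertex_cover G C" "card C = mvc G" using mvc_obtain[OF g(1)] .
    then have "vertex_cover (gmap f G) (f ` C)" by (auto simp: vertex_cover_def gmap_def)
    moreover have "card (f ` C) = card C"
      using C(1) g(2) by (intro card_image) (auto simp: vertex_cover_def intro: inj_on_subset)
    ultimately show ?thesis using mvc_le C by metis
  qed
  have "inj_on (the_inv_into (fst G) f) (fst (gmap f G))"
    using inj_on_the_inv_into[OF assms(2)] by (simp add: gmap_def)
  from le[OF gr_gmap[OF assms] this] have "mvc G \<le> mvc (gmap f G)" by (simp add: gmap_inv[OF assms])
  then show ?thesis using le[OF assms] by simp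
qed

definition gun :: "'a graph \<Rightarrow> 'a graph \<Rightarrow> 'a graph" where
  "gun G H = (fst G \<union> fst H, snd G \<union> snd H)"

lemma gr_gun: "gr G \<Longrightarrow> gr H \<Longrightarrow> gr (gun G H)"
  unfolding gr_def gun_def fst_conv snd_conv by blast

lemma gun_commute: "gun G H = gun H G" by (auto simp: gun_def)

lemma degree_gun: assumes "gr H" "v \<notin> fst H" shows "degree_in (gun G H) v = degree_in G v"
proof -
  have "{e \<in> snd G \<union> snd H. v \<in> e} = {e \<in> snd G. v \<in> e}" using gr_edge_sub[OF assms(1)] assms(2) by auto
  then show ?thesis by (simp add: degree_in_def gun_def)
qed

lemma delete_gun: assumes "gr H" "v \<notin> fst H" shows "delete_vertex (gun G H) v = gun (delete_vertex G v) H"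
  using gr_edge_sub[OF assms(1)] assms(2) by (auto simp: delete_vertex_def gun_def)

lemma degree_0: "snd G = {} \<Longrightarrow> degree_in G v = 0" by (simp add: degree_in_def)

text \<open>The two runs are merged as in merge sort: the larger of the two next degrees is maximal
  in the whole union. A run that is finished has only degrees 0 to compare with.\<close>

lemma mdgl_merge:
  "mdgl G vs \<Longrightarrow> mdgl H ws \<Longrightarrow> gr G \<Longrightarrow> gr H \<Longrightarrow> fst G \<inter> fst H = {} \<Longrightarrow>
   \<exists>us. mdgl (gun G H) us \<and> length us = length vs + length ws"
proof (induction "length vs + length ws" arbitrary: G H vs ws rule: less_induct)
  case less
  \<comment> \<open>Stated for arbitrary \<open>G\<close> and \<open>H\<close>, so that it also
    applies with the roles exchanged, when the next vertex comes from the second graph.\<close>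
  have step: "\<exists>us. mdgl (gun G H) us \<and> length us = length vs + length ws"
    if A: "vs = v # vs'" "\<forall>u\<in>fst H. degree_in H u \<le> degree_in G v" "mdgl G vs" "mdgl H ws" "gr G" "gr H"
      "fst G \<inter> fst H = {}" "length vs + length ws \<le> n"
    and IH: "\<And>(G :: 'a graph) H vs ws. length vs + length ws < n \<Longrightarrow> mdgl G vs \<Longrightarrow> mdgl H ws \<Longrightarrow> gr G \<Longrightarrow> gr H \<Longrightarrow> fst G \<inter> fst H = {} \<Longrightarrow>
         \<exists>us. mdgl (gun G H) us \<and> length us = length vs + length ws"
    for G H :: "'a graph" and vs ws v vs' n
  proof -
    have v: "v \<in> fst G" "v \<notin> fst H" "snd G \<noteq> {}" "mdgl (delete_vertex G v) vs'" "\<forall>u\<in>fst G. degree_in G u \<le> degree_in G v"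
      using A by auto
    have "fst (delete_vertex G v) \<inter> fst H = {}" using A(7) by (auto simp: delete_vertex_def)
    then obtain us where us: "mdgl (gun (delete_vertex G v) H) us" "length us = length vs' + length ws"
      using IH[of vs' ws "delete_vertex G v" H] A(1,4,6,8) v(4) gr_delete[OF A(5)] by auto
    have "degree_in (gun G H) u = degree_in G u" if "u \<in> fst G" for u
      using degree_gun[OF \<open>gr H\<close>] that \<open>fst G \<inter> fst H = {}\<close> by blast
    moreover have "degree_in (gun G H) u = degree_in H u" if "u \<in> fst H" for u
      using degree_gun[OF \<open>gr G\<close>, of u H] that \<open>fst G \<inter> fst H = {}\<close> gun_commute by (metis disjoint_iff)
    ultimately have "\<forall>u\<in>fst (gun G H). degree_in (gun G H) u \<le> degree_in (gun G H) v"
      using v A(2) by (auto simp: gun_def)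
    then have "mdgl (gun G H) (v # us)"
      using us v delete_gun[OF \<open>gr H\<close> v(2)] by (auto simp: gun_def)
    then show ?thesis using us A(1) by (intro exI[of _ "v # us"]) auto
  qed
  show ?case
  proof (cases vs)
    case Nil
    show ?thesis
    proof (cases ws)
      case Nil' : Nil
      then show ?thesis using Nil less.prems by (intro exI[of _ "[]"]) (auto simp: gun_def)
    next
      case (Cons w ws')
      have D: "\<forall>u\<in>fst G. degree_in G u \<le> degree_in H w" using Nil less.prems by (simp add: degree_0)
      have "\<exists>us. mdgl (gun H G) us \<and> length us = length ws + length vs"
        by (rule step[OF Cons D less.prems(2,1,4,3) _ _ less(1)]) (use less.prems(5) in auto)
      then show ?thesis by (simp only: gun_commute[of G H] add.commute)
    qed
  next
    case (Cons v vs')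
    show ?thesis
    proof (cases "ws = [] \<or> degree_in H (hd ws) \<le> degree_in G v")
      case True
      have D: "\<forall>u\<in>fst H. degree_in H u \<le> degree_in G v"
      proof (cases ws)
        case Nil then show ?thesis using less.prems(2) by (simp add: degree_0)
      next
        case (Cons w ws') then show ?thesis using less.prems(2) True by (auto intro: order_trans)
      qed
      show ?thesis by (rule step[OF Cons D less.prems(1,2,3,4,5) order_refl less(1)])
    next
      case False
      then obtain w ws' where w: "ws = w # ws'" "degree_in G v \<le> degree_in H w" by (cases ws) auto
      have D: "\<forall>u\<in>fst G. degree_in G u \<le> degree_in H w" using Cons less.prems(1) w by (auto intro: order_trans)
      have "\<exists>us. mdgl (gun H G) us \<and> length us = length ws + length vs"
        by (rule step[OF w(1) D less.prems(2,1,4,3) _ _ less(1)]) (use less.prems(5) in auto)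
      then show ?thesis by (simp only: gun_commute[of G H] add.commute)
    qed
  qed
qed

text \<open>A vertex of maximum degree in the union has maximum degree in its own component, so
  every run interleaves runs of the components.\<close>

lemma mdgl_split:
  "mdgl (gun G H) us \<Longrightarrow> gr G \<Longrightarrow> gr H \<Longrightarrow> fst G \<inter> fst H = {} \<Longrightarrow>
   \<exists>vs ws. mdgl G vs \<and> mdgl H ws \<and> length us = length vs + length ws"
proof (induction us arbitrary: G H)
  case Nil
  then show ?case by (intro exI[of _ "[]"]) (auto simp: gun_def)
next
  case (Cons v us)
  have step: "\<exists>vs ws. mdgl G vs \<and> mdgl H ws \<and> length (v # us) = length vs + length ws"
    if m: "mdgl (gun G H) (v # us)" and g: "gr G" "gr H" "fst G \<inter> fst H = {}" and v: "v \<in> fst G" for G H :: "'a graph"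
  proof -
    have vH: "v \<notin> fst H" using v g by auto
    have d: "delete_vertex (gun G H) v = gun (delete_vertex G v) H" by (rule delete_gun[OF g(2) vH])
    obtain vs ws where vw: "mdgl (delete_vertex G v) vs" "mdgl H ws" "length us = length vs + length ws"
    proof -
      have "mdgl (gun (delete_vertex G v) H) us" using m d by simp
      moreover have "fst (delete_vertex G v) \<inter> fst H = {}" using g(3) by (auto simp: delete_vertex_def)
      ultimately show thesis using Cons.IH[OF _ gr_delete[OF g(1)] g(2)] that by blast
    qed
    have dg: "degree_in (gun G H) u = degree_in G u" if "u \<in> fst G" for u
      using degree_gun[OF g(2)] that g(3) by blast
    have max: "\<forall>u\<in>fst (gun G H). degree_in (gun G H) u \<le> degree_in G v" using m dg[OF v] by simp
    \<comment> \<open>The component of the chosen vertex must still have an edge: otherwise the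
      maximum degree would be 0 although the union has one.\<close>
    have "snd G \<noteq> {}"
    proof
      assume "snd G = {}"
      then have z: "\<forall>u\<in>fst (gun G H). degree_in (gun G H) u = 0" using max by (simp add: degree_0)
      obtain e where e: "e \<in> snd (gun G H)" using m by auto
      obtain a b where "e = {a, b}" "a \<in> fst (gun G H)" using gr_edgeE[OF gr_gun[OF g(1,2)] e] by metis
      then have "degree_in (gun G H) a > 0"
        using e gr_finite_edges[OF gr_gun[OF g(1,2)]] by (auto simp: degree_in_def card_gt_0_iff)
      then show False using z \<open>a \<in> fst (gun G H)\<close> by simp
    qed
    moreover have "fst G \<subseteq> fst (gun G H)" by (auto simp: gun_def)
    then have "\<forall>u\<in>fst G. degree_in G u \<le> degree_in G v" using max dg by (metis subsetD)
    ultimately show ?thesis using vw v by (intro exI[of _ "v # vs"] exI[of _ ws]) auto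
  qed
  have "v \<in> fst G \<or> v \<in> fst H" using Cons.prems by (auto simp: gun_def)
  then show ?case
  proof
    assume "v \<in> fst G" then show ?thesis using step[of G H] Cons.prems by blast
  next
    assume "v \<in> fst H"
    then obtain vs ws where "mdgl H vs" "mdgl G ws" "length (v # us) = length vs + length ws"
      using step[of H G] Cons.prems by (auto simp: gun_commute inf_commute)
    then show ?thesis by (metis add.commute)
  qed
qed

lemma min_mdg_gun: assumes "gr G" "gr H" "fst G \<inter> fst H = {}"
  shows "min_mdg (gun G H) = min_mdg G + min_mdg H"
proof (rule antisym)
  obtain vs where vs: "mdgl G vs" "length vs = min_mdg G" using min_mdg_obtain[OF assms(1)] .
  obtain ws where ws: "mdgl H ws" "length ws = min_mdg H" using min_mdg_obtain[OF assms(2)] .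
  show "min_mdg (gun G H) \<le> min_mdg G + min_mdg H"
    using mdgl_merge[OF vs(1) ws(1) assms] min_mdg_le vs(2) ws(2) by metis
  obtain us where us: "mdgl (gun G H) us" "length us = min_mdg (gun G H)"
    using min_mdg_obtain[OF gr_gun[OF assms(1,2)]] .
  obtain vs ws where vw: "mdgl G vs" "mdgl H ws" "length us = length vs + length ws"
    using mdgl_split[OF us(1) assms] by blast
  show "min_mdg G + min_mdg H \<le> min_mdg (gun G H)"
    using vw us min_mdg_le[OF vw(1)] min_mdg_le[OF vw(2)] by simp
qed

lemma mvc_gun: assumes "gr G" "gr H" "fst G \<inter> fst H = {}"
  shows "mvc (gun G H) = mvc G + mvc H"
proof (rule antisym)
  have fin: "finite (fst G)" "finite (fst H)" using assms by (auto simp: gr_def)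
  obtain C where C: "vertex_cover G C" "card C = mvc G" using mvc_obtain[OF assms(1)] .
  obtain D where D: "vertex_cover H D" "card D = mvc H" using mvc_obtain[OF assms(2)] .
  have "vertex_cover (gun G H) (C \<union> D)" using C D by (auto simp: vertex_cover_def gun_def)
  moreover have "card (C \<union> D) = card C + card D"
    using C D assms(3) fin by (intro card_Un_disjoint) (auto simp: vertex_cover_def intro: finite_subset)
  ultimately show "mvc (gun G H) \<le> mvc G + mvc H" using mvc_le C D by metis
  obtain E where E: "vertex_cover (gun G H) E" "card E = mvc (gun G H)"
    using mvc_obtain[OF gr_gun[OF assms(1,2)]] .
  have "vertex_cover G (E \<inter> fst G)" unfolding vertex_cover_def
  proof (intro conjI ballI)
    fix e assume "e \<in> snd G"
    then have "e \<inter> E \<noteq> {}" "e \<subseteq> fst G" using E(1) gr_edge_sub[OF assms(1)] by (auto simp: vertex_cover_def gun_def)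
    then show "e \<inter> (E \<inter> fst G) \<noteq> {}" by blast
  qed simp
  moreover have "vertex_cover H (E \<inter> fst H)" unfolding vertex_cover_def
  proof (intro conjI ballI)
    fix e assume "e \<in> snd H"
    then have "e \<inter> E \<noteq> {}" "e \<subseteq> fst H" using E(1) gr_edge_sub[OF assms(2)] by (auto simp: vertex_cover_def gun_def)
    then show "e \<inter> (E \<inter> fst H) \<noteq> {}" by blast
  qed simp
  ultimately have "mvc G + mvc H \<le> card (E \<inter> fst G) + card (E \<inter> fst H)" using mvc_le by (metis add_mono)
  also have "\<dots> = card ((E \<inter> fst G) \<union> (E \<inter> fst H))"
    using assms(3) fin by (intro card_Un_disjoint[symmetric]) auto
  also have "\<dots> \<le> card E"
    using E fin by (intro card_mono) (auto simp: vertex_cover_def gun_def intro: finite_subset)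
  finally show "mvc G + mvc H \<le> mvc (gun G H)" using E by simp
qed

definition gsum :: "nat \<Rightarrow> (nat \<Rightarrow> 'a graph) \<Rightarrow> (nat \<times> 'a) graph" where
  "gsum n Gs = ((\<Union>i<n. Pair i ` fst (Gs i)), (\<Union>i<n. image (Pair i) ` snd (Gs i)))"

lemma gsum_0: "gsum 0 Gs = ({}, {})" by (simp add: gsum_def)

lemma gsum_Suc: "gsum (Suc n) Gs = gun (gmap (Pair n) (Gs n)) (gsum n Gs)"
  by (simp add: gsum_def gun_def gmap_def lessThan_Suc)

lemma gsum_props:
  assumes "\<And>i. i < n \<Longrightarrow> gr (Gs i)"
  shows "gr (gsum n Gs) \<and> min_mdg (gsum n Gs) = (\<Sum>i<n. min_mdg (Gs i)) \<and> mvc (gsum n Gs) = (\<Sum>i<n. mvc (Gs i))"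
  using assms
proof (induction n)
  case 0
  have g: "gr ({} :: (nat \<times> 'a) set, {})" by (simp add: gr_def)
  have "min_mdg ({} :: (nat \<times> 'a) set, {}) = 0" using min_mdg_le[of "({}, {})" "[]"] by simp
  moreover have "mvc ({} :: (nat \<times> 'a) set, {}) = 0" using mvc_le[of "({}, {})" "{}"] by (simp add: vertex_cover_def)
  ultimately show ?case using g by (simp add: gsum_0)
next
  case (Suc n)
  have g: "gr (gmap (Pair n) (Gs n))" using Suc.prems by (intro gr_gmap) (auto simp: inj_on_def)
  have d: "fst (gmap (Pair n) (Gs n)) \<inter> fst (gsum n Gs) = {}" by (auto simp: gmap_def gsum_def)
  have IH: "gr (gsum n Gs)" "min_mdg (gsum n Gs) = (\<Sum>i<n. min_mdg (Gs i))" "mvc (gsum n Gs) = (\<Sum>i<n. mvc (Gs i))"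
    using Suc by auto
  have "min_mdg (gmap (Pair n) (Gs n)) = min_mdg (Gs n)" "mvc (gmap (Pair n) (Gs n)) = mvc (Gs n)"
    using Suc.prems by (intro min_mdg_gmap mvc_gmap; auto simp: inj_on_def)+
  then show ?case
    using gr_gun[OF g IH(1)] min_mdg_gun[OF g IH(1) d] mvc_gun[OF g IH(1) d] IH by (simp add: gsum_Suc)
qed

section \<open>Gadgets\<close>

definition mkg :: "'a set \<Rightarrow> ('a \<Rightarrow> 'a \<Rightarrow> bool) \<Rightarrow> 'a graph" where
  "mkg V adj = (V, {{x, y} | x y. x \<in> V \<and> y \<in> V \<and> x \<noteq> y \<and> adj x y})"

lemma fst_mkg[simp]: "fst (mkg V adj) = V" by (simp add: mkg_def)

lemma gr_mkg: "finite V \<Longrightarrow> gr (mkg V adj)"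
  unfolding gr_def mkg_def by auto

lemma edge_mkg: "symp adj \<Longrightarrow> {x, y} \<in> snd (mkg V adj) \<longleftrightarrow> x \<in> V \<and> y \<in> V \<and> x \<noteq> y \<and> adj x y"
  by (auto simp: mkg_def doubleton_eq_iff dest: sympD)

lemma nb_mkg: "symp adj \<Longrightarrow> x \<in> V \<Longrightarrow> nb (mkg V adj) x = {y \<in> V. y \<noteq> x \<and> adj x y}"
  by (auto simp: nb_def edge_mkg)

lemma cover_mkg: "vertex_cover (mkg V adj) C \<longleftrightarrow>
    C \<subseteq> V \<and> (\<forall>x\<in>V. \<forall>y\<in>V. x \<noteq> y \<longrightarrow> adj x y \<longrightarrow> x \<in> C \<or> y \<in> C)"
proof -
  have "(\<forall>e\<in>snd (mkg V adj). e \<inter> C \<noteq> {}) \<longleftrightarrow> (\<forall>x\<in>V. \<forall>y\<in>V. x \<noteq> y \<longrightarrow> adj x y \<longrightarrow> {x, y} \<inter> C \<noteq> {})"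
    unfolding mkg_def snd_conv by blast
  then show ?thesis unfolding vertex_cover_def fst_mkg by simp
qed

lemma gr_mkg_eq: assumes "gr G" shows "G = mkg (fst G) (\<lambda>x y. {x, y} \<in> snd G)"
proof -
  have "snd G = {{x, y} | x y. x \<in> fst G \<and> y \<in> fst G \<and> x \<noteq> y \<and> {x, y} \<in> snd G}"
    using assms unfolding gr_def by blast
  then show ?thesis by (cases G) (simp add: mkg_def)
qed

subsection \<open>Graphs on which the greedy heuristic is bad\<close>

text \<open>The classical example: the cover \<open>{0} \<times> {..<N}\<close> is beaten in degree by the vertices
  \<open>(j, b)\<close> with \<open>j\<close> neighbours each, taken in the order \<open>j = k, \<dots>, 2\<close>.\<close>

definition badV :: "nat \<Rightarrow> nat \<Rightarrow> (nat \<times> nat) set" where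
  "badV k N = {0} \<times> {..<N} \<union> (SIGMA j:{2..k}. {..<N div j})"

definition bad_adj :: "nat \<times> nat \<Rightarrow> nat \<times> nat \<Rightarrow> bool" where
  "bad_adj x y \<longleftrightarrow> (fst x = 0 \<and> fst y \<noteq> 0 \<and> snd y = snd x div fst y) \<or> (fst y = 0 \<and> fst x \<noteq> 0 \<and> snd x = snd y div fst x)"

text \<open>While row 0 is intact, let \<open>j\<close> be the largest class that is not exhausted.
  By divisibility each of its vertices has all its \<open>j\<close> neighbours in row 0, whereas a
  vertex of row 0 has at most one neighbour in each of the classes 2 to \<open>j\<close>, hence
  fewer than \<open>j\<close>. So all classes are taken before row 0 is touched.\<close>

lemma bad_graph_min_mdg:
  assumes "\<And>j. j \<in> {2..k} \<Longrightarrow> j dvd N" "N > 0"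
  shows "(\<Sum>j\<in>{2..k}. N div j) \<le> min_mdg (mkg (badV k N) bad_adj)"
proof -
  let ?G = "mkg (badV k N) bad_adj" let ?R = "SIGMA j:{2..k}. {..<N div j}"
  have sym: "symp bad_adj" by (auto simp: symp_def bad_adj_def)
  have fin: "finite (badV k N)" by (auto simp: badV_def)
  have g: "gr ?G" by (rule gr_mkg[OF fin])
  have L: "badV k N - ?R = {0} \<times> {..<N}" by (auto simp: badV_def)
  have nbL: "nb ?G (0, l) \<subseteq> (\<lambda>j. (j, l div j)) ` {2..k}" if "l < N" for l
    using that by (subst nb_mkg[OF sym]) (auto simp: badV_def bad_adj_def)
  have nbR: "card (nb ?G (j, b)) = j \<and> nb ?G (j, b) \<subseteq> {0} \<times> {..<N}" if jb: "j \<in> {2..k}" "b < N div j" for j b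
  proof -
    have "N = N div j * j" using assms(1)[OF jb(1)] by simp
    have *: "l div j = b \<longleftrightarrow> b * j \<le> l \<and> l < (b + 1) * j" for l
      using jb(1) by (auto simp: div_nat_eqI mult.commute dividend_less_times_div)
    have "(b + 1) * j \<le> N" using jb assms(1)[OF jb(1)] by (metis Suc_eq_plus1 Suc_leI dvd_div_mult_self mult_le_mono1)
    have "nb ?G (j, b) = Pair 0 ` {l. l < N \<and> b = l div j}"
      using jb by (subst nb_mkg[OF sym]) (auto simp: badV_def bad_adj_def)
    also have "{l. l < N \<and> b = l div j} = {b * j..<(b + 1) * j}"
    proof (rule set_eqI)
      fix l
      have "l < N \<and> b = l div j \<longleftrightarrow> b * j \<le> l \<and> l < (b + 1) * j"
        using *[of l] \<open>(b + 1) * j \<le> N\<close> by (metis less_le_trans)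
      then show "l \<in> {l. l < N \<and> b = l div j} \<longleftrightarrow> l \<in> {b * j..<(b + 1) * j}" by simp
    qed
    finally have "nb ?G (j, b) = Pair 0 ` {b * j..<(b + 1) * j}" .
    moreover have "card (Pair (0::nat) ` {b * j..<(b + 1) * j}) = j"
      by (subst card_image) (auto simp: inj_on_def)
    ultimately show ?thesis using \<open>(b + 1) * j \<le> N\<close> by auto
  qed
  have "?R \<subseteq> set vs" if "mdgl ?G vs" for vs
  proof -
    have "?R \<subseteq> {} \<union> set vs"
    proof (rule mdg_forced[OF g])
      show "?R \<subseteq> fst ?G" by (auto simp: badV_def)
      show "(0, 0) \<in> fst ?G - ?R" using assms(2) by (auto simp: badV_def)
      show "mdgl (gdel ?G {}) vs" using that by simp
      fix U v assume U: "U \<subset> ?R" and v: "v \<in> fst ?G - ?R"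
      obtain l where l: "v = (0, l)" "l < N" using v L by auto
      let ?J = "fst ` (?R - U)"
      have J: "finite ?J" "?J \<noteq> {}" using U by (auto intro!: finite_imageI)
      define j where "j = Max ?J"
      have "j \<in> ?J" using Max_in[OF J] by (simp add: j_def)
      then obtain b where jb: "(j, b) \<in> ?R - U" by auto
      have jmax: "i \<le> j" if "(i, c) \<in> ?R - U" for i c 
        unfolding j_def by (rule Max_ge[OF J(1) image_eqI[of _ _ "(i, c)"]]) (use that in auto)
      have "nb ?G v - U \<subseteq> (\<lambda>i. (i, l div i)) ` {2..j}"
      proof
        fix y assume y: "y \<in> nb ?G v - U"
        then obtain i where i: "y = (i, l div i)" "i \<in> {2..k}" using nbL[OF l(2)] l(1) by auto
        have "y \<in> badV k N" using y nb_V[OF g, of v] by auto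
        then have "y \<in> ?R - U" using y i by (auto simp: badV_def)
        then show "y \<in> (\<lambda>i. (i, l div i)) ` {2..j}" using jmax i by auto
      qed
      then have "card (nb ?G v - U) \<le> card ((\<lambda>i. (i, l div i)) ` {2..j})" by (intro card_mono) auto
      also have "\<dots> \<le> card {2..j}" by (rule card_image_le) simp
      also have "\<dots> < j" using jb by auto
      also have "j = card (nb ?G (j, b) - U)"
      proof -
        have "nb ?G (j, b) \<inter> ?R = {}" using nbR[of j b] jb by auto
        then have "nb ?G (j, b) - U = nb ?G (j, b)" using U by blast
        then show ?thesis using nbR[of j b] jb by simp
      qed
      finally show "\<exists>z\<in>?R - U. card (nb ?G v - U) < card (nb ?G z - U)" using jb by blast
    qed auto
    then show ?thesis by simp
  qed
  moreover obtain vs where vs: "mdgl ?G vs" "length vs = min_mdg ?G" using min_mdg_obtain[OF g] .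
  ultimately have "card ?R \<le> card (set vs)" by (intro card_mono) auto
  then show ?thesis using vs card_length[of vs] by simp
qed

text \<open>Oresme's argument: the \<open>2 ^ m\<close> terms after \<open>1 / 2 ^ m\<close> are
  each at least \<open>1 / 2 ^ Suc m\<close>, so they contribute at least one half.\<close>

lemma harmonic_lower: "real m / 2 \<le> (\<Sum>j\<in>{2..2 ^ m}. 1 / real j)"
proof (induction m)
  case (Suc m)
  have "{2..2 ^ Suc m} = {2..2 ^ m} \<union> {2 ^ m + 1..2 ^ Suc m :: nat}" if "m > 0"
    using that self_le_power[of "2 :: nat" m] by auto
  moreover have "{2..2 ^ Suc 0} = {2..2 ^ 0} \<union> {2 ^ 0 + 1..2 ^ Suc 0 :: nat}" by auto
  ultimately have "{2..2 ^ Suc m} = {2..2 ^ m} \<union> {2 ^ m + 1..2 ^ Suc m :: nat}" by (cases m) auto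
  then have "(\<Sum>j\<in>{2..2 ^ Suc m}. 1 / real j) = (\<Sum>j\<in>{2..2 ^ m}. 1 / real j) + (\<Sum>j\<in>{2 ^ m + 1..2 ^ Suc m}. 1 / real j)"
    by (simp only:) (rule sum.union_disjoint, auto)
  moreover have "(\<Sum>j\<in>{2 ^ m + 1..2 ^ Suc m :: nat}. 1 / real j) \<ge> (\<Sum>j\<in>{2 ^ m + 1..2 ^ Suc m :: nat}. 1 / 2 ^ Suc m)"
    by (intro sum_mono divide_left_mono) (auto simp flip: of_nat_le_iff[where 'a = real])
  moreover have "(\<Sum>j\<in>{2 ^ m + 1..2 ^ Suc m :: nat}. 1 / 2 ^ Suc m :: real) = 1 / 2" by simp
  ultimately show ?case using Suc by simp
qed simp

lemma bad_graph_exists: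
  assumes "q > 0"
  obtains B :: "nat graph" and n where "is_graph B" "fst B = {..<n}" "p * mvc B < q * min_mdg B"
proof -
  \<comment> \<open>The exponent makes the harmonic sum at least \<open>p + 1\<close>, so greedy
    takes \<open>(p + 1) * N\<close> vertices against a cover of size \<open>N\<close>. The
    factorial is a number divisible by every \<open>j\<close> up to \<open>k\<close>.\<close>
  define k :: nat where "k = 2 ^ (2 * p + 2)"
  define N :: nat where "N = fact k"
  let ?G = "mkg (badV k N) bad_adj"
  have N: "N > 0" "\<And>j. j \<in> {2..k} \<Longrightarrow> j dvd N" by (auto simp: N_def dvd_fact)
  have sym: "symp bad_adj" by (auto simp: symp_def bad_adj_def)
  have fin: "finite (badV k N)" by (auto simp: badV_def)
  have g: "gr ?G" by (rule gr_mkg[OF fin])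
  have "vertex_cover ?G ({0} \<times> {..<N})" by (auto simp: cover_mkg badV_def bad_adj_def)
  then have mvc: "mvc ?G \<le> N" using mvc_le by fastforce
  have "real (2 * p + 2) / 2 * real N \<le> (\<Sum>j\<in>{2..k}. 1 / real j) * real N"
    unfolding k_def by (intro mult_right_mono harmonic_lower) simp
  also have "\<dots> = (\<Sum>j\<in>{2..k}. real (N div j))"
    unfolding sum_distrib_right using N(2) by (intro sum.cong refl) (simp add: real_of_nat_div)
  also have "\<dots> \<le> real (min_mdg ?G)"
    using bad_graph_min_mdg[OF N(2,1)] by (metis of_nat_le_iff of_nat_sum)
  finally have "(p + 1) * N \<le> min_mdg ?G" by (simp flip: of_nat_le_iff[where 'a = real]) (simp add: algebra_simps)
  then have "p * mvc ?G < min_mdg ?G" using mvc N(1) by (metis (no_types, lifting) add.commute add_less_le_mono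
        le_less_trans less_add_same_cancel2 less_le_trans mult.commute mult_Suc_right mult_le_mono2 Suc_eq_plus1)
  then have r: "p * mvc ?G < q * min_mdg ?G" using assms by (metis One_nat_def Suc_leI less_le_trans mult_1 mult_le_mono1)
  obtain f where f: "bij_betw f (badV k N) {..<card (badV k N)}"
    using ex_bij_betw_finite_nat[OF fin] by (auto simp: atLeast0LessThan)
  have inj: "inj_on f (fst ?G)" using f by (simp add: bij_betw_def)
  show ?thesis
  proof (rule that)
    show "fst (gmap f ?G) = {..<card (badV k N)}" using f by (simp add: gmap_def bij_betw_def)
    have "badV k N \<noteq> {}" using N(1) by (auto simp: badV_def)
    then show "is_graph (gmap f ?G)" using gr_gmap[OF g inj] by (auto simp: is_graph_gr gmap_def)
    show "p * mvc (gmap f ?G) < q * min_mdg (gmap f ?G)" using r by (simp add: mvc_gmap[OF g inj] min_mdg_gmap[OF g inj])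
  qed
qed

subsection \<open>Forcing the heuristic to take given neighbours\<close>

definition zV :: "'a set \<Rightarrow> 'a set \<Rightarrow> nat \<Rightarrow> (nat \<times> 'a \<times> nat) set" where
  "zV V S D = {0} \<times> V \<times> {0} \<union> {1} \<times> S \<times> {0} \<union> {2} \<times> S \<times> {..<D} \<union> {3} \<times> S \<times> {..<D}"

text \<open>Every \<open>v \<in> S\<close> gets a neighbour \<open>(1, v, 0)\<close> which in turn has \<open>D\<close> paths of length two
  attached. The high degree forces the heuristic to take \<open>(1, v, 0)\<close>, while in a minimum
  vertex cover \<open>(1, v, 0)\<close> costs 1 and can be replaced by \<open>v\<close>.\<close>

definition zadj :: "('a \<Rightarrow> 'a \<Rightarrow> bool) \<Rightarrow> nat \<times> 'a \<times> nat \<Rightarrow> nat \<times> 'a \<times> nat \<Rightarrow> bool" where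
  "zadj E x y \<longleftrightarrow> (fst x = 0 \<and> fst y = 0 \<and> E (fst (snd x)) (fst (snd y))) \<or>
     (fst (snd x) = fst (snd y) \<and>
       ((fst x = 0 \<and> fst y = 1) \<or> (fst x = 1 \<and> fst y = 0) \<or> (fst x = 1 \<and> fst y = 2) \<or> (fst x = 2 \<and> fst y = 1) \<or>
        (snd (snd x) = snd (snd y) \<and> ((fst x = 2 \<and> fst y = 3) \<or> (fst x = 3 \<and> fst y = 2)))))"

lemma symp_zadj: "symp E \<Longrightarrow> symp (zadj E)"
  unfolding symp_def zadj_def by metis

text \<open>While an edge remains, the chosen vertex has positive degree, so each choice destroys an
  edge.\<close>

lemma length_mdgl_le: "mdgl G vs \<Longrightarrow> gr G \<Longrightarrow> length vs \<le> card (snd G)"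
proof (induction vs arbitrary: G)
  case (Cons v vs)
  have "length vs \<le> card (snd (delete_vertex G v))"
    by (rule Cons.IH) (use Cons.prems gr_delete[OF Cons.prems(2)] in auto)
  moreover have "card (snd (delete_vertex G v)) < card (snd G)"
  proof (rule psubset_card_mono)
    show "finite (snd G)" using gr_finite_edges Cons.prems by blast
    obtain e where e: "e \<in> snd G" using Cons.prems by auto
    obtain a b where ab: "e = {a, b}" "a \<in> fst G" using gr_edgeE[OF Cons.prems(2) e] by metis
    have "degree_in G a > 0" using e ab gr_finite_edges[OF Cons.prems(2)] by (auto simp: degree_in_def card_gt_0_iff)
    then have "degree_in G v > 0" using Cons.prems(1) ab(2) by fastforce
    then obtain e' where "e' \<in> snd G" "v \<in> e'" unfolding degree_in_def by (metis (mono_tags, lifting) card.empty empty_Collect_eq less_numeral_extra(3))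
    then show "snd (delete_vertex G v) \<subset> snd G" by (auto simp: delete_vertex_def)
  qed
  ultimately show ?case by simp
qed simp

text \<open>All remaining vertices of \<open>Z\<close> stay of maximum degree whatever part of
  \<open>Z\<close> has been taken, so \<open>Z\<close> can be taken in any order ahead of a run on
  the rest.\<close>

lemma mdg_prefix:
  assumes "gr G" "Z \<subseteq> fst G"
    and "\<And>U z u. U \<subseteq> Z \<Longrightarrow> z \<in> Z - U \<Longrightarrow> u \<in> fst G - U \<Longrightarrow> card (nb G u - U) \<le> card (nb G z - U)"
    and "\<And>U z. U \<subseteq> Z \<Longrightarrow> z \<in> Z - U \<Longrightarrow> nb G z - U \<noteq> {}"
    and "mdgl (gdel G Z) us"
  shows "distinct zs \<Longrightarrow> U \<subseteq> Z \<Longrightarrow> set zs = Z - U \<Longrightarrow> mdgl (gdel G U) (zs @ us)"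
proof (induction zs arbitrary: U)
  case Nil then show ?case using assms(5) by (metis Diff_eq_empty_iff append_Nil list.set(1) subset_antisym)
next
  case (Cons z zs)
  have z: "z \<in> Z - U" using Cons.prems by auto
  have "mdgl (gdel G (insert z U)) (zs @ us)" using Cons by (intro Cons.IH) auto
  moreover obtain y where "y \<in> nb G z - U" using assms(4)[OF Cons.prems(2) z] by blast
  then have "{z, y} \<in> snd (gdel G U)" using z by (auto simp: nb_def gdel_def)
  ultimately show ?case using assms(2) assms(3)[OF Cons.prems(2) z] z
    by (auto simp: mdgl_gdel_Cons[OF assms(1)] simp del: mdgl.simps)
qed

context
  fixes G :: "'a graph" and S :: "'a set" and D :: nat
  assumes gG: "gr G" and SV: "S \<subseteq> fst G" and D2: "D \<ge> 2"
begin

private abbreviation "EE \<equiv> \<lambda>x y. {x, y} \<in> snd G"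
private abbreviation "ZG \<equiv> mkg (zV (fst G) S D) (zadj EE)"
private abbreviation "ZZ \<equiv> {1} \<times> S \<times> {0} :: (nat \<times> 'a \<times> nat) set"

private lemma symZ: "symp (zadj EE)" by (rule symp_zadj) (auto simp: symp_def insert_commute)

private lemma finS: "finite S" "finite (fst G)" using gG SV finite_subset by (auto simp: gr_def)

private lemma finZ: "finite (zV (fst G) S D)" using finS by (simp add: zV_def)

lemma gr_Z: "gr ZG" by (rule gr_mkg[OF finZ])

text \<open>The outer edges of the pendant paths form a matching that costs \<open>D\<close> per
  vertex of \<open>S\<close>. What else lies in the cover includes a cover of \<open>G\<close> and
  the gadget vertices, and the link between \<open>v\<close> and its gadget forces one of its two
  ends.\<close>

lemma Z_cover_split:
  assumes "vertex_cover ZG X"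
  obtains C where "vertex_cover G C" "C = {v. (0, v, 0) \<in> X}"
    "card S * D + card C + card {v \<in> S. (1, v, 0) \<in> X} \<le> card X" "\<And>v. v \<in> S \<Longrightarrow> v \<in> C \<or> (1, v, 0) \<in> X"
proof -
  define C where "C = {v. (0::nat, v, 0::nat) \<in> X}"
  let ?T = "{v \<in> S. (1, v, 0) \<in> X}"
  have X: "X \<subseteq> zV (fst G) S D" "\<And>x y. x \<in> zV (fst G) S D \<Longrightarrow> y \<in> zV (fst G) S D \<Longrightarrow> x \<noteq> y \<Longrightarrow> zadj EE x y \<Longrightarrow> x \<in> X \<or> y \<in> X"
    using assms unfolding cover_mkg by blast+
  have CV: "C \<subseteq> fst G" using X(1) by (auto simp: C_def zV_def)
  have c1: "vertex_cover G C"
    unfolding vertex_cover_def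
  proof (intro conjI ballI)
    show "C \<subseteq> fst G" by (rule CV)
    fix e assume e: "e \<in> snd G"
    obtain u v where uv: "e = {u, v}" "u \<in> fst G" "v \<in> fst G" "u \<noteq> v" using gr_edgeE[OF gG e] .
    have "(0, u, 0) \<in> X \<or> (0, v, 0) \<in> X" by (rule X(2)) (use uv e in \<open>auto simp: zV_def zadj_def\<close>)
    then show "e \<inter> C \<noteq> {}" using uv by (auto simp: C_def)
  qed
  have c3: "v \<in> C \<or> (1, v, 0) \<in> X" if "v \<in> S" for v
    using X(2)[of "(0, v, 0)" "(1, v, 0)"] that SV by (auto simp: zV_def zadj_def C_def)
  \<comment> \<open>Picks for each pendant path an end of its outer edge that lies in
    \<open>X\<close>.\<close>
  define h where "h = (\<lambda>(v, i). if (2::nat, v, i) \<in> X then (2::nat, v, i) else (3, v, i))"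
  have "h (v, i) \<in> X" if "v \<in> S" "i < D" for v i
  proof -
    have "(2, v, i) \<in> X \<or> (3, v, i) \<in> X" by (rule X(2)) (use that in \<open>auto simp: zV_def zadj_def\<close>)
    then show ?thesis by (auto simp: h_def)
  qed
  then have hX: "h ` (S \<times> {..<D}) \<subseteq> X" by auto
  have injh: "inj_on h (S \<times> {..<D})" by (auto simp: inj_on_def h_def split: if_splits)
  let ?A = "h ` (S \<times> {..<D})" and ?B = "(\<lambda>v. (0::nat, v, 0::nat)) ` C" and ?E = "(\<lambda>v. (1::nat, v, 0::nat)) ` ?T"
  have fX: "finite X" using X(1) finZ finite_subset by blast
  have sub: "?A \<union> (?B \<union> ?E) \<subseteq> X" using hX by (auto simp: C_def)
  have f: "finite ?A" "finite ?B" "finite ?E" using sub fX by (meson finite_Un finite_subset)+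
  have d: "?A \<inter> (?B \<union> ?E) = {}" "?B \<inter> ?E = {}" by (auto simp: h_def split: if_splits)
  have "card (?A \<union> (?B \<union> ?E)) = card ?A + (card ?B + card ?E)"
    using f d by (simp add: card_Un_disjoint del: Un_iff)
  moreover have "card ?A = card S * D" using injh finS by (simp add: card_image card_cartesian_product)
  moreover have "card ?B = card C" "card ?E = card ?T" by (auto intro!: card_image simp: inj_on_def)
  ultimately have c2: "card S * D + card C + card ?T \<le> card X"
    using card_mono[OF fX sub] by simp
  show thesis by (rule that[OF c1 C_def c2 c3])
qed

text \<open>The middle vertices of the paths cover everything at \<open>(1, v, 0)\<close> except the
  link to \<open>v\<close>; so the gadget vertex is paid for only where \<open>v\<close> is missing
  from \<open>C\<close>.\<close>

lemma Z_mvc_le: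
  assumes "vertex_cover G C" shows "mvc ZG \<le> card S * D + card C + card (S - C)"
proof -
  let ?X = "{0} \<times> C \<times> {0} \<union> ({1} \<times> (S - C) \<times> {0} \<union> {2} \<times> S \<times> {..<D}) :: (nat \<times> 'a \<times> nat) set"
  have C: "C \<subseteq> fst G" "\<And>u v. {u, v} \<in> snd G \<Longrightarrow> u \<in> C \<or> v \<in> C" using assms by (auto simp: vertex_cover_def)
  have "vertex_cover ZG ?X" unfolding cover_mkg
  proof (intro conjI ballI impI)
    show "?X \<subseteq> zV (fst G) S D" using C(1) by (auto simp: zV_def)
    fix x y assume xy: "x \<in> zV (fst G) S D" "y \<in> zV (fst G) S D" "zadj EE x y"
    obtain a v i b w j where e: "x = (a, v, i)" "y = (b, w, j)" by (metis prod.exhaust)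
    show "x \<in> ?X \<or> y \<in> ?X" using xy C(2)[of v w] unfolding e by (auto simp: zV_def zadj_def)
  qed
  then have "mvc ZG \<le> card ?X" by (rule mvc_le)
  also have "\<dots> \<le> card ({0::nat} \<times> C \<times> {0::nat}) + (card ({1::nat} \<times> (S - C) \<times> {0::nat}) + card ({2::nat} \<times> S \<times> {..<D}))"
    by (intro order_trans[OF card_Un_le] add_mono order_refl card_Un_le)
  finally show ?thesis by (simp add: card_cartesian_product)
qed

text \<open>The gadget vertices are pairwise nonadjacent and have degree \<open>D + 1\<close>; by
  \<open>deg\<close> every other vertex has degree at most \<open>D\<close>. So all of them are
  taken, even beside a cover of \<open>G\<close>, and they can be taken first. What then remains is
  \<open>G\<close>, where greedy is optimal by \<open>opt\<close>, and \<open>card S * D\<close>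
  isolated edges.\<close>

lemma Z_min_mdg:
  assumes deg: "\<And>v. v \<in> fst G \<Longrightarrow> card (nb G v) < D" and S: "S \<noteq> {}" and opt: "min_mdg G = mvc G"
  shows "min_mdg ZG = card S * (D + 1) + mvc G"
proof -
  have fV[simp]: "fst ZG = zV (fst G) S D" by simp
  have nbz: "nb ZG (1, v, 0) = insert (0, v, 0) ((\<lambda>i. (2, v, i)) ` {..<D})" if "v \<in> S" for v
    using that SV by (subst nb_mkg[OF symZ]) (auto simp: zV_def zadj_def)
  have cz: "card (nb ZG (1, v, 0) - U) = D + 1" if "v \<in> S" "U \<subseteq> ZZ" for v U
  proof -
    have "nb ZG (1, v, 0) - U = nb ZG (1, v, 0)" unfolding nbz[OF that(1)] using that(2) by auto
    also have "card \<dots> = D + 1" unfolding nbz[OF that(1)] by (subst card_insert_disjoint) (auto simp: card_image inj_on_def)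
    finally show ?thesis .
  qed
  have co: "card (nb ZG x - U) < D + 1" if x: "x \<in> zV (fst G) S D - ZZ" for x U
  proof -
    have fin: "finite (nb ZG x)" by (rule finite_nb[OF gr_Z])
    have "card (nb ZG x) < D + 1"
    proof -
      consider v where "x = (0, v, 0)" "v \<in> fst G" | v i where "x = (2, v, i)" "v \<in> S" "i < D" | v i where "x = (3, v, i)" "v \<in> S" "i < D"
        using x by (auto simp: zV_def)
      then show ?thesis
      proof cases
        case 1
        have "nb ZG x \<subseteq> insert (1, v, 0) ((\<lambda>u. (0, u, 0)) ` nb G v)"
          using x unfolding 1 by (subst nb_mkg[OF symZ]) (auto simp: zV_def zadj_def nb_def)
        then have "card (nb ZG x) \<le> card (insert (1::nat, v, 0::nat) ((\<lambda>u. (0, u, 0)) ` nb G v))"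
          by (intro card_mono) (auto simp: finite_nb[OF gG])
        also have "\<dots> \<le> Suc (card ((\<lambda>u. (0::nat, u, 0::nat)) ` nb G v))" by (rule card_insert_le_m1) auto
        also have "\<dots> \<le> Suc (card (nb G v))" by (simp add: card_image_le finite_nb[OF gG])
        finally show ?thesis using deg[OF 1(2)] by simp
      next
        case 2
        have "nb ZG x \<subseteq> {(1, v, 0), (3, v, i)}"
          using x unfolding 2 by (subst nb_mkg[OF symZ]) (auto simp: zV_def zadj_def)
        then have "card (nb ZG x) \<le> card {(1::nat, v, 0::nat), (3, v, i)}" by (intro card_mono) auto
        then show ?thesis using D2 by (auto simp: card_insert_if split: if_splits)
      next
        case 3
        have "nb ZG x \<subseteq> {(2, v, i)}"
          using x unfolding 3 by (subst nb_mkg[OF symZ]) (auto simp: zV_def zadj_def)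
        then have "card (nb ZG x) \<le> card {(2::nat, v, i)}" by (intro card_mono) auto
        then show ?thesis using D2 by simp
      qed
    qed
    then show ?thesis using card_mono[OF fin Diff_subset[of _ U]] by linarith
  qed
  have ZV: "ZZ \<subseteq> fst ZG" by (auto simp: zV_def)
  obtain s where s: "s \<in> S" using S by blast
  show ?thesis
  proof (rule antisym)
    obtain vs where vs: "mdgl ZG vs" "length vs = min_mdg ZG" using min_mdg_obtain[OF gr_Z] .
    have "ZZ \<subseteq> {} \<union> set vs"
    proof (rule mdg_forced[OF gr_Z ZV])
      show "(0, s, 0) \<in> fst ZG - ZZ" using s SV by (auto simp: zV_def)
      show "mdgl (gdel ZG {}) vs" using vs by simp
      fix U v assume U: "U \<subset> ZZ" and v: "v \<in> fst ZG - ZZ"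
      then obtain z where z: "(1, z, 0) \<in> ZZ - U" by auto
      then have "card (nb ZG v - U) < card (nb ZG (1, z, 0) - U)" using co[of v U] cz[of z U] U v by auto
      then show "\<exists>z\<in>ZZ - U. card (nb ZG v - U) < card (nb ZG z - U)" using z by blast
    qed auto
    then have e: "{v \<in> S. (1, v, 0) \<in> set vs} = S" by auto
    obtain C where "vertex_cover G C" 
      "card S * D + card C + card {v \<in> S. (1, v, 0) \<in> set vs} \<le> card (set vs)"
      by (rule Z_cover_split[OF mdgl_cover[OF vs(1)]]) (rule that)
    then show "card S * (D + 1) + mvc G \<le> min_mdg ZG"
      using mvc_le[of G C] vs(2) card_length[of vs] unfolding e by (simp add: algebra_simps)
  next
    let ?b = "\<lambda>v. (0::nat, v, 0::nat)"
    \<comment> \<open>The outer edges of the pendant paths, isolated once the gadget vertices are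
      gone.\<close>
    let ?P = "mkg ({2} \<times> S \<times> {..<D} \<union> {3} \<times> S \<times> {..<D}) (zadj EE)"
    have inj: "inj_on ?b (fst G)" by (auto simp: inj_on_def)
    have gP: "gr ?P" by (rule gr_mkg) (use finS in auto)
    have gb: "gr (gmap ?b G)" by (rule gr_gmap[OF gG inj])
    have "gdel ZG ZZ = gun (gmap ?b G) ?P"
    proof -
      have "{e \<in> snd ZG. e \<inter> ZZ = {}} = snd (gmap ?b G) \<union> snd ?P" (is "?l = ?r")
      proof
        show "?l \<subseteq> ?r"
        proof
          fix e assume e: "e \<in> ?l"
          then obtain x y where xy: "e = {x, y}" "x \<in> zV (fst G) S D" "y \<in> zV (fst G) S D" "x \<noteq> y" "zadj EE x y"
            by (auto simp: mkg_def)
          obtain a v i b w j where q: "x = (a, v, i)" "y = (b, w, j)" by (metis prod.exhaust)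
          have n: "x \<notin> ZZ" "y \<notin> ZZ" using e xy by auto
          show "e \<in> ?r"
          proof (cases "a = 0 \<and> b = 0")
            case True
            then have "{v, w} \<in> snd G" "i = 0" "j = 0" using xy q by (auto simp: zV_def zadj_def)
            then have "e \<in> snd (gmap ?b G)" using True xy(1) q by (auto simp: gmap_def image_iff intro!: bexI[of _ "{v, w}"])
            then show ?thesis by simp
          next
            case False
            then have "x \<in> {2} \<times> S \<times> {..<D} \<union> {3} \<times> S \<times> {..<D}" "y \<in> {2} \<times> S \<times> {..<D} \<union> {3} \<times> S \<times> {..<D}"
              using xy q n by (auto simp: zV_def zadj_def)
            then have "e \<in> snd ?P" using xy edge_mkg[OF symZ] by metis
            then show ?thesis by simp
          qed
        qed
        show "?r \<subseteq> ?l"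
        proof
          fix e assume "e \<in> ?r"
          then show "e \<in> ?l"
          proof
            assume "e \<in> snd (gmap ?b G)"
            then obtain e' where e': "e' \<in> snd G" "e = ?b ` e'" by (auto simp: gmap_def)
            obtain u v where uv: "e' = {u, v}" "u \<in> fst G" "v \<in> fst G" "u \<noteq> v" using gr_edgeE[OF gG e'(1)] .
            then have "{?b u, ?b v} \<in> snd ZG" using e' unfolding edge_mkg[OF symZ] by (auto simp: zV_def zadj_def)
            then show ?thesis using e' uv by auto
          next
            assume "e \<in> snd ?P"
            then obtain x y where xy: "e = {x, y}" "x \<noteq> y" "zadj EE x y" "x \<in> {2} \<times> S \<times> {..<D} \<union> {3} \<times> S \<times> {..<D}"
              "y \<in> {2} \<times> S \<times> {..<D} \<union> {3} \<times> S \<times> {..<D}" by (auto simp: mkg_def)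
            then have "{x, y} \<in> snd ZG" unfolding edge_mkg[OF symZ] by (auto simp: zV_def)
            then show ?thesis using xy by auto
          qed
        qed
      qed
      moreover have "zV (fst G) S D - ZZ = ?b ` fst G \<union> ({2} \<times> S \<times> {..<D} \<union> {3} \<times> S \<times> {..<D})"
        by (auto simp: zV_def)
      ultimately show ?thesis unfolding gdel_def gun_def fst_mkg by (simp add: gmap_def)
    qed
    moreover have dis: "fst (gmap ?b G) \<inter> fst ?P = {}" by (auto simp: gmap_def)
    ultimately have mG: "min_mdg (gdel ZG ZZ) = mvc G + min_mdg ?P"
      using min_mdg_gun[OF gb gP dis] min_mdg_gmap[OF gG inj] opt by simp
    have "snd ?P \<subseteq> (\<lambda>(v, i). {(2, v, i), (3, v, i)}) ` (S \<times> {..<D})"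
    proof
      fix e assume "e \<in> snd ?P"
      then obtain x y where "e = {x, y}" "x \<noteq> y" "zadj EE x y" "x \<in> {2} \<times> S \<times> {..<D} \<union> {3} \<times> S \<times> {..<D}"
          "y \<in> {2} \<times> S \<times> {..<D} \<union> {3} \<times> S \<times> {..<D}" by (auto simp: mkg_def)
      then show "e \<in> (\<lambda>(v, i). {(2, v, i), (3, v, i)}) ` (S \<times> {..<D})"
        by (auto simp: zadj_def image_iff insert_commute) blast+
    qed
    then have "card (snd ?P) \<le> card ((\<lambda>(v, i). {(2::nat, v, i), (3, v, i)}) ` (S \<times> {..<D}))"
      using finS by (intro card_mono) auto
    also have "\<dots> \<le> card (S \<times> {..<D})" using finS by (intro card_image_le) auto
    finally have "card (snd ?P) \<le> card S * D" by (simp add: card_cartesian_product)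
    moreover obtain ps where "mdgl ?P ps" "length ps = min_mdg ?P" by (rule min_mdg_obtain[OF gP])
    ultimately have mP: "min_mdg ?P \<le> card S * D" using length_mdgl_le[OF _ gP, of ps] by simp
    obtain us where us: "mdgl (gdel ZG ZZ) us" "length us = min_mdg (gdel ZG ZZ)"
      using min_mdg_obtain[OF gr_gdel[OF gr_Z]] .
    obtain zs where zs: "set zs = ZZ" "distinct zs" using finite_distinct_list[of ZZ] finS by auto
    have "mdgl (gdel ZG {}) (zs @ us)"
    proof (rule mdg_prefix[OF gr_Z ZV _ _ us(1) zs(2)])
      fix U z u assume U: "U \<subseteq> ZZ" and z: "z \<in> ZZ - U" and u: "u \<in> fst ZG - U"
      have "card (nb ZG z - U) = D + 1" using z cz U by auto
      moreover have "card (nb ZG u - U) \<le> D + 1"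
      proof (cases "u \<in> ZZ")
        case True then show ?thesis using cz U by auto
      next
        case False then show ?thesis using co[of u U] u by (simp add: less_imp_le)
      qed
      ultimately show "card (nb ZG u - U) \<le> card (nb ZG z - U)" by simp
    next
      fix U z assume "U \<subseteq> ZZ" "z \<in> ZZ - U"
      then have "card (nb ZG z - U) = D + 1" using cz by auto
      then show "nb ZG z - U \<noteq> {}" by (metis Suc_eq_plus1 card.empty nat.distinct(1))
    qed (use zs in auto)
    then have "min_mdg ZG \<le> length zs + length us" using min_mdg_le by fastforce
    moreover have "length zs = card S" using zs distinct_card[OF zs(2)] by (simp add: card_cartesian_product)
    ultimately show "min_mdg ZG \<le> card S * (D + 1) + mvc G" using us(2) mG mP by (simp add: algebra_simps)
  qed
qed

end

subsection \<open>Graphs of constraint satisfaction problems\<close>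

text \<open>A vertex \<open>(0, v, a, cv, i)\<close> stands for a copy of the assignment of \<open>a\<close> to the variable
  \<open>v\<close>; the copies for \<open>v\<close> form a complete multipartite graph. A vertex \<open>(1, v0, a0, cv, 0)\<close>
  stands for a partial assignment \<open>snd cv\<close> that satisfies the constraint \<open>fst cv\<close>.\<close>

definition conf :: "'v \<Rightarrow> 'a \<Rightarrow> 'c \<times> ('v \<times> 'a) list \<Rightarrow> bool" where
  "conf v a cv \<longleftrightarrow> (\<exists>z\<in>set (snd cv). fst z = v \<and> snd z \<noteq> a)"

text \<open>The \<open>cv\<close> inside a copy of a value names the only constraint vertex it may
  be joined to, and among the copies naming \<open>cv\<close> only number 0 is used. So a copy has
  at most one neighbour of this kind, and it has one iff its value contradicts
  \<open>cv\<close>.\<close>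

definition bcross where
  "bcross x y \<longleftrightarrow> fst x = (0::nat) \<and> fst y = (1::nat) \<and> snd (snd (snd (snd x))) = (0::nat) \<and>
     fst (snd (snd (snd x))) = fst (snd (snd (snd y))) \<and>
     conf (fst (snd x)) (fst (snd (snd x))) (fst (snd (snd (snd x))))"

definition badj :: "nat \<times> 'v \<times> 'a \<times> ('c \<times> ('v \<times> 'a) list) \<times> nat \<Rightarrow>
    nat \<times> 'v \<times> 'a \<times> ('c \<times> ('v \<times> 'a) list) \<times> nat \<Rightarrow> bool" where
  "badj x y \<longleftrightarrow> (fst x = 0 \<and> fst y = 0 \<and> fst (snd x) = fst (snd y) \<and> fst (snd (snd x)) \<noteq> fst (snd (snd y))) \<or>
     (fst x = 1 \<and> fst y = 1 \<and> fst (fst (snd (snd (snd x)))) = fst (fst (snd (snd (snd y)))) \<and>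
        fst (snd (snd (snd x))) \<noteq> fst (snd (snd (snd y)))) \<or>
     bcross x y \<or> bcross y x"

lemma badj_simps:
  "badj (0, v, a, cv, i) (0, w, b, cw, j) \<longleftrightarrow> v = w \<and> a \<noteq> b"
  "badj (0, v, a, cv, i) (Suc 0, w, b, cw, j) \<longleftrightarrow> i = 0 \<and> cv = cw \<and> conf v a cv"
  "badj (Suc 0, w, b, cw, j) (0, v, a, cv, i) \<longleftrightarrow> i = 0 \<and> cv = cw \<and> conf v a cv"
  "badj (Suc 0, v, a, cv, i) (Suc 0, w, b, cw, j) \<longleftrightarrow> fst cv = fst cw \<and> cv \<noteq> cw"
  by (auto simp: badj_def bcross_def)

lemma symp_badj: "symp badj"
  unfolding symp_def badj_def by metis

definition satcv :: "('v \<Rightarrow> 'a) \<Rightarrow> 'c \<times> ('v \<times> 'a) list \<Rightarrow> bool" where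
  "satcv \<sigma> cv \<longleftrightarrow> (\<forall>z\<in>set (snd cv). \<sigma> (fst z) = snd z)"

text \<open>The first component of an element of \<open>CV\<close> identifies a constraint, the
  second one of its satisfying tuples. By \<open>same\<close>, an assignment satisfies at most one
  element per identifier. \<open>dummy\<close> supplies copies with a constraint neighbour for every
  value, and \<open>nbig\<close> makes the copies outweigh the degrees of constraint vertices.
  \<open>v0\<close> and \<open>a0\<close> fill the fields that constraint vertices do not
  use.\<close>

locale csp =
  fixes Vs :: "'v set" and dom :: "'v \<Rightarrow> 'a set" and CV :: "('c \<times> ('v \<times> 'a) list) set" and n :: nat
    and v0 :: 'v and a0 :: 'a
  assumes finVs: "finite Vs" and findom: "\<And>v. v \<in> Vs \<Longrightarrow> finite (dom v)" and domne: "\<And>v. v \<in> Vs \<Longrightarrow> dom v \<noteq> {}"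
    and finCV: "finite CV" and CVne: "CV \<noteq> {}" and Vsne: "Vs \<noteq> {}"
    and same: "\<And>cv cv'. cv \<in> CV \<Longrightarrow> cv' \<in> CV \<Longrightarrow> fst cv = fst cv' \<Longrightarrow> map fst (snd cv) = map fst (snd cv')"
    and dummy: "\<And>v. v \<in> Vs \<Longrightarrow> \<exists>cv\<in>CV. \<forall>a. conf v a cv"
    and scope: "\<And>cv. cv \<in> CV \<Longrightarrow> fst ` set (snd cv) \<subseteq> Vs"
    and nbig: "(\<Sum>v\<in>Vs. card (dom v)) < n"
begin

section \<open>Assignments and vertex covers of the constraint graph\<close>

definition part :: "'v \<Rightarrow> 'a \<Rightarrow> (nat \<times> 'v \<times> 'a \<times> ('c \<times> ('v \<times> 'a) list) \<times> nat) set" where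
  "part v a = {0} \<times> {v} \<times> {a} \<times> CV \<times> {..<n}"

definition cvx :: "'c \<times> ('v \<times> 'a) list \<Rightarrow> nat \<times> 'v \<times> 'a \<times> ('c \<times> ('v \<times> 'a) list) \<times> nat" where
  "cvx cv = (1, v0, a0, cv, 0)"

definition bV :: "(nat \<times> 'v \<times> 'a \<times> ('c \<times> ('v \<times> 'a) list) \<times> nat) set" where
  "bV = {0} \<times> (SIGMA v:Vs. dom v \<times> CV \<times> {..<n}) \<union> cvx ` CV"

abbreviation "BG \<equiv> mkg bV badj"
abbreviation "K \<equiv> card CV * n"

definition valid :: "('v \<Rightarrow> 'a) \<Rightarrow> bool" where "valid \<sigma> \<longleftrightarrow> (\<forall>v\<in>Vs. \<sigma> v \<in> dom v)"

definition Sat :: "('v \<Rightarrow> 'a) \<Rightarrow> ('c \<times> ('v \<times> 'a) list) set" where "Sat \<sigma> = {cv \<in> CV. satcv \<sigma> cv}"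

text \<open>The common cost of all valid assignments: all \<open>K\<close> copies of every value not
  chosen.\<close>

definition W0 :: nat where "W0 = (\<Sum>v\<in>Vs. (card (dom v) - 1) * K)"

definition nonp :: "('v \<Rightarrow> 'a) \<Rightarrow> (nat \<times> 'v \<times> 'a \<times> ('c \<times> ('v \<times> 'a) list) \<times> nat) set" where
  "nonp \<sigma> = {0} \<times> (SIGMA v:Vs. (dom v - {\<sigma> v}) \<times> CV \<times> {..<n})"

definition cov :: "('v \<Rightarrow> 'a) \<Rightarrow> (nat \<times> 'v \<times> 'a \<times> ('c \<times> ('v \<times> 'a) list) \<times> nat) set" where
  "cov \<sigma> = nonp \<sigma> \<union> cvx ` {cv \<in> CV. \<not> satcv \<sigma> cv}"

lemma nonpE:
  assumes "x \<in> nonp \<sigma>"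
  obtains v a cv i where "x = (0, v, a, cv, i)" "v \<in> Vs" "a \<in> dom v" "a \<noteq> \<sigma> v" "cv \<in> CV" "i < n"
proof -
  obtain t v a cv i where "x = (t, v, a, cv, i)" by (rule prod_cases5)
  then show thesis using assms that[of v a cv i] by (simp add: nonp_def)
qed

lemma bV0E:
  assumes "x \<in> bV" "x \<notin> cvx ` CV"
  obtains v a cv i where "x = (0, v, a, cv, i)" "v \<in> Vs" "a \<in> dom v" "cv \<in> CV" "i < n"
proof -
  obtain t v a cv i where "x = (t, v, a, cv, i)" by (rule prod_cases5)
  then show thesis using assms that[of v a cv i] by (simp add: bV_def)
qed

lemma finite_bV: "finite bV" using finVs findom finCV by (auto simp: bV_def)

lemma gr_BG: "gr BG" by (rule gr_mkg[OF finite_bV])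

lemma card_part: "card (part v a) = K" by (simp add: part_def card_cartesian_product)

lemma finite_part: "finite (part v a)" using finCV by (simp add: part_def)

lemma n2: "n \<ge> 2"
proof -
  obtain v where v: "v \<in> Vs" using Vsne by blast
  have "0 < card (dom v)" using findom[OF v] domne[OF v] by (simp add: card_gt_0_iff)
  also have "card (dom v) \<le> (\<Sum>v\<in>Vs. card (dom v))" using finVs v by (intro member_le_sum) auto
  finally show ?thesis using nbig by simp
qed

lemma cardCV: "card CV > 0" using finCV CVne by (simp add: card_gt_0_iff)

lemma K2: "K \<ge> 2" using n2 cardCV by (metis le_trans mult.commute mult_le_mono2 mult_1_right Suc_leI One_nat_def)

lemma finite_nonp: "finite (nonp \<sigma>)" using finVs findom finCV by (auto simp: nonp_def)

lemma card_nonp: assumes "valid \<sigma>" shows "card (nonp \<sigma>) = W0"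
proof -
  have "card (nonp \<sigma>) = (\<Sum>v\<in>Vs. card ((dom v - {\<sigma> v}) \<times> CV \<times> {..<n}))"
    unfolding nonp_def using finVs findom finCV by (simp add: card_cartesian_product card_SigmaI)
  also have "\<dots> = W0" unfolding W0_def
    using assms findom by (intro sum.cong refl) (auto simp: card_cartesian_product valid_def)
  finally show ?thesis .
qed

lemma card_cov: assumes "valid \<sigma>" shows "card (cov \<sigma>) + card (Sat \<sigma>) = W0 + card CV"
proof -
  have "nonp \<sigma> \<inter> cvx ` {cv \<in> CV. \<not> satcv \<sigma> cv} = {}" by (auto simp: nonp_def cvx_def)
  then have "card (cov \<sigma>) = card (nonp \<sigma>) + card (cvx ` {cv \<in> CV. \<not> satcv \<sigma> cv})"
    unfolding cov_def using finite_nonp finCV by (intro card_Un_disjoint) auto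
  also have "card (cvx ` {cv \<in> CV. \<not> satcv \<sigma> cv}) = card {cv \<in> CV. \<not> satcv \<sigma> cv}"
    by (intro card_image) (auto simp: inj_on_def cvx_def)
  finally have "card (cov \<sigma>) = W0 + card {cv \<in> CV. \<not> satcv \<sigma> cv}" by (simp add: card_nonp[OF assms])
  moreover have "card CV = card ({cv \<in> CV. \<not> satcv \<sigma> cv} \<union> Sat \<sigma>)" by (rule arg_cong[of _ _ card]) (auto simp: Sat_def)
  moreover have "\<dots> = card {cv \<in> CV. \<not> satcv \<sigma> cv} + card (Sat \<sigma>)"
    using finCV by (intro card_Un_disjoint) (auto simp: Sat_def)
  ultimately show ?thesis by simp
qed

lemma unsat_conf: "\<not> satcv \<sigma> cv \<Longrightarrow> cv \<in> CV \<Longrightarrow> \<exists>v\<in>Vs. conf v (\<sigma> v) cv"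
  using scope[of cv] unfolding satcv_def conf_def by fastforce

lemma sat_conf: "satcv \<sigma> cv \<Longrightarrow> conf v a cv \<Longrightarrow> a \<noteq> \<sigma> v"
  unfolding satcv_def conf_def by auto

text \<open>By \<open>same\<close> the two tuples have the same scope, and the assignment determines
  the values on it.\<close>

lemma sat_unique: "satcv \<sigma> cv \<Longrightarrow> satcv \<sigma> cv' \<Longrightarrow> cv \<in> CV \<Longrightarrow> cv' \<in> CV \<Longrightarrow> fst cv = fst cv' \<Longrightarrow> cv = cv'"
proof -
  assume a: "satcv \<sigma> cv" "satcv \<sigma> cv'" "cv \<in> CV" "cv' \<in> CV" "fst cv = fst cv'"
  have m: "map snd l = map \<sigma> (map fst l)" if "\<forall>z\<in>set l. \<sigma> (fst z) = snd z" for l :: "('v \<times> 'a) list"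
    using that by (induction l) auto
  have f: "map fst (snd cv) = map fst (snd cv')" using same a by blast
  then have "map snd (snd cv) = map snd (snd cv')" using m a(1,2) unfolding satcv_def by metis
  then have "zip (map fst (snd cv)) (map snd (snd cv)) = zip (map fst (snd cv')) (map snd (snd cv'))" using f by simp
  then have "snd cv = snd cv'" by (simp add: zip_map_fst_snd)
  then show ?thesis using a(5) by (simp add: prod_eq_iff)
qed

text \<open>The copies of different values of a variable are completely joined, so at most one value
  per variable is not entirely in the cover; it defines the assignment. A violated constraint vertex
  still has a conflict edge to a chosen value, whose covering end carries the tag \<open>cv\<close>,
  so different \<open>cv\<close> need different vertices. Satisfied constraint vertices in
  \<open>X\<close> are counted as well; this later decides whether the claim vertex fits into a
  minimum cover.\<close>

lemma cover_lower:
  assumes "vertex_cover BG X"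
  obtains \<sigma> where "valid \<sigma>" "W0 + card {cv \<in> CV. \<not> satcv \<sigma> cv \<or> cvx cv \<in> X} \<le> card X"
proof -
  have X: "X \<subseteq> bV" "\<And>x y. x \<in> bV \<Longrightarrow> y \<in> bV \<Longrightarrow> x \<noteq> y \<Longrightarrow> badj x y \<Longrightarrow> x \<in> X \<or> y \<in> X"
    using assms unfolding cover_mkg by blast+
  have fX: "finite X" using X(1) finite_bV finite_subset by blast
  have "\<exists>a\<in>dom v. \<forall>b\<in>dom v. b \<noteq> a \<longrightarrow> part v b \<subseteq> X" if v: "v \<in> Vs" for v
  proof (cases "\<exists>a\<in>dom v. \<not> part v a \<subseteq> X")
    case True
    then obtain a cv i where a: "a \<in> dom v" "cv \<in> CV" "i < n" "(0, v, a, cv, i) \<notin> X" by (auto simp: part_def)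
    have "part v b \<subseteq> X" if b: "b \<in> dom v" "b \<noteq> a" for b
    proof
      fix x assume "x \<in> part v b"
      then obtain cw j where x: "x = (0, v, b, cw, j)" "cw \<in> CV" "j < n" by (auto simp: part_def)
      have "(0, v, a, cv, i) \<in> X \<or> x \<in> X"
        by (rule X(2)) (use v a b x in \<open>auto simp: bV_def badj_simps\<close>)
      then show "x \<in> X" using a by blast
    qed
    then show ?thesis using a by blast
  next
    case False then show ?thesis using domne[OF v] by blast
  qed
  then obtain \<sigma> where \<sigma>: "\<And>v. v \<in> Vs \<Longrightarrow> \<sigma> v \<in> dom v" "\<And>v b. v \<in> Vs \<Longrightarrow> b \<in> dom v \<Longrightarrow> b \<noteq> \<sigma> v \<Longrightarrow> part v b \<subseteq> X"
  proof -
    assume "\<And>v. v \<in> Vs \<Longrightarrow> \<exists>a\<in>dom v. \<forall>b\<in>dom v. b \<noteq> a \<longrightarrow> part v b \<subseteq> X"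
    then have "\<forall>v\<in>Vs. \<exists>a. a \<in> dom v \<and> (\<forall>b\<in>dom v. b \<noteq> a \<longrightarrow> part v b \<subseteq> X)" by blast
    from bchoice[OF this] show thesis using that by blast
  qed
  have val: "valid \<sigma>" using \<sigma>(1) by (simp add: valid_def)
  let ?T = "{cv \<in> CV. \<not> satcv \<sigma> cv \<or> cvx cv \<in> X}"
  have "\<exists>x\<in>X - nonp \<sigma>. fst (snd (snd (snd x))) = cv" if cv: "cv \<in> ?T" for cv
  proof (cases "cvx cv \<in> X")
    case True then show ?thesis by (intro bexI[of _ "cvx cv"]) (auto simp: cvx_def nonp_def)
  next
    case False
    then obtain v where v: "v \<in> Vs" "conf v (\<sigma> v) cv" using unsat_conf[of \<sigma> cv] cv by blast
    have "(0, v, \<sigma> v, cv, 0) \<in> X \<or> cvx cv \<in> X"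
      by (rule X(2)) (use v cv \<sigma>(1) n2 in \<open>auto simp: bV_def cvx_def badj_simps\<close>)
    then show ?thesis using False by (intro bexI[of _ "(0, v, \<sigma> v, cv, 0)"]) (auto simp: nonp_def)
  qed
  then have "\<forall>cv\<in>?T. \<exists>x. x \<in> X - nonp \<sigma> \<and> fst (snd (snd (snd x))) = cv" by blast
  from bchoice[OF this] obtain h where h: "\<forall>cv\<in>?T. h cv \<in> X - nonp \<sigma> \<and> fst (snd (snd (snd (h cv)))) = cv" by blast
  have "inj_on h ?T" by (rule inj_on_inverseI[of _ "\<lambda>x. fst (snd (snd (snd x)))"]) (use h in blast)
  then have "card (h ` ?T) = card ?T" by (rule card_image)
  moreover have "nonp \<sigma> \<subseteq> X"
  proof
    fix x assume "x \<in> nonp \<sigma>"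
    then obtain v a cv i where "x = (0, v, a, cv, i)" "v \<in> Vs" "a \<in> dom v" "a \<noteq> \<sigma> v" "cv \<in> CV" "i < n" by (rule nonpE)
    moreover from this have "x \<in> part v a" by (simp add: part_def)
    ultimately show "x \<in> X" using \<sigma>(2) by blast
  qed
  then have sub: "nonp \<sigma> \<union> h ` ?T \<subseteq> X" using h by blast
  moreover have "nonp \<sigma> \<inter> h ` ?T = {}" using h by blast
  then have "card (nonp \<sigma> \<union> h ` ?T) = card (nonp \<sigma>) + card (h ` ?T)"
    using finite_nonp finCV by (intro card_Un_disjoint) auto
  ultimately have "W0 + card ?T \<le> card X" using card_mono[OF fX sub] card_nonp[OF val] by simp
  then show thesis using that val by blast
qed

text \<open>Conflict edges at a chosen value lead to violated constraints only, and by
  \<open>sat_unique\<close> two joined constraint vertices are never both satisfied.\<close>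

lemma cover_cov: assumes "valid \<sigma>" shows "vertex_cover BG (cov \<sigma>)"
  unfolding cover_mkg
proof (intro conjI ballI impI)
  show "cov \<sigma> \<subseteq> bV" by (auto simp: cov_def nonp_def bV_def)
  fix x y assume xy: "x \<in> bV" "y \<in> bV" "x \<noteq> y" "badj x y"
  have cross: "x \<in> cov \<sigma> \<or> y \<in> cov \<sigma>" if "x \<in> {0} \<times> (SIGMA v:Vs. dom v \<times> CV \<times> {..<n})" "y \<in> cvx ` CV" "badj x y" for x y
  proof -
    obtain t v a cv i where "x = (t, v, a, cv, i)" by (rule prod_cases5)
    then have x: "x = (0, v, a, cv, i)" "v \<in> Vs" "a \<in> dom v" "cv \<in> CV" "i < n" using that(1) by simp_all
    obtain cw where y: "y = cvx cw" "cw \<in> CV" using \<open>y \<in> cvx ` CV\<close> by auto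
    have c: "cw = cv" "conf v a cv" using \<open>badj x y\<close> x y by (auto simp: cvx_def badj_simps)
    show ?thesis
    proof (cases "a = \<sigma> v")
      case True
      then have "\<not> satcv \<sigma> cv" using sat_conf[of \<sigma> cv v a] c(2) by auto
      then show ?thesis using y c(1) unfolding cov_def by blast
    next
      case False then show ?thesis using x by (simp add: cov_def nonp_def)
    qed
  qed
  consider "x \<in> {0} \<times> (SIGMA v:Vs. dom v \<times> CV \<times> {..<n})" "y \<in> {0} \<times> (SIGMA v:Vs. dom v \<times> CV \<times> {..<n})"
    | "x \<in> {0} \<times> (SIGMA v:Vs. dom v \<times> CV \<times> {..<n})" "y \<in> cvx ` CV"
    | "y \<in> {0} \<times> (SIGMA v:Vs. dom v \<times> CV \<times> {..<n})" "x \<in> cvx ` CV"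
    | "x \<in> cvx ` CV" "y \<in> cvx ` CV"
    using xy(1,2) unfolding bV_def by blast
  then show "x \<in> cov \<sigma> \<or> y \<in> cov \<sigma>"
  proof cases
    case 1 then show ?thesis using xy(4) by (auto simp: cov_def nonp_def badj_simps)
  next
    case 2 then show ?thesis using cross xy(4) by blast
  next
    case 3 then show ?thesis using cross xy(4) symp_badj by (meson sympD)
  next
    case 4
    then obtain cv cw where e: "x = cvx cv" "y = cvx cw" "cv \<in> CV" "cw \<in> CV" by blast
    then have "fst cv = fst cw" "cv \<noteq> cw" using xy(4) by (auto simp: cvx_def badj_simps)
    then have "\<not> satcv \<sigma> cv \<or> \<not> satcv \<sigma> cw" using sat_unique[of \<sigma> cv cw] e(3,4) by blast
    then show ?thesis using e unfolding cov_def by blast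
  qed
qed

definition cross where "cross v a cv i = (if i = 0 \<and> conf v a cv then {cvx cv} else {})"

lemma nb_part:
  assumes "v \<in> Vs" "a \<in> dom v" "cv \<in> CV" "i < n"
  shows "nb BG (0, v, a, cv, i) = (\<Union>b\<in>dom v - {a}. part v b) \<union> cross v a cv i"
proof -
  have "(0, v, a, cv, i) \<in> bV" using assms by (auto simp: bV_def)
  then show ?thesis using assms
    by (subst nb_mkg[OF symp_badj]) (auto simp: bV_def cvx_def badj_simps part_def cross_def split: if_splits)
qed

lemma deg_part:
  assumes "v \<in> Vs" "a \<in> dom v" "cv \<in> CV" "i < n"
  shows "card (nb BG (0, v, a, cv, i) - U) = (\<Sum>b\<in>dom v - {a}. card (part v b - U)) + card (cross v a cv i - U)"
proof -
  have "nb BG (0, v, a, cv, i) - U = (\<Union>b\<in>dom v - {a}. part v b - U) \<union> (cross v a cv i - U)"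
    unfolding nb_part[OF assms] by blast
  moreover have "(\<Union>b\<in>dom v - {a}. part v b - U) \<inter> (cross v a cv i - U) = {}"
    by (auto simp: part_def cross_def cvx_def split: if_splits)
  moreover have "finite (\<Union>b\<in>dom v - {a}. part v b - U)" using findom[OF assms(1)] finite_part by auto
  moreover have "finite (cross v a cv i - U)" by (simp add: cross_def)
  ultimately have "card (nb BG (0, v, a, cv, i) - U) = card (\<Union>b\<in>dom v - {a}. part v b - U) + card (cross v a cv i - U)"
    by (simp add: card_Un_disjoint)
  also have "card (\<Union>b\<in>dom v - {a}. part v b - U) = (\<Sum>b\<in>dom v - {a}. card (part v b - U))"
    using findom[OF assms(1)] finite_part by (intro card_UN_disjoint) (auto simp: part_def)
  finally show ?thesis .
qed

lemma card_cross: "card (cross v a cv i - U) \<le> 1"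
proof -
  have "card (cross v a cv i - U) \<le> card {cvx cv}" by (rule card_mono) (auto simp: cross_def)
  then show ?thesis by simp
qed

text \<open>At most \<open>card CV - 1\<close> constraint neighbours and one copy of each value,
  fewer than \<open>n\<close> in total. The sum of these is below the product
  \<open>card CV * n\<close>.\<close>

lemma deg_cvx: assumes "cv \<in> CV" shows "card (nb BG (cvx cv) - U) < K"
proof -
  have "nb BG (cvx cv) \<subseteq> cvx ` (CV - {cv}) \<union> (\<lambda>(v, a). (0, v, a, cv, 0)) ` (SIGMA v:Vs. dom v)"
    using assms by (subst nb_mkg[OF symp_badj]) (auto simp: bV_def cvx_def badj_simps image_iff)
  then have "card (nb BG (cvx cv)) \<le> card (cvx ` (CV - {cv}) \<union> (\<lambda>(v, a). (0, v, a, cv, 0)) ` (SIGMA v:Vs. dom v))"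
    using finCV finVs findom by (intro card_mono) auto
  also have "\<dots> \<le> card (cvx ` (CV - {cv})) + card ((\<lambda>(v, a). (0::nat, v, a, cv, 0::nat)) ` (SIGMA v:Vs. dom v))"
    by (rule card_Un_le)
  also have "\<dots> \<le> card (CV - {cv}) + card (SIGMA v:Vs. dom v)"
    using finCV finVs findom by (intro add_mono card_image_le) auto
  also have "card (SIGMA v:Vs. dom v) = (\<Sum>v\<in>Vs. card (dom v))" using finVs findom by (simp add: card_SigmaI)
  also have "card (CV - {cv}) = card CV - 1" using assms by simp
  finally have "card (nb BG (cvx cv)) \<le> card CV - 1 + (\<Sum>v\<in>Vs. card (dom v))" .
  then have "card (nb BG (cvx cv)) + 2 \<le> card CV + n" using nbig cardCV by linarith
  moreover have "card CV + n \<le> K + 1"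
  proof -
    obtain c m where "card CV = Suc c" "n = Suc m" using cardCV n2 by (metis Suc_pred gr0I not_numeral_le_zero)
    then show ?thesis by simp
  qed
  moreover have "card (nb BG (cvx cv) - U) \<le> card (nb BG (cvx cv))"
    by (intro card_mono finite_nb[OF gr_BG]) auto
  ultimately show ?thesis by linarith
qed

section \<open>Greedy runs that follow an assignment\<close>

definition partial :: "(nat \<times> 'v \<times> 'a \<times> ('c \<times> ('v \<times> 'a) list) \<times> nat) set \<Rightarrow> 'v \<Rightarrow> 'a \<Rightarrow> bool" where
  "partial U v a \<longleftrightarrow> part v a \<inter> U \<noteq> {} \<and> \<not> part v a \<subseteq> U"

text \<open>Values are eliminated one at a time within each variable: a second part is begun only
  when the one under way has been removed completely.\<close>

definition phase1 where
  "phase1 \<sigma> U \<longleftrightarrow> U \<subseteq> nonp \<sigma> \<and> (\<forall>v\<in>Vs. \<forall>a b. partial U v a \<longrightarrow> partial U v b \<longrightarrow> a = b)"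

lemma max_deg_exists:
  assumes "x \<in> bV - U"
  obtains u where "u \<in> bV - U" "\<And>y. y \<in> bV - U \<Longrightarrow> card (nb BG y - U) \<le> card (nb BG u - U)"
proof -
  let ?f = "\<lambda>v. card (nb BG v - U)" let ?M = "Max (?f ` (bV - U))"
  have fin: "finite (?f ` (bV - U))" using finite_bV by simp
  then have "?M \<in> ?f ` (bV - U)" using assms by (intro Max_in) auto
  then obtain u where "u \<in> bV - U" "?f u = ?M" by auto
  moreover have "?f y \<le> ?M" if "y \<in> bV - U" for y using fin that by auto
  ultimately show thesis using that by (metis (no_types, lifting))
qed

text \<open>The degree of a copy is the number of remaining copies of the other values of its
  variable, plus at most one conflict edge. Hence a copy of a value that is partly removed is
  preferred to those of untouched values, and among untouched values it is free which one to begin,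
  as long as the conflict edge is matched. So the elimination can always spare the value chosen by
  the assignment.\<close>

lemma phase1_step:
  assumes val: "valid \<sigma>" and ph: "phase1 \<sigma> U" and inc: "\<not> nonp \<sigma> \<subseteq> U"
  shows "\<exists>x\<in>nonp \<sigma> - U. (\<forall>y\<in>bV - U. card (nb BG y - U) \<le> card (nb BG x - U)) \<and> phase1 \<sigma> (insert x U)"
proof -
  have U: "U \<subseteq> nonp \<sigma>" and uniq: "\<And>v a b. v \<in> Vs \<Longrightarrow> partial U v a \<Longrightarrow> partial U v b \<Longrightarrow> a = b"
    using ph by (auto simp: phase1_def)
  have spart: "part v (\<sigma> v) \<inter> U = {}" for v using U by (auto simp: part_def nonp_def)
  have cvU: "cvx cv \<notin> U" for cv using U by (auto simp: cvx_def nonp_def)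
  obtain x0 where x0: "x0 \<in> nonp \<sigma> - U" using inc by blast
  then obtain v1 a1 cv1 i1 where x1: "x0 = (0, v1, a1, cv1, i1)" "v1 \<in> Vs" "a1 \<in> dom v1" "a1 \<noteq> \<sigma> v1" "cv1 \<in> CV" "i1 < n"
    using nonpE by blast
  have x0V: "x0 \<in> bV - U" using x0 x1 by (auto simp: bV_def)
  obtain u where u: "u \<in> bV - U" "\<And>y. y \<in> bV - U \<Longrightarrow> card (nb BG y - U) \<le> card (nb BG u - U)"
    using max_deg_exists[OF x0V] by blast
  \<comment> \<open>A remaining copy of a value not chosen sees the whole untouched part of the
    chosen value. So the maximum degree is at least \<open>K\<close> and is not attained at a
    constraint vertex.\<close>
  have "K = card (part v1 (\<sigma> v1) - U)" using spart[of v1] card_part[of v1 "\<sigma> v1"] by (metis Diff_triv)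
  also have "\<dots> \<le> (\<Sum>b\<in>dom v1 - {a1}. card (part v1 b - U))"
    using val x1 findom by (intro member_le_sum) (auto simp: valid_def)
  also have "\<dots> \<le> card (nb BG x0 - U)" unfolding x1(1) by (subst deg_part) (use x1 in auto)
  also have "\<dots> \<le> card (nb BG u - U)" by (rule u(2)[OF x0V])
  finally have uK: "K \<le> card (nb BG u - U)" .
  then have "u \<notin> cvx ` CV" using deg_cvx by (metis imageE leD)
  then obtain v b cv i where ue: "u = (0, v, b, cv, i)" "v \<in> Vs" "b \<in> dom v" "cv \<in> CV" "i < n"
    using u(1) bV0E by blast
  define R where "R = (\<lambda>c. card (part v c - U))"
  have fd: "finite (dom v)" using findom ue by blast
  have RK: "R c \<le> K" for c unfolding R_def using card_mono[OF finite_part Diff_subset[of "part v c" U]] by (simp add: card_part)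
  have Rfull: "R c = K" if "part v c \<inter> U = {}" for c unfolding R_def using that card_part by (simp add: Diff_triv)
  have tot: "(\<Sum>c\<in>dom v - {a}. R c) = (\<Sum>c\<in>dom v. R c) - R a" "R a \<le> (\<Sum>c\<in>dom v. R c)" if "a \<in> dom v" for a
    using fd that by (auto simp: sum_diff1_nat intro: member_le_sum)
  have du: "card (nb BG u - U) \<le> (\<Sum>c\<in>dom v - {b}. R c) + 1"
    unfolding ue(1) R_def by (subst deg_part) (use ue card_cross[of v b cv i U] in auto)
  \<comment> \<open>Otherwise only copies of the chosen value are left of this variable, and
    \<open>u\<close> would have at most its conflict edge.\<close>
  have inc_v: "\<exists>a\<in>dom v - {\<sigma> v}. \<not> part v a \<subseteq> U"
  proof (rule ccontr)
    assume no: "\<not> (\<exists>a\<in>dom v - {\<sigma> v}. \<not> part v a \<subseteq> U)"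
    then have z: "R c = 0" if "c \<in> dom v - {\<sigma> v}" for c using that by (auto simp: R_def Diff_eq_empty_iff[THEN iffD2])
    have "u \<in> part v b" using ue by (auto simp: part_def)
    then have "b = \<sigma> v" using no u(1) ue(3) by blast
    then have "(\<Sum>c\<in>dom v - {b}. R c) = 0" using z by simp
    then show False using du uK K2 by linarith
  qed
  have ub: "u \<in> part v b - U" using ue u(1) by (auto simp: part_def)
  have mem: "x \<in> nonp \<sigma> - U" if "x \<in> part v a - U" "a \<in> dom v" "a \<noteq> \<sigma> v" for x a
    using that ue(2) by (auto simp: part_def nonp_def)
  have keep: "phase1 \<sigma> (insert x U)" if x: "x \<in> part v a - U" "a \<in> dom v" "a \<noteq> \<sigma> v" and o: "\<And>c. partial U v c \<Longrightarrow> c = a" for x a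
    unfolding phase1_def
  proof (intro conjI ballI allI impI)
    show "insert x U \<subseteq> nonp \<sigma>" using U mem[OF x] by blast
    fix w c d assume w: "w \<in> Vs" "partial (insert x U) w c" "partial (insert x U) w d"
    have other: "partial U w c" if "partial (insert x U) w c" "w \<noteq> v \<or> c \<noteq> a" for c
    proof -
      have "x \<notin> part w c" using x(1) that(2) by (auto simp: part_def)
      then show ?thesis using that(1) unfolding partial_def by blast
    qed
    show "c = d"
    proof (cases "w = v")
      case True
      have "c = a" using other[OF w(2)] o True by blast
      moreover have "d = a" using other[OF w(3)] o True by blast
      ultimately show ?thesis by simp
    next
      case False then show ?thesis using other w uniq by blast
    qed
  qed
  show ?thesis
  proof (cases "\<exists>a. partial U v a")
    case True
    then obtain a where a: "partial U v a" by blast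
    then obtain y where y: "y \<in> part v a - U" unfolding partial_def by blast
    obtain y' where y': "y' \<in> part v a" "y' \<in> U" using a unfolding partial_def by blast
    have aD: "a \<in> dom v" "a \<noteq> \<sigma> v" using y' U by (auto simp: part_def nonp_def)
    have only: "c = a" if "partial U v c" for c using uniq[OF ue(2) that a] .
    show ?thesis
    proof (cases "b = a")
      case True
      then show ?thesis using mem[OF ub] keep[OF ub] aD only u(2) by blast
    next
      case False
      have "part v b \<inter> U = {}" using only[of b] False ub unfolding partial_def by blast
      then have Rb: "R b = K" by (rule Rfull)
      have "R a < K"
      proof -
        have "part v a - U \<subset> part v a" using y' by blast
        from psubset_card_mono[OF finite_part this] show ?thesis by (simp add: R_def card_part)
      qed
      \<comment> \<open>The part of \<open>a\<close> has lost a copy and that of \<open>b\<close>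
        has not, so copies of \<open>a\<close> gain at least one neighbour over \<open>u\<close>;
        this makes up for the conflict edge that \<open>u\<close> may have.\<close>
      then have le: "(\<Sum>c\<in>dom v - {b}. R c) + 1 \<le> (\<Sum>c\<in>dom v - {a}. R c)"
        using tot[OF ue(3)] tot[OF aD(1)] Rb by linarith
      obtain cw j where ye: "y = (0, v, a, cw, j)" "cw \<in> CV" "j < n" using y by (auto simp: part_def)
      have "card (nb BG u - U) \<le> card (nb BG y - U)"
        using du le unfolding ye(1) by (subst deg_part) (use ye ue aD in \<open>auto simp: R_def\<close>)
      then have "\<forall>z\<in>bV - U. card (nb BG z - U) \<le> card (nb BG y - U)" using u(2) le_trans by blast
      then show ?thesis using mem[OF y aD] keep[OF y aD only] by blast
    qed
  next
    case False
    obtain a where a: "a \<in> dom v" "a \<noteq> \<sigma> v" "\<not> part v a \<subseteq> U" using inc_v by blast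
    have ea: "part v a \<inter> U = {}" using False a unfolding partial_def by blast
    have eb: "part v b \<inter> U = {}" using False ub unfolding partial_def by blast
    \<comment> \<open>To begin the value \<open>a\<close>, the copy attached to the dummy constraint
      is used: it certainly has a conflict edge, so it does as well as \<open>u\<close>.\<close>
    obtain cw where cw: "cw \<in> CV" "\<And>a. conf v a cw" using dummy[OF ue(2)] by blast
    let ?y = "(0, v, a, cw, 0)"
    have yp: "?y \<in> part v a" using cw n2 by (auto simp: part_def)
    then have y: "?y \<in> part v a - U" using ea by blast
    have "cross v a cw 0 - U = {cvx cw}" using cw(2)[of a] cvU[of cw] unfolding cross_def by (simp add: insert_Diff_if)
    then have "card (cross v a cw 0 - U) = card {cvx cw}" by (rule arg_cong)
    also have "card {cvx cw} = 1" by simp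
    finally have c1: "card (cross v a cw 0 - U) = 1" .
    have "0 < n" using n2 by simp
    from deg_part[OF ue(2) a(1) cw(1) this, of U]
    have "card (nb BG ?y - U) = (\<Sum>c\<in>dom v - {a}. R c) + 1" unfolding c1 R_def .
    also have "(\<Sum>c\<in>dom v - {a}. R c) = (\<Sum>c\<in>dom v - {b}. R c)"
      using tot[OF ue(3)] tot[OF a(1)] Rfull[OF ea] Rfull[OF eb] by simp
    finally have "card (nb BG u - U) \<le> card (nb BG ?y - U)" using du by simp
    then have "\<forall>z\<in>bV - U. card (nb BG z - U) \<le> card (nb BG ?y - U)" using u(2) le_trans by blast
    moreover have "phase1 \<sigma> (insert ?y U)" by (rule keep[OF y a(1,2)]) (use False in blast)
    ultimately show ?thesis using mem[OF y a(1,2)] by blast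
  qed
qed

text \<open>Only chosen values and constraint vertices are left. A satisfied constraint vertex is
  then adjacent just to violated ones of the same identifier, and each of these has the same clique
  neighbours and a conflict edge in addition, so it has larger degree. A copy of a chosen value has
  at most one neighbour, a violated constraint vertex, which can be taken instead.\<close>

lemma phase2_step:
  assumes val: "valid \<sigma>" and U: "nonp \<sigma> \<subseteq> U" "U \<subseteq> cov \<sigma>" and e: "snd (gdel BG U) \<noteq> {}"
  shows "\<exists>x\<in>cov \<sigma> - U. \<forall>y\<in>bV - U. card (nb BG y - U) \<le> card (nb BG x - U)"
proof -
  obtain x1 x2 where xx: "x1 \<in> bV - U" "x2 \<in> bV - U" "x2 \<in> nb BG x1"
    by (rule edge_gdel[OF gr_BG e]) (use that in simp)
  obtain u where u: "u \<in> bV - U" "\<And>y. y \<in> bV - U \<Longrightarrow> card (nb BG y - U) \<le> card (nb BG u - U)"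
    using max_deg_exists[OF xx(1)] by blast
  have fin: "finite (nb BG y - U)" for y using finite_nb[OF gr_BG] by auto
  have "0 < card (nb BG x1 - U)" using xx fin by (auto simp: card_gt_0_iff)
  then have upos: "0 < card (nb BG u - U)" using u(2)[OF xx(1)] by linarith
  then obtain w where w: "w \<in> nb BG u" "w \<notin> U" by (metis DiffE card_gt_0_iff ex_in_conv)
  have wV: "w \<in> bV" using w(1) nb_V[OF gr_BG, of u] by auto
  have adj: "badj u w" using w(1) u(1) by (auto simp: nb_mkg[OF symp_badj])
  show ?thesis
  proof (cases "u \<in> cov \<sigma>")
    case True then show ?thesis using u by blast
  next
    case False
    have remain0: "a = \<sigma> v" if "(0, v, a, cv, i) \<in> bV - U" for v a cv i
    proof (rule ccontr)
      assume "a \<noteq> \<sigma> v"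
      then have "(0, v, a, cv, i) \<in> nonp \<sigma>" using that by (auto simp: bV_def nonp_def cvx_def)
      then show False using that U(1) by blast
    qed
    show ?thesis
    proof (cases "u \<in> cvx ` CV")
      case True
      then obtain cv where cv: "u = cvx cv" "cv \<in> CV" by blast
      then have sat: "satcv \<sigma> cv" using False by (auto simp: cov_def)
      have nb0: "fst y \<noteq> 0" if "y \<in> nb BG u - U" for y
      proof
        assume "fst y = 0"
        moreover have "y \<in> bV - U" "badj u y" using that u(1) nb_V[OF gr_BG, of u] by (auto simp: nb_mkg[OF symp_badj])
        ultimately obtain v a cw i where y: "y = (0, v, a, cw, i)" by (metis prod.exhaust fst_conv)
        then have "a = \<sigma> v" "conf v a cv" using remain0 \<open>y \<in> bV - U\<close> \<open>badj u y\<close> cv by (auto simp: cvx_def badj_simps)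
        then show False using sat_conf[OF sat, of v a] by blast
      qed
      have "w \<in> cvx ` CV" using nb0[of w] w wV by (auto simp: bV_def)
      then obtain cw where cw: "w = cvx cw" "cw \<in> CV" by blast
      have same_id: "fst cv = fst cw" "cv \<noteq> cw" using adj cv cw by (auto simp: cvx_def badj_simps)
      then have unsat: "\<not> satcv \<sigma> cw" using sat_unique[OF sat, of cw] cv(2) cw(2) by blast
      then obtain v where v: "v \<in> Vs" "conf v (\<sigma> v) cw" using unsat_conf[of \<sigma> cw] cw(2) by blast
      let ?z = "(0, v, \<sigma> v, cw, 0)"
      have zV: "?z \<in> bV" using v cw val n2 by (auto simp: bV_def valid_def)
      have zU: "?z \<notin> U" using U(2) by (auto simp: cov_def nonp_def cvx_def)
      have z: "?z \<in> nb BG w - U" using zV zU wV cw v by (auto simp: nb_mkg[OF symp_badj] cvx_def badj_simps)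
      have un: "u \<notin> nb BG u" using u(1) by (auto simp: nb_mkg[OF symp_badj])
      \<comment> \<open>Exchanging \<open>u\<close> and \<open>w\<close> in the clique of their
        identifier preserves the count; the conflicting copy \<open>?z\<close> is the surplus that
        contradicts the maximality of \<open>u\<close>.\<close>
      have "insert ?z (insert u (nb BG u - U) - {w}) \<subseteq> nb BG w - U"
      proof
        fix y assume "y \<in> insert ?z (insert u (nb BG u - U) - {w})"
        then consider "y = ?z" | "y = u" | "y \<in> nb BG u - U" "y \<noteq> w" by blast
        then show "y \<in> nb BG w - U"
        proof cases
          case 1 then show ?thesis using z by simp
        next
          case 2
          then show ?thesis using u(1) adj wV symp_badj cv cw same_id by (auto simp: nb_mkg[OF symp_badj] cvx_def badj_simps)
        next
          case 3
          have "y \<in> bV" "badj u y" using 3 u(1) by (auto simp: nb_mkg[OF symp_badj])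
          moreover have "fst y \<noteq> 0" using nb0 3 by blast
          ultimately obtain cy where "y = cvx cy" "cy \<in> CV" "fst cv = fst cy"
            using cv by (auto simp: bV_def cvx_def badj_simps)
          then show ?thesis using 3 wV \<open>y \<in> bV\<close> cw same_id by (auto simp: nb_mkg[OF symp_badj] cvx_def badj_simps)
        qed
      qed
      then have "card (insert ?z (insert u (nb BG u - U) - {w})) \<le> card (nb BG w - U)" by (intro card_mono fin)
      moreover have "?z \<notin> insert u (nb BG u - U) - {w}" using nb0[of ?z] cv by (auto simp: cvx_def)
      then have "card (insert ?z (insert u (nb BG u - U) - {w})) = Suc (card (insert u (nb BG u - U) - {w}))"
        using fin by (intro card_insert_disjoint) auto
      moreover have "card (insert u (nb BG u - U) - {w}) = card (nb BG u - U)"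
        using w fin un by (subst card_Diff_singleton) auto
      ultimately have "card (nb BG u - U) < card (nb BG w - U)" by simp
      then show ?thesis using u(2)[of w] wV w by auto
    next
      case False
      then obtain v a cv i where ue: "u = (0, v, a, cv, i)" "v \<in> Vs" "a \<in> dom v" "cv \<in> CV" "i < n" using u(1) bV0E by blast
      have a: "a = \<sigma> v" using remain0 u(1) ue(1) by blast
      have "nb BG u - U \<subseteq> cross v a cv i"
      proof
        fix y assume y: "y \<in> nb BG u - U"
        show "y \<in> cross v a cv i"
        proof (rule ccontr)
          assume "y \<notin> cross v a cv i"
          then obtain b where "b \<in> dom v - {a}" "y \<in> part v b" using y unfolding ue(1) nb_part[OF ue(2-5)] by blast
          then have "y \<in> nonp \<sigma>" using ue a by (auto simp: nonp_def part_def)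
          then show False using y U by blast
        qed
      qed
      then have wc: "w \<in> cross v a cv i" and u1: "card (nb BG u - U) \<le> 1"
        using w card_mono[of "cross v a cv i" "nb BG u - U"] card_cross[of v a cv i "{}"] by (auto simp: cross_def split: if_splits)
      then have we: "w = cvx cv" "conf v a cv" "i = 0" by (auto simp: cross_def split: if_splits)
      then have "\<not> satcv \<sigma> cv" using sat_conf[of \<sigma> cv v a] a by auto
      then have "w \<in> cov \<sigma> - U" using we ue w by (auto simp: cov_def)
      moreover have "u \<in> nb BG w - U" using u(1) wV adj symp_badj by (auto simp: nb_mkg[OF symp_badj] dest: sympD) (auto simp: badj_def bcross_def)
      then have "1 \<le> card (nb BG w - U)" using fin by (metis One_nat_def Suc_leI card_gt_0_iff empty_iff)
      ultimately show ?thesis using u(2) u1 by (meson order_trans)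
    qed
  qed
qed

lemma min_mdg_upper:
  assumes val: "valid \<sigma>" shows "min_mdg BG + card (Sat \<sigma>) \<le> W0 + card CV"
proof -
  let ?Inv = "\<lambda>U. phase1 \<sigma> U \<or> nonp \<sigma> \<subseteq> U"
  have "\<exists>vs. mdgl (gdel BG {}) vs \<and> set vs \<subseteq> cov \<sigma> - {}"
  proof (rule mdg_can[OF gr_BG cover_cov[OF val], where Inv = ?Inv])
    show "?Inv {}" by (simp add: phase1_def partial_def)
    fix U assume U: "?Inv U" "U \<subseteq> cov \<sigma>" "snd (gdel BG U) \<noteq> {}"
    show "\<exists>v\<in>cov \<sigma> - U. (\<forall>u\<in>fst BG - U. card (nb BG u - U) \<le> card (nb BG v - U)) \<and> ?Inv (insert v U)"
    proof (cases "nonp \<sigma> \<subseteq> U")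
      case True
      then obtain x where "x \<in> cov \<sigma> - U" "\<forall>y\<in>bV - U. card (nb BG y - U) \<le> card (nb BG x - U)"
        using phase2_step[OF val _ U(2,3)] by blast
      then show ?thesis using True by auto
    next
      case False
      then have "phase1 \<sigma> U" using U(1) by blast
      from phase1_step[OF val this False] show ?thesis unfolding fst_mkg cov_def by blast
    qed
  qed simp
  then obtain vs where vs: "mdgl BG vs" "set vs \<subseteq> cov \<sigma>" by auto
  have "finite (cov \<sigma>)" using finite_nonp finCV by (simp add: cov_def)
  then have "card (set vs) \<le> card (cov \<sigma>)" using vs(2) by (intro card_mono)
  moreover have "card (set vs) = length vs" using mdgl_distinct[OF vs(1)] distinct_card by blast
  ultimately show ?thesis using min_mdg_le[OF vs(1)] card_cov[OF val] by linarith
qed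

text \<open>The lower bound for covers and the greedy run along an optimal assignment meet, and
  \<open>mvc\<close> never exceeds \<open>min_mdg\<close>.\<close>

lemma mvc_BG:
  assumes val: "valid \<sigma>" and max: "\<And>\<tau>. valid \<tau> \<Longrightarrow> card (Sat \<tau>) \<le> card (Sat \<sigma>)"
  shows "mvc BG + card (Sat \<sigma>) = W0 + card CV" "min_mdg BG = mvc BG"
proof -
  obtain X where X: "vertex_cover BG X" "card X = mvc BG" by (rule mvc_obtain[OF gr_BG])
  obtain \<tau> where t: "valid \<tau>" "W0 + card {cv \<in> CV. \<not> satcv \<tau> cv \<or> cvx cv \<in> X} \<le> card X"
    by (rule cover_lower[OF X(1)])
  have "card CV = card ({cv \<in> CV. \<not> satcv \<tau> cv} \<union> Sat \<tau>)" by (rule arg_cong[of _ _ card]) (auto simp: Sat_def)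
  also have "\<dots> \<le> card {cv \<in> CV. \<not> satcv \<tau> cv} + card (Sat \<tau>)" by (rule card_Un_le)
  also have "card {cv \<in> CV. \<not> satcv \<tau> cv} \<le> card {cv \<in> CV. \<not> satcv \<tau> cv \<or> cvx cv \<in> X}"
    using finCV by (intro card_mono) auto
  finally have "W0 + card CV \<le> mvc BG + card (Sat \<tau>)" using t(2) X(2) by linarith
  then have "W0 + card CV \<le> mvc BG + card (Sat \<sigma>)" using max[OF t(1)] by linarith
  then show "mvc BG + card (Sat \<sigma>) = W0 + card CV" "min_mdg BG = mvc BG"
    using min_mdg_upper[OF val] mvc_le_min_mdg[OF gr_BG] by linarith+
qed

text \<open>The gadget costs nothing beyond \<open>D\<close> exactly when the vertex of
  \<open>\<beta>\<close> lies in some minimum cover. That means paying for it although it may be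
  satisfied, and this is affordable iff the other constraints satisfied by some assignment already
  attain the maximum.\<close>

lemma mvc_Z_beta:
  assumes val: "valid \<sigma>" and max: "\<And>\<tau>. valid \<tau> \<Longrightarrow> card (Sat \<tau>) \<le> card (Sat \<sigma>)"
    and beta: "\<beta> \<in> CV" and D: "D \<ge> 2"
  shows "mvc (mkg (zV bV {cvx \<beta>} D) (zadj (\<lambda>x y. {x, y} \<in> snd BG))) =
    D + mvc BG + (if \<exists>\<tau>. valid \<tau> \<and> card (Sat \<sigma>) \<le> card (Sat \<tau> - {\<beta>}) then 0 else 1)" (is "mvc ?Z = D + ?M + ?e")
proof (rule antisym)
  have bb: "{cvx \<beta>} \<subseteq> fst BG" using beta by (auto simp: bV_def)
  have finSat: "finite (Sat \<tau>)" for \<tau> using finCV by (simp add: Sat_def)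
  show "mvc ?Z \<le> D + ?M + ?e"
  proof (cases "\<exists>\<tau>. valid \<tau> \<and> card (Sat \<sigma>) \<le> card (Sat \<tau> - {\<beta>})")
    case True
    then obtain \<tau> where t: "valid \<tau>" "card (Sat \<sigma>) \<le> card (Sat \<tau> - {\<beta>})" by blast
    let ?C = "insert (cvx \<beta>) (cov \<tau>)"
    have "vertex_cover BG ?C" using cover_cov[OF t(1)] bb unfolding vertex_cover_def by auto
    from Z_mvc_le[OF gr_BG bb D this] have "mvc ?Z \<le> D + card ?C" by simp
    moreover have "card ?C \<le> ?M"
    proof (cases "\<beta> \<in> Sat \<tau>")
      case True
      have "card ?C \<le> card (cov \<tau>) + 1" by (simp add: card_insert_le_m1)
      moreover have "card (Sat \<tau> - {\<beta>}) + 1 = card (Sat \<tau>)" using True finSat[of \<tau>] card_Suc_Diff1 by fastforce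
      ultimately show ?thesis using t(2) card_cov[OF t(1)] mvc_BG(1)[OF val max] by linarith
    next
      case False
      then have "cvx \<beta> \<in> cov \<tau>" using beta by (auto simp: cov_def Sat_def)
      then have "card ?C = card (cov \<tau>)" by (simp add: insert_absorb)
      then show ?thesis using False t(2) card_cov[OF t(1)] mvc_BG(1)[OF val max] by simp
    qed
    ultimately show ?thesis using True by simp
  next
    case False
    obtain C where C: "vertex_cover BG C" "card C = ?M" by (rule mvc_obtain[OF gr_BG])
    have "card ({cvx \<beta>} - C) \<le> 1" using card_mono[of "{cvx \<beta>}" "{cvx \<beta>} - C"] by auto
    moreover have "?e = 1" using False by (rule if_not_P)
    ultimately show ?thesis using Z_mvc_le[OF gr_BG bb D C(1)] C(2) by simp
  qed
  have gZ: "gr ?Z" using gr_Z[OF gr_BG bb D] by simp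
  obtain X where X: "vertex_cover ?Z X" "card X = mvc ?Z" by (rule mvc_obtain[OF gZ])
  obtain C where C: "vertex_cover BG C" "card {cvx \<beta>} * D + card C + card {v \<in> {cvx \<beta>}. (1, v, 0) \<in> X} \<le> card X"
    "cvx \<beta> \<in> C \<or> (1, cvx \<beta>, 0) \<in> X"
    by (rule Z_cover_split[OF gr_BG bb D, of X]) (use X(1) that in simp_all)
  show "D + ?M + ?e \<le> mvc ?Z"
  proof (cases "cvx \<beta> \<in> C")
    case False
    then have "{v \<in> {cvx \<beta>}. (1, v, 0) \<in> X} = {cvx \<beta>}" using C(3) by auto
    then show ?thesis using C(2) mvc_le[OF C(1)] X(2) by simp
  next
    case True
    obtain \<tau> where t: "valid \<tau>" "W0 + card {cv \<in> CV. \<not> satcv \<tau> cv \<or> cvx cv \<in> C} \<le> card C"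
      by (rule cover_lower[OF C(1)])
    have "card CV = card ({cv \<in> CV. \<not> satcv \<tau> cv \<or> cvx cv \<in> C} \<union> (Sat \<tau> - {\<beta>}))"
      using card_mono by (intro antisym card_mono) (use finCV True beta in \<open>auto simp: Sat_def\<close>)
    also have "\<dots> \<le> card {cv \<in> CV. \<not> satcv \<tau> cv \<or> cvx cv \<in> C} + card (Sat \<tau> - {\<beta>})" by (rule card_Un_le)
    finally have "W0 + card CV \<le> card C + card (Sat \<tau> - {\<beta>})" using t(2) by linarith
    moreover have "card (Sat \<tau> - {\<beta>}) < card (Sat \<sigma>)" if "?e = 1" using that t(1) by (auto split: if_splits)
    ultimately have "?M + ?e \<le> card C"
      using mvc_BG(1)[OF val max] mvc_le[OF C(1)] by (cases "?e = 1") (auto split: if_splits)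
    then show ?thesis using C(2) X(2) by simp
  qed
qed

end

section \<open>Computations as constraint satisfaction problems\<close>

text \<open>The variable \<open>(0, t, 0)\<close> holds the state, the scanned symbols and the head positions at
  time \<open>t\<close>, the variable \<open>(1, t, pos)\<close> the symbols of all tapes in cell \<open>pos - T\<close> at time \<open>t\<close>, and
  \<open>(2, 0, j)\<close> claims that the \<open>j\<close>-th output bit is 1. A hard constraint carries \<open>T + 2\<close> copies, which
  outweighs all claims.\<close>

definition nxt :: "tm \<Rightarrow> nat \<times> nat list \<Rightarrow> nat \<times> (nat \<times> nat) list" where
  "nxt M z = (if intab M z then tabc M z else (fst z, map (\<lambda>s. (s, 1)) (snd z)))"

text \<open>A value of the variable \<open>(0, t, 0)\<close> is a list: the state, then one scanned
  symbol per tape, then one head position per tape, shifted by \<open>T\<close>. \<open>dq\<close>,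
  \<open>dss\<close> and \<open>dhs\<close> are the three sections.\<close>

definition dq :: "nat list \<Rightarrow> nat" where "dq d = nthd 0 d 0"
definition dss :: "tm \<Rightarrow> nat list \<Rightarrow> nat list" where "dss M d = take (tm_tapes M) (drop 1 d)"
definition dhs :: "tm \<Rightarrow> nat list \<Rightarrow> nat list" where "dhs M d = drop (Suc (tm_tapes M)) d"

definition domD :: "tm \<Rightarrow> nat \<Rightarrow> nat \<Rightarrow> nat list list" where
  "domD M T t = (if t = 0 then map (\<lambda>ss. 0 # ss @ replicate (tm_tapes M) T) (List.n_lists (tm_tapes M) [0..<tm_symbols M])
     else concat (map (\<lambda>q. concat (map (\<lambda>ss. map (\<lambda>hs. q # ss @ hs) (List.n_lists (tm_tapes M) [0..<2 * T + 1]))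
       (List.n_lists (tm_tapes M) [0..<tm_symbols M]))) [0..<tm_states M + 1]))"

text \<open>At time 0 the first tape holds the fixed word \<open>xe\<close>, then \<open>m\<close>
  cells whose bit is free, and blanks elsewhere. These free cells are the only place where the
  initial tapes leave a choice; they hold the guess.\<close>

definition cell0 :: "word \<Rightarrow> nat \<Rightarrow> nat \<Rightarrow> nat \<Rightarrow> nat list" where
  "cell0 xe m T pos = (if pos < T \<or> T + length xe + m \<le> pos then [0]
     else if pos < T + length xe then [if nthd False xe (pos - T) then 2 else 1] else [1, 2])"

definition domC :: "tm \<Rightarrow> word \<Rightarrow> nat \<Rightarrow> nat \<Rightarrow> nat \<Rightarrow> nat \<Rightarrow> nat list list" where
  "domC M xe m T t pos = (if t = 0 then map (\<lambda>s. s # replicate (tm_tapes M - 1) 0) (cell0 xe m T pos)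
     else List.n_lists (tm_tapes M) [0..<tm_symbols M])"

type_synonym var = "nat \<times> nat \<times> nat"
type_synonym cid = "nat \<times> nat \<times> nat \<times> nat"
type_synonym cvt = "cid \<times> (var \<times> nat list) list"

definition tdom :: "tm \<Rightarrow> word \<Rightarrow> nat \<Rightarrow> nat \<Rightarrow> var \<Rightarrow> nat list list" where
  "tdom M xe m T v = (if fst v = 0 then domD M T (fst (snd v))
     else if fst v = 1 then domC M xe m T (fst (snd v)) (snd (snd v)) else [[0], [1]])"

definition tvars :: "nat \<Rightarrow> var list" where
  "tvars T = map (\<lambda>t. (0, t, 0)) [0..<T + 1] @ concat (map (\<lambda>t. map (\<lambda>p. (1, t, p)) [0..<2 * T + 1]) [0..<T + 1]) @
     map (\<lambda>j. (2, 0, j)) [0..<T + 1]"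

text \<open>The \<open>+ 1\<close> on the left offsets the coding of moves, which are raised by one.
  The scanned symbols listed in \<open>d\<close> are at first just claimed; they are tied to the
  tapes by the condition on \<open>c\<close> at the cell where the head stands.\<close>

definition trel :: "tm \<Rightarrow> nat \<Rightarrow> nat list \<Rightarrow> nat list \<Rightarrow> nat list \<Rightarrow> nat list \<Rightarrow> bool" where
  "trel M pos d d' c c' \<longleftrightarrow> dq d' = fst (nxt M (dq d, dss M d)) \<and>
     (\<forall>i\<in>set [0..<tm_tapes M].
        nthd 0 (dhs M d') i + 1 = nthd 0 (dhs M d) i + snd (nthd (0, 0) (snd (nxt M (dq d, dss M d))) i) \<and>
        (if nthd 0 (dhs M d) i = pos
         then nthd 0 c i = nthd 0 (dss M d) i \<and> nthd 0 c' i = fst (nthd (0, 0) (snd (nxt M (dq d, dss M d))) i)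
         else nthd 0 c' i = nthd 0 c i))"

definition cvA :: "tm \<Rightarrow> word \<Rightarrow> nat \<Rightarrow> nat \<Rightarrow> cvt list" where
  "cvA M xe m T = concat (map (\<lambda>t. concat (map (\<lambda>pos. concat (map (\<lambda>w.
     concat (map (\<lambda>d. concat (map (\<lambda>d'. concat (map (\<lambda>c.
       map (\<lambda>c'. ((0, t, pos, w), [((0, t, 0), d), ((0, Suc t, 0), d'), ((1, t, pos), c), ((1, Suc t, pos), c')]))
         (filter (\<lambda>c'. trel M pos d d' c c') (domC M xe m T (Suc t) pos)))
       (domC M xe m T t pos))) (domD M T (Suc t)))) (domD M T t)))
     [0..<T + 2])) [0..<2 * T + 1])) [0..<T])"

text \<open>Claim \<open>j\<close> may be raised to \<open>[1]\<close> only if cell \<open>j\<close>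
  of the output tape, number \<open>tm_tapes M - 1\<close>, holds the symbol 2 at time
  \<open>T\<close>. The value \<open>[0]\<close> is always allowed.\<close>

definition cvB :: "tm \<Rightarrow> word \<Rightarrow> nat \<Rightarrow> nat \<Rightarrow> cvt list" where
  "cvB M xe m T = concat (map (\<lambda>j. concat (map (\<lambda>w. concat (map (\<lambda>c.
       map (\<lambda>b. ((2, j, 0, w), [((1, T, T + j), c), ((2, 0, j), b)]))
         (filter (\<lambda>b. b = [0] \<or> nthd 0 c (tm_tapes M - 1) = 2) [[0], [1]]))
       (domC M xe m T T (T + j)))) [0..<T + 2])) [0..<T + 1])"

text \<open>The soft constraint that rewards a claim. Bit 0 will be the verdict, so
  \<open>cvS 0\<close> is the \<open>\<beta>\<close> of the gadget.\<close>

definition cvS :: "nat \<Rightarrow> cvt" where "cvS j = ((1, j, 0, 0), [((2, 0, j), [1])])"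

text \<open>An unsatisfiable partial assignment: its vertex is adjacent to some copy of every value of \<open>v\<close>,
  which keeps the degrees of these copies high enough for the greedy heuristic.\<close>

definition cvD :: "var \<Rightarrow> cvt" where "cvD v = ((3, v), [(v, []), (v, [1])])"

definition cvs :: "tm \<Rightarrow> word \<Rightarrow> nat \<Rightarrow> nat \<Rightarrow> cvt list" where
  "cvs M xe m T = cvA M xe m T @ cvB M xe m T @ map cvS [0..<T + 1] @ map cvD (tvars T)"

lemma set_domD: "set (domD M T t) = (if t = 0 then {0 # ss @ replicate (tm_tapes M) T | ss. length ss = tm_tapes M \<and> set ss \<subseteq> {..<tm_symbols M}}
   else {q # ss @ hs | q ss hs. q \<le> tm_states M \<and> length ss = tm_tapes M \<and> set ss \<subseteq> {..<tm_symbols M} \<and>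
     length hs = tm_tapes M \<and> set hs \<subseteq> {..2 * T}})"
  unfolding domD_def by (auto simp: set_n_lists image_iff less_Suc_eq_le atLeast0LessThan lessThan_Suc_atMost simp del: upt_Suc)

lemma set_tvars: "set (tvars T) = {(0, t, 0) | t. t \<le> T} \<union> {(1, t, p) | t p. t \<le> T \<and> p \<le> 2 * T} \<union> {(2, 0, j) | j. j \<le> T}"
  unfolding tvars_def by (auto simp: image_iff less_Suc_eq_le simp del: upt_Suc)

lemma cvA_I:
  assumes "t < T" "pos \<le> 2 * T" "w < T + 2" "d \<in> set (domD M T t)" "d' \<in> set (domD M T (Suc t))"
    "c \<in> set (domC M xe m T t pos)" "c' \<in> set (domC M xe m T (Suc t) pos)" "trel M pos d d' c c'"
  shows "((0, t, pos, w), [((0, t, 0), d), ((0, Suc t, 0), d'), ((1, t, pos), c), ((1, Suc t, pos), c')]) \<in> set (cvA M xe m T)"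
  unfolding cvA_def set_concat set_map image_image set_filter set_upt
  by (rule UN_I[of t], use assms in simp, rule UN_I[of pos], use assms in simp, rule UN_I[of w], use assms in simp,
    rule UN_I[of d], use assms in simp, rule UN_I[of d'], use assms in simp, rule UN_I[of c], use assms in simp,
    rule image_eqI[of _ _ c'], use assms in simp_all)

lemma cvA_E:
  assumes "z \<in> set (cvA M xe m T)"
  obtains t pos w d d' c c' where
    "z = ((0, t, pos, w), [((0, t, 0), d), ((0, Suc t, 0), d'), ((1, t, pos), c), ((1, Suc t, pos), c')])"
    "t < T" "pos \<le> 2 * T" "w < T + 2" "d \<in> set (domD M T t)" "d' \<in> set (domD M T (Suc t))"
    "c \<in> set (domC M xe m T t pos)" "c' \<in> set (domC M xe m T (Suc t) pos)" "trel M pos d d' c c'"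
  using assms unfolding cvA_def set_concat set_map image_image set_filter set_upt
  by (elim UN_E imageE CollectE conjE) (rule that, simp_all)

lemma cvB_I:
  assumes "j \<le> T" "w < T + 2" "c \<in> set (domC M xe m T T (T + j))" "b \<in> {[0], [1]}"
    "b = [0] \<or> nthd 0 c (tm_tapes M - 1) = 2"
  shows "((2, j, 0, w), [((1, T, T + j), c), ((2, 0, j), b)]) \<in> set (cvB M xe m T)"
  unfolding cvB_def set_concat set_map image_image set_filter set_upt
  by (rule UN_I[of j], use assms in simp, rule UN_I[of w], use assms in simp, rule UN_I[of c], use assms in simp,
    rule image_eqI[of _ _ b], use assms in simp_all)

lemma cvB_E:
  assumes "z \<in> set (cvB M xe m T)"
  obtains j w c b where "z = ((2, j, 0, w), [((1, T, T + j), c), ((2, 0, j), b)])"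
    "j \<le> T" "w < T + 2" "c \<in> set (domC M xe m T T (T + j))" "b \<in> {[0], [1]}"
    "b = [0] \<or> nthd 0 c (tm_tapes M - 1) = 2"
  using assms unfolding cvB_def set_concat set_map image_image set_filter set_upt
  by (elim UN_E imageE CollectE conjE) (rule that, simp_all)

lemma trel_at:
  assumes "trel M pos d d' c c'" "i < tm_tapes M"
  shows "nthd 0 (dhs M d') i + 1 = nthd 0 (dhs M d) i + snd (nthd (0, 0) (snd (nxt M (dq d, dss M d))) i) \<and>
    (if nthd 0 (dhs M d) i = pos
     then nthd 0 c i = nthd 0 (dss M d) i \<and> nthd 0 c' i = fst (nthd (0, 0) (snd (nxt M (dq d, dss M d))) i)
     else nthd 0 c' i = nthd 0 c i)"
proof -
  have "i \<in> set [0..<tm_tapes M]" using assms(2) by simp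
  then show ?thesis using assms(1) unfolding trel_def by blast
qed

section \<open>Soundness and completeness of the tableau\<close>

locale tableau =
  fixes M :: tm and xe :: word and m T :: nat
  assumes vM: "valid_tm M" and big: "length xe + m \<le> T"
begin

abbreviation "k \<equiv> tm_tapes M"

definition cfg :: "word \<Rightarrow> nat \<Rightarrow> config" where "cfg w t = (tm_step M ^^ t) (tm_init M (xe @ w))"

lemma k1: "k \<ge> 1" and sy3: "tm_symbols M \<ge> 3" using vM by (auto simp: valid_tm_def)

lemma cfg_inv: "length w = m \<Longrightarrow> t \<le> T \<Longrightarrow> cinv M T t (cfg w t)"
  unfolding cfg_def using cinv_steps[OF vM, of "xe @ w" T t] big by simp

text \<open>Also covers a halted machine: there \<open>nxt\<close> rewrites the scanned symbols with
  the move code 1, which is the move 0, so the configuration repeats.\<close>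

lemma nxt_step:
  assumes c: "cinv M N n (q, ts)" and s: "tm_step M (q, ts) = (q', ts')"
  shows "fst (nxt M (q, scan ts)) = q'" "length (snd (nxt M (q, scan ts))) = k"
    "\<And>i. i < k \<Longrightarrow> fst (ts' ! i) = (fst (ts ! i))(snd (ts ! i) := fst (snd (nxt M (q, scan ts)) ! i))"
    "\<And>i. i < k \<Longrightarrow> int (snd (snd (nxt M (q, scan ts)) ! i)) = snd (ts' ! i) - snd (ts ! i) + 1"
proof -
  have l: "length ts = k" "q \<le> tm_states M" using c by (auto simp: cinv_def)
  have "fst (nxt M (q, scan ts)) = q' \<and> length (snd (nxt M (q, scan ts))) = k \<and>
    (\<forall>i<k. fst (ts' ! i) = (fst (ts ! i))(snd (ts ! i) := fst (snd (nxt M (q, scan ts)) ! i)) \<and>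
      int (snd (snd (nxt M (q, scan ts)) ! i)) = snd (ts' ! i) - snd (ts ! i) + 1)"
  proof (cases "q < tm_states M")
    case True
    obtain q2 as where t: "tm_trans M q (scan ts) = (q2, as)" by fastforce
    note st = tm_step_simps[OF vM c True t]
    have n: "nxt M (q, scan ts) = (q2, map (\<lambda>(s, m). (s, nat (m + 1))) as)"
      using st True by (simp add: nxt_def intab_def tabc_def tabdom_def tab_def t)
    have mv: "snd (as ! i) \<in> {-1, 0, 1}" if "i < k" for i
    proof -
      have "as ! i \<in> set as" using that st(4) by simp
      then have "as ! i \<in> {..<tm_symbols M} \<times> {-1, 0, 1}" using st(5) by (rule rev_subsetD)
      then show ?thesis by (simp add: mem_Times_iff)
    qed
    have e: "q' = q2" "ts' = act ts as" using s st(6) by simp_all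
    show ?thesis unfolding n e
    proof (intro conjI allI impI)
      fix i assume i: "i < k"
      then show "fst (act ts as ! i) = (fst (ts ! i))(snd (ts ! i) :=
          fst (snd (q2, map (\<lambda>(s, m). (s, nat (m + 1))) as) ! i))"
        using l(1) st(4) by (simp add: act_nth2 case_prod_unfold)
      show "int (snd (snd (q2, map (\<lambda>(s, m). (s, nat (m + 1))) as) ! i)) = snd (act ts as ! i) - snd (ts ! i) + 1"
        using i l(1) st(4) mv[OF i] by (auto simp: act_nth2 case_prod_unfold)
    qed (use st(4) in simp_all)
  next
    case False
    then have "ts' = ts" "q' = q" using s by (auto simp: tm_step_def)
    moreover have "nxt M (q, scan ts) = (q, map (\<lambda>s. (s, 1)) (scan ts))"
      using False by (simp add: nxt_def intab_def tabdom_def)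
    ultimately show ?thesis using l by (auto simp: scan_nth scan_def[THEN arg_cong, of length])
  qed
  then show "fst (nxt M (q, scan ts)) = q'" "length (snd (nxt M (q, scan ts))) = k"
    "\<And>i. i < k \<Longrightarrow> fst (ts' ! i) = (fst (ts ! i))(snd (ts ! i) := fst (snd (nxt M (q, scan ts)) ! i))"
    "\<And>i. i < k \<Longrightarrow> int (snd (snd (nxt M (q, scan ts)) ! i)) = snd (ts' ! i) - snd (ts ! i) + 1" by blast+
qed

definition hard :: "(var \<Rightarrow> nat list) \<Rightarrow> bool" where
  "hard \<sigma> \<longleftrightarrow> (\<forall>t<T. \<forall>pos\<le>2 * T. trel M pos (\<sigma> (0, t, 0)) (\<sigma> (0, Suc t, 0)) (\<sigma> (1, t, pos)) (\<sigma> (1, Suc t, pos))) \<and>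
     (\<forall>j\<le>T. \<sigma> (2, 0, j) = [0] \<or> nthd 0 (\<sigma> (1, T, T + j)) (k - 1) = 2)"

abbreviation tval :: "(var \<Rightarrow> nat list) \<Rightarrow> bool" where
  "tval \<sigma> \<equiv> (\<forall>v\<in>set (tvars T). \<sigma> v \<in> set (tdom M xe m T v))"

definition outbit :: "word \<Rightarrow> nat \<Rightarrow> bool" where
  "outbit w j \<longleftrightarrow> fst (last (snd (cfg w T))) (int j) = 2"

lemma init_tapes:
  assumes "i < k" shows "snd (tm_init M u) ! i = (word_tape (if i = 0 then u else []), 0)"
  using assms by (auto simp: tm_init_def nth_Cons')

text \<open>The guess is read off the free cells at time 0; by induction over time the hard
  constraints force the variables to describe the run on it. Claims may understate the output but
  never overstate it.\<close>

lemma tableau_sound: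
  assumes v: "tval \<sigma>" and h: "hard \<sigma>"
  obtains w where "length w = m" "\<forall>j\<le>T. \<sigma> (2, 0, j) \<noteq> [0] \<longrightarrow> outbit w j"
proof -
  define w where "w = map (\<lambda>j. nthd 0 (\<sigma> (1, 0, T + length xe + j)) 0 = 2) [0..<m]"
  have lw: "length w = m" by (simp add: w_def)
  define inv where "inv t \<longleftrightarrow> dq (\<sigma> (0, t, 0)) = fst (cfg w t) \<and>
    (\<forall>i<k. int (nthd 0 (dhs M (\<sigma> (0, t, 0))) i) = snd (snd (cfg w t) ! i) + int T) \<and>
    (\<forall>i<k. \<forall>pos\<le>2 * T. nthd 0 (\<sigma> (1, t, pos)) i = fst (snd (cfg w t) ! i) (int pos - int T))" for t
  have "inv t" if "t \<le> T" for t
    using that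
  proof (induction t)
    case 0
    have "(0, 0, 0) \<in> set (tvars T)" by (auto simp: set_tvars)
    then have "\<sigma> (0, 0, 0) \<in> set (domD M T 0)" using v by (auto simp: tdom_def)
    then obtain ss where ss: "\<sigma> (0, 0, 0) = 0 # ss @ replicate k T" "length ss = k" by (auto simp: set_domD)
    have c: "nthd 0 (\<sigma> (1, 0, pos)) i = word_tape (if i = 0 then xe @ w else []) (int pos - int T)" if i: "i < k" and pos: "pos \<le> 2 * T" for i pos
    proof -
      have "(1, 0, pos) \<in> set (tvars T)" using pos by (auto simp: set_tvars)
      then have "\<sigma> (1, 0, pos) \<in> set (domC M xe m T 0 pos)" using v by (auto simp: tdom_def)
      then obtain s where s: "\<sigma> (1, 0, pos) = s # replicate (k - 1) 0" "s \<in> set (cell0 xe m T pos)" by (auto simp: domC_def)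
      show ?thesis
      proof (cases "i = 0")
        case False
        then show ?thesis using s i by (auto simp: nthd_def word_tape_def nth_Cons')
      next
        case True
        have s0: "nthd 0 (\<sigma> (1, 0, pos)) i = s" using s True by (simp add: nthd_def)
        consider "pos < T \<or> T + length xe + m \<le> pos" | "T \<le> pos" "pos < T + length xe" | "T + length xe \<le> pos" "pos < T + length xe + m"
          by linarith
        then show ?thesis
        proof cases
          case 1 then show ?thesis using s s0 True lw by (auto simp: cell0_def word_tape_def)
        next
          case 2
          then have "nat (int pos - int T) = pos - T" "pos - T < length xe" by linarith+
          then show ?thesis using s s0 True lw 2 by (auto simp: cell0_def word_tape_def nth_append)
        next
          case 3
          define j where "j = pos - T - length xe"
          have j: "nat (int pos - int T) = length xe + j" "j < m" "pos = T + length xe + j" using 3 by (auto simp: j_def)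
          have "w ! j \<longleftrightarrow> s = 2" using j s0 True by (simp add: w_def)
          moreover have "s \<in> {1, 2}" using s(2) 3 by (auto simp: cell0_def)
          ultimately show ?thesis using s0 True lw j(1,2) 3 by (auto simp: word_tape_def nth_append j(1))
        qed
      qed
    qed
    have "dq (\<sigma> (0, 0, 0)) = 0" "dhs M (\<sigma> (0, 0, 0)) = replicate k T" using ss by (auto simp: dq_def dhs_def)
    then show ?case using c unfolding inv_def by (auto simp: cfg_def init_tapes) (simp add: tm_init_def)
  next
    case (Suc t)
    obtain q ts where ct: "cfg w t = (q, ts)" by fastforce
    obtain q' ts' where ct': "cfg w (Suc t) = (q', ts')" by fastforce
    have st: "tm_step M (q, ts) = (q', ts')" using ct ct' by (simp add: cfg_def)
    have ci: "cinv M T t (q, ts)" using cfg_inv[OF lw, of t] Suc.prems ct by simp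
    have I: "dq (\<sigma> (0, t, 0)) = q" "\<And>i. i < k \<Longrightarrow> int (nthd 0 (dhs M (\<sigma> (0, t, 0))) i) = snd (ts ! i) + int T"
      "\<And>i pos. i < k \<Longrightarrow> pos \<le> 2 * T \<Longrightarrow> nthd 0 (\<sigma> (1, t, pos)) i = fst (ts ! i) (int pos - int T)"
      using Suc ct by (auto simp: inv_def)
    have rel: "trel M pos (\<sigma> (0, t, 0)) (\<sigma> (0, Suc t, 0)) (\<sigma> (1, t, pos)) (\<sigma> (1, Suc t, pos))" if "pos \<le> 2 * T" for pos
      using h Suc.prems that by (auto simp: hard_def)
    have "(0, t, 0) \<in> set (tvars T)" using Suc.prems by (auto simp: set_tvars)
    then have "\<sigma> (0, t, 0) \<in> set (domD M T t)" using v by (auto simp: tdom_def)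
    then have lss: "length (dss M (\<sigma> (0, t, 0))) = k" by (auto simp: set_domD dss_def split: if_splits)
    \<comment> \<open>The relation for the cell under head \<open>i\<close> compels the claimed
      scanned symbol to be the true one; the head has not left the window, so such a cell
      exists.\<close>
    have ss: "dss M (\<sigma> (0, t, 0)) = scan ts"
    proof (rule nth_equalityI)
      show "length (dss M (\<sigma> (0, t, 0))) = length (scan ts)" using lss ci by (simp add: cinv_def scan_def)
      fix i assume "i < length (dss M (\<sigma> (0, t, 0)))"
      then have i: "i < k" using lss by simp
      define pos where "pos = nthd 0 (dhs M (\<sigma> (0, t, 0))) i"
      have h: "\<bar>snd (ts ! i)\<bar> \<le> int t" using ci i by (auto simp: cinv_def)
      then have pos: "pos \<le> 2 * T" "int pos = snd (ts ! i) + int T" using I(2)[OF i] Suc.prems by (auto simp: pos_def)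
      have "nthd 0 (\<sigma> (1, t, pos)) i = nthd 0 (dss M (\<sigma> (0, t, 0))) i"
        using trel_at[OF rel[OF pos(1)] i] unfolding pos_def[symmetric] by simp
      then show "dss M (\<sigma> (0, t, 0)) ! i = scan ts ! i"
        using I(3)[OF i pos(1)] pos(2) lss i ci by (auto simp: scan_nth cinv_def)
    qed
    note nx = nxt_step[OF ci st]
    have lts: "length ts = k" using ci by (simp add: cinv_def)
    have R: "dq (\<sigma> (0, Suc t, 0)) = q'"
      "\<And>i. i < k \<Longrightarrow> nthd 0 (dhs M (\<sigma> (0, Suc t, 0))) i + 1 = nthd 0 (dhs M (\<sigma> (0, t, 0))) i + snd (snd (nxt M (q, scan ts)) ! i)"
      "\<And>i pos. i < k \<Longrightarrow> pos \<le> 2 * T \<Longrightarrow> nthd 0 (\<sigma> (1, Suc t, pos)) i =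
        (if nthd 0 (dhs M (\<sigma> (0, t, 0))) i = pos then fst (snd (nxt M (q, scan ts)) ! i) else nthd 0 (\<sigma> (1, t, pos)) i)"
    proof -
      show "dq (\<sigma> (0, Suc t, 0)) = q'" using rel[of 0] nx(1) by (simp add: trel_def I(1) ss)
      show "nthd 0 (dhs M (\<sigma> (0, Suc t, 0))) i + 1 = nthd 0 (dhs M (\<sigma> (0, t, 0))) i + snd (snd (nxt M (q, scan ts)) ! i)"
        if "i < k" for i using trel_at[OF rel[of 0] that] nx(2) that by (simp add: I(1) ss)
      show "nthd 0 (\<sigma> (1, Suc t, pos)) i =
        (if nthd 0 (dhs M (\<sigma> (0, t, 0))) i = pos then fst (snd (nxt M (q, scan ts)) ! i) else nthd 0 (\<sigma> (1, t, pos)) i)"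
        if "i < k" "pos \<le> 2 * T" for i pos using trel_at[OF rel[OF that(2)] that(1)] nx(2) that(1) by (auto simp: I(1) ss split: if_splits)
    qed
    have "int (nthd 0 (dhs M (\<sigma> (0, Suc t, 0))) i) = snd (ts' ! i) + int T" if "i < k" for i
      using R(2)[OF that] I(2)[OF that] nx(4)[OF that] by linarith
    moreover have "nthd 0 (\<sigma> (1, Suc t, pos)) i = fst (ts' ! i) (int pos - int T)" if i: "i < k" "pos \<le> 2 * T" for i pos
    proof -
      have "nthd 0 (dhs M (\<sigma> (0, t, 0))) i = pos \<longleftrightarrow> int pos - int T = snd (ts ! i)" using I(2)[OF i(1)] by linarith
      then show ?thesis using R(3)[OF i] I(3)[OF i] nx(3)[OF i(1)] by simp
    qed
    ultimately show ?case using R(1) unfolding inv_def ct' by simp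
  qed
  then have iT: "inv T" by simp
  have "outbit w j" if j: "j \<le> T" "\<sigma> (2, 0, j) \<noteq> [0]" for j
  proof -
    have "nthd 0 (\<sigma> (1, T, T + j)) (k - 1) = 2" using h j by (auto simp: hard_def)
    moreover have "k - 1 < k" "T + j \<le> 2 * T" using k1 j by auto
    ultimately have "fst (snd (cfg w T) ! (k - 1)) (int (T + j) - int T) = 2" using iT unfolding inv_def by metis
    moreover have "last (snd (cfg w T)) = snd (cfg w T) ! (k - 1)"
      using cfg_inv[OF lw, of T] k1 by (intro trans[OF last_conv_nth]) (auto simp: cinv_def)
    ultimately show ?thesis by (simp add: outbit_def)
  qed
  then show thesis using that lw by blast
qed

definition run :: "word \<Rightarrow> var \<Rightarrow> nat list" where
  "run w v = (if fst v = 0 then fst (cfg w (fst (snd v))) # scan (snd (cfg w (fst (snd v)))) @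
       map (\<lambda>z. nat (snd z + int T)) (snd (cfg w (fst (snd v))))
     else if fst v = 1 then map (\<lambda>z. fst z (int (snd (snd v)) - int T)) (snd (cfg w (fst (snd v))))
     else if outbit w (snd (snd v)) then [1] else [0])"

lemma tableau_complete:
  assumes lw: "length w = m"
  shows "tval (run w)" "hard (run w)" "\<And>j. run w (2, 0, j) = (if outbit w j then [1] else [0])"
proof -
  have ci: "cinv M T t (cfg w t)" if "t \<le> T" for t using cfg_inv[OF lw that] .
  have L: "length (snd (cfg w t)) = k" if "t \<le> T" for t using ci[OF that] by (simp add: cinv_def)
  have sy: "set (scan (snd (cfg w t))) \<subseteq> {..<tm_symbols M}" if "t \<le> T" for t
    using ci[OF that] by (auto simp: cinv_def scan_def set_conv_nth case_prod_unfold)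
  have hd: "\<bar>snd (snd (cfg w t) ! i)\<bar> \<le> int t" if "t \<le> T" "i < k" for t i using ci[OF that(1)] that(2) by (simp add: cinv_def)
  have it: "snd (cfg w 0) = map (\<lambda>i. (word_tape (if i = 0 then xe @ w else []), 0)) [0..<k]"
    using L[of 0] by (intro nth_equalityI) (auto simp: cfg_def init_tapes)
  show "tval (run w)"
  proof
    fix v assume "v \<in> set (tvars T)"
    then consider t where "v = (0, t, 0)" "t \<le> T" | t p where "v = (1, t, p)" "t \<le> T" "p \<le> 2 * T" | j where "v = (2, 0, j)" "j \<le> T"
      by (auto simp: set_tvars)
    then show "run w v \<in> set (tdom M xe m T v)"
    proof cases
      case 1
      let ?c = "cfg w t" let ?hs = "map (\<lambda>z. nat (snd z + int T)) (snd ?c)"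
      have ls: "length (scan (snd ?c)) = k" using L[OF 1(2)] by (simp add: scan_def)
      show ?thesis
      proof (cases "t = 0")
        case True
        have "?hs = replicate k T" unfolding True it by (simp add: comp_def map_replicate_const)
        moreover have "fst ?c = 0" unfolding True by (simp add: cfg_def tm_init_def)
        ultimately show ?thesis using 1 True ls sy[OF 1(2)] by (auto simp: tdom_def run_def set_domD)
      next
        case False
        have "set ?hs \<subseteq> {..2 * T}"
        proof
          fix y assume "y \<in> set ?hs"
          then obtain i where "i < k" "y = nat (snd (snd ?c ! i) + int T)" using L[OF 1(2)] by (auto simp: set_conv_nth)
          then show "y \<in> {..2 * T}" using hd[OF 1(2), of i] 1(2) by auto
        qed
        moreover have "fst ?c \<le> tm_states M" using ci[OF 1(2)] by (simp add: cinv_def)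
        moreover have "length ?hs = k" using L[OF 1(2)] by simp
        ultimately have "fst ?c # scan (snd ?c) @ ?hs \<in> set (domD M T t)"
          unfolding set_domD if_not_P[OF False] using ls sy[OF 1(2)] by blast
        then show ?thesis using 1 by (simp add: tdom_def run_def)
      qed
    next
      case 2
      show ?thesis
      proof (cases "t = 0")
        case True
        have "map (\<lambda>z. fst z (int p - int T)) (snd (cfg w 0)) = word_tape (xe @ w) (int p - int T) # replicate (k - 1) 0"
          unfolding it using k1 by (intro nth_equalityI) (auto simp: nth_Cons' word_tape_def)
        moreover have "word_tape (xe @ w) (int p - int T) \<in> set (cell0 xe m T p)"
        proof -
          consider "p < T \<or> T + length xe + m \<le> p" | "T \<le> p" "p < T + length xe" | "T + length xe \<le> p" "p < T + length xe + m"
            by linarith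
          then show ?thesis
          proof cases
            case 1 then show ?thesis using lw by (auto simp: cell0_def word_tape_def)
          next
            case 2
            then have "nat (int p - int T) = p - T" "p - T < length xe" by linarith+
            then show ?thesis using 2 lw by (auto simp: cell0_def word_tape_def nth_append)
          next
            case 3 then show ?thesis using lw by (auto simp: cell0_def word_tape_def)
          qed
        qed
        ultimately show ?thesis using 2 True by (simp add: tdom_def run_def domC_def)
      next
        case False
        have "set (map (\<lambda>z. fst z (int p - int T)) (snd (cfg w t))) \<subseteq> {..<tm_symbols M}"
          using ci[OF 2(2)] by (auto simp: cinv_def set_conv_nth)
        then show ?thesis using 2 False L[OF 2(2)] by (auto simp: tdom_def run_def domC_def set_n_lists)
      qed
    next
      case 3 then show ?thesis by (auto simp: tdom_def run_def)
    qed
  qed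
  show o: "run w (2, 0, j) = (if outbit w j then [1] else [0])" for j by (simp add: run_def)
  show "hard (run w)" unfolding hard_def
  proof (intro conjI allI impI)
    fix j assume j: "j \<le> T"
    have "run w (1, T, T + j) ! (k - 1) = fst (snd (cfg w T) ! (k - 1)) (int j)"
      using L[of T] k1 by (simp add: run_def)
    moreover have "last (snd (cfg w T)) = snd (cfg w T) ! (k - 1)"
      using L[of T] k1 by (intro trans[OF last_conv_nth]) auto
    moreover have "nthd 0 (run w (1, T, T + j)) (k - 1) = run w (1, T, T + j) ! (k - 1)"
      using L[of T] k1 by (simp add: run_def)
    ultimately show "run w (2, 0, j) = [0] \<or> nthd 0 (run w (1, T, T + j)) (k - 1) = 2"
      by (simp add: o outbit_def)
  next
    fix t pos assume t: "t < T" and pos: "pos \<le> 2 * T"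
    obtain q ts where ct: "cfg w t = (q, ts)" by fastforce
    obtain q' ts' where ct': "cfg w (Suc t) = (q', ts')" by fastforce
    have st: "tm_step M (q, ts) = (q', ts')" using ct ct' by (simp add: cfg_def)
    have cc: "cinv M T t (q, ts)" using ci[of t] t ct by simp
    have l: "length ts = k" "length ts' = k" using L[of t] L[of "Suc t"] t ct ct' by auto
    note nx = nxt_step[OF cc st]
    have ls: "length (scan ts) = k" using l by (simp add: scan_def)
    have a: "dq (run w (0, t, 0)) = q" "dss M (run w (0, t, 0)) = scan ts"
      "dhs M (run w (0, t, 0)) = map (\<lambda>z. nat (snd z + int T)) ts"
      "dq (run w (0, Suc t, 0)) = q'" "dhs M (run w (0, Suc t, 0)) = map (\<lambda>z. nat (snd z + int T)) ts'"
      "run w (1, t, pos) = map (\<lambda>z. fst z (int pos - int T)) ts"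
      "run w (1, Suc t, pos) = map (\<lambda>z. fst z (int pos - int T)) ts'"
      using ls l by (auto simp: run_def ct ct' dq_def dss_def dhs_def scan_def)
    have "nat (snd (ts' ! i) + int T) + 1 = nat (snd (ts ! i) + int T) + snd (snd (nxt M (q, scan ts)) ! i)" if "i < k" for i
      using nx(4)[OF that] hd[of t i] hd[of "Suc t" i] t that by (simp add: ct ct')
    moreover have "nat (snd (ts ! i) + int T) = pos \<longleftrightarrow> int pos - int T = snd (ts ! i)" if "i < k" for i
      using hd[of t i] t that by (auto simp: ct)
    ultimately show "trel M pos (run w (0, t, 0)) (run w (0, Suc t, 0)) (run w (1, t, pos)) (run w (1, Suc t, pos))"
      unfolding trel_def a using nx l ls by (auto simp: scan_nth)
  qed
qed

end

text \<open>The scope computed from the identifier alone, whence constraints with equal identifiers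
  have equal scopes, as the locale \<open>csp\<close> demands.\<close>

fun sc :: "nat \<Rightarrow> cid \<Rightarrow> var list" where
  "sc T (a, b, c, d) = (if a = 0 then [(0, b, 0), (0, Suc b, 0), (1, b, c), (1, Suc b, c)]
     else if a = 2 then [(1, T, T + b), (2, 0, b)] else if a = 1 then [(2, 0, b)] else [(b, c, d), (b, c, d)])"

section \<open>The tableau as an instance of the constraint graph\<close>

context tableau
begin

abbreviation "CVt \<equiv> set (cvs M xe m T)"
abbreviation "Vst \<equiv> set (tvars T)"
abbreviation "domt \<equiv> (\<lambda>v. set (tdom M xe m T v))"

lemma cvs_cases:
  assumes "z \<in> CVt"
  obtains (A) "z \<in> set (cvA M xe m T)" | (B) "z \<in> set (cvB M xe m T)"
    | (S) j where "z = cvS j" "j \<le> T" | (D) v where "z = cvD v" "v \<in> Vst"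
proof -
  have "z \<in> set (cvA M xe m T) \<or> z \<in> set (cvB M xe m T) \<or> z \<in> cvS ` {0..<T + 1} \<or> z \<in> cvD ` Vst"
    using assms by (simp add: cvs_def del: upt_Suc)
  then show thesis using A B S D by fastforce
qed

lemma tag_simps: "fst (cvS j) = (1, j, 0, 0)" "fst (cvD v) = (3, v)" by (simp_all add: cvS_def cvD_def)

lemma cvs_scope: assumes "z \<in> CVt" shows "map fst (snd z) = sc T (fst z)" "set (sc T (fst z)) \<subseteq> Vst"
proof -
  have "map fst (snd z) = sc T (fst z) \<and> set (sc T (fst z)) \<subseteq> Vst"
    using assms
  proof (cases rule: cvs_cases)
    case A then show ?thesis by (rule cvA_E) (auto simp: set_tvars)
  next
    case B then show ?thesis by (rule cvB_E) (auto simp: set_tvars)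
  next
    case (S j) then show ?thesis by (auto simp: cvS_def set_tvars)
  next
    case (D v) then show ?thesis by (cases v) (auto simp: cvD_def set_tvars)
  qed
  then show "map fst (snd z) = sc T (fst z)" "set (sc T (fst z)) \<subseteq> Vst" by blast+
qed

lemma csp_tab:
  assumes "(\<Sum>v\<in>Vst. card (domt v)) < n" shows "csp Vst domt CVt n"
proof
  show "domt v \<noteq> {}" if "v \<in> Vst" for v
    using tableau_complete(1)[of "replicate m False"] that by auto
  show "CVt \<noteq> {}" "Vst \<noteq> {}" by (auto simp: cvs_def tvars_def)
  show "map fst (snd cv) = map fst (snd cv')" if "cv \<in> CVt" "cv' \<in> CVt" "fst cv = fst cv'" for cv cv'
    using cvs_scope(1)[OF that(1)] cvs_scope(1)[OF that(2)] that(3) by simp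
  show "\<exists>cv\<in>CVt. \<forall>a. conf v a cv" if "v \<in> Vst" for v
  proof (rule bexI[of _ "cvD v"])
    show "cvD v \<in> CVt" using that by (simp add: cvs_def)
    show "\<forall>a. conf v a (cvD v)" by (auto simp: conf_def cvD_def)
  qed
  show "fst ` set (snd cv) \<subseteq> Vst" if "cv \<in> CVt" for cv
    using cvs_scope[OF that] by (metis set_map)
qed (use assms in auto)

section \<open>Weighing hard constraints against output claims\<close>

definition HB :: "(nat \<times> nat \<times> nat) set" where
  "HB = {0} \<times> {..<T} \<times> {..2 * T} \<union> {2} \<times> {..T} \<times> {0}"

definition hsat :: "(var \<Rightarrow> nat list) \<Rightarrow> nat \<times> nat \<times> nat \<Rightarrow> bool" where
  "hsat \<sigma> z \<longleftrightarrow> (if fst z = 0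
     then trel M (snd (snd z)) (\<sigma> (0, fst (snd z), 0)) (\<sigma> (0, Suc (fst (snd z)), 0)) (\<sigma> (1, fst (snd z), snd (snd z)))
       (\<sigma> (1, Suc (fst (snd z)), snd (snd z)))
     else \<sigma> (2, 0, fst (snd z)) = [0] \<or> nthd 0 (\<sigma> (1, T, T + fst (snd z))) (k - 1) = 2)"

definition HS :: "(var \<Rightarrow> nat list) \<Rightarrow> (nat \<times> nat \<times> nat) set" where
  "HS \<sigma> = {z \<in> HB. hsat \<sigma> z}"

definition ones :: "(var \<Rightarrow> nat list) \<Rightarrow> nat set" where
  "ones \<sigma> = {j. j \<le> T \<and> \<sigma> (2, 0, j) = [1]}"

definition outs :: "word \<Rightarrow> nat set" where "outs w = {j. j \<le> T \<and> outbit w j}"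

lemma fin_HB: "finite HB" by (simp add: HB_def)
lemma fin_HS: "finite (HS \<sigma>)" using fin_HB by (simp add: HS_def)
lemma fin_ones: "finite (ones \<sigma>)" "finite (outs w)" by (simp_all add: ones_def outs_def)

lemma hard_HS: "hard \<sigma> \<longleftrightarrow> HS \<sigma> = HB"
proof -
  have "hsat \<sigma> z" if h: "hard \<sigma>" and z: "z \<in> HB" for z
  proof -
    consider t p where "z = (0, t, p)" "t < T" "p \<le> 2 * T" | j where "z = (2, j, 0)" "j \<le> T"
      using z by (auto simp: HB_def)
    then show ?thesis by cases (use h in \<open>auto simp: hard_def hsat_def\<close>)
  qed
  moreover have "hard \<sigma>" if h: "\<forall>z\<in>HB. hsat \<sigma> z"
    unfolding hard_def
  proof (intro conjI allI impI)
    fix t pos assume "t < T" "pos \<le> 2 * T"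
    then show "trel M pos (\<sigma> (0, t, 0)) (\<sigma> (0, Suc t, 0)) (\<sigma> (1, t, pos)) (\<sigma> (1, Suc t, pos))"
      using bspec[OF h, of "(0, t, pos)"] by (simp add: HB_def hsat_def)
  next
    fix j assume "j \<le> T"
    then show "\<sigma> (2, 0, j) = [0] \<or> nthd 0 (\<sigma> (1, T, T + j)) (k - 1) = 2"
      using bspec[OF h, of "(2, j, 0)"] by (simp add: HB_def hsat_def)
  qed
  ultimately show ?thesis unfolding HS_def by blast
qed

definition h4 :: "(nat \<times> nat \<times> nat) \<times> nat \<Rightarrow> cid" where
  "h4 z = (fst (fst z), fst (snd (fst z)), snd (snd (fst z)), snd z)"

definition Satt :: "(var \<Rightarrow> nat list) \<Rightarrow> cvt set" where "Satt \<sigma> = {cv \<in> CVt. satcv \<sigma> cv}"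

lemma dom_at:
  assumes "tval \<sigma>"
  shows "t \<le> T \<Longrightarrow> \<sigma> (0, t, 0) \<in> set (domD M T t)"
    "t \<le> T \<Longrightarrow> p \<le> 2 * T \<Longrightarrow> \<sigma> (1, t, p) \<in> set (domC M xe m T t p)"
    "j \<le> T \<Longrightarrow> \<sigma> (2, 0, j) \<in> {[0], [1]}"
proof -
  show "t \<le> T \<Longrightarrow> \<sigma> (0, t, 0) \<in> set (domD M T t)"
    using bspec[OF assms, of "(0, t, 0)"] by (simp add: set_tvars tdom_def)
  show "t \<le> T \<Longrightarrow> p \<le> 2 * T \<Longrightarrow> \<sigma> (1, t, p) \<in> set (domC M xe m T t p)"
    using bspec[OF assms, of "(1, t, p)"] by (simp add: set_tvars tdom_def)
  show "j \<le> T \<Longrightarrow> \<sigma> (2, 0, j) \<in> {[0], [1]}"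
    using bspec[OF assms, of "(2, 0, j)"] by (simp add: set_tvars tdom_def)
qed

text \<open>A relation holds under an assignment iff the tuple of assigned values is one of its
  satisfying tuples, so satisfied elements can be counted by identifiers. The elements
  \<open>cvD v\<close> demand two values at once and never occur.\<close>

lemma fst_Satt:
  assumes v: "tval \<sigma>"
  shows "fst ` Satt \<sigma> = h4 ` (HS \<sigma> \<times> {..<T + 2}) \<union> (\<lambda>j. (1, j, 0, 0)) ` ones \<sigma>"
proof (rule equalityI; rule subsetI)
  fix c assume "c \<in> fst ` Satt \<sigma>"
  then obtain z where z: "z \<in> CVt" "satcv \<sigma> z" "c = fst z" by (auto simp: Satt_def)
  show "c \<in> h4 ` (HS \<sigma> \<times> {..<T + 2}) \<union> (\<lambda>j. (1, j, 0, 0)) ` ones \<sigma>"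
    using z(1)
  proof (cases rule: cvs_cases)
    case A
    then show ?thesis
    proof (rule cvA_E)
      fix t pos w d d' c1 c1'
      assume e: "z = ((0, t, pos, w), [((0, t, 0), d), ((0, Suc t, 0), d'), ((1, t, pos), c1), ((1, Suc t, pos), c1')])"
        "t < T" "pos \<le> 2 * T" "w < T + 2" "trel M pos d d' c1 c1'"
      then have "(0, t, pos) \<in> HS \<sigma>" using z(2) by (simp add: HS_def HB_def hsat_def satcv_def)
      moreover have "c = h4 ((0, t, pos), w)" using z(3) e(1) by (simp add: h4_def)
      ultimately show ?thesis using e(4) by blast
    qed
  next
    case B
    then show ?thesis
    proof (rule cvB_E)
      fix j w c1 b
      assume e: "z = ((2, j, 0, w), [((1, T, T + j), c1), ((2, 0, j), b)])" "j \<le> T" "w < T + 2"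
        "b = [0] \<or> nthd 0 c1 (k - 1) = 2"
      then have "(2, j, 0) \<in> HS \<sigma>" using z(2) by (simp add: HS_def HB_def hsat_def satcv_def)
      moreover have "c = h4 ((2, j, 0), w)" using z(3) e(1) by (simp add: h4_def)
      ultimately show ?thesis using e(3) by blast
    qed
  next
    case (S j)
    then have "j \<in> ones \<sigma>" "c = (1, j, 0, 0)" using z by (simp_all add: ones_def satcv_def cvS_def)
    then show ?thesis by blast
  next
    case (D v) then show ?thesis using z(2) by (auto simp: satcv_def cvD_def)
  qed
next
  fix c assume "c \<in> h4 ` (HS \<sigma> \<times> {..<T + 2}) \<union> (\<lambda>j. (1, j, 0, 0)) ` ones \<sigma>"
  then consider (a) t pos w where "c = (0, t, pos, w)" "(0, t, pos) \<in> HS \<sigma>" "w < T + 2"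
    | (b) j w where "c = (2, j, 0, w)" "(2, j, 0) \<in> HS \<sigma>" "w < T + 2"
    | (c) j where "c = (1, j, 0, 0)" "j \<in> ones \<sigma>"
    by (auto simp: h4_def HS_def HB_def)
  then show "c \<in> fst ` Satt \<sigma>"
  proof cases
    case a
    let ?z = "((0, t, pos, w), [((0, t, 0), \<sigma> (0, t, 0)), ((0, Suc t, 0), \<sigma> (0, Suc t, 0)), ((1, t, pos), \<sigma> (1, t, pos)),
      ((1, Suc t, pos), \<sigma> (1, Suc t, pos))])"
    have t: "t < T" "pos \<le> 2 * T" using a(2) by (auto simp: HS_def HB_def)
    have "?z \<in> set (cvA M xe m T)"
      by (rule cvA_I) (use a t dom_at[OF v] in \<open>auto simp: HS_def hsat_def\<close>)
    then have "?z \<in> Satt \<sigma>" by (simp add: Satt_def cvs_def satcv_def)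
    then show ?thesis using a(1) by (force intro: image_eqI[of _ _ ?z])
  next
    case b
    let ?z = "((2, j, 0, w), [((1, T, T + j), \<sigma> (1, T, T + j)), ((2, 0, j), \<sigma> (2, 0, j))])"
    have j: "j \<le> T" using b(2) by (auto simp: HS_def HB_def)
    have "?z \<in> set (cvB M xe m T)"
    proof (rule cvB_I[OF j b(3)])
      show "\<sigma> (1, T, T + j) \<in> set (domC M xe m T T (T + j))" using dom_at(2)[OF v, of T "T + j"] j by simp
      show "\<sigma> (2, 0, j) \<in> {[0], [1]}" using dom_at(3)[OF v j] .
      show "\<sigma> (2, 0, j) = [0] \<or> nthd 0 (\<sigma> (1, T, T + j)) (k - 1) = 2" using b(2) by (simp add: HS_def hsat_def)
    qed
    then have "?z \<in> Satt \<sigma>" by (simp add: Satt_def cvs_def satcv_def)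
    then show ?thesis using b(1) by (force intro: image_eqI[of _ _ ?z])
  next
    case c
    have "cvS j \<in> Satt \<sigma>" using c(2) by (auto simp: Satt_def cvs_def satcv_def cvS_def ones_def simp del: upt_Suc)
    then show ?thesis using c(1) tag_simps(1)[of j] by (metis image_eqI)
  qed
qed

lemma inj_Satt: "inj_on fst (Satt \<sigma>)"
proof (rule inj_onI)
  interpret csp Vst domt CVt "Suc (\<Sum>v\<in>Vst. card (domt v))" by (rule csp_tab) simp
  fix x y assume "x \<in> Satt \<sigma>" "y \<in> Satt \<sigma>" "fst x = fst y"
  then show "x = y" using sat_unique[of \<sigma> x y] unfolding Satt_def by blast
qed

lemma card_Satt:
  assumes v: "tval \<sigma>"
  shows "card (Satt \<sigma>) = card (HS \<sigma>) * (T + 2) + card (ones \<sigma>)"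
    "card (Satt \<sigma> - {cvS 0}) = card (HS \<sigma>) * (T + 2) + card (ones \<sigma> - {0})"
proof -
  let ?A = "h4 ` (HS \<sigma> \<times> {..<T + 2})" let ?s = "\<lambda>j. (1::nat, j::nat, 0::nat, 0::nat)"
  have iA: "inj_on h4 (HS \<sigma> \<times> {..<T + 2})" by (auto simp: inj_on_def h4_def)
  have cA: "card ?A = card (HS \<sigma>) * (T + 2)" using card_image[OF iA] by (simp add: card_cartesian_product)
  have fA: "finite ?A" using fin_HS by simp
  have t1: "fst z \<noteq> 1" if "z \<in> ?A" for z using that by (auto simp: h4_def HS_def HB_def)
  have d: "?A \<inter> ?s ` X = {}" for X using t1 by force
  have cs: "card (?s ` X) = card X" for X by (rule card_image) (auto simp: inj_on_def)
  have "card (Satt \<sigma>) = card (fst ` Satt \<sigma>)" using card_image[OF inj_Satt] by simp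
  also have "\<dots> = card ?A + card (?s ` ones \<sigma>)" unfolding fst_Satt[OF v] using fA fin_ones d by (intro card_Un_disjoint) auto
  finally show "card (Satt \<sigma>) = card (HS \<sigma>) * (T + 2) + card (ones \<sigma>)" unfolding cA cs .
  have "fst ` (Satt \<sigma> - {cvS 0}) = fst ` Satt \<sigma> - {?s 0}"
  proof -
    have "cvS 0 \<in> Satt \<sigma>" if "z \<in> Satt \<sigma>" "fst z = ?s 0" for z
    proof -
      have "z \<in> CVt" using that by (simp add: Satt_def)
      then have "z = cvS 0" using that(2) by (cases rule: cvs_cases) (auto elim!: cvA_E cvB_E simp: cvD_def cvS_def)
      then show ?thesis using that by simp
    qed
    then show ?thesis using inj_Satt[of \<sigma>] tag_simps(1)[of 0] unfolding inj_on_def by (auto simp: image_iff)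
  qed
  also have "\<dots> = ?A \<union> ?s ` (ones \<sigma> - {0})" unfolding fst_Satt[OF v] using t1[of "?s 0"] by auto
  finally have e: "fst ` (Satt \<sigma> - {cvS 0}) = ?A \<union> ?s ` (ones \<sigma> - {0})" .
  have "card (Satt \<sigma> - {cvS 0}) = card (fst ` (Satt \<sigma> - {cvS 0}))"
    using card_image[OF inj_on_subset[OF inj_Satt[of \<sigma>], of "Satt \<sigma> - {cvS 0}"]] by auto
  also have "\<dots> = card ?A + card (?s ` (ones \<sigma> - {0}))" unfolding e using fA fin_ones d by (intro card_Un_disjoint) auto
  finally show "card (Satt \<sigma> - {cvS 0}) = card (HS \<sigma>) * (T + 2) + card (ones \<sigma> - {0})" unfolding cA cs .
qed

text \<open>A violated hard constraint loses all its \<open>T + 2\<close> copies, while there are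
  only \<open>T + 1\<close> claims to gain.\<close>

lemma soft_less:
  assumes "\<not> hard \<sigma>" shows "card (HS \<sigma>) * (T + 2) + card (ones \<sigma>) < card HB * (T + 2)"
proof -
  have "HS \<sigma> \<subset> HB" using assms hard_HS by (auto simp: HS_def)
  then have "Suc (card (HS \<sigma>)) \<le> card HB" using psubset_card_mono[OF fin_HB] by (simp add: Suc_leI)
  then have "Suc (card (HS \<sigma>)) * (T + 2) \<le> card HB * (T + 2)" by (rule mult_le_mono1)
  moreover have "card (ones \<sigma>) \<le> card {..T}" by (rule card_mono) (auto simp: ones_def)
  ultimately show ?thesis by simp
qed

lemma tab_max:
  obtains w where "length w = m" "\<forall>w'. length w' = m \<longrightarrow> card (outs w') \<le> card (outs w)"
proof -
  have "card (outs w) \<le> T + 1" for w using card_mono[of "{..T}" "outs w"] by (auto simp: outs_def)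
  then have b: "\<forall>w. length w = m \<longrightarrow> card (outs w) < T + 2" by (simp add: le_imp_less_Suc)
  have "length (replicate m False) = m" by simp
  from ex_has_greatest_nat[OF this b] show thesis using that by blast
qed

text \<open>By \<open>soft_less\<close> the optimal assignments satisfy all hard constraints, so
  they correspond to the guesses with the most ones in the output. The claim \<open>cvS 0\<close>
  can be paid for within a minimum cover iff the output bits other than bit 0 of some guess already
  attain this maximum.\<close>

lemma tab_main:
  fixes n D v0 a0
  defines "BG \<equiv> mkg (csp.bV Vst domt CVt n v0 a0) badj"
  assumes n: "(\<Sum>v\<in>Vst. card (domt v)) < n" and D: "D \<ge> 2"
  shows "min_mdg BG = mvc BG"
    "mvc (mkg (zV (csp.bV Vst domt CVt n v0 a0) {(1, v0, a0, cvS 0, 0)} D) (zadj (\<lambda>x y. {x, y} \<in> snd BG))) = D + mvc BG +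
      (if \<exists>w. length w = m \<and> (\<forall>w'. length w' = m \<longrightarrow> card (outs w' - {0}) < card (outs w)) then 1 else 0)" (is "?l = ?r")
proof -
  interpret csp Vst domt CVt n v0 a0 by (rule csp_tab[OF n])
  have Sat: "Sat \<sigma> = Satt \<sigma>" for \<sigma> by (simp add: Sat_def Satt_def)
  obtain w where ww: "length w = m" "\<forall>w'. length w' = m \<longrightarrow> card (outs w') \<le> card (outs w)" by (rule tab_max)
  then have w: "length w = m" "\<And>w'. length w' = m \<Longrightarrow> card (outs w') \<le> card (outs w)" by blast+
  have run: "valid (run w)" "card (HS (run w)) = card HB" "ones (run w) = outs w" if "length w = m" for w
    using tableau_complete[OF that] hard_HS by (auto simp: valid_def ones_def outs_def)
  have sound: "\<exists>w. length w = m \<and> ones \<sigma> \<subseteq> outs w" if "valid \<sigma>" "hard \<sigma>" for \<sigma>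
  proof -
    have "tval \<sigma>" using that(1) by (simp add: valid_def)
    from this that(2) obtain w where "length w = m" "\<forall>j\<le>T. \<sigma> (2, 0, j) \<noteq> [0] \<longrightarrow> outbit w j"
      by (rule tableau_sound)
    then show ?thesis by (intro exI[of _ w]) (auto simp: ones_def outs_def)
  qed
  have vt: "tval \<sigma>" if "valid \<sigma>" for \<sigma> using that by (simp add: valid_def)
  have Smax: "card (Sat (run w)) = card HB * (T + 2) + card (outs w)"
    using card_Satt(1)[OF vt[OF run(1)[OF w(1)]]] run[OF w(1)] by (simp add: Sat)
  have max: "card (Sat \<tau>) \<le> card (Sat (run w))" if t: "valid \<tau>" for \<tau>
  proof (cases "hard \<tau>")
    case True
    obtain w' where w': "length w' = m" "ones \<tau> \<subseteq> outs w'" using sound[OF t True] by blast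
    have "card (ones \<tau>) \<le> card (outs w')" using w'(2) fin_ones by (intro card_mono)
    then show ?thesis using w(2)[OF w'(1)] Smax card_Satt(1)[OF vt[OF t]] True hard_HS by (simp add: Sat)
  next
    case False then show ?thesis using soft_less[OF False] Smax card_Satt(1)[OF vt[OF t]] by (simp add: Sat)
  qed
  show "min_mdg BG = mvc BG" unfolding BG_def using mvc_BG(2)[OF run(1)[OF w(1)] max] .
  have b: "cvS 0 \<in> CVt" by (simp add: cvs_def del: upt_Suc)
  have "(\<exists>\<tau>. valid \<tau> \<and> card (Sat (run w)) \<le> card (Sat \<tau> - {cvS 0})) \<longleftrightarrow> (\<exists>w'. length w' = m \<and> card (outs w) \<le> card (outs w' - {0}))"
  proof
    assume "\<exists>\<tau>. valid \<tau> \<and> card (Sat (run w)) \<le> card (Sat \<tau> - {cvS 0})"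
    then obtain \<tau> where t: "valid \<tau>" "card (Sat (run w)) \<le> card (Sat \<tau> - {cvS 0})" by blast
    have e: "card HB * (T + 2) + card (outs w) \<le> card (HS \<tau>) * (T + 2) + card (ones \<tau> - {0})"
      using t Smax card_Satt(2)[OF vt[OF t(1)]] by (simp add: Sat)
    have "card (ones \<tau> - {0}) \<le> card (ones \<tau>)" using fin_ones by (intro card_mono) auto
    then have "hard \<tau>" using e soft_less[of \<tau>] by fastforce
    moreover obtain w' where w': "length w' = m" "ones \<tau> \<subseteq> outs w'" using sound[OF t(1) \<open>hard \<tau>\<close>] by blast
    moreover have "card (ones \<tau> - {0}) \<le> card (outs w' - {0})" using w'(2) fin_ones by (intro card_mono) auto
    ultimately show "\<exists>w'. length w' = m \<and> card (outs w) \<le> card (outs w' - {0})"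
      using e hard_HS by (intro exI[of _ w']) auto
  next
    assume "\<exists>w'. length w' = m \<and> card (outs w) \<le> card (outs w' - {0})"
    then obtain w' where w': "length w' = m" "card (outs w) \<le> card (outs w' - {0})" by blast
    then show "\<exists>\<tau>. valid \<tau> \<and> card (Sat (run w)) \<le> card (Sat \<tau> - {cvS 0})"
      using Smax card_Satt(2)[OF vt[OF run(1)[OF w'(1)]]] run[OF w'(1)] by (intro exI[of _ "run w'"]) (simp add: Sat)
  qed
  moreover have "(\<exists>w'. length w' = m \<and> card (outs w) \<le> card (outs w' - {0})) \<longleftrightarrow>
     \<not> (\<exists>w. length w = m \<and> (\<forall>w'. length w' = m \<longrightarrow> card (outs w' - {0}) < card (outs w)))"
  proof
    assume "\<exists>w'. length w' = m \<and> card (outs w) \<le> card (outs w' - {0})"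
    then obtain w' where w': "length w' = m" "card (outs w) \<le> card (outs w' - {0})" by blast
    show "\<not> (\<exists>w. length w = m \<and> (\<forall>w'. length w' = m \<longrightarrow> card (outs w' - {0}) < card (outs w)))"
    proof
      assume "\<exists>w. length w = m \<and> (\<forall>w'. length w' = m \<longrightarrow> card (outs w' - {0}) < card (outs w))"
      then obtain u where "length u = m" "card (outs w' - {0}) < card (outs u)" using w'(1) by blast
      then show False using w(2)[of u] w'(2) by linarith
    qed
  next
    assume *: "\<not> (\<exists>w. length w = m \<and> (\<forall>w'. length w' = m \<longrightarrow> card (outs w' - {0}) < card (outs w)))"
    then obtain w' where "length w' = m" "\<not> card (outs w' - {0}) < card (outs w)" using w(1) by blast
    then show "\<exists>w'. length w' = m \<and> card (outs w) \<le> card (outs w' - {0})" by (intro exI[of _ w']) simp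
  qed
  ultimately show "?l = ?r"
    using mvc_Z_beta[OF run(1)[OF w(1)] max b D] unfolding BG_def cvx_def by auto
qed

end

section \<open>The graph of the reduction\<close>

subsection \<open>Graphs given by lists\<close>

lemma mkg_cong: assumes "\<And>x y. x \<in> V \<Longrightarrow> y \<in> V \<Longrightarrow> x \<noteq> y \<Longrightarrow> A x y = A' x y" shows "mkg V A = mkg V A'"
proof -
  have "{{x, y} |x y. x \<in> V \<and> y \<in> V \<and> x \<noteq> y \<and> A x y} = {{x, y} |x y. x \<in> V \<and> y \<in> V \<and> x \<noteq> y \<and> A' x y}"
    using assms by metis
  then show ?thesis by (simp add: mkg_def)
qed

lemma mkg_edgeI: "x \<in> V \<Longrightarrow> y \<in> V \<Longrightarrow> x \<noteq> y \<Longrightarrow> A x y \<Longrightarrow> {x, y} \<in> snd (mkg V A)"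
  by (auto simp: mkg_def)

lemma gsum_mkg: "gsum n (\<lambda>i. mkg (V i) (A i)) =
   mkg (\<Union>i<n. Pair i ` V i) (\<lambda>x y. fst x = fst y \<and> A (fst x) (snd x) (snd y))"
proof -
  have "(\<Union>i<n. image (Pair i) ` snd (mkg (V i) (A i))) =
    snd (mkg (\<Union>i<n. Pair i ` V i) (\<lambda>x y. fst x = fst y \<and> A (fst x) (snd x) (snd y)))" (is "?l = ?r")
  proof (rule equalityI; rule subsetI)
    fix e assume "e \<in> ?l"
    then obtain i x y where i: "i < n" "x \<in> V i" "y \<in> V i" "x \<noteq> y" "A i x y" "e = Pair i ` {x, y}"
      unfolding mkg_def by auto
    then have "e = {(i, x), (i, y)}" by simp
    then show "e \<in> ?r" unfolding mkg_def snd_conv using i by force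
  next
    fix e assume "e \<in> ?r"
    then obtain x y where xy: "e = {x, y}" "x \<in> (\<Union>i<n. Pair i ` V i)" "y \<in> (\<Union>i<n. Pair i ` V i)" "x \<noteq> y"
      "fst x = fst y" "A (fst x) (snd x) (snd y)"
      unfolding mkg_def snd_conv by blast
    obtain i u where u: "x = (i, u)" "i < n" "u \<in> V i" using xy(2) by auto
    obtain v where v: "y = (i, v)" "v \<in> V i" using xy(3,5) u(1) by auto
    have "{u, v} \<in> snd (mkg (V i) (A i))" unfolding mkg_def snd_conv using u v xy by auto
    moreover have "e = Pair i ` {u, v}" using xy(1) u v by simp
    ultimately show "e \<in> ?l" using u(2) by blast
  qed
  then show ?thesis by (simp add: gsum_def mkg_def)
qed

lemma map_map_nth: "map f xs = map (\<lambda>i. f (xs ! i)) [0..<length xs]"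
  by (rule nth_equalityI) auto

text \<open>Numbering the vertices by their positions in \<open>vl\<close> makes the matrix
  computable from the list, and isomorphism leaves both numbers unchanged.\<close>

lemma list_graph:
  assumes d: "distinct vl" and ne: "vl \<noteq> []" and s: "symp adj"
  obtains G :: "nat graph" where "is_graph G" "fst G = {..<length vl}"
    "enc_graph G = concat (map (\<lambda>u. map (\<lambda>v. u \<noteq> v \<and> adj u v) vl) vl)"
    "min_mdg G = min_mdg (mkg (set vl) adj)" "mvc G = mvc (mkg (set vl) adj)"
proof -
  let ?n = "length vl" let ?H = "mkg (set vl) adj"
  define ix where "ix = the_inv_into {..<?n} ((!) vl)"
  have bij: "bij_betw ((!) vl) {..<?n} (set vl)" using bij_betw_nth[OF d] by simp
  have inv: "ix (vl ! i) = i" if "i < ?n" for i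
    unfolding ix_def using that bij by (intro the_inv_into_f_f) (auto simp: bij_betw_def)
  have bix: "bij_betw ix (set vl) {..<?n}" unfolding ix_def by (rule bij_betw_the_inv_into[OF bij])
  have inj: "inj_on ix (fst ?H)" using bix by (simp add: bij_betw_def)
  have g: "gr ?H" by (rule gr_mkg) simp
  let ?G = "gmap ix ?H"
  have V: "fst ?G = {..<?n}" using bix by (simp add: gmap_def bij_betw_def)
  have E: "{i, j} \<in> snd ?G \<longleftrightarrow> vl ! i \<noteq> vl ! j \<and> adj (vl ! i) (vl ! j)" if ij: "i < ?n" "j < ?n" for i j
  proof -
    have "{i, j} \<in> snd ?G \<longleftrightarrow> {vl ! i, vl ! j} \<in> snd ?H"
    proof
      assume "{i, j} \<in> snd ?G"
      then obtain e where e: "e \<in> snd ?H" "{i, j} = ix ` e" by (auto simp: gmap_def)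
      have sub: "e \<subseteq> set vl" using gr_edge_sub[OF g e(1)] by simp
      have "ix ` {vl ! i, vl ! j} = ix ` e" using e(2) inv ij by simp
      moreover have "{vl ! i, vl ! j} \<subseteq> set vl" using ij by simp
      ultimately have "{vl ! i, vl ! j} = e"
        by (intro inj_on_image_eq_iff[OF inj, THEN iffD1]) (use sub in simp_all)
      then show "{vl ! i, vl ! j} \<in> snd ?H" using e(1) by simp
    next
      assume "{vl ! i, vl ! j} \<in> snd ?H"
      then have "ix ` {vl ! i, vl ! j} \<in> snd ?G" unfolding gmap_def snd_conv by (rule imageI)
      then show "{i, j} \<in> snd ?G" using inv ij by simp
    qed
    then show ?thesis using edge_mkg[OF s] ij by auto
  qed
  show thesis
  proof (rule that[of ?G])
    show "is_graph ?G" using gr_gmap[OF g inj] ne by (auto simp: is_graph_gr gmap_def)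
    show "fst ?G = {..<?n}" by (rule V)
    show "min_mdg ?G = min_mdg ?H" "mvc ?G = mvc ?H" by (rule min_mdg_gmap[OF g inj] mvc_gmap[OF g inj])+
    have "enc_graph ?G = concat (map (\<lambda>i. map (\<lambda>j. {i, j} \<in> snd ?G) [0..<?n]) [0..<?n])"
      unfolding enc_graph_def V Let_def by simp
    also have "\<dots> = concat (map (\<lambda>i. map (\<lambda>j. vl ! i \<noteq> vl ! j \<and> adj (vl ! i) (vl ! j)) [0..<?n]) [0..<?n])"
      by (intro arg_cong[of _ _ concat] map_cong refl) (simp add: E)
    also have "\<dots> = concat (map (\<lambda>u. map (\<lambda>v. u \<noteq> v \<and> adj u v) vl) vl)"
      unfolding map_map_nth[of "\<lambda>u. map (\<lambda>v. u \<noteq> v \<and> adj u v) vl"] by (subst map_map_nth[of _ vl]) (rule refl)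
    finally show "enc_graph ?G = concat (map (\<lambda>u. map (\<lambda>v. u \<noteq> v \<and> adj u v) vl) vl)" .
  qed
qed

lemma length_enc_graph: "fst G = {..<n} \<Longrightarrow> length (enc_graph G) = n * n"
proof -
  have "length (concat (map (\<lambda>i. map (f i) [0..<n]) [0..<k])) = k * n" for f :: "nat \<Rightarrow> nat \<Rightarrow> bool" and k
    by (induction k) auto
  then show "fst G = {..<n} \<Longrightarrow> length (enc_graph G) = n * n" by (simp add: enc_graph_def)
qed

lemma concat_nth_square:
  assumes "i < k" "j < n"
  shows "concat (map (\<lambda>i. map (f i) [0..<n]) [0..<k]) ! (i * n + j) = f i j"
  using assms(1)
proof (induction k)
  case (Suc k)
  have l: "length (concat (map (\<lambda>i. map (f i) [0..<n]) [0..<k])) = k * n" by (induction k) auto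
  show ?case
  proof (cases "i = k")
    case True then show ?thesis using l assms(2) by (simp add: nth_append)
  next
    case False
    then have i: "i < k" using Suc by simp
    have "i * n + j < Suc i * n" using assms(2) by simp
    also have "\<dots> \<le> k * n" using i by (intro mult_le_mono1) simp
    finally show ?thesis using Suc.IH[OF i] l by (simp add: nth_append)
  qed
qed simp

lemma enc_graph_nth:
  assumes "fst G = {..<n}" "i < n" "j < n" shows "enc_graph G ! (i * n + j) \<longleftrightarrow> {i, j} \<in> snd G"
  using concat_nth_square[OF assms(2,3), of "\<lambda>i j. {i, j} \<in> snd G"] assms(1) by (simp add: enc_graph_def)

text \<open>The length of the matrix determines the number of vertices. With this, membership of a
  code in \<open>S_MDG\<close>, which hides the graph behind an existential, becomes a statement
  about one graph.\<close>

lemma enc_graph_inj: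
  assumes "is_graph G" "fst G = {..<n}" "is_graph H" "fst H = {..<k}" "enc_graph G = enc_graph H" shows "G = H"
proof -
  have "n * n = k * k" using length_enc_graph assms(2,4,5) by metis
  then have "n = k" by (metis nat_neq_iff mult_strict_mono' zero_le)
  have e: "{i, j} \<in> snd G \<longleftrightarrow> {i, j} \<in> snd H" if "i < n" "j < n" for i j
    using enc_graph_nth[OF assms(2) that] enc_graph_nth[of H n i j] assms(4,5) \<open>n = k\<close> that by simp
  have "G = mkg (fst G) (\<lambda>x y. {x, y} \<in> snd G)" using gr_mkg_eq[of G] assms(1) unfolding is_graph_gr by simp
  also have "\<dots> = mkg (fst H) (\<lambda>x y. {x, y} \<in> snd H)"
    unfolding assms(2,4) \<open>n = k\<close>[symmetric] by (rule mkg_cong) (simp add: e)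
  also have "\<dots> = H" using gr_mkg_eq[of H] assms(3) unfolding is_graph_gr by simp
  finally show ?thesis .
qed

lemma S_MDG_enc:
  assumes "is_graph G" "fst G = {..<n}"
  shows "enc_graph G \<in> S_MDG r \<longleftrightarrow> of_nat (min_mdg G) \<le> r * of_nat (mvc G)"
  unfolding S_MDG_def using enc_graph_inj[OF assms] assms by blast

lemma rat_ratio_le:
  assumes "q > 0" "r = of_nat p / of_nat q"
  shows "of_nat a \<le> r * (of_nat b :: rat) \<longleftrightarrow> q * a \<le> p * b"
proof -
  have "of_nat a \<le> r * (of_nat b :: rat) \<longleftrightarrow> of_nat (q * a) \<le> (of_nat (p * b) :: rat)"
    using assms(1) unfolding assms(2) by (simp add: field_simps)
  then show ?thesis by (simp only: of_nat_le_iff)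
qed

subsection \<open>Assembly of the components\<close>

definition zlist :: "'a list \<Rightarrow> 'a list \<Rightarrow> nat \<Rightarrow> (nat \<times> 'a \<times> nat) list" where
  "zlist bl S D = map (\<lambda>v. (0, v, 0)) bl @ map (\<lambda>v. (1, v, 0)) S @
     concat (map (\<lambda>v. map (\<lambda>i. (2, v, i)) [0..<D]) S) @ concat (map (\<lambda>v. map (\<lambda>i. (3, v, i)) [0..<D]) S)"

lemma set_zlist: "set (zlist bl S D) = zV (set bl) (set S) D"
  by (auto simp: zlist_def zV_def)

text \<open>The first entry numbers the components: \<open>a\<close> copies with the gadget at
  \<open>\<beta>\<close>, \<open>b\<close> copies with gadgets at all vertices, \<open>j\<close> bad
  graphs on \<open>nB\<close> vertices. The tag 4 does not occur in \<open>zV\<close> and keeps the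
  bad graphs apart; \<open>\<beta>\<close> is a mere filler there.\<close>

definition flist :: "nat \<Rightarrow> nat \<Rightarrow> nat \<Rightarrow> nat \<Rightarrow> 'a list \<Rightarrow> 'a \<Rightarrow> nat \<Rightarrow> (nat \<times> nat \<times> 'a \<times> nat) list" where
  "flist a b j nB bl \<beta> D = concat (map (\<lambda>i. map (Pair i) (zlist bl [\<beta>] D)) [0..<a]) @
     concat (map (\<lambda>i. map (Pair i) (zlist bl bl D)) [a..<a + b]) @
     concat (map (\<lambda>i. map (\<lambda>u. (i, 4, \<beta>, u)) [0..<nB]) [a + b..<a + b + j])"

definition fadj :: "('a \<Rightarrow> 'a \<Rightarrow> bool) \<Rightarrow> (nat \<times> nat) list \<Rightarrow> nat \<times> nat \<times> 'a \<times> nat \<Rightarrow> nat \<times> nat \<times> 'a \<times> nat \<Rightarrow> bool" where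
  "fadj E BE x y \<longleftrightarrow> fst x = fst y \<and> (zadj E (snd x) (snd y) \<or>
     (fst (snd x) = 4 \<and> fst (snd y) = 4 \<and> (snd (snd (snd x)), snd (snd (snd y))) \<in> set BE))"

definition jnum :: "nat \<Rightarrow> nat \<Rightarrow> nat \<Rightarrow> nat \<Rightarrow> nat" where
  "jnum q d nV D = q * d * D + d * d * (nV * (D + 1)) + q * d"

text \<open>Over the integers, the right side minus the left side is
  \<open>c * q * (q + d) * (e - 1)\<close>. The terms in \<open>Mv\<close> cancel since
  \<open>q * c * d = d * c * q\<close>; each bad graph contributes \<open>- c\<close>; and
  \<open>j\<close> is what remains, divided by \<open>c\<close>, once the constant is to vanish for
  \<open>e = 1\<close>. For ratio 1, that is \<open>d = 0\<close>, no component with gadgets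
  everywhere and no bad graph occurs.\<close>

lemma balance:
  fixes q d c D N Mv e mB vB :: nat
  assumes B: "q * mB = (q + d) * vB + c" and c: "c > 0" and q: "q > 0" and e: "e \<le> 1"
    and j: "j = q * d * D + d * d * N + q * d"
  shows "q * (q * c * (D + 1 + Mv) + d * c * (N + Mv) + j * mB) \<le> (q + d) * (q * c * (D + Mv + e) + d * c * N + j * vB) \<longleftrightarrow> e = 1"
proof -
  have "q * (j * mB) = j * ((q + d) * vB + c)" using B by (metis mult.left_commute)
  then have l: "q * (q * c * (D + 1 + Mv) + d * c * (N + Mv) + j * mB) =
     q * (q * c * (D + 1 + Mv) + d * c * (N + Mv)) + j * c + (q + d) * (j * vB)"
    by (simp add: algebra_simps)
  have "q * (q * c * (D + 1 + Mv) + d * c * (N + Mv)) + j * c =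
    (q + d) * (q * c * (D + Mv) + d * c * N) + c * q * (q + d)" unfolding j by (simp add: algebra_simps)
  then have "q * (q * c * (D + 1 + Mv) + d * c * (N + Mv) + j * mB) =
    (q + d) * (q * c * (D + Mv) + d * c * N + j * vB) + c * q * (q + d)" using l by (simp add: algebra_simps)
  moreover have "(q + d) * (q * c * (D + Mv + e) + d * c * N + j * vB) =
    (q + d) * (q * c * (D + Mv) + d * c * N + j * vB) + c * q * (q + d) * e" by (simp add: algebra_simps)
  moreover have "c * q * (q + d) > 0" using c q by simp
  ultimately show ?thesis using e by (cases e) auto
qed

lemma sum_three:
  fixes a b j x y z :: nat
  shows "(\<Sum>i<a + b + j. if i < a then x else if i < a + b then y else z) = a * x + b * y + j * z"
proof (induction j)
  case 0
  have "(\<Sum>i<a. if i < a then x else if i < a + b then y else z) = a * x" by simp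
  moreover have "(\<Sum>i<a + b'. if i < a then x else if i < a + b then y else z) =
      (\<Sum>i<a. if i < a then x else if i < a + b then y else z) + b' * y" if "b' \<le> b" for b'
    using that by (induction b') simp_all
  ultimately show ?case by simp
qed simp

lemma final_graph:
  fixes V :: "'a set" and E :: "'a \<Rightarrow> 'a \<Rightarrow> bool" and B :: "nat graph"
  defines "G \<equiv> mkg V E" and "EE \<equiv> (\<lambda>x y. {x, y} \<in> snd (mkg V E))"
  assumes sE: "symp E" and bl: "set bl = V" "distinct bl" and b: "\<beta> \<in> V" and opt: "min_mdg G = mvc G"
    and D: "D = length bl + 2"
    and e: "mvc (mkg (zV V {\<beta>} D) (zadj EE)) = D + mvc G + (if A then 1 else 0)"
    and B: "is_graph B" "fst B = {..<nB}" "set BE = {(u, v). {u, v} \<in> snd B}"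
    and c: "q * min_mdg B = (q + d) * mvc B + c" "c > 0" "q > 0"
    and j: "j = jnum q d (length bl) D"
  shows "q * min_mdg (mkg (set (flist (q * c) (d * c) j nB bl \<beta> D)) (fadj E BE)) \<le>
     (q + d) * mvc (mkg (set (flist (q * c) (d * c) j nB bl \<beta> D)) (fadj E BE)) \<longleftrightarrow> A"
    "symp (fadj E BE)" "flist (q * c) (d * c) j nB bl \<beta> D \<noteq> []"
proof -
  have finV: "finite V" using bl by auto
  have nV: "card V = length bl" using bl distinct_card by blast
  have gG: "gr G" unfolding G_def by (rule gr_mkg[OF finV])
  have D2: "D \<ge> 2" by (simp add: D)
  have fG: "fst G = V" by (simp add: G_def)
  have deg: "card (nb G v) < D" if "v \<in> fst G" for v
  proof -
    have "card (nb G v) \<le> card V" using nb_V[OF gG, of v] finV fG by (intro card_mono) auto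
    then show ?thesis using D nV by simp
  qed
  let ?F = "mkg (zV V {\<beta>} D) (zadj EE)" let ?U = "mkg (zV V V D) (zadj EE)"
  have EEG: "EE = (\<lambda>x y. {x, y} \<in> snd G)" by (simp add: EE_def G_def)
  have bs: "{\<beta>} \<subseteq> fst G" using b fG by simp
  have F1: "min_mdg ?F = D + 1 + mvc G"
    using Z_min_mdg[OF gG bs D2 deg _ opt] unfolding EEG fG by simp
  have U1: "min_mdg ?U = card V * (D + 1) + mvc G"
    using Z_min_mdg[OF gG _ D2 deg _ opt, of V] b unfolding EEG fG by auto
  \<comment> \<open>Every \<open>v\<close> needs itself or its gadget vertex in the cover, and
    taking all of \<open>V\<close> suffices; hence this number does not depend on
    \<open>mvc G\<close>, while the greedy cost of the same component does.\<close>
  have U2: "mvc ?U = card V * (D + 1)"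
  proof (rule antisym)
    have "vertex_cover G V" using gG fG by (auto simp: vertex_cover_def elim!: gr_edgeE)
    from Z_mvc_le[OF gG _ D2 this, of V] show "mvc ?U \<le> card V * (D + 1)" unfolding EEG fG by simp
    have gU: "gr ?U" using gr_Z[OF gG _ D2, of V] unfolding EEG fG by simp
    obtain X where X: "vertex_cover ?U X" "card X = mvc ?U" by (rule mvc_obtain[OF gU])
    obtain C where C: "vertex_cover G C" "C = {v. (0, v, 0) \<in> X}" "card V * D + card C + card {v \<in> V. (1, v, 0) \<in> X} \<le> card X"
      "\<And>v. v \<in> V \<Longrightarrow> v \<in> C \<or> (1, v, 0) \<in> X"
      by (rule Z_cover_split[OF gG _ D2, of V X]) (use X(1) fG EEG in simp_all)
    have "C \<subseteq> V" using C(1) fG by (simp add: vertex_cover_def)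
    then have "card V \<le> card (C \<union> {v \<in> V. (1, v, 0) \<in> X})" using C(4) finV by (intro card_mono) (auto intro: finite_subset)
    also have "\<dots> \<le> card C + card {v \<in> V. (1, v, 0) \<in> X}" by (rule card_Un_le)
    finally show "card V * (D + 1) \<le> mvc ?U" using C(3) X(2) by simp
  qed
  have gB: "gr B" using B(1) is_graph_gr by blast
  let ?h = "\<lambda>u :: nat. (4 :: nat, \<beta>, u)"
  let ?BA = "\<lambda>x y :: nat \<times> 'a \<times> nat. (snd (snd x), snd (snd y)) \<in> set BE"
  let ?B = "mkg ({4} \<times> {\<beta>} \<times> {..<nB}) ?BA"
  have Bh: "?B = gmap ?h B"
  proof -
    have "snd ?B = image ?h ` snd B"
    proof (rule equalityI; rule subsetI)
      fix x assume "x \<in> snd ?B"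
      then obtain u v where "u < nB" "v < nB" "u \<noteq> v" "{u, v} \<in> snd B" "x = {?h u, ?h v}"
        unfolding mkg_def using B(3) by auto
      then show "x \<in> image ?h ` snd B" by (auto intro: image_eqI[of _ _ "{u, v}"])
    next
      fix x assume "x \<in> image ?h ` snd B"
      then obtain e' where e': "e' \<in> snd B" "x = ?h ` e'" by auto
      obtain u v where uv: "e' = {u, v}" "u \<in> fst B" "v \<in> fst B" "u \<noteq> v" by (rule gr_edgeE[OF gB e'(1)])
      then have "x = {?h u, ?h v}" "?h u \<noteq> ?h v" "?BA (?h u) (?h v)" using e' B(3) by auto
      moreover have "?h u \<in> {4} \<times> {\<beta>} \<times> {..<nB}" "?h v \<in> {4} \<times> {\<beta>} \<times> {..<nB}" using uv B(2) by auto
      ultimately show "x \<in> snd ?B" using mkg_edgeI[of "?h u" "{4} \<times> {\<beta>} \<times> {..<nB}" "?h v" ?BA] by simp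
    qed
    moreover have "fst ?B = ?h ` fst B" using B(2) by auto
    ultimately show ?thesis by (simp add: gmap_def prod_eq_iff)
  qed
  have injh: "inj_on ?h (fst B)" by (auto simp: inj_on_def)
  have B12: "min_mdg ?B = min_mdg B" "mvc ?B = mvc B" "gr ?B"
    unfolding Bh by (rule min_mdg_gmap[OF gB injh] mvc_gmap[OF gB injh] gr_gmap[OF gB injh])+
  let ?a = "q * c" and ?b = "d * c"
  define VV where "VV i = (if i < ?a then zV V {\<beta>} D else if i < ?a + ?b then zV V V D else {4} \<times> {\<beta>} \<times> {..<nB})" for i
  define AA where "AA i = (if i < ?a + ?b then zadj EE else ?BA)" for i
  have Gs: "mkg (VV i) (AA i) = (if i < ?a then ?F else if i < ?a + ?b then ?U else ?B)" for i
    by (simp add: VV_def AA_def)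
  have gGs: "gr (mkg (VV i) (AA i))" for i
    unfolding Gs using B12(3) gr_Z[OF gG bs D2] gr_Z[OF gG _ D2, of V] unfolding EEG fG by simp
  let ?n = "?a + ?b + j" let ?vl = "flist ?a ?b j nB bl \<beta> D"
  have Vl: "set ?vl = (\<Union>i<?n. Pair i ` VV i)"
  proof -
    have "{..<?n} = {0..<?a} \<union> {?a..<?a + ?b} \<union> {?a + ?b..<?n}" by auto
    then have "(\<Union>i<?n. Pair i ` VV i) = (\<Union>i\<in>{0..<?a}. Pair i ` VV i) \<union> (\<Union>i\<in>{?a..<?a + ?b}. Pair i ` VV i) \<union> (\<Union>i\<in>{?a + ?b..<?n}. Pair i ` VV i)"
      by (simp only: UN_Un)
    moreover have "(\<Union>i\<in>{0..<?a}. Pair i ` VV i) = (\<Union>i\<in>{0..<?a}. Pair i ` zV V {\<beta>} D)"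
      "(\<Union>i\<in>{?a..<?a + ?b}. Pair i ` VV i) = (\<Union>i\<in>{?a..<?a + ?b}. Pair i ` zV V V D)"
      "(\<Union>i\<in>{?a + ?b..<?n}. Pair i ` VV i) = (\<Union>i\<in>{?a + ?b..<?n}. Pair i ` ({4} \<times> {\<beta>} \<times> {..<nB}))"
      by (auto simp: VV_def)
    moreover have "Pair i ` ({4::nat} \<times> {\<beta>} \<times> {..<nB}) = (\<lambda>u. (i, 4, \<beta>, u)) ` {0..<nB}" for i :: nat by auto
    ultimately show ?thesis unfolding flist_def by (simp add: set_zlist bl(1) Un_assoc)
  qed
  have tag: "fst x < 4" if "x \<in> zV V S D" for x S using that by (auto simp: zV_def)
  \<comment> \<open>\<open>EE\<close> is confined to distinct vertices of \<open>V\<close>, which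
    \<open>E\<close> need not be; on distinct vertices of the gadget graph the two give the same
    edges, so the computable \<open>E\<close> may be used.\<close>
  have zz: "zadj EE x y = zadj E x y" if "x \<in> zV V S D" "y \<in> zV V S D" "x \<noteq> y" for x y S
  proof -
    obtain s u i t v l where xy: "x = (s, u, i)" "y = (t, v, l)" by (metis prod.exhaust)
    show ?thesis
    proof (cases "s = 0 \<and> t = 0")
      case True
      then have "u \<in> V" "v \<in> V" "u \<noteq> v" using that xy by (auto simp: zV_def)
      then have "EE u v = E u v" unfolding EE_def edge_mkg[OF sE] by simp
      then show ?thesis using xy True by (simp add: zadj_def)
    next
      case False then show ?thesis using xy by (auto simp: zadj_def)
    qed
  qed
  have "mkg (set ?vl) (fadj E BE) = mkg (\<Union>i<?n. Pair i ` VV i) (\<lambda>x y. fst x = fst y \<and> AA (fst x) (snd x) (snd y))"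
    unfolding Vl
  proof (rule mkg_cong)
    fix x y assume x: "x \<in> (\<Union>i<?n. Pair i ` VV i)" and y: "y \<in> (\<Union>i<?n. Pair i ` VV i)" and ne: "x \<noteq> y"
    obtain i x' where xi: "x = (i, x')" "i < ?n" "x' \<in> VV i" using x by auto
    obtain i' y' where yi: "y = (i', y')" "y' \<in> VV i'" using y by auto
    show "fadj E BE x y = (fst x = fst y \<and> AA (fst x) (snd x) (snd y))"
    proof (cases "i = i'")
      case False then show ?thesis using xi yi by (simp add: fadj_def)
    next
      case True
      then have y': "y' \<in> VV i" "x' \<noteq> y'" using xi yi ne by auto
      show ?thesis
      proof (cases "i < ?a + ?b")
        case True
        then have "VV i = zV V (if i < ?a then {\<beta>} else V) D" by (simp add: VV_def)
        then obtain S where S: "VV i = zV V S D" by blast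
        have "zadj EE x' y' = zadj E x' y'" using zz[of x' S y'] xi y' S by simp
        moreover have "fst x' \<noteq> 4" using tag[of x' S] xi S by auto
        ultimately show ?thesis using xi yi \<open>i = i'\<close> True by (simp add: fadj_def AA_def)
      next
        case False
        then have "VV i = {4} \<times> {\<beta>} \<times> {..<nB}" by (simp add: VV_def)
        then have "x' \<in> {4} \<times> {\<beta>} \<times> {..<nB}" "y' \<in> {4} \<times> {\<beta>} \<times> {..<nB}"
          using xi(3) y'(1) by (simp_all only:)
        then have "fst x' = 4" "fst y' = 4" by auto
        then have "\<not> zadj E x' y'" by (simp add: zadj_def)
        then show ?thesis using xi yi \<open>i = i'\<close> False \<open>fst x' = 4\<close> \<open>fst y' = 4\<close> by (simp add: fadj_def AA_def)
      qed
    qed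
  qed
  also have "\<dots> = gsum ?n (\<lambda>i. mkg (VV i) (AA i))" by (rule gsum_mkg[symmetric])
  finally have TG: "mkg (set ?vl) (fadj E BE) = gsum ?n (\<lambda>i. mkg (VV i) (AA i))" .
  have "min_mdg (mkg (set ?vl) (fadj E BE)) = (\<Sum>i<?n. if i < ?a then D + 1 + mvc G else if i < ?a + ?b then card V * (D + 1) + mvc G else min_mdg B)"
    using gsum_props[of ?n "\<lambda>i. mkg (VV i) (AA i)"] gGs unfolding TG Gs
    by (simp add: if_distrib[of min_mdg] F1 U1 B12 cong: if_cong)
  then have m1: "min_mdg (mkg (set ?vl) (fadj E BE)) = ?a * (D + 1 + mvc G) + ?b * (card V * (D + 1) + mvc G) + j * min_mdg B"
    by (simp only: sum_three)
  have "mvc (mkg (set ?vl) (fadj E BE)) = (\<Sum>i<?n. if i < ?a then D + mvc G + (if A then 1 else 0) else if i < ?a + ?b then card V * (D + 1) else mvc B)"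
    using gsum_props[of ?n "\<lambda>i. mkg (VV i) (AA i)"] gGs unfolding TG Gs
    by (simp add: if_distrib[of mvc] e U2 B12 cong: if_cong)
  then have m2: "mvc (mkg (set ?vl) (fadj E BE)) = ?a * (D + mvc G + (if A then 1 else 0)) + ?b * (card V * (D + 1)) + j * mvc B"
    by (simp only: sum_three)
  have j': "j = q * d * D + d * d * (card V * (D + 1)) + q * d" unfolding j jnum_def nV ..
  have "q * min_mdg (mkg (set ?vl) (fadj E BE)) \<le> (q + d) * mvc (mkg (set ?vl) (fadj E BE)) \<longleftrightarrow> (if A then 1 else 0) = (1::nat)"
    unfolding m1 m2 by (rule balance[OF c _ j']) simp
  then show "q * min_mdg (mkg (set ?vl) (fadj E BE)) \<le> (q + d) * mvc (mkg (set ?vl) (fadj E BE)) \<longleftrightarrow> A" by simp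
  show "symp (fadj E BE)"
    using symp_zadj[OF sE] B(3) unfolding symp_def fadj_def by (auto simp: insert_commute)
  have "(0, 0, \<beta>, 0) \<in> set ?vl" unfolding Vl using b c by (intro UN_I[of 0]) (auto simp: VV_def zV_def)
  then show "?vl \<noteq> []" by auto
qed

section \<open>Hardness\<close>

lemma pf_remdups[pf_intros]: assumes "pf l" shows "pf (\<lambda>x. remdups (l x))"
proof -
  have *: "fold (\<lambda>a acc. if a \<in> set acc then acc else a # acc) (rev l) [] = remdups l" for l :: "'b list"
    by (induction l) auto
  have le: "len (remdups l) \<le> len l" for l :: "'b list" by (induction l) auto
  have "pf (\<lambda>x. fold (\<lambda>a acc. if a \<in> set acc then acc else a # acc) (rev (l x)) [])"
  proof (rule pf_fold[where B = "\<lambda>x. len (l x)"])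
    fix x k
    have "fold (\<lambda>a acc. if a \<in> set acc then acc else a # acc) (take k (rev (l x))) [] = remdups (rev (take k (rev (l x))))"
      using *[of "rev (take k (rev (l x)))"] by simp
    moreover have "len (rev (take k (rev (l x)))) \<le> len (l x)" by (metis len_rev len_take)
    ultimately show "len (fold (\<lambda>a acc. if a \<in> set acc then acc else a # acc) (take k (rev (l x))) []) \<le> len (l x)"
      using le order_trans by metis
  qed (use assms in \<open>auto intro!: pf_intros pbx_intros\<close>)
  then show ?thesis by (simp add: *)
qed

text \<open>The length \<open>k\<close> is a constant, in use the number of tapes, so the number of
  these lists is polynomial.\<close>

lemma pf_n_lists[pf_intros]: assumes "pf l" shows "pf (\<lambda>x. List.n_lists k (l x))"
  by (induction k) (auto intro!: pf_intros pf_compose[OF assms])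

lemma pf_nxt[pf_intros]: assumes "pf f" shows "pf (\<lambda>x. nxt M (f x))"
  unfolding nxt_def by (intro pf_intros assms)

lemma pf_dsel[pf_intros]: assumes "pf f" shows "pf (\<lambda>x. dq (f x))" "pf (\<lambda>x. dss M (f x))" "pf (\<lambda>x. dhs M (f x))"
  unfolding dq_def dss_def dhs_def by (intro pf_intros assms)+

lemma pf_trel[pf_intros]:
  assumes "pf p" "pf d" "pf d'" "pf c" "pf c'" shows "pf (\<lambda>x. trel M (p x) (d x) (d' x) (c x) (c' x))"
  unfolding trel_def
  by (intro pf_intros assms pf_compose[OF assms(1)] pf_compose[OF assms(2)] pf_compose[OF assms(3)]
      pf_compose[OF assms(4)] pf_compose[OF assms(5)])

lemma pf_domD[pf_intros]: assumes "pf T" "pf t" shows "pf (\<lambda>x. domD M (T x) (t x))"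
  unfolding domD_def by (intro pf_intros assms pf_compose[OF assms(1)])

lemma pf_cell0[pf_intros]: assumes "pf xe" "pf m" "pf T" "pf p" shows "pf (\<lambda>x. cell0 (xe x) (m x) (T x) (p x))"
  unfolding cell0_def by (intro pf_intros assms)

lemma pf_domC[pf_intros]:
  assumes "pf xe" "pf m" "pf T" "pf t" "pf p" shows "pf (\<lambda>x. domC M (xe x) (m x) (T x) (t x) (p x))"
  unfolding domC_def by (intro pf_intros assms)

lemma pf_tdom[pf_intros]:
  assumes "pf xe" "pf m" "pf T" "pf v" shows "pf (\<lambda>x. tdom M (xe x) (m x) (T x) (v x))"
  unfolding tdom_def by (intro pf_intros assms)

lemma pf_tvars[pf_intros]: assumes "pf T" shows "pf (\<lambda>x. tvars (T x))"
  unfolding tvars_def by (intro pf_intros assms pf_compose[OF assms])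

lemma pf_cvA[pf_intros]: assumes "pf xe" "pf m" "pf T" shows "pf (\<lambda>x. cvA M (xe x) (m x) (T x))"
  unfolding cvA_def by (intro pf_intros assms pf_compose[OF assms(1)] pf_compose[OF assms(2)] pf_compose[OF assms(3)])

lemma pf_cvB[pf_intros]: assumes "pf xe" "pf m" "pf T" shows "pf (\<lambda>x. cvB M (xe x) (m x) (T x))"
  unfolding cvB_def by (intro pf_intros assms pf_compose[OF assms(1)] pf_compose[OF assms(2)] pf_compose[OF assms(3)])

lemma pf_cvS[pf_intros]: assumes "pf j" shows "pf (\<lambda>x. cvS (j x))"
  unfolding cvS_def by (intro pf_intros assms)

lemma pf_cvD[pf_intros]: assumes "pf v" shows "pf (\<lambda>x. cvD (v x))"
  unfolding cvD_def by (intro pf_intros assms)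

lemma pf_cvs[pf_intros]: assumes "pf xe" "pf m" "pf T" shows "pf (\<lambda>x. cvs M (xe x) (m x) (T x))"
  unfolding cvs_def by (intro pf_intros assms)

definition bN :: "tm \<Rightarrow> word \<Rightarrow> nat \<Rightarrow> nat \<Rightarrow> nat" where
  "bN M xe m T = Suc (sum_list (map (\<lambda>v. length (tdom M xe m T v)) (tvars T)))"

definition bvert :: "cvt \<Rightarrow> nat \<times> var \<times> nat list \<times> cvt \<times> nat" where
  "bvert cv = (1, (0, 0, 0), [], cv, 0)"

definition blist :: "tm \<Rightarrow> word \<Rightarrow> nat \<Rightarrow> nat \<Rightarrow> (nat \<times> var \<times> nat list \<times> cvt \<times> nat) list" where
  "blist M xe m T = remdups (concat (map (\<lambda>v. concat (map (\<lambda>a. concat (map (\<lambda>cv. map (\<lambda>i. (0, v, a, cv, i))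
     [0..<bN M xe m T]) (cvs M xe m T))) (tdom M xe m T v))) (tvars T)) @ map bvert (cvs M xe m T))"

lemma pf_bN[pf_intros]: assumes "pf xe" "pf m" "pf T" shows "pf (\<lambda>x. bN M (xe x) (m x) (T x))"
  unfolding bN_def by (intro pf_intros assms pf_compose[OF assms(1)] pf_compose[OF assms(2)] pf_compose[OF assms(3)])

lemma pf_bvert[pf_intros]: assumes "pf f" shows "pf (\<lambda>x. bvert (f x))"
  unfolding bvert_def by (intro pf_intros assms)

lemma pf_blist[pf_intros]: assumes "pf xe" "pf m" "pf T" shows "pf (\<lambda>x. blist M (xe x) (m x) (T x))"
  unfolding blist_def by (intro pf_intros assms pf_compose[OF assms(1)] pf_compose[OF assms(2)] pf_compose[OF assms(3)])

lemma pf_conf[pf_intros]: assumes "pf v" "pf a" "pf cv" shows "pf (\<lambda>x. conf (v x) (a x) (cv x))"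
  unfolding conf_def by (intro pf_intros assms pf_compose[OF assms(1)] pf_compose[OF assms(2)])

lemma pf_badj[pf_intros]:
  fixes f g :: "'x::enc \<Rightarrow> nat \<times> 'v::enc \<times> 'a::enc \<times> ('c::enc \<times> ('v \<times> 'a) list) \<times> nat"
  assumes "pf f" "pf g" shows "pf (\<lambda>x. badj (f x) (g x))"
  unfolding badj_def bcross_def by (intro pf_intros assms)

definition flist2 :: "tm \<Rightarrow> nat \<Rightarrow> nat \<Rightarrow> nat \<Rightarrow> nat \<Rightarrow> word \<Rightarrow> nat \<Rightarrow> nat \<Rightarrow> _" where
  "flist2 M q d c nB xe m T = remdups (flist (q * c) (d * c) (jnum q d (length (blist M xe m T)) (length (blist M xe m T) + 2)) nB
     (blist M xe m T) (bvert (cvS 0)) (length (blist M xe m T) + 2))"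

definition fgr :: "tm \<Rightarrow> nat \<Rightarrow> nat \<Rightarrow> nat \<Rightarrow> nat \<Rightarrow> (nat \<times> nat) list \<Rightarrow> word \<Rightarrow> nat \<Rightarrow> nat \<Rightarrow> word" where
  "fgr M q d c nB BE xe m T = concat (map (\<lambda>u. map (\<lambda>v. u \<noteq> v \<and> fadj badj BE u v) (flist2 M q d c nB xe m T))
     (flist2 M q d c nB xe m T))"

lemma pf_zlist[pf_intros]: assumes "pf bl" "pf S" "pf D" shows "pf (\<lambda>x. zlist (bl x) (S x) (D x))"
  unfolding zlist_def by (intro pf_intros assms pf_compose[OF assms(3)])

lemma pf_jnum[pf_intros]: assumes "pf n" "pf D" shows "pf (\<lambda>x. jnum q d (n x) (D x))"
  unfolding jnum_def by (intro pf_intros assms)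

lemma pf_flist[pf_intros]: assumes "pf j" "pf bl" "pf b" "pf D" shows "pf (\<lambda>x. flist a c (j x) nB (bl x) (b x) (D x))"
  unfolding flist_def by (intro pf_intros assms pf_compose[OF assms(2)] pf_compose[OF assms(3)] pf_compose[OF assms(4)])

lemma pf_flist2[pf_intros]: assumes "pf xe" "pf m" "pf T" shows "pf (\<lambda>x. flist2 M q d c nB (xe x) (m x) (T x))"
  unfolding flist2_def by (intro pf_intros assms)

lemma pf_zadj_badj[pf_intros]:
  fixes f g :: "'x::enc \<Rightarrow> nat \<times> (nat \<times> 'v::enc \<times> 'a::enc \<times> ('c::enc \<times> ('v \<times> 'a) list) \<times> nat) \<times> nat"
  assumes "pf f" "pf g" shows "pf (\<lambda>x. zadj badj (f x) (g x))"
  unfolding zadj_def by (intro pf_intros assms)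

lemma pf_fadj_badj[pf_intros]:
  fixes f g :: "'x::enc \<Rightarrow> nat \<times> nat \<times> (nat \<times> 'v::enc \<times> 'a::enc \<times> ('c::enc \<times> ('v \<times> 'a) list) \<times> nat) \<times> nat"
  assumes "pf f" "pf g" shows "pf (\<lambda>x. fadj badj BE (f x) (g x))"
  unfolding fadj_def by (intro pf_intros assms)

lemma pf_fgr[pf_intros]: assumes "pf xe" "pf m" "pf T" shows "pf (\<lambda>x. fgr M q d c nB BE (xe x) (m x) (T x))"
  unfolding fgr_def by (intro pf_intros assms pf_compose[OF assms(1)] pf_compose[OF assms(2)] pf_compose[OF assms(3)])

lemma sum_card_le_length: "(\<Sum>v\<in>set vs. card (set (f v))) \<le> sum_list (map (\<lambda>v. length (f v)) vs)"
proof (induction vs)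
  case (Cons v vs)
  show ?case
  proof (cases "v \<in> set vs")
    case True then show ?thesis using Cons by (simp add: insert_absorb)
  next
    case False then show ?thesis using Cons card_length[of "f v"] by simp
  qed
qed simp

context tableau
begin

lemma bN_big: "(\<Sum>v\<in>Vst. card (domt v)) < bN M xe m T"
  unfolding bN_def by (rule le_imp_less_Suc[OF sum_card_le_length])

lemma set_blist: "set (blist M xe m T) = csp.bV Vst domt CVt (bN M xe m T) (0, 0, 0) []"
proof -
  interpret csp Vst domt CVt "bN M xe m T" "(0, 0, 0)" "[]" by (rule csp_tab[OF bN_big])
  have "bvert ` CVt = cvx ` CVt" by (simp add: bvert_def cvx_def)
  moreover have "(\<Union>v\<in>Vst. \<Union>a\<in>domt v. \<Union>cv\<in>CVt. (\<lambda>i. (0::nat, v, a, cv, i)) ` {0..<bN M xe m T}) =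
     {0} \<times> (SIGMA v:Vst. domt v \<times> CVt \<times> {..<bN M xe m T})" by (auto simp: image_iff)
  ultimately show ?thesis unfolding bV_def blist_def by simp
qed

lemma fgr_S_MDG:
  assumes B: "is_graph B" "fst B = {..<nB}" "set BE = {(u, v). {u, v} \<in> snd B}"
    and c: "q * min_mdg B = (q + d) * mvc B + c" "c > 0" "q > 0"
    and r: "r = of_nat (q + d) / of_nat q"
  shows "fgr M q d c nB BE xe m T \<in> S_MDG r \<longleftrightarrow>
    (\<exists>w. length w = m \<and> (\<forall>w'. length w' = m \<longrightarrow> card (outs w' - {0}) < card (outs w)))" (is "_ \<longleftrightarrow> ?A")
proof -
  let ?bl = "blist M xe m T" let ?D = "length ?bl + 2" let ?V = "csp.bV Vst domt CVt (bN M xe m T) (0, 0, 0) []"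
  let ?j = "jnum q d (length ?bl) ?D" let ?vl = "flist (q * c) (d * c) ?j nB ?bl (bvert (cvS 0)) ?D"
  have "cvS 0 \<in> CVt" by (simp add: cvs_def del: upt_Suc)
  then have "bvert (cvS 0) \<in> set ?bl" by (simp add: blist_def)
  then have b: "bvert (cvS 0) \<in> ?V" unfolding set_blist .
  note t = tab_main[OF bN_big, of ?D "(0, 0, 0)" "[]"]
  have D: "2 \<le> ?D" by simp
  have dis: "distinct ?bl" unfolding blist_def by simp
  have e: "mvc (mkg (zV ?V {bvert (cvS 0)} ?D) (zadj (\<lambda>x y. {x, y} \<in> snd (mkg ?V badj)))) = ?D + mvc (mkg ?V badj) + (if ?A then 1 else 0)"
    unfolding bvert_def using t(2)[OF D] by simp
  note fg = final_graph[OF symp_badj set_blist dis b t(1)[OF D] refl e B c refl]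
  have ne: "remdups ?vl \<noteq> []" using fg(3) by simp
  obtain G where G: "is_graph G" "fst G = {..<length (remdups ?vl)}"
    "enc_graph G = concat (map (\<lambda>u. map (\<lambda>v. u \<noteq> v \<and> fadj badj BE u v) (remdups ?vl)) (remdups ?vl))"
    "min_mdg G = min_mdg (mkg (set (remdups ?vl)) (fadj badj BE))" "mvc G = mvc (mkg (set (remdups ?vl)) (fadj badj BE))"
    by (rule list_graph[OF distinct_remdups ne fg(2)])
  have "fgr M q d c nB BE xe m T = enc_graph G" unfolding G(3) fgr_def flist2_def ..
  then have "fgr M q d c nB BE xe m T \<in> S_MDG r \<longleftrightarrow> q * min_mdg G \<le> (q + d) * mvc G"
    using S_MDG_enc[OF G(1,2)] rat_ratio_le[OF c(3) r] by simp
  then show ?thesis using fg(1) unfolding G(4,5) set_remdups by simp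
qed

text \<open>After \<open>T\<close> steps the tapes are blank beyond \<open>T\<close>, so the output
  has at most \<open>T + 1\<close> bits and the claims 0 to \<open>T\<close> miss none.\<close>

lemma outs_word:
  assumes "tm_halts_with M (xe @ w) t y" "t \<le> T" "length w = m"
  shows "outs w = {j. j < length y \<and> y ! j}"
proof -
  have "tm_halts_with M (xe @ w) T y" using tm_halts_mono assms by blast
  then have l: "fst (last (snd (cfg w T))) = word_tape y" by (simp add: tm_halts_with_def cfg_def case_prod_unfold)
  have ci: "cinv M T T (cfg w T)" using cfg_inv[OF assms(3)] by simp
  have "last (snd (cfg w T)) = snd (cfg w T) ! (k - 1)"
    using ci k1 by (intro trans[OF last_conv_nth]) (auto simp: cinv_def)
  moreover have "fst (snd (cfg w T) ! (k - 1)) (int T + 1) = 0" using ci k1 by (simp add: cinv_def)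
  ultimately have "word_tape y (int T + 1) = 0" using l by simp
  then have "length y \<le> T + 1" by (auto simp: word_tape_def split: if_splits)
  then show ?thesis unfolding outs_def outbit_def l by (auto simp: word_tape_def split: if_splits)
qed

end

subsection \<open>Guessing answers and witnesses\<close>

text \<open>A total parser reading bit by bit: the pending first bit of a pair, the current word,
  the finished words. Any pair of unequal bits, even 10, closes a word.\<close>

definition dstep :: "bool \<Rightarrow> bool list \<times> word \<times> word list \<Rightarrow> bool list \<times> word \<times> word list" where
  "dstep b z = (case fst z of [] \<Rightarrow> ([b], snd z)
     | a # _ \<Rightarrow> if a = b then ([], fst (snd z) @ [b], snd (snd z)) else ([], [], snd (snd z) @ [fst (snd z)]))"

definition dec :: "word \<Rightarrow> word list" where "dec w = snd (snd (fold dstep w ([], [], [])))"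

lemma fold_dstep_enc_word: "fold dstep (enc_word u @ r) ([], acc, out) = fold dstep r ([], [], out @ [acc @ u])"
  by (induction u arbitrary: acc) (simp_all add: enc_word_dbl dstep_def)

lemma fold_dstep_enc_words: "fold dstep (enc_words ws @ r) ([], [], out) = fold dstep r ([], [], out @ ws)"
  by (induction ws arbitrary: out) (simp_all add: enc_words_def fold_dstep_enc_word del: fold_append)

lemma fold_dstep_prefix: "\<exists>more. snd (snd (fold dstep r z)) = snd (snd z) @ more"
proof (induction r arbitrary: z)
  case (Cons b r)
  obtain more where "snd (snd (fold dstep r (dstep b z))) = snd (snd (dstep b z)) @ more" using Cons by blast
  moreover have "\<exists>m2. snd (snd (dstep b z)) = snd (snd z) @ m2" by (auto simp: dstep_def split: list.split)
  ultimately show ?case by auto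
qed simp

text \<open>Padding behind the coded words can only add further words, so a guess can be filled up
  to a prescribed length.\<close>

lemma dec_enc_words: "\<exists>more. dec (enc_words ws @ r) = ws @ more"
  unfolding dec_def fold_dstep_enc_words using fold_dstep_prefix[of r "([], [], [] @ ws)"] by simp

lemma fold_dstep_size:
  "length (fst (fold dstep w ([], [], []))) \<le> 1 \<and> length (fst (snd (fold dstep w ([], [], [])))) \<le> length w \<and>
   length (snd (snd (fold dstep w ([], [], [])))) \<le> length w \<and>
   (\<forall>u\<in>set (snd (snd (fold dstep w ([], [], [])))). length u \<le> length w)"
  by (induction w rule: rev_induct) (auto simp: dstep_def split: list.splits)

lemma len_word: "len (w :: word) = 4 * length w" by (induction w) auto

lemma pf_dec[pf_intros]: assumes "pf f" shows "pf (\<lambda>x. dec (f x))"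
proof -
  have "pf (\<lambda>x. fold dstep (f x) ([], [], []))"
  proof (rule pf_fold[where B = "\<lambda>x. 10 + (2 * (4 * length (f x)) + 2) + length (f x) * (2 * (4 * length (f x)) + 2)"])
    show "pf (\<lambda>z :: 'a \<times> bool \<times> bool list \<times> word \<times> word list. dstep (fst (snd z)) (snd (snd z)))"
      unfolding dstep_def by (intro pf_intros)
    show "pbx (\<lambda>x. 10 + (2 * (4 * length (f x)) + 2) + length (f x) * (2 * (4 * length (f x)) + 2))"
      by (intro pbx_add pbx_mult pbx_const pbx_length[OF assms])
    fix x k
    let ?w = "take k (f x)" let ?z = "fold dstep ?w ([], [], [])" let ?n = "length (f x)"
    have wl: "length ?w \<le> ?n" by simp
    have s: "length (fst ?z) \<le> 1" "length (fst (snd ?z)) \<le> length ?w" "length (snd (snd ?z)) \<le> length ?w"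
      "\<forall>u\<in>set (snd (snd ?z)). length u \<le> length ?w" using fold_dstep_size[of ?w] by blast+
    have "len (snd (snd ?z)) \<le> length (snd (snd ?z)) * (2 * (4 * ?n) + 2)"
      by (rule len_le) (use s(4) wl in \<open>force simp: len_word\<close>)
    also have "\<dots> \<le> ?n * (2 * (4 * ?n) + 2)" using s(3) wl by (intro mult_right_mono) auto
    finally have "len (snd (snd ?z)) \<le> ?n * (2 * (4 * ?n) + 2)" .
    moreover have "len ?z = 2 * len (fst ?z) + 2 + (2 * len (fst (snd ?z)) + 2 + len (snd (snd ?z)))"
      by (cases ?z) (simp add: enc_prod_def enc_pair_def)
    ultimately show "len ?z \<le> 10 + (2 * (4 * ?n) + 2) + ?n * (2 * (4 * ?n) + 2)"
      using s(1,2) wl by (simp add: len_word)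
  qed (use assms in \<open>auto intro!: pf_intros\<close>)
  then show ?thesis unfolding dec_def by (intro pf_intros)
qed

text \<open>\<open>enc_words ws\<close> is at the same time the code of the list
  \<open>map Raw ws\<close>, so parsing the queries is a recoding on the range of
  \<open>enc_words\<close>; the choice operator is harmless because codes are injective.\<close>

lemma pf_queries:
  assumes "polytime (\<lambda>x. enc_words (g x))" "pf h" shows "pf (\<lambda>x. g (h x))"
proof -
  have em: "enc (map Raw ws) = enc_words ws" for ws by (simp add: enc_list_def comp_def)
  define f2 where "f2 = (\<lambda>r. map Raw (SOME ws. enc_words ws = unraw r))"
  have some: "enc_words (SOME ws. enc_words ws = unraw r) = unraw r" if "\<exists>ws. enc_words ws = unraw r" for r
    using someI_ex[OF that] .
  have 1: "pf_on {r. \<exists>ws. enc_words ws = unraw r} f2"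
    by (rule pf_on_recode) (auto simp: f2_def em some enc_raw_def)
  have "pf (\<lambda>x. Raw (enc_words (g (h x))))" using polytime_pf[OF assms] by (intro pf_intros)
  from pf_on_comp[OF this 1] have "pf (\<lambda>x. f2 (Raw (enc_words (g (h x)))))" by auto
  then have "pf (\<lambda>x. map unraw (f2 (Raw (enc_words (g (h x))))))" by (intro pf_intros)
  then show ?thesis
  proof (rule pf_on_cong)
    fix x
    have "enc_words (SOME ws. enc_words ws = enc_words (g (h x))) = enc_words (g (h x))" using some[of "Raw (enc_words (g (h x)))"] by auto
    then have "map Raw (SOME ws. enc_words ws = enc_words (g (h x))) = map Raw (g (h x))"
      unfolding em[symmetric] by (rule enc_inj)
    then show "map unraw (f2 (Raw (enc_words (g (h x))))) = g (h x)" by (simp add: f2_def comp_def)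
  qed
qed

subsection \<open>The reduction\<close>

lemma cnt_less:
  assumes "length ys = length zs" "\<And>i. i < length ys \<Longrightarrow> ys ! i \<Longrightarrow> zs ! i" "ys \<noteq> zs"
  shows "length (filter id ys) < length (filter id zs)"
proof -
  have "{i. i < length ys \<and> id (ys ! i)} \<subset> {i. i < length zs \<and> id (zs ! i)}"
  proof -
    obtain i where "i < length ys" "ys ! i \<noteq> zs ! i" using assms(1,3) nth_equalityI by blast
    then show ?thesis using assms(1,2) by auto
  qed
  then show ?thesis unfolding length_filter_conv_card by (intro psubset_card_mono) auto
qed

theorem par_hard:
  assumes L: "L \<in> class_P_NP_par" and q: "q > 0" and r: "r = of_nat (q + d) / of_nat q"
  shows "L \<le>\<^sub>m\<^sup>p S_MDG r"
proof -
  obtain N g V where N: "N \<in> class_NP" and V: "V \<in> class_P" and pg: "polytime (\<lambda>x. enc_words (g x))"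
    and Liff: "\<And>x. x \<in> L \<longleftrightarrow> enc_pair x (map (\<lambda>y. y \<in> N) (g x)) \<in> V"
    using L unfolding class_P_NP_par_def by blast
  obtain R pR where R: "R \<in> class_P" and Niff: "\<And>y. y \<in> N \<longleftrightarrow> (\<exists>w. length w \<le> poly pR (length y) \<and> enc_pair y w \<in> R)"
    using N unfolding class_NP_def by blast
  define chk where "chk = (\<lambda>y w. length w \<le> poly pR (length y) \<and> enc_pair y w \<in> R)"
  define ans where "ans = (\<lambda>x w. map (\<lambda>i. i < length (dec w) \<and> chk (nthd [] (g x) i) (nthd [] (dec w) i)) [0..<length (g x)])"
  \<comment> \<open>The verdict is bit 0 and the vector of verified answers is written twice, so
    that the number of ones is \<open>2 s + acc\<close>.\<close>
  define Val where "Val = (\<lambda>x w. (enc_pair x (ans x w) \<in> V) # ans x w @ ans x w)"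
  \<comment> \<open>The machine gets the code of \<open>x\<close> followed by the guess; the guess
    starts after the \<open>2 * length x + 2\<close> bits of \<open>enc_word x\<close>.\<close>
  define F where "F = (\<lambda>z. Val (nthd [] (dec z) 0) (drop (2 * length (nthd [] (dec z) 0) + 2) z))"
  have pchk: "pf (\<lambda>x. chk (f x) (h x))" if "pf f" "pf h" for f h :: "'z::enc \<Rightarrow> word"
    unfolding chk_def by (intro pf_intros that class_P_pf[OF R])
  note pfg = pf_queries[OF pg]
  have pans: "pf (\<lambda>z :: word \<times> word. ans (fst z) (snd z))"
    unfolding ans_def by (intro pf_intros pchk pfg)
  have pVal: "pf (\<lambda>z :: word \<times> word. Val (fst z) (snd z))"
    unfolding Val_def by (intro pf_intros pans class_P_pf[OF V])
  have pF: "pf F" unfolding F_def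
    by (rule pf_compose[OF pVal, of "\<lambda>z. (nthd [] (dec z) 0, drop (2 * length (nthd [] (dec z) 0) + 2) z)", unfolded fst_conv snd_conv])
      (intro pf_intros)
  have "pf (\<lambda>z. Raw (F (unraw z)))" by (intro pf_intros pf_compose[OF pF])
  from pf_polytime[OF this] have "polytime F" by (simp add: enc_raw_def)
  then obtain M pM where M: "valid_tm M" and tM: "\<And>z. \<exists>t\<le>poly pM (length z). tm_halts_with M z t (F z)"
    unfolding polytime_def by blast
  have Fpair: "F (enc_word x @ w) = Val x w" for x w
  proof -
    obtain more where "dec (enc_words [x] @ w) = [x] @ more" using dec_enc_words by blast
    then have "nthd [] (dec (enc_word x @ w)) 0 = x" by (simp add: enc_words_def nthd_def)
    then show ?thesis by (simp add: F_def)
  qed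
  obtain pq where pq: "\<And>x. length (enc_words (g x)) \<le> poly pq (length x)"
  proof -
    have "pf (\<lambda>x. Raw (enc_words (g (unraw x))))" using polytime_pf[OF pg pf_raw_list[OF pf_id]] by (intro pf_intros)
    then obtain p where p: "\<And>x. x \<in> UNIV \<Longrightarrow> len (Raw (enc_words (g (unraw x)))) \<le> poly p (len x)" by (rule pf_size) blast
    show thesis by (rule that[of p]) (use p[of "Raw _"] in simp)
  qed
  \<comment> \<open>\<open>poly pq\<close> bounds the number of queries as well as the length of
    each; every witness of length at most \<open>poly pR\<close> of that takes twice its length plus
    2 bits. \<open>TT\<close> adds the length of the tape inscription to the running time, as the
    tableau requires.\<close>
  define mm where "mm = (\<lambda>x :: word. poly pq (length x) * (2 * poly pR (poly pq (length x)) + 2))"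
  define TT where "TT = (\<lambda>x :: word. poly pM (2 * length x + 2 + mm x) + (2 * length x + 2 + mm x))"
  have enc_words_mem: "y \<in> set ws \<Longrightarrow> length y \<le> length (enc_words ws)" "length ws \<le> length (enc_words ws)" for y ws
    by (induction ws) (auto simp: enc_words_def)
  have witness: "\<exists>w. length w = mm x \<and> ans x w = map (\<lambda>y. y \<in> N) (g x)" for x
  proof -
    define wit where "wit = (\<lambda>y. if y \<in> N then SOME w. chk y w else [])"
    have wit: "chk y (wit y)" if "y \<in> N" for y
    proof -
      have "\<exists>w. chk y w" using that Niff by (simp add: chk_def)
      from someI_ex[OF this] show ?thesis using that by (simp add: wit_def)
    qed
    have le: "length (wit y) \<le> poly pR (poly pq (length x))" if "y \<in> set (g x)" for y
    proof (cases "y \<in> N")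
      case True
      then have "length (wit y) \<le> poly pR (length y)" using wit by (simp add: chk_def)
      also have "\<dots> \<le> poly pR (poly pq (length x))"
        using enc_words_mem(1)[OF that] pq[of x] by (intro poly_nat_mono) simp
      finally show ?thesis .
    qed (simp add: wit_def)
    let ?ws = "map wit (g x)"
    have s: "length (enc_words us) \<le> length us * (2 * b + 2)" if "\<forall>u\<in>set us. length u \<le> b" for us and b :: nat
      using that by (induction us) (auto simp: enc_words_def)
    have "length (enc_words ?ws) \<le> length ?ws * (2 * poly pR (poly pq (length x)) + 2)" by (rule s) (use le in auto)
    also have "\<dots> \<le> mm x" unfolding mm_def using enc_words_mem(2)[of "g x"] pq[of x] by (intro mult_le_mono1) simp
    finally have l: "length (enc_words ?ws) \<le> mm x" .
    \<comment> \<open>Guesses have the fixed length \<open>mm x\<close>, so the code of the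
      witnesses is padded.\<close>
    let ?w = "enc_words ?ws @ replicate (mm x - length (enc_words ?ws)) False"
    obtain more where more: "dec ?w = ?ws @ more" using dec_enc_words by blast
    have "ans x ?w = map (\<lambda>y. y \<in> N) (g x)"
    proof (rule nth_equalityI)
      fix i assume "i < length (ans x ?w)"
      then have i: "i < length (g x)" by (simp add: ans_def)
      have "chk (g x ! i) (wit (g x ! i)) \<longleftrightarrow> g x ! i \<in> N" using wit Niff by (auto simp: chk_def)
      then show "ans x ?w ! i = map (\<lambda>y. y \<in> N) (g x) ! i"
        using i unfolding ans_def more by (simp add: nthd_def nth_append)
    qed (simp add: ans_def)
    then show ?thesis using l by (intro exI[of _ ?w]) simp
  qed
  have ans_le: "ans x w ! i \<Longrightarrow> map (\<lambda>y. y \<in> N) (g x) ! i" if "i < length (ans x w)" for x w i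
    using that Niff by (auto simp: ans_def chk_def)
  have lans: "length (ans x w) = length (g x)" for x w by (simp add: ans_def)
  obtain B :: "nat graph" and nB where B: "is_graph B" "fst B = {..<nB}" "(q + d) * mvc B < q * min_mdg B"
    by (rule bad_graph_exists[OF q, of "q + d"])
  define c where "c = q * min_mdg B - (q + d) * mvc B"
  have c: "q * min_mdg B = (q + d) * mvc B + c" "c > 0" using B(3) by (auto simp: c_def)
  have "{(u, v). {u, v} \<in> snd B} \<subseteq> {..<nB} \<times> {..<nB}" using gr_edge_sub[of B] B(1,2) by (auto simp: is_graph_gr)
  then have "finite {(u, v). {u, v} \<in> snd B}" by (rule finite_subset) simp
  then obtain BE where BE: "set BE = {(u, v). {u, v} \<in> snd B}" using finite_list by blast
  define f where "f = (\<lambda>x. fgr M q d c nB BE (enc_pair x []) (mm x) (TT x))"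
  have pmm: "pf (\<lambda>x. mm (h x))" if "pf h" for h :: "'z::enc \<Rightarrow> word" unfolding mm_def by (intro pf_intros that)
  have pTT: "pf (\<lambda>x. TT (h x))" if "pf h" for h :: "'z::enc \<Rightarrow> word" unfolding TT_def by (intro pf_intros pmm that)
  have "pf (\<lambda>x. Raw (f (unraw x)))" unfolding f_def by (intro pf_intros pmm pTT)
  from pf_polytime[OF this] have "polytime f" by (simp add: enc_raw_def)
  moreover have "x \<in> L \<longleftrightarrow> f x \<in> S_MDG r" for x
  proof -
    let ?xe = "enc_word x"
    interpret tableau M ?xe "mm x" "TT x" by unfold_locales (use M in \<open>auto simp: TT_def\<close>)
    have outs: "outs w = {j. j < length (Val x w) \<and> Val x w ! j}" if "length w = mm x" for w
    proof -
      obtain t where t: "t \<le> poly pM (length (?xe @ w))" "tm_halts_with M (?xe @ w) t (F (?xe @ w))" using tM by blast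
      have "t \<le> TT x" using t(1) that by (simp add: TT_def add.commute)
      from outs_word[OF t(2) this that] show ?thesis by (simp add: Fpair)
    qed
    let ?cnt = "\<lambda>w. length (filter id (ans x w))" let ?acc = "\<lambda>w. enc_pair x (ans x w) \<in> V"
    have fin: "finite (outs w)" if "length w = mm x" for w using outs[OF that] by simp
    have c1: "card (outs w) = (if ?acc w then 1 else 0) + 2 * ?cnt w" if "length w = mm x" for w
    proof -
      have "card (outs w) = length (filter id (Val x w))" unfolding outs[OF that] length_filter_conv_card by simp
      then show ?thesis by (simp add: Val_def)
    qed
    have c2: "card (outs w - {0}) = 2 * ?cnt w" if "length w = mm x" for w
    proof (cases "?acc w")
      case True
      then have "0 \<in> outs w" using outs[OF that] by (simp add: Val_def)
      then have "card (outs w - {0}) = card (outs w) - 1" by (rule card_Diff_singleton)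
      then show ?thesis using c1[OF that] True by simp
    next
      case False
      then have "0 \<notin> outs w" using outs[OF that] by (simp add: Val_def)
      then show ?thesis using c1[OF that] False by simp
    qed
    obtain w0 where w0: "length w0 = mm x" "ans x w0 = map (\<lambda>y. y \<in> N) (g x)" using witness by blast
    have acc0: "?acc w0 \<longleftrightarrow> x \<in> L" unfolding w0(2) Liff ..
    \<comment> \<open>Verified answers are true answers, so a guess with a different answer vector
      misses a true yes. This costs 2 in the number of ones, more than the verdict can
      restore.\<close>
    have less: "?cnt w < ?cnt w0" if "ans x w \<noteq> ans x w0" for w
      by (rule cnt_less) (use that ans_le w0(2) lans in auto)
    have "f x \<in> S_MDG r \<longleftrightarrow> (\<exists>w. length w = mm x \<and> (\<forall>w'. length w' = mm x \<longrightarrow> card (outs w' - {0}) < card (outs w)))"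
      unfolding f_def using fgr_S_MDG[OF B(1,2) BE c q r] by (simp add: enc_pair_def)
    also have "\<dots> \<longleftrightarrow> x \<in> L"
    proof
      assume "\<exists>w. length w = mm x \<and> (\<forall>w'. length w' = mm x \<longrightarrow> card (outs w' - {0}) < card (outs w))"
      \<comment> \<open>Comparing with \<open>w0\<close> shows that \<open>w\<close> beats twice the
        maximal count: it must have the true answers, and the excess can only be the
        verdict.\<close>
      then obtain w where w: "length w = mm x" "card (outs w0 - {0}) < card (outs w)" using w0(1) by blast
      then have lt: "2 * ?cnt w0 < (if ?acc w then 1 else 0) + 2 * ?cnt w" using c1[OF w(1)] c2[OF w0(1)] by simp
      then have "ans x w = ans x w0" using less[of w] by (cases "ans x w = ans x w0") (auto split: if_splits)
      then show "x \<in> L" using lt acc0 by (auto split: if_splits)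
    next
      assume "x \<in> L"
      have "card (outs w' - {0}) < card (outs w0)" if "length w' = mm x" for w'
      proof -
        have "?cnt w' \<le> ?cnt w0" using less[of w'] by (cases "ans x w' = ans x w0") auto
        then show ?thesis using c1[OF w0(1)] c2[OF that] acc0 \<open>x \<in> L\<close> by simp
      qed
      then show "\<exists>w. length w = mm x \<and> (\<forall>w'. length w' = mm x \<longrightarrow> card (outs w' - {0}) < card (outs w))"
        using w0(1) by blast
    qed
    finally show ?thesis by blast
  qed
  ultimately show ?thesis unfolding many_one_reducible_def by blast
qed

section \<open>Membership\<close>

lemma dec_enc_words_exact: "dec (enc_words ws) = ws"
  using fold_dstep_enc_words[of ws "[]" "[]"] by (simp add: dec_def)

definition unp1 :: "word \<Rightarrow> word" where "unp1 z = nthd [] (dec z) 0"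
definition unp2 :: "word \<Rightarrow> word" where "unp2 z = drop (2 * length (unp1 z) + 2) z"

lemma unp_enc_pair[simp]: "unp1 (enc_pair x w) = x" "unp2 (enc_pair x w) = w"
proof -
  obtain more where "dec (enc_words [x] @ w) = [x] @ more" using dec_enc_words by blast
  then show *: "unp1 (enc_pair x w) = x" by (simp add: enc_words_def nthd_def unp1_def enc_pair_def)
  show "unp2 (enc_pair x w) = w" unfolding unp2_def * by (simp add: enc_pair_def)
qed

lemma pf_unp[pf_intros]: assumes "pf f" shows "pf (\<lambda>x. unp1 (f x))" "pf (\<lambda>x. unp2 (f x))"
  unfolding unp2_def unp1_def by (intro pf_intros assms)+

section \<open>Checking graphs, covers and greedy runs on adjacency matrices\<close>

definition ad :: "word \<Rightarrow> nat \<Rightarrow> nat \<Rightarrow> nat \<Rightarrow> bool" where "ad x n i j = nthd False x (i * n + j)"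

text \<open>The square root of the length, found by search. The default 0 marks lengths that are not
  squares and is rejected by \<open>gvalid\<close>, as is the empty matrix.\<close>

definition gsize :: "word \<Rightarrow> nat" where
  "gsize x = nthd 0 (filter (\<lambda>i. i * i = length x) [0..<Suc (length x)]) 0"

definition gvalid :: "word \<Rightarrow> bool" where
  "gvalid x \<longleftrightarrow> gsize x \<noteq> 0 \<and> gsize x * gsize x = length x \<and>
     (\<forall>i\<in>set [0..<gsize x]. \<not> ad x (gsize x) i i \<and> (\<forall>j\<in>set [0..<gsize x]. ad x (gsize x) i j = ad x (gsize x) j i))"

definition cdeg :: "word \<Rightarrow> nat \<Rightarrow> nat list \<Rightarrow> nat \<Rightarrow> nat" where
  "cdeg x n U v = length (filter (\<lambda>u. u \<notin> set U \<and> ad x n v u) [0..<n])"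

definition cover_chk :: "word \<Rightarrow> nat \<Rightarrow> nat list \<Rightarrow> bool" where
  "cover_chk x n vs \<longleftrightarrow> (\<forall>i\<in>set [0..<n]. \<forall>j\<in>set [0..<n]. ad x n i j \<longrightarrow> i \<in> set vs \<or> j \<in> set vs)"

definition mdg_chk :: "word \<Rightarrow> nat \<Rightarrow> nat list \<Rightarrow> bool" where
  "mdg_chk x n vs \<longleftrightarrow> cover_chk x n vs \<and> (\<forall>i\<in>set [0..<length vs].
     nthd 0 vs i < n \<and> nthd 0 vs i \<notin> set (take i vs) \<and> 0 < cdeg x n (take i vs) (nthd 0 vs i) \<and>
     (\<forall>u\<in>set [0..<n]. u \<notin> set (take i vs) \<longrightarrow> cdeg x n (take i vs) u \<le> cdeg x n (take i vs) (nthd 0 vs i)))"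

lemma pf_ad[pf_intros]: assumes "pf x" "pf n" "pf i" "pf j" shows "pf (\<lambda>z. ad (x z) (n z) (i z) (j z))"
  unfolding ad_def by (intro pf_intros assms)

lemma pf_gsize[pf_intros]: assumes "pf x" shows "pf (\<lambda>z. gsize (x z))"
  unfolding gsize_def by (intro pf_intros assms pf_compose[OF assms])

lemma pf_gvalid[pf_intros]: assumes "pf x" shows "pf (\<lambda>z. gvalid (x z))"
  unfolding gvalid_def by (intro pf_intros assms pf_compose[OF assms])

lemma pf_cdeg[pf_intros]: assumes "pf x" "pf n" "pf U" "pf v" shows "pf (\<lambda>z. cdeg (x z) (n z) (U z) (v z))"
  unfolding cdeg_def by (intro pf_intros assms pf_compose[OF assms(1)] pf_compose[OF assms(2)] pf_compose[OF assms(3)] pf_compose[OF assms(4)])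

lemma pf_cover_chk[pf_intros]: assumes "pf x" "pf n" "pf vs" shows "pf (\<lambda>z. cover_chk (x z) (n z) (vs z))"
  unfolding cover_chk_def by (intro pf_intros assms pf_compose[OF assms(1)] pf_compose[OF assms(2)] pf_compose[OF assms(3)])

lemma pf_mdg_chk[pf_intros]: assumes "pf x" "pf n" "pf vs" shows "pf (\<lambda>z. mdg_chk (x z) (n z) (vs z))"
  unfolding mdg_chk_def by (intro pf_intros assms pf_compose[OF assms(1)] pf_compose[OF assms(2)] pf_compose[OF assms(3)])

lemma gsize_eq:
  assumes n: "length x = n * n" shows "gsize x = n"
proof -
  have u: "i * i = length x \<longleftrightarrow> i = n" for i
    using n by (metis nat_neq_iff mult_strict_mono' zero_le)
  have "n \<le> length x" using n by (cases n) auto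
  have "filter (\<lambda>i. i = n) [0..<m] = (if n < m then [n] else [])" for m by (induction m) auto
  then have "filter (\<lambda>i. i * i = length x) [0..<Suc (length x)] = [n]"
    unfolding u using \<open>n \<le> length x\<close> by simp
  then show ?thesis by (simp add: gsize_def nthd_def)
qed

lemma gvalid_graph:
  "gvalid x \<longleftrightarrow> (\<exists>G n. is_graph G \<and> fst G = {..<n} \<and> x = enc_graph G)"
proof
  assume v: "gvalid x"
  define n where "n = gsize x"
  have n: "n \<noteq> 0" "length x = n * n" "\<And>i j. i < n \<Longrightarrow> j < n \<Longrightarrow> ad x n i j = ad x n j i" "\<And>i. i < n \<Longrightarrow> \<not> ad x n i i"
    using v by (auto simp: gvalid_def n_def)
  define adj where "adj i j \<longleftrightarrow> i < n \<and> j < n \<and> ad x n i j" for i j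
  have s: "symp adj" using n(3) by (auto simp: symp_def adj_def)
  let ?G = "mkg {..<n} adj"
  have g: "is_graph ?G" using n(1) gr_mkg[of "{..<n}" adj] by (auto simp: is_graph_gr)
  have l: "length (enc_graph ?G) = n * n" by (rule length_enc_graph) simp
  have "enc_graph ?G = x"
  proof (rule nth_equalityI)
    show "length (enc_graph ?G) = length x" using l n(2) by simp
    fix t assume "t < length (enc_graph ?G)"
    then have t: "t < n * n" using l by simp
    have ij: "t div n < n" "t mod n < n" "t div n * n + t mod n = t" using t n(1) by (auto simp: less_mult_imp_div_less)
    have "enc_graph ?G ! (t div n * n + t mod n) \<longleftrightarrow> {t div n, t mod n} \<in> snd ?G"
      by (rule enc_graph_nth) (use ij in auto)
    also have "\<dots> \<longleftrightarrow> ad x n (t div n) (t mod n)"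
      using edge_mkg[OF s, of "t div n" "t mod n" "{..<n}"] ij n(4)[of "t div n"] by (auto simp: adj_def)
    also have "\<dots> \<longleftrightarrow> x ! t" using ij t n(2) by (simp add: ad_def)
    finally show "enc_graph ?G ! t = x ! t" using ij by simp
  qed
  then show "\<exists>G n. is_graph G \<and> fst G = {..<n} \<and> x = enc_graph G" using g by (metis fst_mkg)
next
  assume "\<exists>G n. is_graph G \<and> fst G = {..<n} \<and> x = enc_graph G"
  then obtain G n where G: "is_graph G" "fst G = {..<n}" "x = enc_graph G" by blast
  have l: "length x = n * n" using length_enc_graph[OF G(2)] G(3) by simp
  have s: "gsize x = n" by (rule gsize_eq[OF l])
  have "i * n + j < n * n" if "i < n" "j < n" for i j
  proof -
    have "i * n + j < Suc i * n" using that by simp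
    also have "\<dots> \<le> n * n" using that by (intro mult_le_mono1) simp
    finally show ?thesis .
  qed
  then have a: "ad x n i j \<longleftrightarrow> {i, j} \<in> snd G" if "i < n" "j < n" for i j
    using enc_graph_nth[OF G(2) that] that l by (simp add: ad_def G(3))
  have "{i, i} \<notin> snd G" for i
  proof
    assume e: "{i, i} \<in> snd G"
    have gG: "gr G" using G(1) is_graph_gr by blast
    obtain u v where "{i, i} = {u, v}" "u \<noteq> v" by (rule gr_edgeE[OF gG e])
    then show False by auto
  qed
  then show "gvalid x" unfolding gvalid_def s using l a G(1,2) by (auto simp: is_graph_def insert_commute)
qed

text \<open>Unrolls the recursion into conditions on the prefixes of the list, which a program can
  test. That an edge is left before each choice becomes the positive degree of the chosen vertex, as
  this degree is maximal.\<close>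

lemma mdgl_index:
  assumes "gr G"
  shows "mdgl (gdel G U) vs \<longleftrightarrow> (\<forall>i<length vs. vs ! i \<in> fst G - (U \<union> set (take i vs)) \<and>
      0 < card (nb G (vs ! i) - (U \<union> set (take i vs))) \<and>
      (\<forall>u\<in>fst G - (U \<union> set (take i vs)). card (nb G u - (U \<union> set (take i vs))) \<le> card (nb G (vs ! i) - (U \<union> set (take i vs))))) \<and>
    snd (gdel G (U \<union> set vs)) = {}"
proof (induction vs arbitrary: U)
  case Nil then show ?case by simp
next
  case (Cons v vs)
  have e: "snd (gdel G U) \<noteq> {} \<longleftrightarrow> 0 < card (nb G v - U)"
    if v: "v \<in> fst G - U" and m: "\<forall>u\<in>fst G - U. card (nb G u - U) \<le> card (nb G v - U)"
  proof
    assume "snd (gdel G U) \<noteq> {}"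
    then obtain a b where ab: "a \<in> fst G - U" "b \<in> fst G - U" "b \<in> nb G a" by (rule edge_gdel[OF assms])
    then have "0 < card (nb G a - U)" using finite_nb[OF assms, of a] by (auto simp: card_gt_0_iff)
    then show "0 < card (nb G v - U)" using m ab(1) by force
  next
    assume "0 < card (nb G v - U)"
    then obtain b where "b \<in> nb G v - U" by (metis card.empty ex_in_conv less_numeral_extra(3))
    then have "{v, b} \<in> snd (gdel G U)" using v by (auto simp: nb_def gdel_def)
    then show "snd (gdel G U) \<noteq> {}" by blast
  qed
  show ?case
    unfolding mdgl_gdel_Cons[OF assms] Cons.IH[of "insert v U"] length_Cons All_less_Suc2
    using e by (auto simp: insert_commute)
qed

context
  fixes G :: "nat graph" and n :: nat
  assumes G: "is_graph G" "fst G = {..<n}"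
begin

private lemma gG: "gr G" using G(1) is_graph_gr by blast

private lemma ad_G: "i < n \<Longrightarrow> j < n \<Longrightarrow> ad (enc_graph G) n i j \<longleftrightarrow> j \<in> nb G i"
proof -
  assume ij: "i < n" "j < n"
  have "i * n + j < Suc i * n" using ij by simp
  also have "\<dots> \<le> n * n" using ij by (intro mult_le_mono1) simp
  finally show ?thesis using enc_graph_nth[OF G(2) ij] length_enc_graph[OF G(2)] by (simp add: ad_def nb_def)
qed

private lemma cdeg_G: "v < n \<Longrightarrow> cdeg (enc_graph G) n U v = card (nb G v - set U)"
proof -
  assume v: "v < n"
  have "cdeg (enc_graph G) n U v = card (set (filter (\<lambda>u. u \<notin> set U \<and> ad (enc_graph G) n v u) [0..<n]))"
    unfolding cdeg_def by (rule distinct_card[symmetric]) simp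
  also have "set (filter (\<lambda>u. u \<notin> set U \<and> ad (enc_graph G) n v u) [0..<n]) = nb G v - set U"
    using ad_G[OF v] nb_V[OF gG, of v] G(2) by auto
  finally show ?thesis .
qed

lemma cover_chk_G: "cover_chk (enc_graph G) n vs \<longleftrightarrow> (\<forall>e\<in>snd G. e \<inter> set vs \<noteq> {})"
proof
  assume c: "cover_chk (enc_graph G) n vs"
  show "\<forall>e\<in>snd G. e \<inter> set vs \<noteq> {}"
  proof
    fix e assume e: "e \<in> snd G"
    obtain u v where uv: "e = {u, v}" "u \<in> fst G" "v \<in> fst G" "u \<noteq> v" by (rule gr_edgeE[OF gG e])
    then have "ad (enc_graph G) n u v" using ad_G[of u v] e G(2) by (simp add: nb_def)
    then show "e \<inter> set vs \<noteq> {}" using c uv G(2) by (auto simp: cover_chk_def)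
  qed
next
  assume c: "\<forall>e\<in>snd G. e \<inter> set vs \<noteq> {}"
  have "i \<in> set vs \<or> j \<in> set vs" if "i < n" "j < n" "ad (enc_graph G) n i j" for i j
  proof -
    have "{i, j} \<in> snd G" using that ad_G by (simp add: nb_def)
    then show ?thesis using c by fastforce
  qed
  then show "cover_chk (enc_graph G) n vs" by (simp add: cover_chk_def)
qed

lemma mdg_chk_G: "mdg_chk (enc_graph G) n vs \<longleftrightarrow> mdgl G vs"
proof -
  have "(\<forall>e\<in>snd G. e \<inter> set vs \<noteq> {}) \<longleftrightarrow> snd (gdel G ({} \<union> set vs)) = {}" by (auto simp: gdel_def)
  moreover have "(nthd 0 vs i < n \<and> nthd 0 vs i \<notin> set (take i vs) \<and> 0 < cdeg (enc_graph G) n (take i vs) (nthd 0 vs i) \<and>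
     (\<forall>u\<in>set [0..<n]. u \<notin> set (take i vs) \<longrightarrow> cdeg (enc_graph G) n (take i vs) u \<le> cdeg (enc_graph G) n (take i vs) (nthd 0 vs i)))
    \<longleftrightarrow> vs ! i \<in> fst G - ({} \<union> set (take i vs)) \<and>
      0 < card (nb G (vs ! i) - ({} \<union> set (take i vs))) \<and>
      (\<forall>u\<in>fst G - ({} \<union> set (take i vs)). card (nb G u - ({} \<union> set (take i vs))) \<le> card (nb G (vs ! i) - ({} \<union> set (take i vs))))"
    if "i < length vs" for i
    using that cdeg_G G(2) by auto
  ultimately show ?thesis using mdgl_index[OF gG, of "{}" vs] unfolding mdg_chk_def cover_chk_G by auto
qed

lemma n_le: "n \<le> length (enc_graph G)" using length_enc_graph[OF G(2)] by simp

end

section \<open>The NP queries and their witnesses\<close>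

definition query :: "word \<Rightarrow> nat \<Rightarrow> bool \<Rightarrow> word" where
  "query x k b = enc_words [x, replicate k True, [b]]"

text \<open>A witness is a list of vertices in unary: each decoded word stands for its length. The
  bound \<open>k\<close> is likewise given by the length of a word, and the last word of the query
  selects the kind of question, so that a single NP set answers both.\<close>

definition qchk :: "nat \<Rightarrow> nat \<Rightarrow> word \<Rightarrow> word \<Rightarrow> bool" where
  "qchk p q y w \<longleftrightarrow> (if nthd [] (dec y) 2 = [True]
     then mdg_chk (nthd [] (dec y) 0) (gsize (nthd [] (dec y) 0)) (map length (dec w)) \<and> length (dec w) \<le> length (nthd [] (dec y) 1)
     else cover_chk (nthd [] (dec y) 0) (gsize (nthd [] (dec y) 0)) (map length (dec w)) \<and>
       p * length (dec w) < q * length (nthd [] (dec y) 1))"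

lemma pf_qchk: assumes "pf y" "pf w" shows "pf (\<lambda>z. qchk p q (y z) (w z))"
  unfolding qchk_def by (intro pf_intros assms)

lemma pf_enc_word[pf_intros]: assumes "pf f" shows "pf (\<lambda>x. enc_word (f x))"
proof -
  have "pf (\<lambda>x. enc_pair (f x) [])" by (intro pf_intros assms)
  then show ?thesis by (simp add: enc_pair_def)
qed

lemma pf_query[pf_intros]: assumes "pf f" "pf g" "pf h" shows "pf (\<lambda>x. query (f x) (g x) (h x))"
proof -
  have "pf (\<lambda>x. concat [enc_word (f x), enc_word (replicate (g x) True), enc_word [h x]])"
    by (intro pf_intros assms)
  then show ?thesis by (simp add: query_def enc_words_def)
qed

text \<open>At most \<open>n\<close> vertices below \<open>n\<close> in unary take
  \<open>n * (2 * n + 2)\<close> bits, which is at most \<open>4 * n * n\<close>, and the query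
  contains the \<open>n * n\<close> bits of the matrix.\<close>

definition witness_set :: "nat \<Rightarrow> nat \<Rightarrow> lang" where
  "witness_set p q = {y. \<exists>w. length w \<le> 4 * length y \<and> qchk p q y w}"

lemma witness_set_NP: "witness_set p q \<in> class_NP"
proof -
  let ?R = "{z. qchk p q (unp1 z) (unp2 z)}"
  have "pf (\<lambda>z. unraw z \<in> ?R)" unfolding mem_Collect_eq by (intro pf_qchk pf_intros)
  then have "?R \<in> class_P" by (rule pf_class_P)
  moreover have "y \<in> witness_set p q \<longleftrightarrow> (\<exists>w. length w \<le> poly [:0, 4:] (length y) \<and> enc_pair y w \<in> ?R)" for y
    by (simp add: witness_set_def mult.commute)
  ultimately show ?thesis unfolding class_NP_def by blast
qed

lemma query_G:
  assumes G: "is_graph G" "fst G = {..<n}"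
  shows "query (enc_graph G) k b \<in> witness_set p q \<longleftrightarrow>
    (if b then min_mdg G \<le> k else \<exists>C. vertex_cover G C \<and> p * card C < q * k)"
proof -
  let ?x = "enc_graph G" let ?y = "query ?x k b"
  have gG: "gr G" using G(1) is_graph_gr by blast
  have s: "gsize ?x = n" by (rule gsize_eq[OF length_enc_graph[OF G(2)]])
  have y: "dec ?y = [?x, replicate k True, [b]]" unfolding query_def by (rule dec_enc_words_exact)
  have q: "qchk p q ?y w \<longleftrightarrow> (if b then mdgl G (map length (dec w)) \<and> length (dec w) \<le> k
     else (\<forall>e\<in>snd G. e \<inter> set (map length (dec w)) \<noteq> {}) \<and> p * length (dec w) < q * k)" for w
    unfolding qchk_def y by (simp add: nthd_def s mdg_chk_G[OF G] cover_chk_G[OF G])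
  have wit: "\<exists>w. length w \<le> 4 * length ?y \<and> map length (dec w) = vs" if d: "distinct vs" "set vs \<subseteq> {..<n}" for vs
  proof -
    let ?w = "enc_words (map (\<lambda>v. replicate v True) vs)"
    have s: "length (enc_words us) \<le> length us * (2 * m + 2)" if "\<forall>u\<in>set us. length u \<le> m" for us and m :: nat
      using that by (induction us) (auto simp: enc_words_def)
    have "length ?w \<le> length (map (\<lambda>v. replicate v True) vs) * (2 * n + 2)" by (rule s) (use d(2) in auto)
    also have "\<dots> \<le> n * (2 * n + 2)"
      using card_mono[OF _ d(2)] distinct_card[OF d(1)] by (intro mult_le_mono1) simp
    also have "\<dots> \<le> 4 * (n * n)" by (cases n) auto
    also have "n * n = length ?x" using length_enc_graph[OF G(2)] by simp
    also have "length ?x \<le> length ?y" by (simp add: query_def enc_words_def)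
    finally have "length ?w \<le> 4 * length ?y" by simp
    moreover have "map length (dec ?w) = vs" unfolding dec_enc_words_exact by (simp add: comp_def)
    ultimately show ?thesis by blast
  qed
  show ?thesis
  proof (cases b)
    case True
    have "?y \<in> witness_set p q \<longleftrightarrow> min_mdg G \<le> k"
    proof
      assume "?y \<in> witness_set p q"
      then obtain w where "mdgl G (map length (dec w))" "length (dec w) \<le> k" using q True by (auto simp: witness_set_def)
      then show "min_mdg G \<le> k" using min_mdg_le[of G "map length (dec w)"] by simp
    next
      assume k: "min_mdg G \<le> k"
      obtain vs where vs: "mdgl G vs" "length vs = min_mdg G" by (rule min_mdg_obtain[OF gG])
      obtain w where w: "length w \<le> 4 * length ?y" "map length (dec w) = vs" using wit mdgl_distinct[OF vs(1)] G(2) by blast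
      then have "length (dec w) = length vs" by (metis length_map)
      then have "qchk p q ?y w" unfolding q using True vs w(2) k by simp
      then show "?y \<in> witness_set p q" using w(1) by (auto simp: witness_set_def)
    qed
    then show ?thesis using True by simp
  next
    case False
    have "?y \<in> witness_set p q \<longleftrightarrow> (\<exists>C. vertex_cover G C \<and> p * card C < q * k)"
    proof
      assume "?y \<in> witness_set p q"
      then obtain w where w: "\<forall>e\<in>snd G. e \<inter> set (map length (dec w)) \<noteq> {}" "p * length (dec w) < q * k"
        using q False by (auto simp: witness_set_def)
      \<comment> \<open>The numbers in the witness need not be vertices, nor distinct; restricting
        to the vertex set keeps the cover and does not enlarge it.\<close>
      let ?C = "set (map length (dec w)) \<inter> fst G"
      have "vertex_cover G ?C" unfolding vertex_cover_def
      proof (intro conjI ballI)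
        fix e assume "e \<in> snd G"
        then show "e \<inter> ?C \<noteq> {}" using w(1) gr_edge_sub[OF gG] by blast
      qed simp
      moreover have "card ?C \<le> length (dec w)"
      proof -
        have "card ?C \<le> card (set (map length (dec w)))" by (intro card_mono) auto
        also have "\<dots> \<le> length (dec w)" using card_length[of "map length (dec w)"] by simp
        finally show ?thesis .
      qed
      then have "p * card ?C < q * k" using w(2) by (meson le_less_trans mult_le_mono2)
      ultimately show "\<exists>C. vertex_cover G C \<and> p * card C < q * k" by blast
    next
      assume "\<exists>C. vertex_cover G C \<and> p * card C < q * k"
      then obtain C where C: "vertex_cover G C" "p * card C < q * k" by blast
      have CV: "C \<subseteq> {..<n}" using C(1) G(2) by (simp add: vertex_cover_def)
      then obtain vs where vs: "set vs = C" "distinct vs" using finite_distinct_list finite_subset by (metis finite_lessThan)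
      obtain w where w: "length w \<le> 4 * length ?y" "map length (dec w) = vs" using wit[OF vs(2)] vs(1) CV by blast
      then have "length (dec w) = card C" using distinct_card[OF vs(2)] vs(1) by (metis length_map)
      then have "qchk p q ?y w" unfolding q using False C vs(1) w(2) by (simp add: vertex_cover_def)
      then show "?y \<in> witness_set p q" using w(1) by (auto simp: witness_set_def)
    qed
    then show ?thesis using False by simp
  qed
qed

theorem S_MDG_in_par:
  assumes q: "q > 0" and r: "r = of_nat p / of_nat q"
  shows "S_MDG r \<in> class_P_NP_par"
proof -
  \<comment> \<open>The bound \<open>k\<close> runs up to the length of the matrix, which is at
    least the number of vertices and hence at least \<open>min_mdg\<close>. The answers on greedy
    runs come first, those on covers are shifted by \<open>Suc (length x)\<close>.\<close>
  define qs where "qs = (\<lambda>x. map (\<lambda>k. query x k True) [0..<Suc (length x)] @ map (\<lambda>k. query x k False) [0..<Suc (length x)])"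
  define V where "V = {z. gvalid (unp1 z) \<and> (\<exists>k\<in>set [0..<Suc (length (unp1 z))].
     nthd False (unp2 z) k \<and> \<not> nthd False (unp2 z) (Suc (length (unp1 z)) + k))}"
  have "pf (\<lambda>z. unraw z \<in> V)" unfolding V_def mem_Collect_eq by (intro pf_intros)
  then have VP: "V \<in> class_P" by (rule pf_class_P)
  have "pf (\<lambda>x. Raw (concat (map enc_word (qs (unraw x)))))" unfolding qs_def by (intro pf_intros)
  from pf_polytime[OF this] have "polytime (\<lambda>x. enc_words (qs x))" by (simp add: enc_words_def)
  moreover have "x \<in> S_MDG r \<longleftrightarrow> enc_pair x (map (\<lambda>y. y \<in> witness_set p q) (qs x)) \<in> V" for x
  proof -
    let ?a = "map (\<lambda>y. y \<in> witness_set p q) (qs x)" let ?K = "Suc (length x)"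
    have a: "nthd False ?a k \<longleftrightarrow> query x k True \<in> witness_set p q"
      "nthd False ?a (?K + k) \<longleftrightarrow> query x k False \<in> witness_set p q" if "k < ?K" for k
      using that by (auto simp: qs_def nthd_def nth_append simp del: upt_Suc)
    have V: "enc_pair x ?a \<in> V \<longleftrightarrow> gvalid x \<and> (\<exists>k<?K. query x k True \<in> witness_set p q \<and> query x k False \<notin> witness_set p q)"
      unfolding V_def using a by (auto simp del: upt_Suc)
    show ?thesis
    proof (cases "gvalid x")
      case False
      then have "x \<notin> S_MDG r" unfolding gvalid_graph S_MDG_def mem_Collect_eq by blast
      then show ?thesis using V False by blast
    next
      case True
      then obtain G n where G: "is_graph G" "fst G = {..<n}" "x = enc_graph G" using gvalid_graph by blast
      have gG: "gr G" using G(1) is_graph_gr by blast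
      have "x \<in> S_MDG r \<longleftrightarrow> q * min_mdg G \<le> p * mvc G" unfolding G(3) S_MDG_enc[OF G(1,2)] rat_ratio_le[OF q r] ..
      also have "\<dots> \<longleftrightarrow> (\<exists>k<?K. min_mdg G \<le> k \<and> \<not> (\<exists>C. vertex_cover G C \<and> p * card C < q * k))"
      proof
        assume le: "q * min_mdg G \<le> p * mvc G"
        obtain vs where vs: "mdgl G vs" "length vs = min_mdg G" by (rule min_mdg_obtain[OF gG])
        have "length vs \<le> n"
          using mdgl_distinct[OF vs(1)] distinct_card[of vs] card_mono[of "{..<n}" "set vs"] G(2) by simp
        then have "min_mdg G < ?K" using vs(2) n_le[OF G(1,2)] G(3) by simp
        moreover have "\<not> p * card C < q * min_mdg G" if "vertex_cover G C" for C
          using le mvc_le[OF that] by (meson leD mult_le_mono2 order_trans)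
        ultimately show "\<exists>k<?K. min_mdg G \<le> k \<and> \<not> (\<exists>C. vertex_cover G C \<and> p * card C < q * k)" by blast
      next
        assume "\<exists>k<?K. min_mdg G \<le> k \<and> \<not> (\<exists>C. vertex_cover G C \<and> p * card C < q * k)"
        then obtain k where k: "min_mdg G \<le> k" "\<not> (\<exists>C. vertex_cover G C \<and> p * card C < q * k)" by blast
        obtain C where C: "vertex_cover G C" "card C = mvc G" by (rule mvc_obtain[OF gG])
        then have "q * k \<le> p * mvc G" using k(2) by (metis not_less)
        then show "q * min_mdg G \<le> p * mvc G" using k(1) by (meson mult_le_mono2 order_trans)
      qed
      also have "\<dots> \<longleftrightarrow> enc_pair x ?a \<in> V" unfolding V using True query_G[OF G(1,2)] G(3) by simp
      finally show ?thesis .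
    qed
  qed
  ultimately show ?thesis unfolding class_P_NP_par_def using witness_set_NP VP by blast
qed

theorem theorem4p3:
  fixes r :: rat
  assumes "r \<ge> 1"
  shows "many_one_complete class_P_NP_par (S_MDG r)"
proof -
  obtain a b where ab: "quotient_of r = (a, b)" by fastforce
  have b: "b > 0" using quotient_of_denom_pos[OF ab] .
  have r: "r = of_int a / of_int b" using quotient_of_div[OF ab] .
  have "b \<le> a" using assms b unfolding r by (simp add: field_simps)
  define q where "q = nat b"
  define d where "d = nat (a - b)"
  have q: "q > 0" using b by (simp add: q_def)
  have r': "r = of_nat (q + d) / of_nat q" using b \<open>b \<le> a\<close> unfolding r q_def d_def by simp
  show ?thesis
    unfolding many_one_complete_def using S_MDG_in_par[OF q r'] par_hard[OF _ q r'] by blast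
qed

end
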